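(* Let $T>0$, $\lambda>0$, $u_0\in H^2(\mathbb{T}^2)$, and let $u=(u_1,u_2)$ be the solution on $[0,T)$ (in the sense of the context) of the Kuramoto-Sivashinsky equation $$\partial_t u+(u\cdot\nabla)u+\lambda\Delta u+\Delta^2u=0\ \text{ in }\mathbb{T}^2\times[0,T],\qquad u(0)=u_0 .$$ If $u_1\in L^2\big(0,T;\dot B^{-1/2}_{\infty,\infty}(\mathbb{T}^2)\big)\cap L^2\big(0,T;\dot B^{1/2}_{\infty,\infty}(\mathbb{T}^2)\big)$, then the equation admits a global strong solution, i.e. $u\in L^\infty([0,T];H^2(\mathbb{T}^2))\cap L^2([0,T];H^4(\mathbb{T}^2))$.
   Context: $\mathbb{T}^2=\mathbb{R}^2/(2\pi\mathbb{Z}^2)$; $u:\mathbb{T}^2\times[0,T]\to\mathbb{R}^2$ is not assumed divergence free. Strong solution on $[0,T')$: $u\in L^\infty([0,T');H^2(\mathbb{T}^2))\cap L^2([0,T');H^4(\mathbb{T}^2))$ such that for every smooth $\psi$ on $\mathbb{T}^2$, $\langle\partial_tu,\psi\rangle+(u\cdot\nabla u,\psi)+(\Delta u,\Delta\psi)=\lambda(\nabla u,\nabla\psi)$, with $u(0)=u_0$. By "solution on $[0,T)$" we mean a function that is a strong solution on $[0,T')$ for every $0<T'<T$. Homogeneous toroidal Besov spaces (here $d=2$): let $\mathcal{D}_0(\mathbb{T}^d)$ be the smooth $2\pi$-periodic functions with zero integral and $\mathcal{D}_0'(\mathbb{T}^d)$ its dual. Fix $\phi\in C^\infty(\mathbb{R}^d)$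 with $0\le\phi\le1$, $\operatorname{supp}\phi\subset\{1/2<|\xi|<2\}$, $\sum_{j\in\mathbb{Z}}\phi(2^{-j}\xi)=1$ for $\xi\ne0$, and set $\varphi_j(x)=\sum_{m\in\mathbb{Z}^d}\phi(2^{-j}m)e^{im\cdot x}$. For $s\in\mathbb{R}$, $1\le p,q\le\infty$, $\dot B^s_{p,q}(\mathbb{T}^d)$ is the set of $f\in\mathcal{D}_0'(\mathbb{T}^d)$ with $\|f\|_{\dot B^s_{p,q}}=\big\|\big(2^{sj}\|\varphi_j*f\|_{L^p(\mathbb{T}^d)}\big)_{j\in\mathbb{Z}}\big\|_{\ell^q(\mathbb{Z})}<\infty$. *)

theory Defs
  imports "HOL-Probability.Essential_Supremum"
begin

section \<open>$L^p$ norms with values in $[0,\infty]$\<close>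

text \<open>Only positive exponents \<open>r\<close> are used, so \<open>\<infinity>\<close> is sent to \<open>\<infinity>\<close>.\<close>
definition epowr :: "ennreal \<Rightarrow> real \<Rightarrow> ennreal" where
  "epowr x r = (if x = \<infinity> then \<infinity> else ennreal (enn2real x powr r))"

text \<open>\<open>M\<close> may be a counting measure, which gives the sequence space norms.\<close>
definition Lp_norm :: "ennreal \<Rightarrow> 'x measure \<Rightarrow> ('x \<Rightarrow> ennreal) \<Rightarrow> ennreal" where
  "Lp_norm p M f =
     (if p = \<infinity> then esssup M f
      else epowr (\<integral>\<^sup>+ x. epowr (f x) (enn2real p) \<partial>M) (1 / enn2real p))"

section \<open>Smooth functions\<close>

definition partial :: "'a::euclidean_space \<Rightarrow> ('a \<Rightarrow> 'b::real_normed_vector) \<Rightarrow> 'a \<Rightarrow> 'b" where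
  "partial b f x = frechet_derivative f (at x) b"

text \<open>A list \<open>bs\<close> of basis vectors plays the role of a multi-index; \<open>fold partial bs f\<close>
  differentiates \<open>f\<close> successively in these directions. Differentiability of all iterated
  partial derivatives makes all of them continuous.\<close>
definition smooth :: "('a::euclidean_space \<Rightarrow> 'b::real_normed_vector) \<Rightarrow> bool" where
  "smooth f \<longleftrightarrow> (\<forall>bs. set bs \<subseteq> Basis \<longrightarrow> (\<forall>x. fold partial bs f differentiable (at x)))"

definition laplacian :: "('a::euclidean_space \<Rightarrow> 'b::real_normed_vector) \<Rightarrow> 'a \<Rightarrow> 'b" where
  "laplacian f x = (\<Sum>b\<in>Basis. partial b (partial b f) x)"

section \<open>Functions on the torus\<close>

text \<open>A function on the torus \<open>\<real>\<^sup>d / (2\<pi>\<int>\<^sup>d)\<close> is a function on \<open>\<real>\<^sup>d\<close> that is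
  \<open>2\<pi>\<close>-periodic in each coordinate; integrals are taken over a fundamental cube, with
  unnormalised Lebesgue measure.\<close>

definition periodic :: "('a::euclidean_space \<Rightarrow> 'b) \<Rightarrow> bool" where
  "periodic f \<longleftrightarrow> (\<forall>x. \<forall>b\<in>Basis. f (x + (2 * pi) *\<^sub>R b) = f x)"

definition torus :: "'a::euclidean_space measure" where
  "torus = lebesgue_on (cbox 0 ((2 * pi) *\<^sub>R One))"

definition int_lattice :: "'a::euclidean_space set" where
  "int_lattice = {m. \<forall>b\<in>Basis. m \<bullet> b \<in> \<int>}"

definition torus_smooth :: "('a::euclidean_space \<Rightarrow> 'b::real_normed_vector) set" where
  "torus_smooth = {\<psi>. smooth \<psi> \<and> periodic \<psi>}"

definition L2_norm :: "('a::euclidean_space \<Rightarrow> 'b::euclidean_space) \<Rightarrow> ennreal" where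
  "L2_norm f = Lp_norm 2 torus (\<lambda>x. ennreal (norm (f x)))"

definition L2_torus :: "('a::euclidean_space \<Rightarrow> 'b::euclidean_space) set" where
  "L2_torus = {f. periodic f \<and> f \<in> borel_measurable torus \<and> L2_norm f < \<infinity>}"

definition L2_inner :: "('a::euclidean_space \<Rightarrow> 'b::euclidean_space) \<Rightarrow> ('a \<Rightarrow> 'b) \<Rightarrow> real" where
  "L2_inner f g = (LINT x|torus. f x \<bullet> g x)"

definition fourier_coeff :: "('a::euclidean_space \<Rightarrow> real) \<Rightarrow> 'a \<Rightarrow> complex" where
  "fourier_coeff f m =
     (LINT x|torus. complex_of_real (f x) * cis (- (m \<bullet> x))) / of_real ((2 * pi) ^ DIM('a))"

text \<open>The square of this norm is the sum of \<open>(1 + |m|\<^sup>2)\<^sup>s |c\<^sub>b(m)|\<^sup>2\<close> over all frequencies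
  \<open>m\<close> and all components \<open>b\<close>, with \<open>c\<^sub>b(m)\<close> the Fourier coefficients of component \<open>b\<close>.\<close>
definition sobolev_norm :: "real \<Rightarrow> ('a::euclidean_space \<Rightarrow> 'b::euclidean_space) \<Rightarrow> ennreal" where
  "sobolev_norm s f =
     Lp_norm 2 (count_space (int_lattice \<times> Basis))
       (\<lambda>(m, b). ennreal ((1 + (norm m)\<^sup>2) powr (s / 2) * cmod (fourier_coeff (\<lambda>x. f x \<bullet> b) m)))"

text \<open>For \<open>s \<ge> 0\<close>.\<close>
definition sobolev :: "real \<Rightarrow> ('a::euclidean_space \<Rightarrow> 'b::euclidean_space) set" where
  "sobolev s = {f. f \<in> L2_torus \<and> sobolev_norm s f < \<infinity>}"

definition has_weak_partial ::
    "'a::euclidean_space \<Rightarrow> ('a \<Rightarrow> 'b::euclidean_space) \<Rightarrow> ('a \<Rightarrow> 'b) \<Rightarrow> bool" where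
  "has_weak_partial b f g \<longleftrightarrow> periodic g \<and> integrable torus g \<and>
     (\<forall>\<psi> :: 'a \<Rightarrow> real. \<psi> \<in> torus_smooth \<longrightarrow>
        (LINT x|torus. partial b \<psi> x *\<^sub>R f x) = - (LINT x|torus. \<psi> x *\<^sub>R g x))"

text \<open>Weak derivatives are unique up to null sets, and are only used inside integrals.\<close>
definition weak_partial ::
    "'a::euclidean_space \<Rightarrow> ('a \<Rightarrow> 'b::euclidean_space) \<Rightarrow> 'a \<Rightarrow> 'b" where
  "weak_partial b f = (SOME g. has_weak_partial b f g)"

definition weak_laplacian :: "('a::euclidean_space \<Rightarrow> 'b::euclidean_space) \<Rightarrow> 'a \<Rightarrow> 'b" where
  "weak_laplacian f x = (\<Sum>b\<in>Basis. weak_partial b (weak_partial b f) x)"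

definition convection :: "('a::euclidean_space \<Rightarrow> 'a) \<Rightarrow> ('a \<Rightarrow> 'b::euclidean_space) \<Rightarrow> 'a \<Rightarrow> 'b" where
  "convection v w x = (\<Sum>b\<in>Basis. (v x \<bullet> b) *\<^sub>R weak_partial b w x)"

section \<open>Homogeneous toroidal Besov spaces\<close>

definition test_functions0 :: "('a::euclidean_space \<Rightarrow> complex) set" where
  "test_functions0 = {\<psi>. \<psi> \<in> torus_smooth \<and> (LINT x|torus. \<psi> x) = 0}"

text \<open>The dual of \<^term>\<open>test_functions0\<close> with its Frechet topology: complex linear functionals
  bounded by finitely many of the suprema of derivatives. Only the values on
  \<^term>\<open>test_functions0\<close> are relevant.\<close>
definition distributions0 :: "(('a::euclidean_space \<Rightarrow> complex) \<Rightarrow> complex) set" where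
  "distributions0 = {F.
     (\<forall>\<psi>\<in>test_functions0. \<forall>\<theta>\<in>test_functions0. F (\<lambda>x. \<psi> x + \<theta> x) = F \<psi> + F \<theta>) \<and>
     (\<forall>c. \<forall>\<psi>\<in>test_functions0. F (\<lambda>x. c * \<psi> x) = c * F \<psi>) \<and>
     (\<exists>C k. \<forall>\<psi>\<in>test_functions0.
        cmod (F \<psi>) \<le> C * (\<Sum>bs | set bs \<subseteq> Basis \<and> length bs \<le> k. SUP x. cmod (fold partial bs \<psi> x)))}"

definition distribution_of :: "('a::euclidean_space \<Rightarrow> real) \<Rightarrow> ('a \<Rightarrow> complex) \<Rightarrow> complex" where
  "distribution_of f \<psi> = (LINT x|torus. complex_of_real (f x) * \<psi> x)"

definition dyadic_partition :: "('a::euclidean_space \<Rightarrow> real) \<Rightarrow> bool" where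
  "dyadic_partition \<phi> \<longleftrightarrow> smooth \<phi> \<and> (\<forall>\<xi>. 0 \<le> \<phi> \<xi> \<and> \<phi> \<xi> \<le> 1) \<and>
     closure {\<xi>. \<phi> \<xi> \<noteq> 0} \<subseteq> {\<xi>. 1 / 2 < norm \<xi> \<and> norm \<xi> < 2} \<and>
     (\<forall>\<xi>. \<xi> \<noteq> 0 \<longrightarrow> ((\<lambda>j::int. \<phi> ((2 powi (- j)) *\<^sub>R \<xi>)) has_sum 1) UNIV)"

text \<open>All but finitely many terms of this sum vanish.\<close>
definition dyadic_kernel :: "('a::euclidean_space \<Rightarrow> real) \<Rightarrow> int \<Rightarrow> 'a \<Rightarrow> complex" where
  "dyadic_kernel \<phi> j x =
     (\<Sum>\<^sub>\<infinity>m\<in>int_lattice. complex_of_real (\<phi> ((2 powi (- j)) *\<^sub>R m)) * cis (m \<bullet> x))"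

definition dyadic_block ::
    "('a::euclidean_space \<Rightarrow> real) \<Rightarrow> int \<Rightarrow> (('a \<Rightarrow> complex) \<Rightarrow> complex) \<Rightarrow> 'a \<Rightarrow> complex" where
  "dyadic_block \<phi> j F x = F (\<lambda>y. dyadic_kernel \<phi> j (x - y))"

definition besov_norm ::
    "('a::euclidean_space \<Rightarrow> real) \<Rightarrow> real \<Rightarrow> ennreal \<Rightarrow> ennreal
       \<Rightarrow> (('a \<Rightarrow> complex) \<Rightarrow> complex) \<Rightarrow> ennreal" where
  "besov_norm \<phi> s p q F =
     Lp_norm q (count_space UNIV)
       (\<lambda>j::int. ennreal (2 powr (s * of_int j)) *
          Lp_norm p torus (\<lambda>x. ennreal (cmod (dyadic_block \<phi> j F x))))"

definition besov ::
    "('a::euclidean_space \<Rightarrow> real) \<Rightarrow> real \<Rightarrow> ennreal \<Rightarrow> ennreal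
       \<Rightarrow> (('a \<Rightarrow> complex) \<Rightarrow> complex) set" where
  "besov \<phi> s p q = {F. F \<in> distributions0 \<and> besov_norm \<phi> s p q F < \<infinity>}"

section \<open>Bochner spaces\<close>

text \<open>Strong measurability is almost everywhere approximation by simple functions with values
  in \<open>X\<close>, in the norm \<open>N\<close> of \<open>X\<close>.\<close>
definition strongly_measurable ::
    "real set \<Rightarrow> 'f::minus set \<Rightarrow> ('f \<Rightarrow> ennreal) \<Rightarrow> (real \<Rightarrow> 'f) \<Rightarrow> bool" where
  "strongly_measurable I X N u \<longleftrightarrow>
     (\<exists>s. (\<forall>n::nat. simple_function (lebesgue_on I) (s n) \<and> s n ` I \<subseteq> X) \<and>
          (AE t in lebesgue_on I. (\<lambda>n. N (s n t - u t)) \<longlonglongrightarrow> 0))"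

definition bochner ::
    "ennreal \<Rightarrow> real set \<Rightarrow> 'f::minus set \<Rightarrow> ('f \<Rightarrow> ennreal) \<Rightarrow> (real \<Rightarrow> 'f) set" where
  "bochner p I X N = {u. (AE t in lebesgue_on I. u t \<in> X) \<and> strongly_measurable I X N u \<and>
     Lp_norm p (lebesgue_on I) (\<lambda>t. N (u t)) < \<infinity>}"

abbreviation bochner_sobolev ::
    "ennreal \<Rightarrow> real set \<Rightarrow> real \<Rightarrow> (real \<Rightarrow> 'a::euclidean_space \<Rightarrow> 'b::euclidean_space) set" where
  "bochner_sobolev p I s \<equiv> bochner p I (sobolev s) (sobolev_norm s)"

abbreviation bochner_besov ::
    "('a::euclidean_space \<Rightarrow> real) \<Rightarrow> ennreal \<Rightarrow> real set \<Rightarrow> real \<Rightarrow> ennreal \<Rightarrow> ennreal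
       \<Rightarrow> (real \<Rightarrow> ('a \<Rightarrow> complex) \<Rightarrow> complex) set" where
  "bochner_besov \<phi> r I s p q \<equiv> bochner r I (besov \<phi> s p q) (besov_norm \<phi> s p q)"

section \<open>The Kuramoto-Sivashinsky equation\<close>

definition has_weak_time_derivative :: "real \<Rightarrow> (real \<Rightarrow> real) \<Rightarrow> (real \<Rightarrow> real) \<Rightarrow> bool" where
  "has_weak_time_derivative T h g \<longleftrightarrow>
     integrable (lebesgue_on {0<..<T}) h \<and> integrable (lebesgue_on {0<..<T}) g \<and>
     (\<forall>\<theta> :: real \<Rightarrow> real. smooth \<theta> \<and> compact (closure {t. \<theta> t \<noteq> 0}) \<and>
          closure {t. \<theta> t \<noteq> 0} \<subseteq> {0<..<T} \<longrightarrow>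
        (LINT t|lebesgue_on {0<..<T}. h t * deriv \<theta> t)
          = - (LINT t|lebesgue_on {0<..<T}. g t * \<theta> t))"

text \<open>The function \<open>u\<close> is only determined for almost every time, so \<open>u(0) = u\<^sub>0\<close> refers to
  its representative that is continuous in time with values in $L^2$.\<close>
definition has_initial_value ::
    "real \<Rightarrow> (real \<Rightarrow> 'a::euclidean_space \<Rightarrow> 'b::euclidean_space) \<Rightarrow> ('a \<Rightarrow> 'b) \<Rightarrow> bool" where
  "has_initial_value T u u0 \<longleftrightarrow>
     (\<exists>v. (\<forall>t\<in>{0..<T}. v t \<in> L2_torus) \<and>
          (AE t in lebesgue_on {0..<T}. AE x in torus. v t x = u t x) \<and>
          (\<forall>t\<in>{0..<T}. ((\<lambda>r. L2_norm (v r - v t)) \<longlongrightarrow> 0) (at t within {0..<T})) \<and>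
          (AE x in torus. v 0 x = u0 x))"

text \<open>The function \<open>dt\<close> is \<open>\<langle>\<partial>\<^sub>tu, \<psi>\<rangle>\<close>, the distributional derivative of \<open>t \<mapsto> (u(t), \<psi>)\<close>.\<close>
definition strong_solution ::
    "real \<Rightarrow> ('a::euclidean_space \<Rightarrow> 'a) \<Rightarrow> real \<Rightarrow> (real \<Rightarrow> 'a \<Rightarrow> 'a) \<Rightarrow> bool" where
  "strong_solution lam u0 T u \<longleftrightarrow>
     u \<in> bochner_sobolev \<infinity> {0..<T} 2 \<and> u \<in> bochner_sobolev 2 {0..<T} 4 \<and>
     (\<forall>\<psi> :: 'a \<Rightarrow> 'a. \<psi> \<in> torus_smooth \<longrightarrow>
        (\<exists>dt. has_weak_time_derivative T (\<lambda>t. L2_inner (u t) \<psi>) dt \<and>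
           (AE t in lebesgue_on {0<..<T}.
              dt t + L2_inner (convection (u t) (u t)) \<psi>
                + L2_inner (weak_laplacian (u t)) (laplacian \<psi>)
              = lam * (\<Sum>b\<in>Basis. L2_inner (weak_partial b (u t)) (partial b \<psi>))))) \<and>
     has_initial_value T u u0"

definition solution_on ::
    "real \<Rightarrow> ('a::euclidean_space \<Rightarrow> 'a) \<Rightarrow> real \<Rightarrow> (real \<Rightarrow> 'a \<Rightarrow> 'a) \<Rightarrow> bool" where
  "solution_on lam u0 T u \<longleftrightarrow> (\<forall>T'. 0 < T' \<and> T' < T \<longrightarrow> strong_solution lam u0 T' u)"

end

theory Submission
  imports Defs
begin

text \<open>
  In \<open>\<integral>(u \<cdot> \<nabla>)u \<cdot> u\<close> the cubic terms in \<open>u\<^sub>2\<close> alone integrate to zero, and integration by parts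
  leaves only terms that contain the oscillation \<open>w = u\<^sub>1 - mean\<close>. Only the Littlewood-Paley blocks
  with \<open>j \<ge> 0\<close> contribute to \<open>w\<close>, because nonzero frequencies have norm at least 1, so summing
  \<open>2\<^bsup>-j/2\<^esup>\<close> bounds \<open>sup \<bar>w\<bar>\<close> by the \<open>B\<^bsup>1/2\<^esup>\<close> norm of \<open>u\<^sub>1\<close>. Gronwall's lemma then bounds the
  energy and \<open>\<integral>\<parallel>\<Delta>u\<parallel>\<^sup>2\<close> up to time \<open>T\<close>. The nonlinearity is bounded in \<open>L\<^sup>2\<close> by the square of the
  \<open>H\<^sup>2\<close> norm, which is integrable in time by the first step; a second application of
  Gronwall's lemma gives the bounds in \<open>L\<^sup>\<infinity>H\<^sup>2\<close> and \<open>L\<^sup>2H\<^sup>4\<close>. All energy identities are derived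
  for single Fourier modes, for which the weak formulation is an ordinary differential equation, and
  then summed.
\<close>

subsection \<open>Integration over the torus\<close>

text \<open>The Besov norm is homogeneous and does not see the mean m of u_1, although m multiplies
  nonlinear terms. The way out is that, after integration by parts, m is left only in a product with
  w and a derivative of u_2. Young's inequality turns this into the squared supremum of w times
  |m|^2, and |m|^2 is one term of the energy itself. Gaps in regularity shape the rest. The equation
  holds weakly in time and only on [0,T') with T' < T. Each Fourier coefficient is therefore first
  identified with an absolutely continuous function, and the H^2 bound on [0,T') serves only to make
  integrals finite; it enters no final constant. Weak derivatives come from a choice operator, so
  they are pinned down through their Fourier coefficients. Measurability in time of the nonlinear
  coefficients is read off the equation, since it cannot be read off the definition of the
  convection term.\<close>

lemma space_torus: "space (torus :: 'a::euclidean_space measure) = cbox 0 ((2 * pi) *\<^sub>R One)"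
  by (simp add: torus_def)

lemma measure_space_torus:
  "measure (torus :: 'a::euclidean_space measure) (space torus) = (2 * pi) ^ DIM('a)"
  by (simp add: torus_def measure_restrict_space content_cbox_if box_eq_empty)

lemma emeasure_space_torus:
  "emeasure (torus :: 'a::euclidean_space measure) (space torus) < \<infinity>"
proof -
  have "emeasure lborel (cbox 0 ((2 * pi) *\<^sub>R One) :: 'a set) < \<infinity>"
    by (rule emeasure_lborel_cbox_finite)
  then show ?thesis
    by (simp add: torus_def emeasure_restrict_space)
qed

interpretation torus: finite_measure "torus :: 'a::euclidean_space measure"
proof
  show "emeasure (torus :: 'a measure) (space torus) \<noteq> \<infinity>"
    using emeasure_space_torus[where 'a='a] by simp
qed

lemma torus_measurable_continuous:
  assumes "continuous_on UNIV f"
  shows "f \<in> borel_measurable torus"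
  unfolding torus_def
  by (rule continuous_imp_measurable_on_sets_lebesgue) (use assms continuous_on_subset in auto)

lemma torus_integrable_continuous:
  fixes f :: "'a::euclidean_space \<Rightarrow> 'b::euclidean_space"
  assumes "continuous_on UNIV f"
  shows "integrable torus f"
proof -
  have "compact (f ` cbox 0 ((2 * pi) *\<^sub>R One))"
    by (intro compact_continuous_image continuous_on_subset[OF assms]) auto
  then obtain B where B: "\<And>x. x \<in> cbox 0 ((2 * pi) *\<^sub>R One) \<Longrightarrow> norm (f x) \<le> B"
    by (meson bounded_iff compact_imp_bounded image_eqI)
  show ?thesis
    by (rule torus.integrable_const_bound[of _ B])
      (use B in \<open>auto simp: space_torus intro!: AE_I2 torus_measurable_continuous assms\<close>)
qed

text \<open>Translation invariance is available for \<open>lborel\<close>, while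
  \<open>torus\<close> restricts the completed measure; for Borel functions both give the same
  integral.\<close>

lemma torus_integral_lborel:
  fixes f :: "'a::euclidean_space \<Rightarrow> 'b::{banach, second_countable_topology}"
  assumes "f \<in> borel_measurable borel"
  shows "(LINT x|torus. f x) = (LINT x|lborel. indicator (cbox 0 ((2 * pi) *\<^sub>R One)) x *\<^sub>R f x)"
proof -
  have "(LINT x|torus. f x) = (LINT x|lebesgue. indicator (cbox 0 ((2 * pi) *\<^sub>R One)) x *\<^sub>R f x)"
    unfolding torus_def by (subst integral_restrict_space) auto
  also have "\<dots> = (LINT x|lborel. indicator (cbox 0 ((2 * pi) *\<^sub>R One)) x *\<^sub>R f x)"
    using assms by (intro integral_completion) measurable
  finally show ?thesis .
qed

section \<open>Null faces of the cube and translation invariance\<close>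

lemma AE_hyperplane_lborel:
  fixes b :: "'a::euclidean_space"
  assumes "b \<in> Basis"
  shows "AE x in lborel. x \<bullet> b \<noteq> c"
proof -
  have "negligible {x. b \<bullet> x = c}"
    using assms by (intro negligible_hyperplane) auto
  then have "{x. b \<bullet> x = c} \<in> null_sets lebesgue"
    using negligible_iff_null_sets by blast
  then have "AE x in lebesgue. x \<notin> {x. b \<bullet> x = c}"
    by (rule AE_not_in)
  then have "AE x in lborel. x \<notin> {x. b \<bullet> x = c}"
    using AE_completion_iff by blast
  then show ?thesis
    by (simp add: inner_commute)
qed

lemma AE_torus_iff:
  "(AE x in (torus :: 'a::euclidean_space measure). P x) \<longleftrightarrow>
     (AE x in lborel. x \<in> cbox 0 ((2 * pi) *\<^sub>R One) \<longrightarrow> P x)"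
  unfolding torus_def by (subst AE_restrict_space_iff) (auto simp: AE_completion_iff)

text \<open>The faces are null, so pointwise arguments may assume strict inequalities in every
  coordinate.\<close>

lemma AE_torus_box: "AE x in (torus :: 'a::euclidean_space measure). x \<in> box 0 ((2 * pi) *\<^sub>R One)"
proof -
  have "AE x in lborel. \<forall>b\<in>(Basis :: 'a set). x \<bullet> b \<noteq> 0 \<and> x \<bullet> b \<noteq> 2 * pi"
    by (intro AE_finite_allI AE_conjI AE_hyperplane_lborel) auto
  then show ?thesis
    unfolding AE_torus_iff
    by (rule AE_mp) (intro AE_I2, auto simp: mem_box less_le)
qed

text \<open>The shifted cube splits into a part that stays inside the original one and a slab that
  sticks out; periodicity moves the slab back by a full period, and the two pieces reassemble the
  cube.\<close>

lemma torus_integral_translate: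
  fixes F :: "'a::euclidean_space \<Rightarrow> 'b::euclidean_space"
  assumes per: "periodic F" and cont: "continuous_on UNIV F"
    and b: "b \<in> Basis" and s: "0 \<le> s" "s \<le> 2 * pi"
  shows "(LINT x|torus. F (x + s *\<^sub>R b)) = (LINT x|torus. F x)"
proof -
  define Q where "Q = cbox (0::'a) ((2 * pi) *\<^sub>R One)"
  \<comment> \<open>Half-open in direction b: with the closed cube a face would be counted twice,
    and the identity \<open>split\<close> would hold only almost everywhere.\<close>
  define A where "A = {x. (\<forall>c\<in>Basis - {b}. 0 \<le> x \<bullet> c \<and> x \<bullet> c \<le> 2 * pi) \<and> 0 \<le> x \<bullet> b \<and> x \<bullet> b < 2 * pi}"
  define L where "L = {x::'a. x \<bullet> b < s}"
  have F[measurable]: "F \<in> borel_measurable borel"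
    using cont by (rule borel_measurable_continuous_onI)
  have Q_alt: "Q = {x. (\<forall>c\<in>Basis - {b}. 0 \<le> x \<bullet> c \<and> x \<bullet> c \<le> 2 * pi) \<and> 0 \<le> x \<bullet> b \<and> x \<bullet> b \<le> 2 * pi}"
    using b by (auto simp: Q_def mem_box)
  have [measurable]: "Q \<in> sets borel" "L \<in> sets borel"
    unfolding Q_def L_def by measurable
  have AQ: "A = Q - {x. x \<bullet> b = 2 * pi}"
    unfolding A_def Q_alt by auto
  have [measurable]: "A \<in> sets borel"
    unfolding AQ by measurable
  have to_A: "(LINT x|torus. G x) = (LINT x|lborel. indicator A x *\<^sub>R G x)"
    if [measurable]: "G \<in> borel_measurable borel" for G :: "'a \<Rightarrow> 'b"
  proof -
    have "(LINT x|torus. G x) = (LINT x|lborel. indicator Q x *\<^sub>R G x)"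
      unfolding Q_def by (rule torus_integral_lborel) fact
    also have "\<dots> = (LINT x|lborel. indicator A x *\<^sub>R G x)"
      by (rule integral_cong_AE)
        (use AE_hyperplane_lborel[OF b, of "2 * pi"] in \<open>auto simp: AQ indicator_def\<close>)
    finally show ?thesis .
  qed
  have shift: "(LINT x|lborel. G (x + v)) = (LINT x|lborel. G x)"
    if [measurable]: "G \<in> borel_measurable borel" for G :: "'a \<Rightarrow> 'b" and v
  proof -
    have "(LINT x|lborel. G x) = (LINT x|distr lborel borel ((+) v). G x)"
      by (simp add: lborel_distr_plus)
    also have "\<dots> = (LINT x|lborel. G (v + x))"
      by (subst integral_distr) auto
    finally show ?thesis by (simp add: add.commute)
  qed
  have integ: "integrable lborel (\<lambda>x. indicator B x *\<^sub>R G x)"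
    if G: "continuous_on UNIV G" and [measurable]: "B \<in> sets borel" and "B \<subseteq> Q" for G :: "'a \<Rightarrow> 'b" and B
  proof -
    have [measurable]: "G \<in> borel_measurable borel"
      using G by (rule borel_measurable_continuous_onI)
    have "integrable lborel (\<lambda>x. indicator Q x *\<^sub>R G x)"
      using borel_integrable_compact[of Q G] G unfolding Q_def
      by (auto intro: continuous_on_subset simp: if_distrib indicator_def cong: if_cong)
    then show ?thesis
      by (rule Bochner_Integration.integrable_bound)
        (use \<open>B \<subseteq> Q\<close> in \<open>auto simp: indicator_def\<close>)
  qed
  have Fper: "F (x + (2 * pi) *\<^sub>R b) = F x" for x
    using per b by (auto simp: periodic_def)
  have cont_s: "continuous_on UNIV (\<lambda>x. F (x + v))" for v
    by (intro continuous_on_compose2[OF cont]) (auto intro!: continuous_intros)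
  have split: "indicator A (x - s *\<^sub>R b) = (indicator (A - L) x + indicator (A \<inter> L) (x - (2 * pi) *\<^sub>R b) :: real)" for x
  proof -
    have c: "(x - t *\<^sub>R b) \<bullet> c = x \<bullet> c - (if c = b then t else 0)" if "c \<in> Basis" for t c
      using that b by (auto simp: inner_diff_left inner_not_same_Basis)
    have 1: "x - t *\<^sub>R b \<in> A \<longleftrightarrow> (\<forall>c\<in>Basis - {b}. 0 \<le> x \<bullet> c \<and> x \<bullet> c \<le> 2 * pi) \<and> t \<le> x \<bullet> b \<and> x \<bullet> b < t + 2 * pi" for t
      unfolding A_def using c b by auto
    have 2: "x - t *\<^sub>R b \<in> L \<longleftrightarrow> x \<bullet> b < s + t" for t
      unfolding L_def using c b by auto
    show ?thesis
      using 1[of s] 1[of "2*pi"] 1[of 0] 2[of "2 * pi"] 2[of 0] s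
      by (auto simp: indicator_def)
  qed
  have "(LINT x|torus. F (x + s *\<^sub>R b)) = (LINT x|lborel. indicator A x *\<^sub>R F (x + s *\<^sub>R b))"
    by (rule to_A) measurable
  also have "\<dots> = (LINT x|lborel. indicator A ((x + s *\<^sub>R b) - s *\<^sub>R b) *\<^sub>R F (x + s *\<^sub>R b))"
    by simp
  also have "\<dots> = (LINT x|lborel. indicator A (x - s *\<^sub>R b) *\<^sub>R F x)"
    by (rule shift[of "\<lambda>x. indicator A (x - s *\<^sub>R b) *\<^sub>R F x"]) measurable
  also have "\<dots> = (LINT x|lborel. indicator (A - L) x *\<^sub>R F x + indicator (A \<inter> L) (x - (2 * pi) *\<^sub>R b) *\<^sub>R F x)"
    by (simp add: split scaleR_left_distrib)
  also have "\<dots> = (LINT x|lborel. indicator (A - L) x *\<^sub>R F x) + (LINT x|lborel. indicator (A \<inter> L) (x - (2 * pi) *\<^sub>R b) *\<^sub>R F x)"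
  proof (rule Bochner_Integration.integral_add)
    show "integrable lborel (\<lambda>x. indicator (A - L) x *\<^sub>R F x)"
      by (rule integ[OF cont]) (auto simp: AQ)
    have "integrable lborel (\<lambda>x. indicator (A \<inter> L) x *\<^sub>R F (x + (2 * pi) *\<^sub>R b))"
      by (rule integ[OF cont_s]) (auto simp: AQ)
    then have "integrable (distr lborel borel ((+) ((2 * pi) *\<^sub>R b))) (\<lambda>x. indicator (A \<inter> L) (x - (2 * pi) *\<^sub>R b) *\<^sub>R F x)"
      by (subst integrable_distr_eq) (auto simp: add.commute)
    then show "integrable lborel (\<lambda>x. indicator (A \<inter> L) (x - (2 * pi) *\<^sub>R b) *\<^sub>R F x)"
      by (simp add: lborel_distr_plus)
  qed
  also have "(LINT x|lborel. indicator (A \<inter> L) (x - (2 * pi) *\<^sub>R b) *\<^sub>R F x) =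
     (LINT x|lborel. indicator (A \<inter> L) ((x + (2 * pi) *\<^sub>R b) - (2 * pi) *\<^sub>R b) *\<^sub>R F (x + (2 * pi) *\<^sub>R b))"
    by (rule shift[symmetric, of "\<lambda>x. indicator (A \<inter> L) (x - (2 * pi) *\<^sub>R b) *\<^sub>R F x"]) measurable
  also have "\<dots> = (LINT x|lborel. indicator (A \<inter> L) x *\<^sub>R F x)"
    by (simp add: Fper)
  also have "(LINT x|lborel. indicator (A - L) x *\<^sub>R F x) + \<dots> = (LINT x|lborel. indicator (A - L) x *\<^sub>R F x + indicator (A \<inter> L) x *\<^sub>R F x)"
    by (rule Bochner_Integration.integral_add[symmetric]; rule integ[OF cont]) (auto simp: AQ)
  also have "\<dots> = (LINT x|lborel. indicator A x *\<^sub>R F x)"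
    by (rule Bochner_Integration.integral_cong) (auto simp: indicator_def)
  also have "\<dots> = (LINT x|torus. F x)"
    by (rule to_A[symmetric]) measurable
  finally show ?thesis .
qed

lemma periodic_cis: "m \<in> int_lattice \<Longrightarrow> periodic (\<lambda>x. cis (m \<bullet> x))"
  unfolding periodic_def int_lattice_def
  by (auto simp: inner_add_right cis_mult[symmetric] cis_multiple_2pi)

lemma continuous_on_cis_inner [continuous_intros]: "continuous_on S (\<lambda>x. cis (m \<bullet> x))"
  by (intro continuous_intros)

text \<open>For m \<noteq> 0 a shift by half a wavelength along some coordinate reverses the sign of
  the wave but leaves its integral unchanged. The shift is short enough because a nonzero integer
  has modulus at least 1.\<close>

lemma torus_integral_cis:
  fixes m :: "'a::euclidean_space"
  assumes m: "m \<in> int_lattice"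
  shows "(LINT x|torus. cis (m \<bullet> x)) = (if m = 0 then (2 * pi) ^ DIM('a) else 0)"
proof (cases "m = 0")
  case True
  then show ?thesis by (simp add: measure_space_torus scaleR_conv_of_real)
next
  case False
  then obtain b where b: "b \<in> Basis" "m \<bullet> b \<noteq> 0"
    using euclidean_all_zero_iff by blast
  have int: "m \<bullet> b \<in> \<int>" using m b by (auto simp: int_lattice_def)
  define s where "s = pi / \<bar>m \<bullet> b\<bar>"
  have "1 \<le> \<bar>m \<bullet> b\<bar>" using int b by (auto elim!: Ints_cases)
  then have s: "0 \<le> s" "s \<le> 2 * pi"
    unfolding s_def by (auto simp: field_simps)
  have "s * (m \<bullet> b) = pi \<or> s * (m \<bullet> b) = - pi"
    using b by (auto simp: s_def abs_if)
  then have "cis (s * (m \<bullet> b)) = -1"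
    by (auto simp: complex_eq_iff)
  then have *: "cis (m \<bullet> (x + s *\<^sub>R b)) = - cis (m \<bullet> x)" for x
    by (simp add: inner_add_right flip: cis_mult)
  have "(LINT x|torus. cis (m \<bullet> x)) = (LINT x|torus. cis (m \<bullet> (x + s *\<^sub>R b)))"
    by (rule torus_integral_translate[symmetric])
      (use periodic_cis[OF m] s b in \<open>auto intro: continuous_on_cis_inner\<close>)
  also have "\<dots> = - (LINT x|torus. cis (m \<bullet> x))"
    by (simp add: *)
  finally show ?thesis using False by simp
qed

lemma has_vector_derivative_tendsto0:
  assumes "(f has_vector_derivative D) (at 0)"
  shows "((\<lambda>s. (f s - f 0) /\<^sub>R s) \<longlongrightarrow> D) (at 0)"
proof -
  have "((\<lambda>s. (f s - f 0 - s *\<^sub>R D) /\<^sub>R \<bar>s\<bar>) \<longlongrightarrow> 0) (at 0)"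
    using assms unfolding has_vector_derivative_def has_derivative_at_within by simp
  then have "((\<lambda>s. norm ((f s - f 0 - s *\<^sub>R D) /\<^sub>R \<bar>s\<bar>)) \<longlongrightarrow> 0) (at 0)"
    by (rule tendsto_norm_zero)
  then have "((\<lambda>s. norm ((f s - f 0) /\<^sub>R s - D)) \<longlongrightarrow> 0) (at 0)"
  proof (rule Lim_transform_eventually)
    show "\<forall>\<^sub>F s in at 0. norm ((f s - f 0 - s *\<^sub>R D) /\<^sub>R \<bar>s\<bar>) = norm ((f s - f 0) /\<^sub>R s - D)"
      unfolding eventually_at_filter
    proof (intro always_eventually allI impI)
      fix s :: real assume "s \<noteq> 0"
      then have "(f s - f 0) /\<^sub>R s - D = (f s - f 0 - s *\<^sub>R D) /\<^sub>R s"
        by (simp add: scaleR_right_diff_distrib)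
      then show "norm ((f s - f 0 - s *\<^sub>R D) /\<^sub>R \<bar>s\<bar>) = norm ((f s - f 0) /\<^sub>R s - D)"
        by (simp only: norm_scaleR abs_inverse abs_abs)
    qed
  qed
  then show ?thesis
    by (rule LIM_zero_cancel[OF tendsto_norm_zero_cancel])
qed

text \<open>The mean of the difference quotients vanishes by translation invariance.\<close>
lemma torus_integral_partial:
  fixes F :: "'a::euclidean_space \<Rightarrow> 'b::euclidean_space"
  assumes per: "periodic F" and b: "b \<in> Basis"
    and diff: "\<And>x. F differentiable (at x)" and cont: "continuous_on UNIV (partial b F)"
  shows "(LINT x|torus. partial b F x) = 0"
proof -
  have contF: "continuous_on UNIV F"
    by (simp add: continuous_on_eq_continuous_at diff differentiable_imp_continuous_within)
  have der: "((\<lambda>s. F (x + s *\<^sub>R b)) has_vector_derivative partial b F (x + s *\<^sub>R b)) (at s)" for x s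
  proof -
    have *: "((\<lambda>s. x + s *\<^sub>R b) has_derivative (\<lambda>h. h *\<^sub>R b)) (at s)"
      by (auto intro!: derivative_eq_intros)
    have "(F has_derivative frechet_derivative F (at (x + s *\<^sub>R b))) (at (x + s *\<^sub>R b))"
      using diff frechet_derivative_works by blast
    then have "((\<lambda>s. F (x + s *\<^sub>R b)) has_derivative (\<lambda>h. frechet_derivative F (at (x + s *\<^sub>R b)) (h *\<^sub>R b))) (at s)"
      using has_derivative_compose[OF *] by blast
    moreover have "(\<lambda>h. frechet_derivative F (at (x + s *\<^sub>R b)) (h *\<^sub>R b)) = (\<lambda>h. h *\<^sub>R partial b F (x + s *\<^sub>R b))"
      unfolding partial_def using diff linear_frechet_derivative linear_scale by blast
    ultimately show ?thesis by (simp add: has_vector_derivative_def)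
  qed
  \<comment> \<open>The points x + s b with x in the cube and s \<le> 1 may leave the cube; K
    contains them all, which gives one bound B for every difference quotient.\<close>
  define K where "K = cbox (0::'a) ((2 * pi) *\<^sub>R One + b)"
  have "compact (partial b F ` K)"
    unfolding K_def by (intro compact_continuous_image continuous_on_subset[OF cont]) auto
  then obtain B where B: "\<And>x. x \<in> K \<Longrightarrow> norm (partial b F x) \<le> B"
    by (meson bounded_iff compact_imp_bounded image_eqI)
  define h where "h n = 1 / real (Suc n)" for n
  have h: "0 < h n" "h n \<le> 1" for n
    by (auto simp: h_def)
  define q where "q n x = (1 / h n) *\<^sub>R (F (x + h n *\<^sub>R b) - F x)" for n x
  have cont_s: "continuous_on UNIV (\<lambda>x. F (x + v))" for v
    by (intro continuous_on_compose2[OF contF]) (auto intro!: continuous_intros)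
  have "(\<lambda>n. LINT x|torus. q n x) \<longlonglongrightarrow> (LINT x|torus. partial b F x)"
  proof (rule integral_dominated_convergence[where w="\<lambda>_. B"])
    show "partial b F \<in> borel_measurable torus"
      by (rule torus_measurable_continuous[OF cont])
    show "q n \<in> borel_measurable torus" for n
      unfolding q_def by (intro torus_measurable_continuous continuous_intros cont_s contF)
    show "integrable torus (\<lambda>_. B)" by auto
    show "AE x in torus. (\<lambda>n. q n x) \<longlonglongrightarrow> partial b F x"
    proof (rule AE_I2)
      fix x
      have "((\<lambda>s. (F (x + s *\<^sub>R b) - F x) /\<^sub>R s) \<longlongrightarrow> partial b F x) (at 0)"
        using has_vector_derivative_tendsto0[OF der[of x 0]] by simp
      moreover have "filterlim h (at 0) sequentially"
        unfolding filterlim_at using h LIMSEQ_inverse_real_of_nat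
        by (auto intro!: always_eventually simp: less_le h_def[abs_def] inverse_eq_divide)
      ultimately have "(\<lambda>n. (F (x + h n *\<^sub>R b) - F x) /\<^sub>R h n) \<longlonglongrightarrow> partial b F x"
        by (rule filterlim_compose[of "\<lambda>s. (F (x + s *\<^sub>R b) - F x) /\<^sub>R s" _ "at 0" h])
      then show "(\<lambda>n. q n x) \<longlonglongrightarrow> partial b F x"
        unfolding q_def by (simp add: inverse_eq_divide)
    qed
    show "AE x in torus. norm (q n x) \<le> B" for n
    proof (rule AE_I2)
      fix x :: 'a assume x: "x \<in> space torus"
      have "\<exists>s\<in>{0<..<h n}. norm (F (x + h n *\<^sub>R b) - F (x + 0 *\<^sub>R b)) \<le> norm ((h n - 0) *\<^sub>R partial b F (x + s *\<^sub>R b))"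
        by (rule mvt_general[OF h(1)])
          (use der in \<open>auto simp: has_vector_derivative_def intro!: continuous_at_imp_continuous_on
             intro: has_derivative_continuous\<close>)
      then obtain s where s: "0 < s" "s < h n"
        "norm (F (x + h n *\<^sub>R b) - F x) \<le> h n * norm (partial b F (x + s *\<^sub>R b))"
        using h[of n] by auto
      have "x + s *\<^sub>R b \<in> K"
        using x s h[of n] b by (auto simp: K_def space_torus mem_box inner_add_left inner_Basis split: if_splits)
      then have "h n * norm (partial b F (x + s *\<^sub>R b)) \<le> h n * B"
        using B h[of n] by (intro mult_left_mono) auto
      with s have "norm (F (x + h n *\<^sub>R b) - F x) \<le> h n * B" by linarith
      then have "norm (F (x + h n *\<^sub>R b) - F x) / h n \<le> B"
        using h[of n] by (subst pos_divide_le_eq) (auto simp: mult.commute)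
      moreover have "norm (q n x) = norm (F (x + h n *\<^sub>R b) - F x) / h n"
        using h[of n] unfolding q_def norm_scaleR by simp
      ultimately show "norm (q n x) \<le> B"
        by simp
    qed
  qed
  moreover have "(LINT x|torus. q n x) = 0" for n
  proof -
    have "(LINT x|torus. q n x) = (1 / h n) *\<^sub>R ((LINT x|torus. F (x + h n *\<^sub>R b)) - (LINT x|torus. F x))"
      unfolding q_def by (simp add: Bochner_Integration.integral_diff torus_integrable_continuous cont_s contF)
    also have "\<dots> = 0"
      using torus_integral_translate[OF per contF b, of "h n"] h[of n] pi_gt3 by auto
    finally show ?thesis .
  qed
  ultimately show ?thesis
    by (simp add: LIMSEQ_const_iff)
qed

subsection \<open>Uniqueness of Fourier coefficients\<close>

text \<open>Generated rather than given by explicit sums: vanishing Fourier coefficients then extend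
  by induction to every trigonometric polynomial, and closure under products only needs addition of
  frequencies.\<close>

inductive trig_poly :: "('a::euclidean_space \<Rightarrow> complex) \<Rightarrow> bool" where
  mode: "m \<in> int_lattice \<Longrightarrow> trig_poly (\<lambda>x. cis (m \<bullet> x))"
| scale: "trig_poly p \<Longrightarrow> trig_poly (\<lambda>x. c * p x)"
| add: "trig_poly p \<Longrightarrow> trig_poly q \<Longrightarrow> trig_poly (\<lambda>x. p x + q x)"

lemma int_lattice_0 [simp]: "0 \<in> int_lattice"
  by (auto simp: int_lattice_def)

lemma int_lattice_add: "m \<in> int_lattice \<Longrightarrow> n \<in> int_lattice \<Longrightarrow> m + n \<in> int_lattice"
  by (auto simp: int_lattice_def inner_add_left)

lemma int_lattice_uminus: "m \<in> int_lattice \<Longrightarrow> - m \<in> int_lattice"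
  by (auto simp: int_lattice_def)

lemma int_lattice_diff: "m \<in> int_lattice \<Longrightarrow> n \<in> int_lattice \<Longrightarrow> m - n \<in> int_lattice"
  by (auto simp: int_lattice_def inner_diff_left)

lemma int_lattice_Basis: "b \<in> Basis \<Longrightarrow> b \<in> int_lattice"
  by (auto simp: int_lattice_def inner_Basis)

lemma trig_poly_const: "trig_poly (\<lambda>x::'a::euclidean_space. c)"
  using scale[OF mode[OF int_lattice_0], of c] by simp

lemma trig_poly_mult:
  assumes "trig_poly p" "trig_poly q"
  shows "trig_poly (\<lambda>x. p x * q x)"
  using assms(1)
proof induction
  case (mode m)
  show ?case using assms(2)
  proof induction
    case (mode n)
    then show ?case
      using trig_poly.mode[OF int_lattice_add[OF \<open>m \<in> int_lattice\<close> mode]]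
      by (simp add: cis_mult inner_add_left)
  next
    case (scale q c)
    then show ?case using trig_poly.scale[OF scale.IH, of c] by (simp add: mult_ac)
  next
    case (add q r)
    then show ?case using trig_poly.add[OF add.IH] by (simp add: distrib_left)
  qed
next
  case (scale p c)
  then show ?case using trig_poly.scale[OF scale.IH, of c] by (simp add: mult_ac)
next
  case (add p r)
  then show ?case using trig_poly.add[OF add.IH] by (simp add: distrib_right)
qed

lemma trig_poly_prod: "finite A \<Longrightarrow> (\<And>i. i \<in> A \<Longrightarrow> trig_poly (p i)) \<Longrightarrow> trig_poly (\<lambda>x. \<Prod>i\<in>A. p i x)"
  by (induction A rule: finite_induct) (auto intro: trig_poly_const trig_poly_mult)

lemma trig_poly_cos: "b \<in> Basis \<Longrightarrow> trig_poly (\<lambda>x. complex_of_real (cos (x \<bullet> b - c)))"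
proof -
  assume b: "b \<in> Basis"
  have "trig_poly (\<lambda>x. (cis (- c) / 2) * cis (b \<bullet> x) + (cis c / 2) * cis ((- b) \<bullet> x))"
    using b by (intro trig_poly.intros int_lattice_Basis int_lattice_uminus)
  moreover have "complex_of_real (cos (x \<bullet> b - c)) =
    (cis (- c) / 2) * cis (b \<bullet> x) + (cis c / 2) * cis ((- b) \<bullet> x)" for x
    by (simp add: complex_eq_iff cis_mult cos_diff sin_diff inner_commute field_simps)
  ultimately show ?thesis by simp
qed

text \<open>This lets the one-variable Weierstrass theorem supply approximations on the torus, by
  substituting cosines into polynomials.\<close>

lemma trig_poly_polynomial:
  assumes "real_polynomial_function g" "trig_poly (\<lambda>x. complex_of_real (q x))"
  shows "trig_poly (\<lambda>x. complex_of_real (g (q x)))"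
  using assms(1)
proof induction
  case (linear f)
  then have "f y = f 1 * y" for y :: real
    using linear_scale[of f y 1] by (simp add: bounded_linear.linear)
  then have "(\<lambda>x. complex_of_real (f (q x))) = (\<lambda>x. complex_of_real (f 1) * complex_of_real (q x))"
    by (metis of_real_mult)
  then show ?case using trig_poly.scale[OF assms(2)] by simp
next
  case (const c)
  then show ?case by (rule trig_poly_const)
next
  case (add f g)
  then show ?case using trig_poly.add by fastforce
next
  case (mult f g)
  then show ?case using trig_poly_mult by fastforce
qed

lemma torus_integrable_mult_bounded:
  fixes f g :: "'a::euclidean_space \<Rightarrow> 'b::{banach, second_countable_topology, real_normed_div_algebra}"
  assumes "integrable torus f" "g \<in> borel_measurable torus" "AE x in torus. norm (g x) \<le> B"
  shows "integrable torus (\<lambda>x. f x * g x)"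
proof (rule Bochner_Integration.integrable_bound)
  show "integrable torus (\<lambda>x. B * norm (f x))" using assms by simp
  show "(\<lambda>x. f x * g x) \<in> borel_measurable torus" using assms by auto
  show "AE x in torus. norm (f x * g x) \<le> norm (B * norm (f x))"
    using assms(3)
  proof eventually_elim
    case (elim x)
    have "norm (f x) * norm (g x) \<le> norm (f x) * \<bar>B\<bar>"
      using elim by (intro mult_left_mono) auto
    then show ?case by (simp add: norm_mult mult.commute abs_mult)
  qed
qed

lemma torus_integrable_mult_cis:
  assumes "integrable torus f"
  shows "integrable torus (\<lambda>x. f x * cis (m \<bullet> x))"
  by (rule torus_integrable_mult_bounded[of _ _ 1])
    (auto intro!: assms torus_measurable_continuous continuous_intros)

text \<open>Turns a coordinate interval into a positivity condition on a cosine centred at its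
  midpoint. Cosine decreases in the distance from the midpoint up to pi; beyond pi the distance is
  still at most 2 pi - r, and reflection at pi gives a value of at most cos r.\<close>

lemma cos_gt_cos_iff:
  assumes l: "0 \<le> l" "l < u" "u \<le> 2 * pi" and y: "0 < y" "y < 2 * pi"
  shows "cos (y - (l + u) / 2) - cos ((u - l) / 2) > 0 \<longleftrightarrow> l < y \<and> y < u"
proof -
  define c r where "c = (l + u) / 2" and "r = (u - l) / 2"
  have lu: "l = c - r" "u = c + r" by (auto simp: c_def r_def field_simps)
  have r: "0 < r" "r \<le> pi" using l by (auto simp: r_def)
  have abs: "cos (y - c) = cos \<bar>y - c\<bar>" by simp
  have "cos \<bar>y - c\<bar> > cos r \<longleftrightarrow> \<bar>y - c\<bar> < r"
  proof (cases "\<bar>y - c\<bar> \<le> pi")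
    case True
    then show ?thesis using r cos_mono_less_eq[of r "\<bar>y - c\<bar>"] by simp
  next
    case False
    have "cos \<bar>y - c\<bar> = cos (2 * pi - \<bar>y - c\<bar>)" by (simp add: cos_diff)
    moreover have "\<bar>y - c\<bar> \<le> 2 * pi - r"
      using l y unfolding lu by linarith
    moreover have "cos (2 * pi - z) \<le> cos r" if "z \<le> 2 * pi - r" "\<not> z \<le> pi" for z
      using that r by (intro cos_monotone_0_pi_le) auto
    ultimately have "cos \<bar>y - c\<bar> \<le> cos r"
      using False by metis
    then show ?thesis using False r by auto
  qed
  then show ?thesis
    unfolding c_def[symmetric] r_def[symmetric] abs by (auto simp: lu)
qed

text \<open>All integrals of f against trigonometric polynomials vanish. Indicators of boxes are
  bounded pointwise limits of such polynomials, so f integrates to zero over boxes, then over Borel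
  sets, then over all measurable sets.\<close>

theorem torus_fourier_unique:
  fixes f :: "'a::euclidean_space \<Rightarrow> complex"
  assumes int: "integrable torus f"
    and coeff: "\<And>m. m \<in> int_lattice \<Longrightarrow> (LINT x|torus. f x * cis (m \<bullet> x)) = 0"
  shows "AE x in torus. f x = 0"
proof -
  have fp: "integrable torus (\<lambda>x. f x * p x) \<and> (LINT x|torus. f x * p x) = 0" if "trig_poly p" for p
    using that
  proof induction
    case (mode m)
    then show ?case using coeff torus_integrable_mult_cis[OF int] by auto
  next
    case (scale p c)
    then show ?case by (simp add: mult.left_commute)
  next
    case (add p q)
    then show ?case by (simp add: distrib_left)
  qed
  \<comment> \<open>A continuous ramp that tends to the indicator of the positive half-line.
    Approximation on [-2,2] suffices because a difference of two cosines stays there.\<close>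
  define step where "step n y = min 1 (max 0 (real n * y))" for n and y :: real
  have "\<exists>g. real_polynomial_function g \<and> (\<forall>y\<in>{-2..2}. \<bar>step n y - g y\<bar> < 1 / Suc n)" for n
  proof -
    have "continuous_on {-2..2} (step n)"
      unfolding step_def by (intro continuous_intros)
    then obtain g where "real_polynomial_function g" "\<And>y. y \<in> {-2..2} \<Longrightarrow> \<bar>step n y - g y\<bar> < 1 / Suc n"
      by (rule Stone_Weierstrass_real_polynomial_function[rotated, where e="1 / Suc n"]) auto
    then show ?thesis by blast
  qed
  then obtain g where g: "\<And>n. real_polynomial_function (g n)"
    "\<And>n y. y \<in> {-2..2} \<Longrightarrow> \<bar>step n y - g n y\<bar> < 1 / Suc n" by metis
  have gb: "\<bar>g n y\<bar> \<le> 2" if "y \<in> {-2..2}" for n y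
  proof -
    have "\<bar>step n y\<bar> \<le> 1" by (auto simp: step_def)
    moreover have "1 / real (Suc n) \<le> 1" by simp
    ultimately show ?thesis using g(2)[OF that, of n] by linarith
  qed
  have glim: "(\<lambda>n. g n y) \<longlonglongrightarrow> (if y > 0 then 1 else 0)" if y: "y \<in> {-2..2}" for y
  proof -
    have "(\<lambda>n. step n y) \<longlonglongrightarrow> (if y > 0 then 1 else 0)"
    proof (cases "y > 0")
      case True
      obtain N where N: "1 < real N * y" using True reals_Archimedean3 by blast
      have "step n y = 1" if "n \<ge> N" for n
      proof -
        have "real N * y \<le> real n * y" using that True by (intro mult_right_mono) auto
        then show ?thesis using N by (simp add: step_def)
      qed
      then have "eventually (\<lambda>n. step n y = 1) sequentially" by (auto simp: eventually_sequentially)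
      then show ?thesis using True by (simp add: tendsto_eventually)
    next
      case False
      then have "step n y = 0" for n by (simp add: step_def mult_nonneg_nonpos)
      then show ?thesis using False by simp
    qed
    moreover have "(\<lambda>n. step n y - g n y) \<longlonglongrightarrow> 0"
      by (rule Lim_null_comparison[OF always_eventually LIMSEQ_inverse_real_of_nat])
        (use g(2)[OF y] in \<open>auto intro!: less_imp_le simp: inverse_eq_divide\<close>)
    ultimately have "(\<lambda>n. step n y - (step n y - g n y)) \<longlonglongrightarrow> (if y > 0 then 1 else 0) - 0"
      by (rule tendsto_diff)
    then show ?thesis by simp
  qed
  have box: "(LINT x|torus. indicator (box l u) x *\<^sub>R f x) = 0" for l u :: 'a
  proof -
    \<comment> \<open>The box is clipped to the cube, as \<open>cos_gt_cos_iff\<close> requires;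
      almost every point lies in the open cube, where clipping changes nothing.\<close>
    define l' where "l' b = max 0 (l \<bullet> b)" for b
    define u' where "u' b = min (2 * pi) (u \<bullet> b)" for b
    define q where "q b x = cos (x \<bullet> b - (l' b + u' b) / 2) - cos ((u' b - l' b) / 2)" for b and x :: 'a
    have in_box: "x \<in> box l u \<longleftrightarrow> (\<forall>b\<in>Basis. l' b < x \<bullet> b \<and> x \<bullet> b < u' b)"
      if "x \<in> box 0 ((2 * pi) *\<^sub>R One)" for x
      using that by (auto simp: mem_box l'_def u'_def)
    show ?thesis
    proof (cases "\<forall>b\<in>Basis. l' b < u' b")
      case False
      then obtain b where b: "b \<in> Basis" "u' b \<le> l' b" by force
      have "AE x in torus. indicator (box l u) x *\<^sub>R f x = 0"
        using AE_torus_box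
      proof eventually_elim
        case (elim x)
        have "x \<notin> box l u" using in_box[OF elim] b by force
        then show ?case by simp
      qed
      then show ?thesis by (rule integral_eq_zero_AE)
    next
      case True
      have q2: "q b x \<in> {-2..2}" for b x
        unfolding q_def using cos_le_one cos_ge_minus_one by (smt (verit) atLeastAtMost_iff)
      define P where "P n x = (\<Prod>b\<in>Basis. complex_of_real (g n (q b x)))" for n x
      have q: "trig_poly (\<lambda>x. complex_of_real (q b x))" if "b \<in> Basis" for b
        using trig_poly.add[OF trig_poly_cos[OF that] trig_poly_const[of "- complex_of_real (cos ((u' b - l' b) / 2))"], of "(l' b + u' b) / 2"]
        unfolding q_def by simp
      have P: "trig_poly (P n)" for n
        unfolding P_def
      proof (rule trig_poly_prod)
        fix b :: 'a assume b: "b \<in> Basis"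
        show "trig_poly (\<lambda>x. complex_of_real (g n (q b x)))"
          by (rule trig_poly_polynomial[OF g(1) q[OF b]])
      qed simp
      have "(\<lambda>n. LINT x|torus. f x * P n x) \<longlonglongrightarrow> (LINT x|torus. indicator (box l u) x *\<^sub>R f x)"
      proof (rule integral_dominated_convergence[where w="\<lambda>x. 2 ^ DIM('a) * norm (f x)"])
        show "(\<lambda>x. indicator (box l u) x *\<^sub>R f x) \<in> borel_measurable torus"
        proof -
          have "box l u \<inter> space torus \<in> sets torus"
            by (auto simp: torus_def sets_restrict_space)
          then show ?thesis using int borel_measurable_integrable by (intro borel_measurable_scaleR borel_measurable_indicator') (auto simp: Collect_conj_eq Int_commute)
        qed
        show "(\<lambda>x. f x * P n x) \<in> borel_measurable torus" for n
          using fp[OF P[of n]] borel_measurable_integrable by blast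
        show "integrable torus (\<lambda>x. 2 ^ DIM('a) * norm (f x))" using int by simp
        show "AE x in torus. (\<lambda>n. f x * P n x) \<longlonglongrightarrow> indicator (box l u) x *\<^sub>R f x"
          using AE_torus_box
        proof eventually_elim
          case (elim x)
          have "(\<lambda>n. P n x) \<longlonglongrightarrow> (\<Prod>b\<in>Basis. complex_of_real (if q b x > 0 then 1 else 0))"
            unfolding P_def by (intro tendsto_prod tendsto_of_real glim q2)
          also have "(\<Prod>b\<in>Basis. complex_of_real (if q b x > 0 then 1 else 0)) = indicator (box l u) x"
          proof -
            have "q b x > 0 \<longleftrightarrow> l' b < x \<bullet> b \<and> x \<bullet> b < u' b" if "b \<in> Basis" for b
              unfolding q_def using that True elim
              by (intro cos_gt_cos_iff) (auto simp: mem_box l'_def u'_def)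
            then show ?thesis
              unfolding indicator_def in_box[OF elim] by (auto simp: prod_zero_iff intro!: prod.neutral)
          qed
          finally have "(\<lambda>n. f x * P n x) \<longlonglongrightarrow> f x * indicator (box l u) x"
            by (intro tendsto_mult tendsto_const)
          moreover have "f x * indicator (box l u) x = indicator (box l u) x *\<^sub>R f x"
            by (simp add: indicator_def)
          ultimately show ?case by simp
        qed
        show "AE x in torus. norm (f x * P n x) \<le> 2 ^ DIM('a) * norm (f x)" for n
        proof (rule AE_I2)
          fix x
          have "norm (P n x) = (\<Prod>b\<in>Basis. \<bar>g n (q b x)\<bar>)"
            unfolding P_def by (simp add: prod_norm[symmetric])
          also have "\<dots> \<le> (\<Prod>b\<in>(Basis::'a set). 2)"
            by (intro prod_mono conjI gb q2) auto
          finally have "norm (P n x) \<le> 2 ^ DIM('a)" by simp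
          then show "norm (f x * P n x) \<le> 2 ^ DIM('a) * norm (f x)"
            by (simp add: norm_mult mult.commute mult_left_mono)
        qed
      qed
      moreover have "(LINT x|torus. f x * P n x) = 0" for n
        using fp[OF P[of n]] by simp
      ultimately show ?thesis
        by (simp add: LIMSEQ_const_iff)
    qed
  qed
  have sets: "S \<inter> space torus \<in> sets (torus :: 'a measure)" if "S \<in> sets borel" for S :: "'a set"
    using that by (auto simp: torus_def sets_restrict_space)
  have ii: "integrable torus (\<lambda>x. indicator S x *\<^sub>R f x)" if "S \<in> sets borel" for S :: "'a set"
  proof -
    have "integrable torus (\<lambda>x. indicator (S \<inter> space torus) x *\<^sub>R f x)"
      by (rule integrable_mult_indicator[OF sets[OF that] int])
    then show ?thesis
      by (rule iffD1[OF Bochner_Integration.integrable_cong, rotated -1]) (auto simp: indicator_def)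
  qed
  have total: "(LINT x|torus. f x) = 0"
    using coeff[of 0] by simp
  have borel: "(LINT x|torus. indicator S x *\<^sub>R f x) = 0" if "S \<in> sets borel" for S
  proof -
    \<comment> \<open>Boxes are closed under intersection and generate the Borel sets, so the claim
      extends through complements and disjoint unions.\<close>
    have "Int_stable (range (\<lambda>(a, b). box a b :: 'a set))"
      by (auto simp: Int_stable_def box_Int_box)
    moreover have "range (\<lambda>(a, b). box a b :: 'a set) \<subseteq> Pow UNIV" by simp
    moreover have "S \<in> sigma_sets UNIV (range (\<lambda>(a, b). box a b))"
      using that by (simp add: borel_eq_box)
    ultimately show ?thesis
    proof (induction rule: sigma_sets_induct_disjoint)
      case (basic A)
      then show ?case using box by auto
    next
      case empty
      then show ?case by simp
    next
      case (compl A)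
      then have A: "A \<in> sets borel" by (simp add: borel_eq_box)
      have "(LINT x|torus. indicator (UNIV - A) x *\<^sub>R f x) = (LINT x|torus. f x - indicator A x *\<^sub>R f x)"
        by (rule Bochner_Integration.integral_cong) (auto simp: indicator_def)
      also have "\<dots> = 0"
        using ii[OF A] int total compl by simp
      finally show ?case .
    next
      case (union A)
      then have A: "A i \<in> sets borel" for i using union(2) by (auto simp: borel_eq_box)
      have "(\<lambda>n. LINT x|torus. indicator (\<Union>i<n. A i) x *\<^sub>R f x) \<longlonglongrightarrow> (LINT x|torus. indicator (\<Union>i. A i) x *\<^sub>R f x)"
      proof (rule integral_dominated_convergence[where w="\<lambda>x. norm (f x)"])
        show "(\<lambda>x. indicator (\<Union>i. A i) x *\<^sub>R f x) \<in> borel_measurable torus"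
          using ii[of "\<Union>i. A i"] A by auto
        show "(\<lambda>x. indicator (\<Union>i<n. A i) x *\<^sub>R f x) \<in> borel_measurable torus" for n
          using ii[of "\<Union>i<n. A i"] A by auto
        show "AE x in torus. (\<lambda>n. indicator (\<Union>i<n. A i) x *\<^sub>R f x) \<longlonglongrightarrow> indicator (\<Union>i. A i) x *\<^sub>R f x"
        proof (intro AE_I2 tendsto_scaleR tendsto_const)
          fix x
          show "(\<lambda>n. indicat_real (\<Union>i<n. A i) x) \<longlonglongrightarrow> indicat_real (\<Union>i. A i) x"
            by (rule LIMSEQ_indicator_UN)
        qed
      qed (use int in \<open>auto simp: indicator_def\<close>)
      moreover have "(LINT x|torus. indicator (\<Union>i<n. A i) x *\<^sub>R f x) = 0" for n
      proof -
        have "indicator (\<Union>i<n. A i) x *\<^sub>R f x = (\<Sum>i<n. indicator (A i) x *\<^sub>R f x)" for x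
          by (subst indicator_UN_disjoint)
            (use union(1) in \<open>auto simp: scaleR_left.sum disjoint_family_on_def\<close>)
        then have "(LINT x|torus. indicator (\<Union>i<n. A i) x *\<^sub>R f x) = (LINT x|torus. (\<Sum>i<n. indicator (A i) x *\<^sub>R f x))"
          by (simp only:)
        also have "\<dots> = (\<Sum>i<n. LINT x|torus. indicator (A i) x *\<^sub>R f x)"
          by (rule Bochner_Integration.integral_sum) (rule ii[OF A])
        also have "\<dots> = 0"
          by (rule sum.neutral) (use union(3) in blast)
        finally show ?thesis .
      qed
      ultimately show ?case by (simp add: LIMSEQ_const_iff)
    qed
  qed
  show ?thesis
  proof (rule torus.density_zero[OF int])
    fix A assume "A \<in> sets (torus :: 'a measure)"
    then obtain S where S: "S \<in> sets lebesgue" "A = cbox 0 ((2 * pi) *\<^sub>R One) \<inter> S"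
      by (auto simp: torus_def sets_restrict_space)
    \<comment> \<open>A Lebesgue set differs from its Borel main part by a null set only.\<close>
    have M: "main_part lborel S \<in> sets borel"
      using main_part_sets[of S lborel] S by simp
    have "AE x in lborel. x \<notin> null_part lborel S"
      using S by (intro AE_notin_null_part) auto
    then have "AE x in torus. indicator A x *\<^sub>R f x = indicator (main_part lborel S) x *\<^sub>R f x"
      unfolding AE_torus_iff
    proof eventually_elim
      case (elim x)
      then have "x \<in> S \<longleftrightarrow> x \<in> main_part lborel S"
        using main_part_null_part_Un[of S lborel] S(1) by blast
      then show ?case by (auto simp: S indicator_def)
    qed
    then have "(LINT x|torus. indicator A x *\<^sub>R f x) = (LINT x|torus. indicator (main_part lborel S) x *\<^sub>R f x)"
      using int ii[OF M] \<open>A \<in> sets torus\<close>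
      by (intro integral_cong_AE) (auto intro!: borel_measurable_scaleR)
    then show "(LINT x:A|torus. f x) = 0"
      using borel[OF M] by (simp add: set_lebesgue_integral_def)
  qed
qed

subsection \<open>Absolutely convergent Fourier series on the two-dimensional torus\<close>

lemma int_lattice_vec2: "(int_lattice :: (real^2) set) = range (\<lambda>(a::int, b::int). vector [real_of_int a, real_of_int b])"
proof (intro set_eqI iffI)
  fix m :: "real^2"
  assume "m \<in> int_lattice"
  then have "\<forall>b\<in>Basis. m \<bullet> b \<in> \<int>" by (simp add: int_lattice_def)
  moreover have "axis i (1::real) \<in> Basis" for i :: 2
    by (auto simp: Basis_vec_def)
  ultimately have "m $ 1 \<in> \<int>" "m $ 2 \<in> \<int>"
    by (auto simp: cart_eq_inner_axis)
  then obtain a b where "m $ 1 = of_int a" "m $ 2 = of_int b" by (auto elim!: Ints_cases)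
  then have "m = (\<lambda>(a::int, b::int). vector [real_of_int a, real_of_int b]) (a, b)"
    by (simp add: vec_eq_iff forall_2)
  then show "m \<in> range (\<lambda>(a::int, b::int). vector [real_of_int a, real_of_int b])" by blast
next
  fix m :: "real^2"
  assume "m \<in> range (\<lambda>(a::int, b::int). vector [real_of_int a, real_of_int b])"
  then obtain a b :: int where "m = vector [real_of_int a, real_of_int b]" by auto
  then have "m $ i \<in> \<int>" for i
    using exhaust_2[of i] by auto
  then show "m \<in> int_lattice"
    by (auto simp: int_lattice_def Basis_vec_def inner_axis)
qed

lemma countable_int_lattice: "countable (int_lattice :: (real^2) set)"
  unfolding int_lattice_vec2 by (rule countable_image) simp

lemma infinite_int_lattice: "infinite (int_lattice :: (real^2) set)"
proof
  assume "finite (int_lattice :: (real^2) set)"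
  then have "finite ((\<lambda>m. m $ 1) ` (int_lattice :: (real^2) set))" by simp
  moreover have "range real_of_int \<subseteq> (\<lambda>m. m $ 1) ` (int_lattice :: (real^2) set)"
  proof
    fix y assume "y \<in> range real_of_int"
    then obtain a where "y = real_of_int a" by auto
    then show "y \<in> (\<lambda>m. m $ 1) ` (int_lattice :: (real^2) set)"
      unfolding int_lattice_vec2 by (intro image_eqI[of _ _ "vector [real_of_int a, real_of_int 0]"]) (auto intro!: rangeI image_eqI[of _ _ "(a, 0)"])
  qed
  ultimately have "finite (range real_of_int)" by (rule finite_subset[rotated])
  then show False using finite_imageD[of real_of_int UNIV] infinite_UNIV_int by (simp add: inj_def)
qed

text \<open>An enumeration by naturals turns lattice sums into series and lets quantification over
  frequencies commute with \<open>AE\<close>.\<close>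

definition freq :: "nat \<Rightarrow> real^2" where
  "freq = from_nat_into int_lattice"

lemma bij_freq: "bij_betw freq UNIV int_lattice"
  unfolding freq_def by (rule bij_betw_from_nat_into[OF countable_int_lattice infinite_int_lattice])

lemma freq_in [simp]: "freq k \<in> int_lattice"
  using bij_freq by (auto simp: bij_betw_def)

lemma freq_inj [simp]: "freq j = freq k \<longleftrightarrow> j = k"
  using bij_freq by (auto simp: bij_betw_def inj_on_def)

lemma freq_surj: "m \<in> int_lattice \<Longrightarrow> \<exists>k. freq k = m"
  using bij_betw_imp_surj_on[OF bij_freq] by (metis rangeE)

definition mode :: "nat \<Rightarrow> real^2 \<Rightarrow> complex" where
  "mode k x = cis (freq k \<bullet> x)"

definition fser :: "(nat \<Rightarrow> complex) \<Rightarrow> real^2 \<Rightarrow> complex" where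
  "fser a x = (\<Sum>k. a k * mode k x)"

definition fc :: "(real^2 \<Rightarrow> complex) \<Rightarrow> nat \<Rightarrow> complex" where
  "fc g k = (LINT x|torus. g x * cis (- (freq k \<bullet> x))) / (4 * pi\<^sup>2)"

text \<open>The Fourier multiplier of the derivative in direction b. Differentiating on the level of
  coefficients avoids differentiating a series.\<close>

definition dcoef :: "real^2 \<Rightarrow> (nat \<Rightarrow> complex) \<Rightarrow> nat \<Rightarrow> complex" where
  "dcoef b a k = \<i> * of_real (freq k \<bullet> b) * a k"

lemma fourier_coeff_fc: "fourier_coeff f (freq k) = fc (\<lambda>x. of_real (f x)) k"
  by (simp add: fourier_coeff_def fc_def power_mult_distrib)

lemma cmod_mode [simp]: "cmod (mode k x) = 1"
  by (simp add: mode_def)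

lemma continuous_on_mode [continuous_intros]: "continuous_on S (mode k)"
  unfolding mode_def by (intro continuous_intros)

lemma mode_measurable [measurable]: "mode k \<in> borel_measurable torus"
  by (intro torus_measurable_continuous continuous_intros)

lemma torus_integral_mode_cnj:
  "(LINT x|torus. mode j x * cis (- (freq k \<bullet> x))) = (if j = k then 4 * pi\<^sup>2 else 0)"
proof -
  have "mode j x * cis (- (freq k \<bullet> x)) = cis ((freq j - freq k) \<bullet> x)" for x
    by (simp add: mode_def cis_mult inner_diff_left)
  then show ?thesis
    by (simp add: torus_integral_cis int_lattice_diff power_mult_distrib)
qed

section \<open>Series with summable coefficients: continuity, coefficients, Parseval\<close>

context
  fixes a :: "nat \<Rightarrow> complex"
  assumes a: "summable (\<lambda>k. cmod (a k))"
begin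

lemma fser_sums: "(\<lambda>k. a k * mode k x) sums fser a x"
  unfolding fser_def by (rule summable_sums, rule summable_norm_cancel) (simp add: norm_mult a)

lemma fser_partial_bound: "cmod (\<Sum>k<n. a k * mode k x) \<le> (\<Sum>k. cmod (a k))"
proof -
  have "cmod (\<Sum>k<n. a k * mode k x) \<le> (\<Sum>k<n. cmod (a k))"
    by (rule order_trans[OF norm_sum]) (simp add: norm_mult)
  also have "\<dots> \<le> (\<Sum>k. cmod (a k))"
    by (rule sum_le_suminf[OF a]) auto
  finally show ?thesis .
qed

lemma fser_bound: "cmod (fser a x) \<le> (\<Sum>k. cmod (a k))"
  using fser_sums[of x] fser_partial_bound
  by (auto simp: sums_def intro!: LIMSEQ_le_const2[OF tendsto_norm])

lemma continuous_on_fser: "continuous_on S (fser a)"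
proof -
  have "uniform_limit UNIV (\<lambda>n x. \<Sum>k<n. a k * mode k x) (\<lambda>x. \<Sum>k. a k * mode k x) sequentially"
    by (rule Weierstrass_m_test[OF _ a]) (simp add: norm_mult)
  then have "continuous_on UNIV (\<lambda>x. \<Sum>k. a k * mode k x)"
    by (rule uniform_limit_theorem[rotated]) (auto intro!: continuous_intros always_eventually)
  then show ?thesis
    unfolding fser_def using continuous_on_subset by blast
qed

lemma fser_measurable: "fser a \<in> borel_measurable torus"
  by (intro torus_measurable_continuous continuous_on_fser)

lemma periodic_fser: "periodic (fser a)"
  using periodic_cis[OF freq_in] by (simp add: periodic_def fser_def mode_def)

text \<open>The partial sums are bounded by the sum of the moduli of the coefficients, so dominated
  convergence exchanges series and integral. Orthogonality, Parseval and the construction of weak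
  derivatives all rest on this exchange.\<close>

lemma fser_integral_sums:
  assumes g: "integrable torus g"
  shows "(\<lambda>k. a k * (LINT x|torus. mode k x * g x)) sums (LINT x|torus. fser a x * g x)"
proof -
  have m: "integrable torus (\<lambda>x. mode k x * g x)" for k
    using torus_integrable_mult_bounded[OF g mode_measurable, of k 1] by (simp add: mult.commute)
  have "(\<lambda>n. LINT x|torus. (\<Sum>k<n. a k * mode k x) * g x) \<longlonglongrightarrow> (LINT x|torus. fser a x * g x)"
  proof (rule integral_dominated_convergence[where w="\<lambda>x. (\<Sum>k. cmod (a k)) * norm (g x)"])
    have [measurable]: "g \<in> borel_measurable torus" using g by simp
    note fser_measurable[measurable]
    show "(\<lambda>x. fser a x * g x) \<in> borel_measurable torus" by measurable
    show "(\<lambda>x. (\<Sum>k<n. a k * mode k x) * g x) \<in> borel_measurable torus" for n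
      by measurable
    show "integrable torus (\<lambda>x. (\<Sum>k. cmod (a k)) * norm (g x))" using g by simp
    show "AE x in torus. (\<lambda>n. (\<Sum>k<n. a k * mode k x) * g x) \<longlonglongrightarrow> fser a x * g x"
      using fser_sums by (intro AE_I2 tendsto_mult tendsto_const) (simp add: sums_def)
    show "AE x in torus. norm ((\<Sum>k<n. a k * mode k x) * g x) \<le> (\<Sum>k. cmod (a k)) * norm (g x)" for n
      using fser_partial_bound by (intro AE_I2) (simp add: norm_mult mult_right_mono)
  qed
  moreover have "(LINT x|torus. (\<Sum>k<n. a k * mode k x) * g x) = (\<Sum>k<n. a k * (LINT x|torus. mode k x * g x))" for n
    by (simp add: sum_distrib_right mult.assoc Bochner_Integration.integral_sum m)
  ultimately show ?thesis by (simp add: sums_def)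
qed

lemma fc_fser: "fc (fser a) k = a k"
proof -
  have "integrable torus (\<lambda>x. cis (- (freq k \<bullet> x)))"
    by (intro torus_integrable_continuous continuous_intros)
  from fser_integral_sums[OF this]
  have 1: "(\<lambda>j. a j * (if j = k then 4 * pi\<^sup>2 else 0)) sums (LINT x|torus. fser a x * cis (- (freq k \<bullet> x)))"
    by (simp add: torus_integral_mode_cnj)
  have 2: "(\<lambda>j. a j * (if j = k then 4 * pi\<^sup>2 else 0)) sums (a k * (4 * pi\<^sup>2))"
    using sums_If_finite_set[of "{k}" "\<lambda>j. a j * (4 * pi\<^sup>2)"] by (simp add: if_distrib cong: if_cong)
  show ?thesis
    unfolding fc_def sums_unique2[OF 1 2] by simp
qed

lemma fser_parseval: "(\<lambda>k. (cmod (a k))\<^sup>2) sums ((LINT x|torus. (cmod (fser a x))\<^sup>2) / (4 * pi\<^sup>2))"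
proof -
  have c: "continuous_on UNIV (\<lambda>x. cnj (fser a x))"
    by (intro continuous_intros continuous_on_fser)
  have *: "(LINT x|torus. mode k x * cnj (fser a x)) = 4 * pi\<^sup>2 * cnj (a k)" for k
  proof -
    have "(LINT x|torus. mode k x * cnj (fser a x)) = (LINT x|torus. cnj (fser a x * cis (- (freq k \<bullet> x))))"
      by (simp add: mode_def cis_cnj mult.commute)
    also have "\<dots> = cnj (LINT x|torus. fser a x * cis (- (freq k \<bullet> x)))"
      by (rule Bochner_Integration.integral_cnj)
    also have "(LINT x|torus. fser a x * cis (- (freq k \<bullet> x))) = 4 * pi\<^sup>2 * a k"
      using fc_fser[of k] by (simp add: fc_def field_simps)
    finally show ?thesis by simp
  qed
  have "(\<lambda>k. a k * (4 * pi\<^sup>2 * cnj (a k))) sums (LINT x|torus. fser a x * cnj (fser a x))"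
    using fser_integral_sums[OF torus_integrable_continuous[OF c]] unfolding * .
  moreover have "(LINT x|torus. fser a x * cnj (fser a x)) = of_real (LINT x|torus. (cmod (fser a x))\<^sup>2)"
    by (simp only: complex_norm_square[symmetric] integral_complex_of_real of_real_power[symmetric])
  moreover have "a k * (4 * pi\<^sup>2 * cnj (a k)) = of_real (4 * pi\<^sup>2 * (cmod (a k))\<^sup>2)" for k
    using complex_norm_square[of "a k"] by (simp add: algebra_simps)
  ultimately have "(\<lambda>k. 4 * pi\<^sup>2 * (cmod (a k))\<^sup>2) sums (LINT x|torus. (cmod (fser a x))\<^sup>2)"
    by (simp only: sums_of_real_iff)
  from sums_divide[OF this, of "4 * pi\<^sup>2"] show ?thesis by simp
qed

end

lemma fc_integrable: "integrable torus g \<Longrightarrow> integrable torus (\<lambda>x. g x * cis (- (freq k \<bullet> x)))"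
  using torus_integrable_mult_cis[of g "- freq k"] by simp

text \<open>The difference of both sides has vanishing coefficients, so uniqueness applies. This
  turns knowledge about the coefficients of a merely integrable function into pointwise
  knowledge.\<close>

theorem AE_eq_fser:
  assumes g: "integrable torus g" and s: "summable (\<lambda>k. cmod (fc g k))"
  shows "AE x in torus. g x = fser (fc g) x"
proof -
  have F: "integrable torus (fser (fc g))"
    by (intro torus_integrable_continuous continuous_on_fser s)
  have "AE x in torus. g x - fser (fc g) x = 0"
  proof (rule torus_fourier_unique)
    show "integrable torus (\<lambda>x. g x - fser (fc g) x)" using g F by simp
    fix m :: "real^2" assume "m \<in> int_lattice"
    then obtain k where k: "freq k = - m" using freq_surj int_lattice_uminus by blast
    have "fc g k = fc (fser (fc g)) k" by (simp add: fc_fser s)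
    then show "(LINT x|torus. (g x - fser (fc g) x) * cis (m \<bullet> x)) = 0"
      using fc_integrable[OF g, of k] fc_integrable[OF F, of k]
      by (simp add: fc_def k left_diff_distrib)
  qed
  then show ?thesis by simp
qed

text \<open>The squared distance between g and its n-th partial sum is nonnegative, which bounds the
  first n coefficients. It serves the convection term, whose coefficients are controlled only in the
  square sum.\<close>

lemma bessel:
  assumes g: "continuous_on UNIV g"
  shows "summable (\<lambda>k. (cmod (fc g k))\<^sup>2)" "(\<Sum>k. (cmod (fc g k))\<^sup>2) \<le> (LINT x|torus. (cmod (g x))\<^sup>2) / (4 * pi\<^sup>2)"
proof -
  have *: "(\<Sum>k<n. (cmod (fc g k))\<^sup>2) \<le> (LINT x|torus. (cmod (g x))\<^sup>2) / (4 * pi\<^sup>2)" for n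
  proof -
    define a where "a k = (if k < n then fc g k else 0)" for k
    have sa: "summable (\<lambda>k. cmod (a k))"
      by (rule summable_finite[of "{..<n}"]) (auto simp: a_def)
    have gi: "integrable torus g" using g by (rule torus_integrable_continuous)
    have cnjg: "continuous_on UNIV (\<lambda>x. cnj (g x))" using g by (intro continuous_intros)
    have m: "(LINT x|torus. mode k x * cnj (g x)) = 4 * pi\<^sup>2 * cnj (fc g k)" for k
    proof -
      have "(LINT x|torus. mode k x * cnj (g x)) = (LINT x|torus. cnj (g x * cis (- (freq k \<bullet> x))))"
        by (simp add: mode_def cis_cnj mult.commute)
      also have "\<dots> = cnj (LINT x|torus. g x * cis (- (freq k \<bullet> x)))"
        by (rule Bochner_Integration.integral_cnj)
      also have "(LINT x|torus. g x * cis (- (freq k \<bullet> x))) = 4 * pi\<^sup>2 * fc g k"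
        by (simp add: fc_def)
      finally show ?thesis by simp
    qed
    have P: "(LINT x|torus. fser a x * cnj (g x)) = of_real (4 * pi\<^sup>2 * (\<Sum>k<n. (cmod (fc g k))\<^sup>2))"
    proof -
      have 1: "(\<lambda>k. a k * (4 * pi\<^sup>2 * cnj (fc g k))) sums (LINT x|torus. fser a x * cnj (g x))"
        using fser_integral_sums[OF sa torus_integrable_continuous[OF cnjg]] unfolding m .
      have 2: "(\<lambda>k. a k * (4 * pi\<^sup>2 * cnj (fc g k))) sums (\<Sum>k<n. a k * (4 * pi\<^sup>2 * cnj (fc g k)))"
        by (rule sums_finite) (auto simp: a_def)
      have 3: "(\<Sum>k<n. a k * (4 * pi\<^sup>2 * cnj (fc g k))) = (\<Sum>k<n. of_real (4 * pi\<^sup>2 * (cmod (fc g k))\<^sup>2))"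
      proof (rule sum.cong[OF refl])
        fix k assume "k \<in> {..<n}"
        then show "a k * (4 * pi\<^sup>2 * cnj (fc g k)) = of_real (4 * pi\<^sup>2 * (cmod (fc g k))\<^sup>2)"
          using complex_norm_square[of "fc g k"] by (simp add: a_def algebra_simps)
      qed
      show ?thesis
        unfolding sum_distrib_left of_real_sum 3[symmetric] by (rule sums_unique2[OF 1 2])
    qed
    have Q: "(LINT x|torus. (cmod (fser a x))\<^sup>2) = 4 * pi\<^sup>2 * (\<Sum>k<n. (cmod (fc g k))\<^sup>2)"
    proof -
      have "(\<lambda>k. (cmod (a k))\<^sup>2) sums (\<Sum>k<n. (cmod (a k))\<^sup>2)"
        by (rule sums_finite) (auto simp: a_def)
      moreover have "(\<Sum>k<n. (cmod (a k))\<^sup>2) = (\<Sum>k<n. (cmod (fc g k))\<^sup>2)"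
        by (simp add: a_def)
      ultimately show ?thesis
        using sums_unique2[OF fser_parseval[OF sa]] by (simp add: field_simps)
    qed
    have "0 \<le> (LINT x|torus. (cmod (g x - fser a x))\<^sup>2)" by simp
    also have "\<dots> = (LINT x|torus. (cmod (g x))\<^sup>2 - 2 * Re (fser a x * cnj (g x)) + (cmod (fser a x))\<^sup>2)"
    proof (rule Bochner_Integration.integral_cong[OF refl])
      fix x show "(cmod (g x - fser a x))\<^sup>2 = (cmod (g x))\<^sup>2 - 2 * Re (fser a x * cnj (g x)) + (cmod (fser a x))\<^sup>2"
        by (simp add: cmod_power2) (simp add: power2_eq_square algebra_simps)
    qed
    also have "\<dots> = (LINT x|torus. (cmod (g x))\<^sup>2) - 2 * (LINT x|torus. Re (fser a x * cnj (g x))) + (LINT x|torus. (cmod (fser a x))\<^sup>2)"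
    proof -
      have 1: "integrable torus (\<lambda>x. (cmod (g x))\<^sup>2)" "integrable torus (\<lambda>x. Re (fser a x * cnj (g x)))"
        "integrable torus (\<lambda>x. (cmod (fser a x))\<^sup>2)"
        by (intro torus_integrable_continuous continuous_intros continuous_on_fser g sa)+
      have "(LINT x|torus. A x - 2 * B x + C x) = (LINT x|torus. A x) - 2 * (LINT x|torus. B x) + (LINT x|torus. C x)"
        if "integrable torus A" "integrable torus B" "integrable torus C" for A B C :: "real^2 \<Rightarrow> real"
        using that by simp
      from this[OF 1] show ?thesis .
    qed
    also have "(LINT x|torus. Re (fser a x * cnj (g x))) = Re (LINT x|torus. fser a x * cnj (g x))"
      by (rule integral_Re) (intro torus_integrable_continuous continuous_intros continuous_on_fser g sa)
    finally show ?thesis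
      unfolding P Q by (simp add: field_simps)
  qed
  show "summable (\<lambda>k. (cmod (fc g k))\<^sup>2)"
    by (rule summableI_nonneg_bounded[OF _ *]) auto
  then show "(\<Sum>k. (cmod (fc g k))\<^sup>2) \<le> (LINT x|torus. (cmod (g x))\<^sup>2) / (4 * pi\<^sup>2)"
    using * by (rule suminf_le_const)
qed

text \<open>A triple of modes contributes only if its frequencies sum to zero, and then the three
  multipliers from \<open>dcoef\<close> cancel; dominated convergence passes from partial sums to
  the series. It acts as integration by parts for three factors.\<close>

lemma leibniz_integral:
  assumes s: "summable (\<lambda>k. cmod (p k))" "summable (\<lambda>k. cmod (q k))" "summable (\<lambda>k. cmod (r k))"
    and d: "summable (\<lambda>k. cmod (dcoef b p k))" "summable (\<lambda>k. cmod (dcoef b q k))" "summable (\<lambda>k. cmod (dcoef b r k))"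
  shows "(LINT x|torus. fser (dcoef b p) x * fser q x * fser r x) +
         (LINT x|torus. fser p x * fser (dcoef b q) x * fser r x) +
         (LINT x|torus. fser p x * fser q x * fser (dcoef b r) x) = 0"
proof -
  define T where "T a n x = (\<Sum>k<n. a k * mode k x)" for a :: "nat \<Rightarrow> complex" and n x
  have Tc: "continuous_on S (T a n)" for a n S
    unfolding T_def by (intro continuous_intros)
  have Tm: "integrable torus (\<lambda>x. T a n x * T a' n x * T a'' n x)" for a a' a'' n
    by (intro torus_integrable_continuous continuous_intros Tc)
  have lim: "(\<lambda>n. LINT x|torus. T a n x * T a' n x * T a'' n x) \<longlonglongrightarrow> (LINT x|torus. fser a x * fser a' x * fser a'' x)"
    if "summable (\<lambda>k. cmod (a k))" "summable (\<lambda>k. cmod (a' k))" "summable (\<lambda>k. cmod (a'' k))" for a a' a''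
  proof (rule integral_dominated_convergence[where w="\<lambda>_. (\<Sum>k. cmod (a k)) * (\<Sum>k. cmod (a' k)) * (\<Sum>k. cmod (a'' k))"])
    show "(\<lambda>x. fser a x * fser a' x * fser a'' x) \<in> borel_measurable torus"
      by (intro torus_measurable_continuous continuous_intros continuous_on_fser that)
    show "(\<lambda>x. T a n x * T a' n x * T a'' n x) \<in> borel_measurable torus" for n
      by (intro torus_measurable_continuous continuous_intros Tc)
    show "AE x in torus. (\<lambda>n. T a n x * T a' n x * T a'' n x) \<longlonglongrightarrow> fser a x * fser a' x * fser a'' x"
      using fser_sums that unfolding T_def by (intro AE_I2 tendsto_mult) (auto simp: sums_def)
    show "AE x in torus. norm (T a n x * T a' n x * T a'' n x) \<le> (\<Sum>k. cmod (a k)) * (\<Sum>k. cmod (a' k)) * (\<Sum>k. cmod (a'' k))" for n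
      unfolding T_def norm_mult
      by (intro AE_I2 mult_mono fser_partial_bound that mult_nonneg_nonneg suminf_nonneg) auto
  qed auto
  have expand: "(LINT x|torus. T a n x * T a' n x * T a'' n x) =
      (\<Sum>i<n. \<Sum>j<n. \<Sum>k<n. a i * a' j * a'' k * (LINT x|torus. cis ((freq i + freq j + freq k) \<bullet> x)))" for a a' a'' n
  proof -
    have triple: "(\<Sum>i<n. A i) * (\<Sum>j<n. B j) * (\<Sum>k<n. C k) = (\<Sum>i<n. \<Sum>j<n. \<Sum>k<n. A i * B j * C k)"
      for A B C :: "nat \<Rightarrow> complex"
    proof -
      have "(\<Sum>i<n. A i) * (\<Sum>j<n. B j) * (\<Sum>k<n. C k) = (\<Sum>i<n. A i * (\<Sum>j<n. \<Sum>k<n. B j * C k))"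
        unfolding sum_product[symmetric] sum_distrib_right[symmetric] by (rule mult.assoc)
      then show ?thesis by (simp only: sum_distrib_left mult.assoc)
    qed
    have "T a n x * T a' n x * T a'' n x = (\<Sum>i<n. \<Sum>j<n. \<Sum>k<n. a i * a' j * a'' k * cis ((freq i + freq j + freq k) \<bullet> x))" for x
      unfolding T_def triple mode_def
      by (intro sum.cong refl) (simp add: inner_add_left mult_ac flip: cis_mult)
    then have "(LINT x|torus. T a n x * T a' n x * T a'' n x) =
      (LINT x|torus. (\<Sum>i<n. \<Sum>j<n. \<Sum>k<n. a i * a' j * a'' k * cis ((freq i + freq j + freq k) \<bullet> x)))"
      by (simp only:)
    also have "\<dots> = (\<Sum>i<n. \<Sum>j<n. \<Sum>k<n. (LINT x|torus. a i * a' j * a'' k * cis ((freq i + freq j + freq k) \<bullet> x)))"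
    proof -
      have I: "integrable torus (\<lambda>x::real^2. c * cis (m \<bullet> x))" for c m
        by (intro torus_integrable_continuous continuous_intros)
      show ?thesis
        by (simp only: Bochner_Integration.integral_sum Bochner_Integration.integrable_sum I)
    qed
    also have "\<dots> = (\<Sum>i<n. \<Sum>j<n. \<Sum>k<n. a i * a' j * a'' k * (LINT x|torus. cis ((freq i + freq j + freq k) \<bullet> x)))"
      by (simp only: integral_mult_right_zero)
    finally show ?thesis .
  qed
  have "(LINT x|torus. T (dcoef b p) n x * T q n x * T r n x) + (LINT x|torus. T p n x * T (dcoef b q) n x * T r n x)
      + (LINT x|torus. T p n x * T q n x * T (dcoef b r) n x) = 0" for n
    unfolding expand sum.distrib[symmetric]
  proof (intro sum.neutral ballI)
    fix i j k
    have m: "freq i + freq j + freq k \<in> int_lattice" by (intro int_lattice_add freq_in)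
    show "dcoef b p i * q j * r k * (LINT x|torus. cis ((freq i + freq j + freq k) \<bullet> x)) +
       p i * dcoef b q j * r k * (LINT x|torus. cis ((freq i + freq j + freq k) \<bullet> x)) +
       p i * q j * dcoef b r k * (LINT x|torus. cis ((freq i + freq j + freq k) \<bullet> x)) = 0"
    proof (cases "freq i + freq j + freq k = 0")
      case True
      have "dcoef b p i * q j * r k + p i * dcoef b q j * r k + p i * q j * dcoef b r k =
        \<i> * of_real ((freq i + freq j + freq k) \<bullet> b) * (p i * q j * r k)"
        by (simp add: dcoef_def inner_add_left algebra_simps)
      then show ?thesis unfolding distrib_right[symmetric] True by simp
    next
      case False
      then show ?thesis using torus_integral_cis[OF m] by simp
    qed
  qed
  moreover have "(\<lambda>n. (LINT x|torus. T (dcoef b p) n x * T q n x * T r n x) + (LINT x|torus. T p n x * T (dcoef b q) n x * T r n x)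
      + (LINT x|torus. T p n x * T q n x * T (dcoef b r) n x)) \<longlonglongrightarrow> (LINT x|torus. fser (dcoef b p) x * fser q x * fser r x) +
         (LINT x|torus. fser p x * fser (dcoef b q) x * fser r x) +
         (LINT x|torus. fser p x * fser q x * fser (dcoef b r) x)"
    by (intro tendsto_add lim s d)
  ultimately show ?thesis by (simp only: LIMSEQ_const_iff)
qed

subsection \<open>The convection term on the Fourier side\<close>

text \<open>The symbol of minus the Laplacian.\<close>

definition fsq :: "nat \<Rightarrow> real" where
  "fsq k = (norm (freq k))\<^sup>2"

lemma fsq_nonneg [simp]: "0 \<le> fsq k"
  by (simp add: fsq_def)

section \<open>Lattice sums and the embedding of H^2\<close>

lemma sum_inverse_int_squares_le:
  assumes "finite (A :: int set)"
  shows "(\<Sum>a\<in>A. 1 / (1 + (real_of_int a)\<^sup>2)) \<le> 2 * (\<Sum>n. 1 / (1 + (real n)\<^sup>2))"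
proof -
  let ?g = "\<lambda>n. 1 / (1 + (real n)\<^sup>2)" and ?f = "\<lambda>a. 1 / (1 + (real_of_int a)\<^sup>2)"
  have "summable (\<lambda>n. ?g (Suc n))"
  proof (rule summable_comparison_test')
    show "summable (\<lambda>n. 1 / (real (Suc n))\<^sup>2)"
      using sums_summable[OF inverse_squares_sums] by (simp add: add.commute)
    show "norm (?g (Suc n)) \<le> 1 / (real (Suc n))\<^sup>2" if "n \<ge> 0" for n
    proof -
      have "0 < (real (Suc n))\<^sup>2" by (intro zero_less_power) simp
      then have "?g (Suc n) \<le> 1 / (real (Suc n))\<^sup>2" by (intro frac_le) auto
      then show ?thesis by simp
    qed
  qed
  then have g: "summable ?g" by (subst (asm) summable_Suc_iff)
  have part: "(\<Sum>a\<in>B. ?f a) \<le> (\<Sum>n. ?g n)" if "finite B" "inj_on (\<lambda>a. nat \<bar>a\<bar>) B" for B :: "int set"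
  proof -
    have "(\<Sum>a\<in>B. ?f a) = (\<Sum>n\<in>(\<lambda>a. nat \<bar>a\<bar>) ` B. ?g n)"
      using that(2) by (subst sum.reindex) (auto simp: o_def)
    also have "\<dots> \<le> (\<Sum>n. ?g n)"
      using that(1) by (intro sum_le_suminf[OF g]) auto
    finally show ?thesis .
  qed
  have "A = {a\<in>A. a \<ge> 0} \<union> {a\<in>A. a < 0}" by auto
  then have "(\<Sum>a\<in>A. ?f a) = (\<Sum>a\<in>{a\<in>A. a \<ge> 0}. ?f a) + (\<Sum>a\<in>{a\<in>A. a < 0}. ?f a)"
    using assms by (metis (no_types, lifting) Collect_conj_eq Int_Collect
        finite_Un sum.union_disjoint disjoint_iff mem_Collect_eq not_le)
  also have "\<dots> \<le> (\<Sum>n. ?g n) + (\<Sum>n. ?g n)"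
    using assms by (intro add_mono part) (auto simp: inj_on_def)
  finally show ?thesis by simp
qed

lemma norm_sq_vec2: "(norm (x :: real^2))\<^sup>2 = (x $ 1)\<^sup>2 + (x $ 2)\<^sup>2"
  by (simp add: norm_vec_def L2_set_def sum_2)

text \<open>The weight is dominated by a product of one-dimensional weights, since (1 + a^2)(1 +
  b^2) \<le> (1 + a^2 + b^2)^2. This convergence is what embeds H^2 into the absolutely convergent
  Fourier series.\<close>

lemma summable_weight: "summable (\<lambda>k. 1 / (1 + fsq k)\<^sup>2)"
proof (rule summableI_nonneg_bounded)
  define B where "B = 2 * (\<Sum>n. 1 / (1 + (real n)\<^sup>2))"
  fix n
  define fl where "fl i k = \<lfloor>freq k $ i\<rfloor>" for i k
  have fl: "real_of_int (fl i k) = freq k $ i" for i k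
  proof -
    have "freq k $ i \<in> \<int>"
      using freq_in[of k] unfolding int_lattice_vec2
      by (auto simp: image_iff) (metis Ints_of_int exhaust_2 vector_2)
    then show ?thesis by (auto simp: fl_def elim!: Ints_cases)
  qed
  define A where "A i = fl i ` {..<n}" for i
  let ?h = "\<lambda>a. 1 / (1 + (real_of_int a)\<^sup>2)"
  have inj: "inj_on (\<lambda>k. (fl 1 k, fl 2 k)) {..<n}"
  proof (rule inj_onI)
    fix j k assume "(fl 1 j, fl 2 j) = (fl 1 k, fl 2 k)"
    then have "freq j $ 1 = freq k $ 1" "freq j $ 2 = freq k $ 2" by (auto simp flip: fl)
    then have "freq j = freq k" by (simp add: vec_eq_iff forall_2)
    then show "j = k" by simp
  qed
  have "(\<Sum>k<n. 1 / (1 + fsq k)\<^sup>2) \<le> (\<Sum>k<n. ?h (fl 1 k) * ?h (fl 2 k))"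
  proof (rule sum_mono)
    fix k
    have "(1 + (freq k $ 1)\<^sup>2) * (1 + (freq k $ 2)\<^sup>2) \<le> (1 + fsq k) * (1 + fsq k)"
      unfolding fsq_def norm_sq_vec2 by (intro mult_mono) auto
    then have "1 / ((1 + fsq k) * (1 + fsq k)) \<le> 1 / ((1 + (freq k $ 1)\<^sup>2) * (1 + (freq k $ 2)\<^sup>2))"
      by (intro divide_left_mono) (auto intro!: mult_pos_pos add_pos_nonneg)
    then show "1 / (1 + fsq k)\<^sup>2 \<le> ?h (fl 1 k) * ?h (fl 2 k)"
      by (simp add: fl power2_eq_square)
  qed
  also have "\<dots> = (\<Sum>(a, b)\<in>(\<lambda>k. (fl 1 k, fl 2 k)) ` {..<n}. ?h a * ?h b)"
    using inj by (simp add: sum.reindex o_def)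
  also have "\<dots> \<le> (\<Sum>(a, b)\<in>A 1 \<times> A 2. ?h a * ?h b)"
    by (rule sum_mono2) (auto simp: A_def)
  also have "\<dots> = (\<Sum>a\<in>A 1. ?h a) * (\<Sum>b\<in>A 2. ?h b)"
    by (simp add: sum_product sum.cartesian_product)
  also have "\<dots> \<le> B * B"
    unfolding B_def by (intro mult_mono sum_inverse_int_squares_le sum_nonneg mult_nonneg_nonneg suminf_nonneg
        order_trans[OF sum_nonneg sum_inverse_int_squares_le, of "{}"]) (auto simp: A_def)
  finally show "(\<Sum>k<n. 1 / (1 + fsq k)\<^sup>2) \<le> B * B" .
qed auto

lemma cauchy_schwarz_series:
  fixes x y :: "nat \<Rightarrow> real"
  assumes "summable (\<lambda>k. (x k)\<^sup>2)" "summable (\<lambda>k. (y k)\<^sup>2)" "\<And>k. 0 \<le> x k" "\<And>k. 0 \<le> y k"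
  shows "summable (\<lambda>k. x k * y k)"
    and "(\<Sum>k. x k * y k)\<^sup>2 \<le> (\<Sum>k. (x k)\<^sup>2) * (\<Sum>k. (y k)\<^sup>2)"
proof -
  show s: "summable (\<lambda>k. x k * y k)"
  proof (rule summable_comparison_test')
    show "summable (\<lambda>k. (x k)\<^sup>2 + (y k)\<^sup>2)" using assms by (intro summable_add)
    fix k
    have "2 * (x k * y k) \<le> (x k)\<^sup>2 + (y k)\<^sup>2"
      using sum_squares_bound[of "x k" "y k"] by simp
    then show "norm (x k * y k) \<le> (x k)\<^sup>2 + (y k)\<^sup>2"
      using mult_nonneg_nonneg[OF assms(3)[of k] assms(4)[of k]] by simp
  qed
  have "(\<lambda>n. (\<Sum>k<n. x k * y k)\<^sup>2) \<longlonglongrightarrow> (\<Sum>k. x k * y k)\<^sup>2"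
    by (intro tendsto_power summable_LIMSEQ s)
  then show "(\<Sum>k. x k * y k)\<^sup>2 \<le> (\<Sum>k. (x k)\<^sup>2) * (\<Sum>k. (y k)\<^sup>2)"
  proof (rule LIMSEQ_le_const2, intro exI allI impI)
    fix n
    have "(\<Sum>k<n. x k * y k)\<^sup>2 \<le> (\<Sum>k<n. (x k)\<^sup>2) * (\<Sum>k<n. (y k)\<^sup>2)"
      by (rule Cauchy_Schwarz_ineq_sum)
    also have "\<dots> \<le> (\<Sum>k. (x k)\<^sup>2) * (\<Sum>k. (y k)\<^sup>2)"
      using assms by (intro mult_mono sum_le_suminf sum_nonneg suminf_nonneg) auto
    finally show "(\<Sum>k<n. x k * y k)\<^sup>2 \<le> (\<Sum>k. (x k)\<^sup>2) * (\<Sum>k. (y k)\<^sup>2)" .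
  qed
qed

text \<open>The squared constant with which the H^2 norm bounds the sum of the moduli of the
  coefficients.\<close>

definition Cw :: real where
  "Cw = (\<Sum>k. 1 / (1 + fsq k)\<^sup>2)"

lemma Cw_nonneg: "0 \<le> Cw"
  unfolding Cw_def by (rule suminf_nonneg[OF summable_weight]) simp

text \<open>Cauchy-Schwarz, after writing \<open>a k\<close> as \<open>1 / (1 + fsq k)\<close> times
  \<open>(1 + fsq k) * a k\<close>.\<close>

lemma weighted_l1:
  fixes a :: "nat \<Rightarrow> real"
  assumes "summable (\<lambda>k. (1 + fsq k)\<^sup>2 * (a k)\<^sup>2)" "\<And>k. 0 \<le> a k"
  shows "summable a" and "(\<Sum>k. a k)\<^sup>2 \<le> Cw * (\<Sum>k. (1 + fsq k)\<^sup>2 * (a k)\<^sup>2)"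
proof -
  have nz: "1 + fsq k \<noteq> 0" for k using fsq_nonneg[of k] by linarith
  have *: "1 / (1 + fsq k) * ((1 + fsq k) * a k) = a k" for k
    using nz[of k] by simp
  have pos: "0 \<le> 1 / (1 + fsq k)" "0 \<le> (1 + fsq k) * a k" for k
    using assms(2)[of k] by auto
  show "summable a"
    using cauchy_schwarz_series(1)[of "\<lambda>k. 1 / (1 + fsq k)" "\<lambda>k. (1 + fsq k) * a k"] summable_weight assms pos
    unfolding * by (simp add: power_divide power_mult_distrib)
  show "(\<Sum>k. a k)\<^sup>2 \<le> Cw * (\<Sum>k. (1 + fsq k)\<^sup>2 * (a k)\<^sup>2)"
    using cauchy_schwarz_series(2)[of "\<lambda>k. 1 / (1 + fsq k)" "\<lambda>k. (1 + fsq k) * a k"] summable_weight assms pos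
    unfolding * by (simp add: power_divide power_mult_distrib Cw_def)
qed

text \<open>Absolute convergence up to two derivatives. Membership in H^4 implies it, by
  \<open>weighted_l1\<close> applied to the moduli of the coefficients times
  \<open>1 + fsq k\<close>.\<close>

definition nice :: "(nat \<Rightarrow> complex) \<Rightarrow> bool" where
  "nice a \<longleftrightarrow> summable (\<lambda>k. (1 + fsq k) * cmod (a k))"

lemma nice_of_weighted:
  assumes "summable (\<lambda>k. (1 + fsq k) ^ 4 * (cmod (a k))\<^sup>2)"
  shows "nice a"
  unfolding nice_def
  by (rule weighted_l1(1)) (use assms in \<open>simp_all add: power_mult_distrib mult.assoc[symmetric] flip: power_add\<close>)

lemma abs_freq_inner: "b \<in> Basis \<Longrightarrow> \<bar>freq k \<bullet> b\<bar> \<le> 1 + fsq k" "b \<in> Basis \<Longrightarrow> (freq k \<bullet> b)\<^sup>2 \<le> fsq k"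
proof -
  assume "b \<in> Basis"
  then have *: "\<bar>freq k \<bullet> b\<bar> \<le> norm (freq k)" by (rule Basis_le_norm)
  then show "(freq k \<bullet> b)\<^sup>2 \<le> fsq k"
    unfolding fsq_def using power_mono[OF *, of 2] by simp
  have "norm (freq k) \<le> 1 + fsq k"
    unfolding fsq_def using sum_squares_bound[of 1 "norm (freq k)"] norm_ge_zero[of "freq k"] by (simp del: norm_ge_zero)
  with * show "\<bar>freq k \<bullet> b\<bar> \<le> 1 + fsq k" by linarith
qed

lemma cmod_dcoef: "cmod (dcoef b a k) = \<bar>freq k \<bullet> b\<bar> * cmod (a k)"
  by (simp add: dcoef_def norm_mult)

lemma nice_summable: "nice a \<Longrightarrow> summable (\<lambda>k. cmod (a k))"
  unfolding nice_def
  by (rule summable_comparison_test'[where N=0]) (auto simp: algebra_simps)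

lemma nice_dcoef: "nice a \<Longrightarrow> b \<in> Basis \<Longrightarrow> summable (\<lambda>k. cmod (dcoef b a k))"
  unfolding nice_def
  by (rule summable_comparison_test'[where N=0]) (auto simp: cmod_dcoef intro!: mult_right_mono abs_freq_inner)

lemma nice_dcoef2: "nice a \<Longrightarrow> b \<in> Basis \<Longrightarrow> summable (\<lambda>k. cmod (dcoef b (dcoef b a) k))"
  unfolding nice_def
proof (rule summable_comparison_test'[where N=0])
  fix k assume b: "b \<in> Basis"
  have "\<bar>freq k \<bullet> b\<bar> * \<bar>freq k \<bullet> b\<bar> \<le> 1 + fsq k"
    using abs_freq_inner(2)[OF b, of k] by (simp add: power2_eq_square abs_mult[symmetric])
  then show "norm (cmod (dcoef b (dcoef b a) k)) \<le> (1 + fsq k) * cmod (a k)"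
    by (simp add: cmod_dcoef mult.assoc[symmetric] mult_right_mono)
qed

abbreviation e1 :: "real^2" where "e1 \<equiv> axis 1 1"
abbreviation e2 :: "real^2" where "e2 \<equiv> axis 2 1"

lemma Basis_real2: "(Basis :: (real^2) set) = {e1, e2}"
  by (auto simp: Basis_vec_def) (metis exhaust_2)

lemma e12 [simp]: "e1 \<noteq> e2" "e2 \<noteq> e1"
  by (auto simp: axis_eq_axis)

lemma sum_Basis_real2: "(\<Sum>b\<in>(Basis :: (real^2) set). g b) = g e1 + g e2"
  by (simp add: Basis_real2)

lemma fsq_inner: "fsq k = (freq k \<bullet> e1)\<^sup>2 + (freq k \<bullet> e2)\<^sup>2"
  by (simp add: fsq_def norm_sq_vec2 cart_eq_inner_axis)

text \<open>The nonlinear estimates are stated for coefficient sequences, which makes them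
  independent of how weak derivatives are chosen. That the field is real serves to drop a conjugate
  in the energy pairing.\<close>

locale nice_field =
  fixes c :: "real^2 \<Rightarrow> nat \<Rightarrow> complex"
  assumes nice: "b \<in> Basis \<Longrightarrow> nice (c b)"
    and real_valued: "b \<in> Basis \<Longrightarrow> AE x in torus. cnj (fser (c b) x) = fser (c b) x"
begin

text \<open>The component b of (u . grad) u, with derivatives taken on coefficients; products of
  uniformly convergent series make it continuous.\<close>

definition N :: "real^2 \<Rightarrow> real^2 \<Rightarrow> complex" where
  "N b x = (\<Sum>j\<in>Basis. fser (c j) x * fser (dcoef j (c b)) x)"

definition nh :: "real^2 \<Rightarrow> nat \<Rightarrow> complex" where
  "nh b = fc (N b)"

lemma Basis_e [simp]: "e1 \<in> Basis" "e2 \<in> Basis"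
  by (auto simp: Basis_real2)

lemmas summ = nice_summable[OF nice] nice_dcoef[OF nice]

lemma N_cont: "b \<in> Basis \<Longrightarrow> continuous_on UNIV (N b)"
  unfolding N_def by (intro continuous_intros continuous_on_fser summ)

lemma parseval: "b \<in> Basis \<Longrightarrow> (\<lambda>k. (cmod (c b k))\<^sup>2) sums ((LINT x|torus. (cmod (fser (c b) x))\<^sup>2) / (4 * pi\<^sup>2))"
  "b \<in> Basis \<Longrightarrow> j \<in> Basis \<Longrightarrow> (\<lambda>k. (cmod (dcoef j (c b) k))\<^sup>2) sums ((LINT x|torus. (cmod (fser (dcoef j (c b)) x))\<^sup>2) / (4 * pi\<^sup>2))"
  by (auto intro!: fser_parseval summ)

text \<open>Only the series of u is expanded, because the coefficients of N are controlled only in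
  the square sum. The pairing first comes out conjugated; conjugating back and using that u is real
  gives the stated form.\<close>

lemma energy_pairing:
  assumes b: "b \<in> Basis"
  shows "(\<lambda>k. cnj (c b k) * nh b k) sums ((LINT x|torus. N b x * fser (c b) x) / (4 * pi\<^sup>2))"
proof -
  have cN: "continuous_on UNIV (\<lambda>x. cnj (N b x))" by (intro continuous_intros N_cont b)
  have m: "(LINT x|torus. mode k x * cnj (N b x)) = 4 * pi\<^sup>2 * cnj (nh b k)" for k
  proof -
    have "(LINT x|torus. mode k x * cnj (N b x)) = (LINT x|torus. cnj (N b x * cis (- (freq k \<bullet> x))))"
      by (simp add: mode_def cis_cnj mult.commute)
    also have "\<dots> = cnj (LINT x|torus. N b x * cis (- (freq k \<bullet> x)))"
      by (rule Bochner_Integration.integral_cnj)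
    also have "(LINT x|torus. N b x * cis (- (freq k \<bullet> x))) = 4 * pi\<^sup>2 * nh b k"
      by (simp add: nh_def fc_def)
    finally show ?thesis by simp
  qed
  have "(\<lambda>k. c b k * (4 * pi\<^sup>2 * cnj (nh b k))) sums (LINT x|torus. fser (c b) x * cnj (N b x))"
    using fser_integral_sums[OF summ(1)[OF b] torus_integrable_continuous[OF cN]] unfolding m .
  from sums_divide[OF this, of "4 * pi\<^sup>2"]
  have "(\<lambda>k. c b k * cnj (nh b k)) sums ((LINT x|torus. fser (c b) x * cnj (N b x)) / (4 * pi\<^sup>2))"
    by (simp add: mult.left_commute)
  then have "(\<lambda>k. cnj (c b k * cnj (nh b k))) sums cnj ((LINT x|torus. fser (c b) x * cnj (N b x)) / (4 * pi\<^sup>2))"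
    by (rule iffD2[OF sums_cnj])
  moreover have "cnj (LINT x|torus. fser (c b) x * cnj (N b x)) = (LINT x|torus. cnj (fser (c b) x * cnj (N b x)))"
    by (rule Bochner_Integration.integral_cnj[symmetric])
  moreover have "\<dots> = (LINT x|torus. N b x * fser (c b) x)"
  proof (rule integral_cong_AE)
    show "AE x in torus. cnj (fser (c b) x * cnj (N b x)) = N b x * fser (c b) x"
      using real_valued[OF b] by (auto elim!: eventually_mono)
  qed (intro torus_measurable_continuous continuous_intros N_cont continuous_on_fser summ b)+
  ultimately show ?thesis by simp
qed

text \<open>A product estimate: u is bounded in the supremum norm and its gradient in the square
  norm, both through S. The factor 4 is 2 from
  \<open>(x + y)\<^sup>2 \<le> 2 * (x\<^sup>2 + y\<^sup>2)\<close> times 2 for the two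
  derivatives.\<close>

lemma convection_bound:
  fixes S :: real
  assumes S: "\<And>b. b \<in> Basis \<Longrightarrow> summable (\<lambda>k. (1 + fsq k)\<^sup>2 * (cmod (c b k))\<^sup>2)"
    and S_def: "S = (\<Sum>b\<in>Basis. \<Sum>k. (1 + fsq k)\<^sup>2 * (cmod (c b k))\<^sup>2)"
    and b: "b \<in> Basis"
  shows "summable (\<lambda>k. (cmod (nh b k))\<^sup>2)" "(\<Sum>k. (cmod (nh b k))\<^sup>2) \<le> 4 * Cw * S\<^sup>2"
proof -
  define Sb where "Sb b = (\<Sum>k. (1 + fsq k)\<^sup>2 * (cmod (c b k))\<^sup>2)" for b
  have Sb: "0 \<le> Sb j" "Sb j \<le> S" if "j \<in> Basis" for j
  proof -
    have *: "0 \<le> Sb j" if "j \<in> Basis" for j unfolding Sb_def by (rule suminf_nonneg[OF S[OF that]]) simp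
    then show "0 \<le> Sb j" using that .
    show "Sb j \<le> S" unfolding S_def Sb_def[symmetric] using that * by (intro member_le_sum) auto
  qed
  have L: "(cmod (fser (c j) x))\<^sup>2 \<le> Cw * S" if "j \<in> Basis" for j x
  proof -
    have "(cmod (fser (c j) x))\<^sup>2 \<le> (\<Sum>k. cmod (c j k))\<^sup>2"
      by (intro power_mono fser_bound summ that) auto
    also have "\<dots> \<le> Cw * Sb j"
      unfolding Sb_def by (rule weighted_l1(2)[OF S[OF that]]) simp
    also have "\<dots> \<le> Cw * S"
      using Sb[OF that] Cw_nonneg by (intro mult_left_mono)
    finally show ?thesis .
  qed
  have d: "(LINT x|torus. (cmod (fser (dcoef j (c b)) x))\<^sup>2) \<le> 4 * pi\<^sup>2 * S" if "j \<in> Basis" for j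
  proof -
    have "(LINT x|torus. (cmod (fser (dcoef j (c b)) x))\<^sup>2) / (4 * pi\<^sup>2) = (\<Sum>k. (cmod (dcoef j (c b) k))\<^sup>2)"
      by (rule sums_unique[OF parseval(2)[OF b that]])
    also have "\<dots> \<le> Sb b"
      unfolding Sb_def
    proof (rule suminf_le[OF _ sums_summable[OF parseval(2)[OF b that]] S[OF b]])
      fix k
      have "(freq k \<bullet> j)\<^sup>2 \<le> (1 + fsq k)\<^sup>2"
        using power_mono[OF abs_freq_inner(1)[OF that, of k], of 2] by simp
      then show "(cmod (dcoef j (c b) k))\<^sup>2 \<le> (1 + fsq k)\<^sup>2 * (cmod (c b k))\<^sup>2"
        by (simp add: cmod_dcoef power_mult_distrib mult_right_mono)
    qed
    also have "\<dots> \<le> S" by (rule Sb[OF b])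
    finally show ?thesis by (simp add: field_simps)
  qed
  have pw: "(cmod (N b x))\<^sup>2 \<le> 2 * (Cw * S) * ((cmod (fser (dcoef e1 (c b)) x))\<^sup>2 + (cmod (fser (dcoef e2 (c b)) x))\<^sup>2)" for x
  proof -
    have "(cmod (N b x))\<^sup>2 \<le> (cmod (fser (c e1) x * fser (dcoef e1 (c b)) x) + cmod (fser (c e2) x * fser (dcoef e2 (c b)) x))\<^sup>2"
      unfolding N_def sum_Basis_real2 by (intro power_mono norm_triangle_ineq) auto
    also have "\<dots> \<le> 2 * ((cmod (fser (c e1) x * fser (dcoef e1 (c b)) x))\<^sup>2 + (cmod (fser (c e2) x * fser (dcoef e2 (c b)) x))\<^sup>2)"
      using sum_squares_bound[of "cmod (fser (c e1) x * fser (dcoef e1 (c b)) x)" "cmod (fser (c e2) x * fser (dcoef e2 (c b)) x)"]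
      by (simp add: power2_sum)
    also have "\<dots> \<le> 2 * (Cw * S * (cmod (fser (dcoef e1 (c b)) x))\<^sup>2 + Cw * S * (cmod (fser (dcoef e2 (c b)) x))\<^sup>2)"
      unfolding norm_mult power_mult_distrib
      by (intro mult_left_mono add_mono mult_right_mono L) auto
    finally show ?thesis by (simp add: algebra_simps)
  qed
  note bs = bessel[OF N_cont[OF b], folded nh_def]
  show "summable (\<lambda>k. (cmod (nh b k))\<^sup>2)" by (rule bs)
  have CS: "0 \<le> Cw * S" using Sb[OF b] Cw_nonneg by auto
  have I: "integrable torus (\<lambda>x. (cmod (fser (dcoef j (c b)) x))\<^sup>2)" if "j \<in> Basis" for j
    by (intro torus_integrable_continuous continuous_intros continuous_on_fser summ b that)
  have "(LINT x|torus. (cmod (N b x))\<^sup>2) \<le> (LINT x|torus. 2 * (Cw * S) * ((cmod (fser (dcoef e1 (c b)) x))\<^sup>2 + (cmod (fser (dcoef e2 (c b)) x))\<^sup>2))"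
    by (intro integral_mono pw torus_integrable_continuous continuous_intros N_cont continuous_on_fser summ b) auto
  also have "\<dots> = 2 * (Cw * S) * ((LINT x|torus. (cmod (fser (dcoef e1 (c b)) x))\<^sup>2) + (LINT x|torus. (cmod (fser (dcoef e2 (c b)) x))\<^sup>2))"
    using I by simp
  also have "\<dots> \<le> 2 * (Cw * S) * (4 * pi\<^sup>2 * S + 4 * pi\<^sup>2 * S)"
    using CS by (intro mult_left_mono add_mono d) auto
  finally have "(LINT x|torus. (cmod (N b x))\<^sup>2) / (4 * pi\<^sup>2) \<le> 4 * Cw * S\<^sup>2"
    by (simp add: field_simps power2_eq_square)
  with bs(2) show "(\<Sum>k. (cmod (nh b k))\<^sup>2) \<le> 4 * Cw * S\<^sup>2" by linarith
qed

definition k0 :: nat where "k0 = inv freq 0"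

lemma freq_k0 [simp]: "freq k0 = 0"
proof -
  have "0 \<in> range freq" using bij_betw_imp_surj_on[OF bij_freq] by simp
  then show ?thesis unfolding k0_def by (rule f_inv_into_f)
qed

definition w0 :: "nat \<Rightarrow> complex" where "w0 = (c e1)(k0 := 0)"

text \<open>Every term of \<open>\<integral>(u \<cdot> \<nabla>)u \<cdot> u\<close> that does not vanish contains \<open>u\<^sub>1\<close>, and integration by
  parts removes its mean, except in a product that is bilinear in \<open>w = u\<^sub>1 - mean\<close> and \<open>\<nabla>u\<^sub>2\<close>.\<close>
lemma convection_cancel:
  assumes W: "AE x in torus. cmod (fser w0 x) \<le> W"
  shows "cmod (\<Sum>b\<in>Basis. (LINT x|torus. N b x * fser (c b) x) / (4 * pi\<^sup>2))
    \<le> (\<Sum>b\<in>Basis. \<Sum>k. fsq k * (cmod (c b k))\<^sup>2) / 2 + W\<^sup>2 * (\<Sum>b\<in>Basis. \<Sum>k. (cmod (c b k))\<^sup>2)"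
proof -
  \<comment> \<open>Coefficients of the constant function 1. With it as one factor,
    \<open>leibniz_integral\<close> becomes integration by parts for two factors.\<close>
  define one :: "nat \<Rightarrow> complex" where "one k = (if k = k0 then 1 else 0)" for k
  define m where "m = c e1 k0"
  have one: "summable (\<lambda>k. cmod (one k))"
    by (rule summable_finite[of "{k0}"]) (auto simp: one_def)
  have d0: "dcoef j a k0 = 0" for j a by (simp add: dcoef_def)
  have done0: "dcoef j one = (\<lambda>k. 0)" for j by (auto simp: dcoef_def one_def)
  have fser0: "fser (\<lambda>k. 0) x = 0" for x by (simp add: fser_def)
  have fone: "fser one x = 1" for x
  proof -
    have "(\<lambda>k. one k * mode k x) sums (\<Sum>k\<in>{k0}. one k * mode k x)"
      by (rule sums_finite) (auto simp: one_def)
    moreover have "(\<Sum>k\<in>{k0}. one k * mode k x) = 1" by (simp add: one_def mode_def)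
    ultimately show ?thesis using sums_unique[of "\<lambda>k. one k * mode k x"] by (simp add: fser_def)
  qed
  have w: "summable (\<lambda>k. cmod (w0 k))"
    by (rule summable_comparison_test'[OF summ(1)[of e1], of 0]) (auto simp: w0_def)
  have dw: "dcoef j w0 = dcoef j (c e1)" for j
    by (auto simp: dcoef_def w0_def)
  have F1: "fser (c e1) x = m + fser w0 x" for x
  proof -
    have "(\<lambda>k. m * (one k * mode k x) + w0 k * mode k x) sums (m * fser one x + fser w0 x)"
      by (intro sums_add sums_mult fser_sums one w)
    moreover have "m * (one k * mode k x) + w0 k * mode k x = c e1 k * mode k x" for k
      by (auto simp: m_def one_def w0_def)
    ultimately have "(\<lambda>k. c e1 k * mode k x) sums (m * fser one x + fser w0 x)" by simp
    then show ?thesis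
      using sums_unique2[OF fser_sums[OF summ(1)[OF Basis_e(1)]]] by (simp add: fone)
  qed
  let ?F1 = "fser (c e1)" and ?F2 = "fser (c e2)" and ?w = "fser w0"
  let ?D = "\<lambda>j b. fser (dcoef j (c b))"
  note cs = continuous_on_fser[OF summ(1)] continuous_on_fser[OF summ(2)] continuous_on_fser[OF w]
  have I: "integrable torus g" if "continuous_on UNIV g" for g :: "real^2 \<Rightarrow> complex"
    using that by (rule torus_integrable_continuous)
  have IR: "integrable torus g" if "continuous_on UNIV g" for g :: "real^2 \<Rightarrow> real"
    using that by (rule torus_integrable_continuous)
  \<comment> \<open>The integrand is a third of the derivative of the cube of u_b.\<close>
  have cube: "(LINT x|torus. fser (c b) x * ?D b b x * fser (c b) x) = 0" if b: "b \<in> Basis" for b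
  proof -
    have "(LINT x|torus. ?D b b x * fser (c b) x * fser (c b) x) + (LINT x|torus. fser (c b) x * ?D b b x * fser (c b) x)
        + (LINT x|torus. fser (c b) x * fser (c b) x * ?D b b x) = 0"
      by (rule leibniz_integral) (use summ b in auto)
    moreover have "(\<lambda>x. ?D b b x * fser (c b) x * fser (c b) x) = (\<lambda>x. fser (c b) x * ?D b b x * fser (c b) x)"
      "(\<lambda>x. fser (c b) x * fser (c b) x * ?D b b x) = (\<lambda>x. fser (c b) x * ?D b b x * fser (c b) x)"
      by (auto simp: mult_ac)
    ultimately have "3 * (LINT x|torus. fser (c b) x * ?D b b x * fser (c b) x) = 0" by simp
    then show ?thesis by simp
  qed
  \<comment> \<open>The integrand is half of the derivative of the square of u_2: transport of u_2
    by the mean of u_1 does not change the energy.\<close>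
  have A: "(LINT x|torus. ?D e1 e2 x * ?F2 x) = 0"
  proof -
    have "(LINT x|torus. fser (dcoef e1 one) x * ?F2 x * ?F2 x) + (LINT x|torus. fser one x * ?D e1 e2 x * ?F2 x)
        + (LINT x|torus. fser one x * ?F2 x * ?D e1 e2 x) = 0"
      by (rule leibniz_integral) (use summ one done0 in auto)
    moreover have "(\<lambda>x. ?F2 x * ?D e1 e2 x) = (\<lambda>x. ?D e1 e2 x * ?F2 x)"
      by (auto simp: mult_ac)
    ultimately have "2 * (LINT x|torus. ?D e1 e2 x * ?F2 x) = 0" by (simp add: done0 fser0 fone)
    then show ?thesis by simp
  qed
  \<comment> \<open>Moves the derivative from u_1 to u_2 and leaves w undifferentiated. In this term
    the mean does not drop out; it survives as the factor m in G.\<close>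
  have B: "(LINT x|torus. ?F2 x * ?D e2 e1 x) = - (LINT x|torus. ?D e2 e2 x * ?w x)"
  proof -
    have "(LINT x|torus. ?D e2 e2 x * ?w x * fser one x) + (LINT x|torus. ?F2 x * fser (dcoef e2 w0) x * fser one x)
        + (LINT x|torus. ?F2 x * ?w x * fser (dcoef e2 one) x) = 0"
      by (rule leibniz_integral) (use summ one done0 w dw in auto)
    then show ?thesis by (simp add: done0 fser0 fone dw add_eq_0_iff)
  qed
  define G where "G x = ?w x * ?D e1 e2 x * ?F2 x - m * ?D e2 e2 x * ?w x + ?F2 x * ?D e2 e1 x * ?w x" for x
  have "(\<Sum>b\<in>Basis. (LINT x|torus. N b x * fser (c b) x)) =
     (LINT x|torus. ?F1 x * ?D e1 e1 x * ?F1 x + ?F2 x * ?D e2 e1 x * ?F1 x) +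
     (LINT x|torus. ?F1 x * ?D e1 e2 x * ?F2 x + ?F2 x * ?D e2 e2 x * ?F2 x)"
    by (simp add: sum_Basis_real2 N_def distrib_right)
  also have "\<dots> = ((LINT x|torus. ?F1 x * ?D e1 e1 x * ?F1 x) + (LINT x|torus. ?F2 x * ?D e2 e1 x * ?F1 x)) +
     ((LINT x|torus. ?F1 x * ?D e1 e2 x * ?F2 x) + (LINT x|torus. ?F2 x * ?D e2 e2 x * ?F2 x))"
    by (intro arg_cong2[where f="(+)"] Bochner_Integration.integral_add I continuous_intros cs) auto
  also have "\<dots> = (LINT x|torus. ?F2 x * ?D e2 e1 x * ?F1 x) + (LINT x|torus. ?F1 x * ?D e1 e2 x * ?F2 x)"
    by (simp add: cube)
  also have "(LINT x|torus. ?F2 x * ?D e2 e1 x * ?F1 x) = (LINT x|torus. m * (?F2 x * ?D e2 e1 x) + ?F2 x * ?D e2 e1 x * ?w x)"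
    by (simp add: F1 algebra_simps)
  also have "\<dots> = (LINT x|torus. m * (?F2 x * ?D e2 e1 x)) + (LINT x|torus. ?F2 x * ?D e2 e1 x * ?w x)"
    by (intro Bochner_Integration.integral_add I continuous_intros cs) auto
  also have "(LINT x|torus. m * (?F2 x * ?D e2 e1 x)) = - (LINT x|torus. m * ?D e2 e2 x * ?w x)"
    by (simp add: B mult.assoc)
  also have "(LINT x|torus. ?F1 x * ?D e1 e2 x * ?F2 x) = (LINT x|torus. m * (?D e1 e2 x * ?F2 x) + ?w x * ?D e1 e2 x * ?F2 x)"
    by (simp add: F1 algebra_simps)
  also have "\<dots> = (LINT x|torus. m * (?D e1 e2 x * ?F2 x)) + (LINT x|torus. ?w x * ?D e1 e2 x * ?F2 x)"
    by (intro Bochner_Integration.integral_add I continuous_intros cs) auto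
  also have "(LINT x|torus. m * (?D e1 e2 x * ?F2 x)) = 0"
    by (simp add: A)
  finally have "(\<Sum>b\<in>Basis. (LINT x|torus. N b x * fser (c b) x)) =
    ((LINT x|torus. ?w x * ?D e1 e2 x * ?F2 x) - (LINT x|torus. m * ?D e2 e2 x * ?w x)) + (LINT x|torus. ?F2 x * ?D e2 e1 x * ?w x)"
    by simp
  also have "\<dots> = (LINT x|torus. G x)"
  proof -
    have "integrable torus (\<lambda>x. ?w x * ?D e1 e2 x * ?F2 x)" "integrable torus (\<lambda>x. m * ?D e2 e2 x * ?w x)"
      "integrable torus (\<lambda>x. ?F2 x * ?D e2 e1 x * ?w x)"
      by (auto intro!: I continuous_intros cs)
    then show ?thesis unfolding G_def by simp
  qed
  finally have sumG: "(\<Sum>b\<in>Basis. (LINT x|torus. N b x * fser (c b) x)) = (LINT x|torus. G x)" .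
  \<comment> \<open>Young's inequality for the three terms of G. Three different first derivatives
    occur, each once with factor 1/2, so together they cost at most half of the gradient norm; u_2
    occurs in two terms and m in one.\<close>
  define H where "H x = (cmod (?D e1 e2 x))\<^sup>2 / 2 + (cmod (?D e2 e2 x))\<^sup>2 / 2 + (cmod (?D e2 e1 x))\<^sup>2 / 2
      + W\<^sup>2 * (cmod (?F2 x))\<^sup>2 + W\<^sup>2 * (cmod m)\<^sup>2 / 2" for x
  have ag: "cmod x * cmod y * cmod z \<le> (cmod x)\<^sup>2 / 2 + W\<^sup>2 * (cmod y)\<^sup>2 / 2" if "cmod z \<le> W" for x y z :: complex
  proof -
    have "cmod x * cmod y * cmod z \<le> cmod x * cmod y * W"
      using that by (intro mult_left_mono) auto
    also have "\<dots> \<le> (cmod x)\<^sup>2 / 2 + W\<^sup>2 * (cmod y)\<^sup>2 / 2"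
      using sum_squares_bound[of "cmod x" "W * cmod y"] by (simp add: power_mult_distrib mult_ac)
    finally show ?thesis .
  qed
  have "cmod (LINT x|torus. G x) \<le> (LINT x|torus. cmod (G x))"
    by (rule integral_norm_bound)
  also have "\<dots> \<le> (LINT x|torus. H x)"
  proof (rule integral_mono_AE)
    show "integrable torus (\<lambda>x. cmod (G x))" unfolding G_def by (auto intro!: IR continuous_intros cs)
    show "integrable torus H" unfolding H_def by (auto intro!: IR continuous_intros cs)
    show "AE x in torus. cmod (G x) \<le> H x"
      using W
    proof eventually_elim
      case (elim x)
      have "cmod (G x) \<le> cmod (?w x * ?D e1 e2 x * ?F2 x) + cmod (m * ?D e2 e2 x * ?w x) + cmod (?F2 x * ?D e2 e1 x * ?w x)"
        unfolding G_def by (intro norm_triangle_le add_mono norm_triangle_ineq4 order_refl)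
      also have "\<dots> \<le> H x"
        using ag[OF elim, of "?D e1 e2 x" "?F2 x"] ag[OF elim, of "?D e2 e2 x" m] ag[OF elim, of "?D e2 e1 x" "?F2 x"]
        unfolding H_def norm_mult by (simp add: mult_ac)
      finally show ?case .
    qed
  qed
  also have "(LINT x|torus. H x) = (LINT x|torus. (cmod (?D e1 e2 x))\<^sup>2) / 2 + (LINT x|torus. (cmod (?D e2 e2 x))\<^sup>2) / 2
      + (LINT x|torus. (cmod (?D e2 e1 x))\<^sup>2) / 2
      + W\<^sup>2 * (LINT x|torus. (cmod (?F2 x))\<^sup>2) + 4 * pi\<^sup>2 * (W\<^sup>2 * (cmod m)\<^sup>2 / 2)"
  proof -
    have "integrable torus (\<lambda>x. (cmod (?D e1 e2 x))\<^sup>2)" "integrable torus (\<lambda>x. (cmod (?D e2 e2 x))\<^sup>2)"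
      "integrable torus (\<lambda>x. (cmod (?D e2 e1 x))\<^sup>2)" "integrable torus (\<lambda>x. (cmod (?F2 x))\<^sup>2)"
      by (auto intro!: IR continuous_intros cs)
    then show ?thesis unfolding H_def by (simp add: measure_space_torus power_mult_distrib)
  qed
  finally have le: "cmod (LINT x|torus. G x) \<le> (LINT x|torus. (cmod (?D e1 e2 x))\<^sup>2) / 2 + (LINT x|torus. (cmod (?D e2 e2 x))\<^sup>2) / 2
      + (LINT x|torus. (cmod (?D e2 e1 x))\<^sup>2) / 2
      + W\<^sup>2 * (LINT x|torus. (cmod (?F2 x))\<^sup>2) + 4 * pi\<^sup>2 * (W\<^sup>2 * (cmod m)\<^sup>2 / 2)" .
  have fin: "cmod (\<Sum>b\<in>Basis. (LINT x|torus. N b x * fser (c b) x) / (4 * pi\<^sup>2)) \<le>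
      ((LINT x|torus. (cmod (?D e1 e2 x))\<^sup>2) / (4 * pi\<^sup>2) + (LINT x|torus. (cmod (?D e2 e2 x))\<^sup>2) / (4 * pi\<^sup>2)
      + (LINT x|torus. (cmod (?D e2 e1 x))\<^sup>2) / (4 * pi\<^sup>2)) / 2
      + W\<^sup>2 * ((LINT x|torus. (cmod (?F2 x))\<^sup>2) / (4 * pi\<^sup>2) + (cmod m)\<^sup>2 / 2)"
  proof -
    have V: "(a/2 + b/2 + c/2 + w*d + V * (w*m/2)) / V = (a/V + b/V + c/V) / 2 + w * (d/V + m/2)"
      if "V \<noteq> 0" for a b c d w m V :: real
      using that by (simp add: field_simps)
    have "cmod ((LINT x|torus. G x) / (4 * pi\<^sup>2)) = cmod (LINT x|torus. G x) / (4 * pi\<^sup>2)"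
      by (simp add: norm_divide norm_mult norm_power)
    also have "\<dots> \<le> ((LINT x|torus. (cmod (?D e1 e2 x))\<^sup>2) / 2 + (LINT x|torus. (cmod (?D e2 e2 x))\<^sup>2) / 2
      + (LINT x|torus. (cmod (?D e2 e1 x))\<^sup>2) / 2
      + W\<^sup>2 * (LINT x|torus. (cmod (?F2 x))\<^sup>2) + 4 * pi\<^sup>2 * (W\<^sup>2 * (cmod m)\<^sup>2 / 2)) / (4 * pi\<^sup>2)"
      by (rule divide_right_mono[OF le]) simp
    finally show ?thesis
      unfolding sum_divide_distrib[symmetric] sumG by (subst (asm) V) auto
  qed
  have q: "summable (\<lambda>k. (freq k \<bullet> j)\<^sup>2 * (cmod (c b k))\<^sup>2)"
    "(LINT x|torus. (cmod (?D j b x))\<^sup>2) / (4 * pi\<^sup>2) = (\<Sum>k. (freq k \<bullet> j)\<^sup>2 * (cmod (c b k))\<^sup>2)"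
    if "j \<in> Basis" "b \<in> Basis" for j b
    using parseval(2)[OF that(2,1)] sums_summable sums_unique by (force simp: cmod_dcoef power_mult_distrib)+
  have dsum: "(\<Sum>k. fsq k * (cmod (c b k))\<^sup>2) = (\<Sum>k. (freq k \<bullet> e1)\<^sup>2 * (cmod (c b k))\<^sup>2) + (\<Sum>k. (freq k \<bullet> e2)\<^sup>2 * (cmod (c b k))\<^sup>2)"
    if "b \<in> Basis" for b
    unfolding fsq_inner distrib_right using q(1) that by (intro suminf_add[symmetric]) auto
  have nn: "0 \<le> (\<Sum>k. (freq k \<bullet> j)\<^sup>2 * (cmod (c b k))\<^sup>2)" if "j \<in> Basis" "b \<in> Basis" for j b
    using q(1)[OF that] by (intro suminf_nonneg) auto
  have P: "summable (\<lambda>k. (cmod (c b k))\<^sup>2)" "(LINT x|torus. (cmod (fser (c b) x))\<^sup>2) / (4 * pi\<^sup>2) = (\<Sum>k. (cmod (c b k))\<^sup>2)"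
    if "b \<in> Basis" for b
    using parseval(1)[OF that] sums_summable sums_unique by auto
  \<comment> \<open>The mean is the single coefficient at frequency zero, so its square is part of
    the energy.\<close>
  have M: "(cmod m)\<^sup>2 \<le> (\<Sum>k. (cmod (c e1 k))\<^sup>2)"
    using sum_le_suminf[OF P(1)[of e1], of "{k0}"] by (simp add: m_def)
  have "W\<^sup>2 * ((\<Sum>k. (cmod (c e2 k))\<^sup>2) + (cmod m)\<^sup>2 / 2) \<le> W\<^sup>2 * ((\<Sum>k. (cmod (c e1 k))\<^sup>2) + (\<Sum>k. (cmod (c e2 k))\<^sup>2))"
  proof (rule mult_left_mono)
    show "(\<Sum>k. (cmod (c e2 k))\<^sup>2) + (cmod m)\<^sup>2 / 2 \<le> (\<Sum>k. (cmod (c e1 k))\<^sup>2) + (\<Sum>k. (cmod (c e2 k))\<^sup>2)"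
      using M zero_le_power2[of "cmod m"] by linarith
  qed simp
  then show ?thesis
    using fin nn[of e1 e1] unfolding q(2)[OF Basis_e(1) Basis_e(2)] q(2)[OF Basis_e(2) Basis_e(2)] q(2)[OF Basis_e(2) Basis_e(1)]
      P(2)[OF Basis_e(2)] sum_Basis_real2 dsum[OF Basis_e(1)] dsum[OF Basis_e(2)]
    by (simp only: Basis_e) argo
qed

end

subsection \<open>Integrals over intervals of time\<close>

lemma time_integrable_sub:
  fixes f :: "real \<Rightarrow> 'b::{banach, second_countable_topology}"
  assumes "integrable (lebesgue_on {a<..<b}) f" "a \<le> c" "d \<le> b"
  shows "integrable (lebesgue_on {c<..<d}) f"
proof -
  have *: "set_integrable lebesgue {a<..<b} f"
    using assms(1) unfolding set_integrable_def by (subst (asm) integrable_restrict_space) auto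
  have "set_integrable lebesgue {c<..<d} f"
    by (rule set_integrable_subset[OF *]) (use assms in auto)
  then show ?thesis
    unfolding set_integrable_def by (subst integrable_restrict_space) auto
qed

text \<open>Passing to the Henstock-Kurzweil integral makes endpoints irrelevant and provides
  additivity over adjacent intervals and continuity of the indefinite integral.\<close>

lemma time_integral_eq:
  fixes f :: "real \<Rightarrow> real"
  assumes "integrable (lebesgue_on {a<..<b}) f"
  shows "(LINT s|lebesgue_on {a<..<b}. f s) = integral {a..b} f" "f integrable_on {a..b}"
proof -
  have 1: "f integrable_on {a<..<b}"
    using assms by (intro integrable_on_lebesgue_on) auto
  show "f integrable_on {a..b}"
    using 1 integrable_on_open_interval_real by blast
  have "(LINT s|lebesgue_on {a<..<b}. f s) = integral {a<..<b} f"
    using assms by (intro lebesgue_integral_eq_integral) auto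
  then show "(LINT s|lebesgue_on {a<..<b}. f s) = integral {a..b} f"
    using integral_open_interval_real by metis
qed

lemma time_integral_split:
  fixes f :: "real \<Rightarrow> real"
  assumes f: "integrable (lebesgue_on {a<..<c}) f" and "a \<le> b" "b \<le> c"
  shows "(LINT s|lebesgue_on {a<..<c}. f s) = (LINT s|lebesgue_on {a<..<b}. f s) + (LINT s|lebesgue_on {b<..<c}. f s)"
proof -
  have "integrable (lebesgue_on {a<..<b}) f" "integrable (lebesgue_on {b<..<c}) f"
    using time_integrable_sub[OF f] assms by auto
  then show ?thesis
    using time_integral_eq(1) f Henstock_Kurzweil_Integration.integral_combine[OF assms(2,3) time_integral_eq(2)[OF f]] by simp
qed

lemma time_integral_continuous:
  fixes f :: "real \<Rightarrow> real"
  assumes f: "integrable (lebesgue_on {a<..<b}) f"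
  shows "continuous_on {a..b} (\<lambda>t. LINT s|lebesgue_on {a<..<t}. f s)"
proof -
  have "continuous_on {a..b} (\<lambda>t. integral {a..t} f)"
    by (rule indefinite_integral_continuous_1) (rule time_integral_eq(2)[OF f])
  then show ?thesis
    by (rule continuous_on_eq) (use time_integral_eq(1)[OF time_integrable_sub[OF f]] in auto)
qed

lemma time_AE_iff: "(AE t in lebesgue_on {a<..<b::real}. P t) \<longleftrightarrow> (AE t in lebesgue. a < t \<and> t < b \<longrightarrow> P t)"
  by (subst AE_restrict_space_iff) auto

lemma time_AE_sub: "(AE t in lebesgue_on {a<..<b::real}. P t) \<Longrightarrow> a \<le> c \<Longrightarrow> d \<le> b \<Longrightarrow> AE t in lebesgue_on {c<..<d}. P t"
  unfolding time_AE_iff by (auto elim!: eventually_mono)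

lemma time_measurable_sub: "f \<in> borel_measurable (lebesgue_on {a<..<b::real}) \<Longrightarrow> a \<le> c \<Longrightarrow> d \<le> b \<Longrightarrow> f \<in> borel_measurable (lebesgue_on {c<..<d})"
  by (rule measurable_restrict_mono) auto

lemma finite_measure_time: "finite_measure (lebesgue_on {a<..<b::real})"
proof
  have "emeasure lborel {a<..<b} < \<infinity>"
    by (cases "a \<le> b") auto
  then show "emeasure (lebesgue_on {a<..<b}) (space (lebesgue_on {a<..<b})) \<noteq> \<infinity>"
    by (simp add: emeasure_restrict_space)
qed

lemma continuous_time_integrable:
  fixes h :: "real \<Rightarrow> real"
  assumes "continuous_on {a..b} h" "integrable (lebesgue_on {a<..<b}) g"
  shows "integrable (lebesgue_on {a<..<b}) (\<lambda>s. h s * g s)"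
proof -
  have "compact (h ` {a..b})" using assms(1) by (intro compact_continuous_image) auto
  then obtain B where B: "\<And>x. x \<in> {a..b} \<Longrightarrow> \<bar>h x\<bar> \<le> B"
    by (metis bounded_iff compact_imp_bounded image_eqI real_norm_def)
  have h: "h \<in> borel_measurable (lebesgue_on {a<..<b})"
    by (rule continuous_imp_measurable_on_sets_lebesgue[OF continuous_on_subset[OF assms(1)]]) auto
  show ?thesis
  proof (rule Bochner_Integration.integrable_bound)
    show "integrable (lebesgue_on {a<..<b}) (\<lambda>s. B * \<bar>g s\<bar>)" using assms(2) by auto
    show "(\<lambda>s. h s * g s) \<in> borel_measurable (lebesgue_on {a<..<b})" using h assms(2) by auto
    show "AE s in lebesgue_on {a<..<b}. norm (h s * g s) \<le> norm (B * \<bar>g s\<bar>)"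
    proof (rule AE_I2)
      fix s assume "s \<in> space (lebesgue_on {a<..<b})"
      then have "\<bar>h s\<bar> \<le> B" by (intro B) auto
      then have "\<bar>h s\<bar> * \<bar>g s\<bar> \<le> \<bar>B\<bar> * \<bar>g s\<bar>" by (intro mult_right_mono) auto
      then show "norm (h s * g s) \<le> norm (B * \<bar>g s\<bar>)" by (simp add: abs_mult)
    qed
  qed
qed

text \<open>The chain rule for an absolutely continuous function, without differentiating it. On a
  short interval \<open>(h b)\<^sup>2 - (h a)\<^sup>2\<close> is h b + h a times the integral of g,
  which differs from twice the integral of h g by at most e times the integral of |g|, by uniform
  continuity of h. All terms are additive over intervals, so bisection extends the estimate to
  [0,t].\<close>

lemma primitive_square:
  fixes g h :: "real \<Rightarrow> real"
  assumes g: "integrable (lebesgue_on {0<..<t}) g" and t: "0 \<le> t"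
    and h: "\<And>s. 0 \<le> s \<Longrightarrow> s \<le> t \<Longrightarrow> h s = h 0 + (LINT r|lebesgue_on {0<..<s}. g r)"
  shows "(h t)\<^sup>2 = (h 0)\<^sup>2 + 2 * (LINT s|lebesgue_on {0<..<t}. h s * g s)"
proof -
  have hc: "continuous_on {0..t} h"
    by (rule continuous_on_eq[of _ "\<lambda>s. h 0 + (LINT r|lebesgue_on {0<..<s}. g r)"])
      (auto intro!: continuous_intros time_integral_continuous g h[symmetric])
  have hg: "integrable (lebesgue_on {0<..<t}) (\<lambda>s. h s * g s)"
    by (rule continuous_time_integrable[OF hc g])
  have ag: "integrable (lebesgue_on {0<..<t}) (\<lambda>s. \<bar>g s\<bar>)" using g by simp
  have hd: "h b - h a = (LINT s|lebesgue_on {a<..<b}. g s)" if "0 \<le> a" "a \<le> b" "b \<le> t" for a b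
    using h[of a] h[of b] time_integral_split[OF time_integrable_sub[OF g], of 0 b a] that by simp
  have small: "\<bar>(h t)\<^sup>2 - (h 0)\<^sup>2 - 2 * (LINT s|lebesgue_on {0<..<t}. h s * g s)\<bar> \<le> e * (LINT s|lebesgue_on {0<..<t}. \<bar>g s\<bar>)"
    if e: "0 < e" for e
  proof -
    have "uniformly_continuous_on {0..t} h" by (rule compact_uniformly_continuous[OF hc]) simp
    then obtain d where d: "d > 0" "\<And>x y. x \<in> {0..t} \<Longrightarrow> y \<in> {0..t} \<Longrightarrow> dist y x < d \<Longrightarrow> dist (h y) (h x) < e / 2"
      unfolding uniformly_continuous_on_def using e by (metis half_gt_zero)
    have "0 \<le> (0::real) \<longrightarrow> t \<le> t \<longrightarrow> \<bar>(h t)\<^sup>2 - (h 0)\<^sup>2 - 2 * (LINT s|lebesgue_on {0<..<t}. h s * g s)\<bar> \<le> e * (LINT s|lebesgue_on {0<..<t}. \<bar>g s\<bar>)"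
    proof (rule Bolzano[where P = "\<lambda>a b. 0 \<le> a \<longrightarrow> b \<le> t \<longrightarrow> \<bar>(h b)\<^sup>2 - (h a)\<^sup>2 - 2 * (LINT s|lebesgue_on {a<..<b}. h s * g s)\<bar> \<le> e * (LINT s|lebesgue_on {a<..<b}. \<bar>g s\<bar>)", OF t])
      fix a b c :: real
      assume 1: "0 \<le> a \<longrightarrow> b \<le> t \<longrightarrow> \<bar>(h b)\<^sup>2 - (h a)\<^sup>2 - 2 * (LINT s|lebesgue_on {a<..<b}. h s * g s)\<bar> \<le> e * (LINT s|lebesgue_on {a<..<b}. \<bar>g s\<bar>)"
        and 2: "0 \<le> b \<longrightarrow> c \<le> t \<longrightarrow> \<bar>(h c)\<^sup>2 - (h b)\<^sup>2 - 2 * (LINT s|lebesgue_on {b<..<c}. h s * g s)\<bar> \<le> e * (LINT s|lebesgue_on {b<..<c}. \<bar>g s\<bar>)"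
        and ab: "a \<le> b" and bc: "b \<le> c"
      show "0 \<le> a \<longrightarrow> c \<le> t \<longrightarrow> \<bar>(h c)\<^sup>2 - (h a)\<^sup>2 - 2 * (LINT s|lebesgue_on {a<..<c}. h s * g s)\<bar> \<le> e * (LINT s|lebesgue_on {a<..<c}. \<bar>g s\<bar>)"
      proof (intro impI)
        assume "0 \<le> a" "c \<le> t"
        then have s: "(LINT s|lebesgue_on {a<..<c}. h s * g s) = (LINT s|lebesgue_on {a<..<b}. h s * g s) + (LINT s|lebesgue_on {b<..<c}. h s * g s)"
          "(LINT s|lebesgue_on {a<..<c}. \<bar>g s\<bar>) = (LINT s|lebesgue_on {a<..<b}. \<bar>g s\<bar>) + (LINT s|lebesgue_on {b<..<c}. \<bar>g s\<bar>)"
          using ab bc by (auto intro!: time_integral_split time_integrable_sub[OF hg] time_integrable_sub[OF ag])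
        show "\<bar>(h c)\<^sup>2 - (h a)\<^sup>2 - 2 * (LINT s|lebesgue_on {a<..<c}. h s * g s)\<bar> \<le> e * (LINT s|lebesgue_on {a<..<c}. \<bar>g s\<bar>)"
          using 1 2 \<open>0 \<le> a\<close> \<open>c \<le> t\<close> ab bc unfolding s distrib_left by linarith
      qed
    next
      fix x :: real
      show "\<exists>d>0. \<forall>a b. a \<le> x \<and> x \<le> b \<and> b - a < d \<longrightarrow> 0 \<le> a \<longrightarrow> b \<le> t \<longrightarrow> \<bar>(h b)\<^sup>2 - (h a)\<^sup>2 - 2 * (LINT s|lebesgue_on {a<..<b}. h s * g s)\<bar> \<le> e * (LINT s|lebesgue_on {a<..<b}. \<bar>g s\<bar>)"
      proof (intro exI[of _ d] conjI d(1) allI impI)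
        fix a b assume x: "a \<le> x \<and> x \<le> b \<and> b - a < d" and a: "0 \<le> a" and b: "b \<le> t"
        have ab: "a \<le> b" using x by linarith
        have gi: "integrable (lebesgue_on {a<..<b}) g" and hgi: "integrable (lebesgue_on {a<..<b}) (\<lambda>s. h s * g s)"
          using time_integrable_sub[OF g a b] time_integrable_sub[OF hg a b] by auto
        have "(h b)\<^sup>2 - (h a)\<^sup>2 = (h b + h a) * (LINT s|lebesgue_on {a<..<b}. g s)"
          using hd[OF a ab b] by (simp add: power2_eq_square algebra_simps)
        then have "(h b)\<^sup>2 - (h a)\<^sup>2 - 2 * (LINT s|lebesgue_on {a<..<b}. h s * g s) =
          (LINT s|lebesgue_on {a<..<b}. (h b + h a) * g s - 2 * (h s * g s))"
          using gi hgi by simp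
        also have "\<bar>\<dots>\<bar> \<le> (LINT s|lebesgue_on {a<..<b}. e * \<bar>g s\<bar>)"
        proof (rule integral_abs_bound_integral)
          show "integrable (lebesgue_on {a<..<b}) (\<lambda>s. (h b + h a) * g s - 2 * (h s * g s))" using gi hgi by simp
          show "integrable (lebesgue_on {a<..<b}) (\<lambda>s. e * \<bar>g s\<bar>)" using gi by simp
          fix s assume "s \<in> space (lebesgue_on {a<..<b})"
          then have s: "a < s" "s < b" by auto
          have "dist (h b) (h s) < e / 2" "dist (h a) (h s) < e / 2"
            using s a b x d(2)[of s b] d(2)[of s a] by (auto simp: dist_real_def)
          then have "\<bar>h b + h a - 2 * h s\<bar> \<le> e" unfolding dist_real_def by linarith
          then have "\<bar>h b + h a - 2 * h s\<bar> * \<bar>g s\<bar> \<le> e * \<bar>g s\<bar>" by (intro mult_right_mono) auto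
          then show "\<bar>(h b + h a) * g s - 2 * (h s * g s)\<bar> \<le> e * \<bar>g s\<bar>"
            by (simp add: abs_mult[symmetric] algebra_simps)
        qed
        finally show "\<bar>(h b)\<^sup>2 - (h a)\<^sup>2 - 2 * (LINT s|lebesgue_on {a<..<b}. h s * g s)\<bar> \<le> e * (LINT s|lebesgue_on {a<..<b}. \<bar>g s\<bar>)"
          by simp
      qed
    qed
    then show ?thesis by simp
  qed
  define G where "G = (LINT s|lebesgue_on {0<..<t}. \<bar>g s\<bar>)"
  have "\<bar>(h t)\<^sup>2 - (h 0)\<^sup>2 - 2 * (LINT s|lebesgue_on {0<..<t}. h s * g s)\<bar> \<le> 0"
  proof (rule field_le_epsilon)
    fix e :: real assume "0 < e"
    have "0 \<le> G" unfolding G_def by simp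
    have "\<bar>(h t)\<^sup>2 - (h 0)\<^sup>2 - 2 * (LINT s|lebesgue_on {0<..<t}. h s * g s)\<bar> \<le> e / (G + 1) * G"
      unfolding G_def using \<open>0 < e\<close> \<open>0 \<le> G\<close> by (intro small divide_pos_pos) (simp_all add: G_def add_nonneg_pos)
    also have "\<dots> \<le> 0 + e" using \<open>0 < e\<close> \<open>0 \<le> G\<close> by (simp add: field_simps)
    finally show "\<bar>(h t)\<^sup>2 - (h 0)\<^sup>2 - 2 * (LINT s|lebesgue_on {0<..<t}. h s * g s)\<bar> \<le> 0 + e" .
  qed
  then show ?thesis by simp
qed

text \<open>On an interval with \<open>\<integral>K \<le> 1/2\<close> the bound is immediate from \<open>1 / (1 - \<delta>) \<le> exp (2 \<delta>)\<close>; the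
  factor 2 in the exponent avoids differentiating absolutely continuous functions.\<close>
lemma gronwall_integral:
  fixes K E :: "real \<Rightarrow> real"
  assumes K: "integrable (lebesgue_on {0<..<T}) K" "AE s in lebesgue_on {0<..<T}. 0 \<le> K s"
    and E: "AE s in lebesgue_on {0<..<T}. 0 \<le> E s"
    and KE: "\<And>t. t < T \<Longrightarrow> integrable (lebesgue_on {0<..<t}) (\<lambda>s. K s * E s)"
    and A: "0 \<le> A"
    and le: "AE t in lebesgue_on {0<..<T}. E t \<le> A + (LINT s|lebesgue_on {0<..<t}. K s * E s)"
  shows "AE t in lebesgue_on {0<..<T}. E t \<le> A * exp (2 * (LINT s|lebesgue_on {0<..<T}. K s))"
proof -
  \<comment> \<open>The integral majorant of E. It is monotone, so on each short interval E can be
    compared with its value at the right endpoint.\<close>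
  define y where "y t = A + (LINT s|lebesgue_on {0<..<t}. K s * E s)" for t
  define \<kappa> where "\<kappa> t = (LINT s|lebesgue_on {0<..<t}. K s)" for t
  \<comment> \<open>Only t < T is treated, because the product of K and E is known to be integrable
    only below T; the bound uses K on all of (0,T) and is uniform in t.\<close>
  have y_bound: "y t \<le> A * exp (2 * (LINT s|lebesgue_on {0<..<T}. K s))" if t: "0 < t" "t < T" for t
  proof -
    have KEt: "integrable (lebesgue_on {0<..<t}) (\<lambda>s. K s * E s)" by (rule KE[OF t(2)])
    have Kt: "integrable (lebesgue_on {0<..<t}) K" using time_integrable_sub[OF K(1)] t by simp
    have KE0: "AE s in lebesgue_on {0<..<t}. 0 \<le> K s * E s"
      using time_AE_sub[OF K(2), of 0 t] time_AE_sub[OF E, of 0 t] t by (auto elim: eventually_elim2)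
    have y_diff: "y b - y a = (LINT s|lebesgue_on {a<..<b}. K s * E s)" if "0 \<le> a" "a \<le> b" "b \<le> t" for a b
      unfolding y_def using time_integral_split[OF time_integrable_sub[OF KEt], of 0 b a] that by simp
    have k_diff: "\<kappa> b - \<kappa> a = (LINT s|lebesgue_on {a<..<b}. K s)" if "0 \<le> a" "a \<le> b" "b \<le> t" for a b
      unfolding \<kappa>_def using time_integral_split[OF time_integrable_sub[OF Kt], of 0 b a] that by simp
    have y_mono: "y a \<le> y b" if "0 \<le> a" "a \<le> b" "b \<le> t" for a b
      using y_diff[OF that] integral_nonneg_AE[OF time_AE_sub[OF KE0, of a b]] that by simp
    have k_mono: "\<kappa> a \<le> \<kappa> b" if "0 \<le> a" "a \<le> b" "b \<le> t" for a b
      using k_diff[OF that] integral_nonneg_AE[OF time_AE_sub[OF K(2), of a b]] that t by simp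
    have y0: "y 0 = A" by (simp add: y_def)
    have y_nonneg: "0 \<le> y a" if "0 \<le> a" "a \<le> t" for a
      using y_mono[of 0 a] that A y0 by simp
    have "continuous_on {0..t} \<kappa>" unfolding \<kappa>_def by (rule time_integral_continuous[OF Kt])
    then have "uniformly_continuous_on {0..t} \<kappa>" by (rule compact_uniformly_continuous) simp
    then obtain d where d: "d > 0" "\<And>u v. u \<in> {0..t} \<Longrightarrow> v \<in> {0..t} \<Longrightarrow> dist v u < d \<Longrightarrow> dist (\<kappa> v) (\<kappa> u) < 1 / 2"
      unfolding uniformly_continuous_on_def by (metis half_gt_zero zero_less_one)
    have "0 \<le> (0::real) \<longrightarrow> t \<le> t \<longrightarrow> y t \<le> y 0 * exp (2 * (\<kappa> t - \<kappa> 0))"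
    proof (rule Bolzano[where P="\<lambda>a b. 0 \<le> a \<longrightarrow> b \<le> t \<longrightarrow> y b \<le> y a * exp (2 * (\<kappa> b - \<kappa> a))", OF less_imp_le[OF t(1)]])
      fix a b c assume 1: "0 \<le> a \<longrightarrow> b \<le> t \<longrightarrow> y b \<le> y a * exp (2 * (\<kappa> b - \<kappa> a))"
        and 2: "0 \<le> b \<longrightarrow> c \<le> t \<longrightarrow> y c \<le> y b * exp (2 * (\<kappa> c - \<kappa> b))" and abc: "a \<le> b" "b \<le> c"
      show "0 \<le> a \<longrightarrow> c \<le> t \<longrightarrow> y c \<le> y a * exp (2 * (\<kappa> c - \<kappa> a))"
      proof (intro impI)
        assume ac: "0 \<le> a" "c \<le> t"
        then have "y c \<le> y b * exp (2 * (\<kappa> c - \<kappa> b))" using 2 abc by simp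
        also have "\<dots> \<le> y a * exp (2 * (\<kappa> b - \<kappa> a)) * exp (2 * (\<kappa> c - \<kappa> b))"
          using 1 ac abc by (intro mult_right_mono) auto
        also have "\<dots> = y a * exp (2 * (\<kappa> c - \<kappa> a))"
          by (simp add: mult.assoc exp_add[symmetric] algebra_simps)
        finally show "y c \<le> y a * exp (2 * (\<kappa> c - \<kappa> a))" .
      qed
    next
      fix x
      show "\<exists>d>0. \<forall>a b. a \<le> x \<and> x \<le> b \<and> b - a < d \<longrightarrow> 0 \<le> a \<longrightarrow> b \<le> t \<longrightarrow> y b \<le> y a * exp (2 * (\<kappa> b - \<kappa> a))"
      proof (intro exI[of _ d] conjI d(1) allI impI)
        fix a b assume x: "a \<le> x \<and> x \<le> b \<and> b - a < d" and a: "0 \<le> a" and b: "b \<le> t"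
        then have ab: "a \<le> b" by linarith
        define \<delta> where "\<delta> = \<kappa> b - \<kappa> a"
        have \<delta>: "0 \<le> \<delta>" "\<delta> < 1 / 2"
          using k_mono[OF a ab b] d(2)[of a b] x a b ab by (auto simp: \<delta>_def dist_real_def)
        have "(LINT s|lebesgue_on {a<..<b}. K s * E s) \<le> (LINT s|lebesgue_on {a<..<b}. y b * K s)"
        proof (rule integral_mono_AE)
          show "integrable (lebesgue_on {a<..<b}) (\<lambda>s. K s * E s)" using time_integrable_sub[OF KEt a b] .
          show "integrable (lebesgue_on {a<..<b}) (\<lambda>s. y b * K s)" using time_integrable_sub[OF Kt a b] by simp
          have "AE s in lebesgue_on {a<..<b}. 0 \<le> K s" "AE s in lebesgue_on {a<..<b}. E s \<le> y s"
            using time_AE_sub[OF K(2), of a b] time_AE_sub[OF le[folded y_def], of a b] a b t by auto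
          moreover have "AE s in lebesgue_on {a<..<b}. a < s \<and> s < b" by (rule AE_I2) auto
          ultimately show "AE s in lebesgue_on {a<..<b}. K s * E s \<le> y b * K s"
          proof eventually_elim
            case (elim s)
            have "K s * E s \<le> K s * y b"
              using elim y_mono[of s b] a b by (intro mult_left_mono) auto
            then show ?case by (simp add: mult.commute)
          qed
        qed
        then have "y b - y a \<le> y b * \<delta>"
          using y_diff[OF a ab b] k_diff[OF a ab b] by (simp add: \<delta>_def)
        then have "y b * (1 - \<delta>) \<le> y a" by (simp add: algebra_simps)
        moreover have "1 \<le> (1 - \<delta>) * exp (2 * \<delta>)"
        proof -
          \<comment> \<open>The product equals 1 + \<delta> (1 - 2 \<delta>); this is where steps
            with \<delta> < 1/2 are used.\<close>
          have "1 \<le> (1 - \<delta>) * (1 + 2 * \<delta>)" using \<delta> mult_nonneg_nonneg[of \<delta> "1 - 2 * \<delta>"] by (simp add: algebra_simps)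
          also have "\<dots> \<le> (1 - \<delta>) * exp (2 * \<delta>)"
            using \<delta> exp_ge_add_one_self[of "2 * \<delta>"] by (intro mult_left_mono) auto
          finally show ?thesis .
        qed
        ultimately have "y b * (1 - \<delta>) * exp (2 * \<delta>) \<le> y a * exp (2 * \<delta>)" "y b * 1 \<le> y b * ((1 - \<delta>) * exp (2 * \<delta>))"
          using y_nonneg[of b] a ab b by (intro mult_right_mono mult_left_mono; simp)+
        then show "y b \<le> y a * exp (2 * (\<kappa> b - \<kappa> a))" unfolding \<delta>_def[symmetric] mult.assoc by linarith
      qed
    qed
    then have "y t \<le> A * exp (2 * \<kappa> t)" using y0 by (simp add: \<kappa>_def)
    also have "\<dots> \<le> A * exp (2 * (LINT s|lebesgue_on {0<..<T}. K s))"
    proof -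
      have "(LINT s|lebesgue_on {0<..<T}. K s) = \<kappa> t + (LINT s|lebesgue_on {t<..<T}. K s)"
        unfolding \<kappa>_def using t by (intro time_integral_split K) auto
      moreover have "0 \<le> (LINT s|lebesgue_on {t<..<T}. K s)"
        using time_AE_sub[OF K(2), of t T] t by (intro integral_nonneg_AE) auto
      ultimately show ?thesis using A by (intro mult_left_mono) auto
    qed
    finally show ?thesis .
  qed
  have "AE t in lebesgue_on {0<..<T}. 0 < t \<and> t < T" by (rule AE_I2) auto
  then show ?thesis using le unfolding y_def[symmetric]
    by eventually_elim (use y_bound in force)
qed

subsection \<open>Weak time derivatives\<close>

text \<open>Smoothness quantifies over all lists of directions; a family of differentiable functions
  that is closed under partial derivatives replaces their computation.\<close>

lemma smooth_coinduct:
  assumes "f \<in> \<F>" and "\<And>g x. g \<in> \<F> \<Longrightarrow> g differentiable (at x)"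
    and "\<And>g b. g \<in> \<F> \<Longrightarrow> b \<in> Basis \<Longrightarrow> partial b g \<in> \<F>"
  shows "smooth f"
  unfolding smooth_def
proof (intro allI impI)
  fix bs :: "'a list" and x assume "set bs \<subseteq> Basis"
  then have "fold partial bs f \<in> \<F>" using assms(1)
    by (induction bs arbitrary: f) (auto intro: assms(3))
  then show "fold partial bs f differentiable (at x)" by (rule assms(2))
qed

lemma smooth_differentiable: "smooth f \<Longrightarrow> f differentiable (at x)"
  unfolding smooth_def by (elim allE[of _ "[]"]) auto

lemma smooth_partial:
  fixes f :: "'a::euclidean_space \<Rightarrow> 'b::real_normed_vector"
  shows "smooth f \<Longrightarrow> b \<in> Basis \<Longrightarrow> smooth (partial b f)"
  unfolding smooth_def
proof (intro allI impI)
  fix bs :: "'a list" and x :: 'a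
  assume "\<forall>bs. set bs \<subseteq> Basis \<longrightarrow> (\<forall>x. fold partial bs f differentiable at x)" "b \<in> Basis" "set bs \<subseteq> Basis"
  then show "fold partial bs (partial b f) differentiable at x"
    by (elim allE[of _ "b # bs"]) auto
qed

lemma smooth_continuous: "smooth f \<Longrightarrow> continuous_on S f"
  using smooth_differentiable differentiable_imp_continuous_within
  by (metis continuous_at_imp_continuous_on)

lemma partial_real:
  fixes f :: "real \<Rightarrow> real"
  assumes "(f has_real_derivative D) (at x)"
  shows "partial 1 f x = D"
proof -
  have "frechet_derivative f (at x) = (*) D"
    using assms unfolding has_field_derivative_def by (rule frechet_derivative_at[symmetric])
  then show ?thesis by (simp add: partial_def)
qed

lemma smooth_line:
  fixes \<phi> :: "'a::euclidean_space \<Rightarrow> real"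
  assumes "smooth \<phi>" "b \<in> Basis"
  shows "((\<lambda>s. \<phi> (s *\<^sub>R b)) has_real_derivative partial b \<phi> (s *\<^sub>R b)) (at s)"
proof -
  have *: "((\<lambda>s. s *\<^sub>R b) has_derivative (\<lambda>h. h *\<^sub>R b)) (at s)"
    by (auto intro!: derivative_eq_intros)
  have d: "\<phi> differentiable (at (s *\<^sub>R b))" using assms(1) by (rule smooth_differentiable)
  then have "(\<phi> has_derivative frechet_derivative \<phi> (at (s *\<^sub>R b))) (at (s *\<^sub>R b))"
    using frechet_derivative_works by blast
  then have "((\<lambda>s. \<phi> (s *\<^sub>R b)) has_derivative (\<lambda>h. frechet_derivative \<phi> (at (s *\<^sub>R b)) (h *\<^sub>R b))) (at s)"
    using has_derivative_compose[OF *] by blast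
  moreover have "(\<lambda>h. frechet_derivative \<phi> (at (s *\<^sub>R b)) (h *\<^sub>R b)) = (*) (partial b \<phi> (s *\<^sub>R b))"
    using linear_scale[OF linear_frechet_derivative[OF d]] by (auto simp: partial_def fun_eq_iff)
  ultimately show ?thesis by (simp add: has_field_derivative_def)
qed

text \<open>The mollifier in time is a restriction of the Littlewood-Paley function to a line.\<close>
lemma smooth_step_exists:
  fixes \<phi> :: "'a::euclidean_space \<Rightarrow> real"
  assumes \<phi>: "dyadic_partition \<phi>"
  obtains R \<rho> :: "real \<Rightarrow> real" where "\<And>x. (R has_real_derivative \<rho> x) (at x)" "continuous_on UNIV \<rho>"
    "\<And>x. 0 \<le> \<rho> x" "\<And>x. x \<le> -2 \<Longrightarrow> R x = 0" "\<And>x. 2 \<le> x \<Longrightarrow> R x = 1"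
    "\<And>a b e. smooth (\<lambda>t. R ((t - a) / e) - R ((t - b) / e))"
proof -
  have sm: "smooth \<phi>" and nn: "\<And>\<xi>. 0 \<le> \<phi> \<xi>" and supp: "closure {\<xi>. \<phi> \<xi> \<noteq> 0} \<subseteq> {\<xi>. 1 / 2 < norm \<xi> \<and> norm \<xi> < 2}"
    and part: "\<And>\<xi>. \<xi> \<noteq> 0 \<Longrightarrow> ((\<lambda>j::int. \<phi> ((2 powi (- j)) *\<^sub>R \<xi>)) has_sum 1) UNIV"
    using \<phi> unfolding dyadic_partition_def by auto
  have far: "\<phi> \<xi> = 0" if "norm \<xi> \<ge> 2" for \<xi>
    using supp closure_subset[of "{\<xi>. \<phi> \<xi> \<noteq> 0}"] that by force
  obtain b :: 'a where b: "b \<in> Basis" using nonempty_Basis by blast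
  then have nb: "norm b = 1" "b \<noteq> 0" by auto
  define \<rho>0 where "\<rho>0 s = \<phi> (s *\<^sub>R b)" for s
  have c0: "continuous_on UNIV \<rho>0"
    unfolding \<rho>0_def by (intro continuous_on_compose2[OF smooth_continuous[OF sm]] continuous_intros) auto
  \<comment> \<open>The dyadic sum at b equals 1, so some term is nonzero; this keeps the primitive
    of the restriction from being constant.\<close>
  have "\<exists>j::int. \<phi> ((2 powi (- j)) *\<^sub>R b) \<noteq> 0"
  proof (rule ccontr)
    assume "\<nexists>j::int. \<phi> ((2 powi (- j)) *\<^sub>R b) \<noteq> 0"
    then have "((\<lambda>j::int. 0) has_sum (1::real)) UNIV" using part[OF nb(2)] by simp
    then show False using has_sum_0[of UNIV "\<lambda>j::int. 0::real"] has_sum_unique by fastforce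
  qed
  then obtain s0 where s0: "\<rho>0 s0 \<noteq> 0" unfolding \<rho>0_def by blast
  obtain R0 where "\<And>x. (R0 has_vector_derivative \<rho>0 x) (at x)"
    using einterval_antiderivative[of "-\<infinity>" "\<infinity>" \<rho>0] c0 by (auto simp: continuous_on_eq_continuous_at)
  then have R0: "(R0 has_real_derivative \<rho>0 x) (at x)" for x
    by (simp add: has_real_derivative_iff_has_vector_derivative)
  have z: "\<rho>0 x = 0" if "\<bar>x\<bar> \<ge> 2" for x
    unfolding \<rho>0_def using that nb by (intro far) simp
  have "\<exists>c. \<forall>x\<in>{..-2}. R0 x = c"
  proof (rule has_field_derivative_zero_constant)
    fix x :: real assume "x \<in> {..-2}"
    then have "\<rho>0 x = 0" using z[of x] by simp
    then show "(R0 has_real_derivative 0) (at x within {..-2})"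
      using has_field_derivative_at_within[OF R0[of x]] by simp
  qed simp
  then have l: "R0 x = R0 (-2)" if "x \<le> -2" for x using that by force
  have "\<exists>c. \<forall>x\<in>{2..}. R0 x = c"
  proof (rule has_field_derivative_zero_constant)
    fix x :: real assume "x \<in> {2..}"
    then have "\<rho>0 x = 0" using z[of x] by simp
    then show "(R0 has_real_derivative 0) (at x within {2..})"
      using has_field_derivative_at_within[OF R0[of x]] by simp
  qed simp
  then have r: "R0 x = R0 2" if "2 \<le> x" for x using that by force
  have mono: "R0 x \<le> R0 y" if "x \<le> y" for x y
    by (rule DERIV_nonneg_imp_nondecreasing[OF that]) (use R0 nn in \<open>auto simp: \<rho>0_def\<close>)
  define c where "c = R0 2 - R0 (-2)"
  have "c \<noteq> 0"
  proof
    assume "c = 0"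
    then have "R0 x = R0 (-2)" for x
      using l[of x] r[of x] mono[of "-2" x] mono[of x 2] by (cases "x \<le> -2"; cases "2 \<le> x") (auto simp: c_def)
    then have "R0 = (\<lambda>_. R0 (-2))" by blast
    then have "(R0 has_real_derivative 0) (at s0)" by (metis DERIV_const)
    then show False using DERIV_unique[OF R0[of s0]] s0 by blast
  qed
  then have c: "0 < c" using mono[of "-2" 2] by (simp add: c_def)
  define R where "R x = (R0 x - R0 (-2)) / c" for x
  \<comment> \<open>The primitive R together with multiples of all smooth functions restricted to
    the line. The family is closed under differentiation, since the derivative of R is a multiple of
    the restriction of \<phi>.\<close>
  define \<G> where "\<G> = insert R {\<lambda>s. \<kappa> * g (s *\<^sub>R b) | \<kappa> g. smooth g}"
  have \<rho>\<G>: "(\<lambda>s. (1 / c) * \<phi> (s *\<^sub>R b)) \<in> \<G>" using sm unfolding \<G>_def by blast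
  have dR: "(R has_real_derivative \<rho>0 x / c) (at x)" for x
    unfolding R_def using c by (auto intro!: derivative_eq_intros R0)
  have G: "\<exists>G'\<in>\<G>. \<forall>x. (G has_real_derivative G' x) (at x)" if GG: "G \<in> \<G>" for G
  proof (cases "G = R")
    case True
    then show ?thesis using \<rho>\<G> dR by (auto simp: \<rho>0_def intro!: bexI[OF _ \<rho>\<G>])
  next
    case False
    then obtain \<kappa> g where g: "G = (\<lambda>s. \<kappa> * g (s *\<^sub>R b))" "smooth g" using GG by (auto simp: \<G>_def)
    have M: "(\<lambda>s. \<kappa> * partial b g (s *\<^sub>R b)) \<in> \<G>" using smooth_partial[OF g(2) b] unfolding \<G>_def by blast
    have "\<forall>x. (G has_real_derivative \<kappa> * partial b g (x *\<^sub>R b)) (at x)"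
      unfolding g(1) by (intro allI DERIV_cmult smooth_line g b)
    then show ?thesis by (rule bexI[OF _ M])
  qed
  show ?thesis
  proof
    show "(R has_real_derivative \<rho>0 x / c) (at x)" for x by (rule dR)
    show "continuous_on UNIV (\<lambda>x. \<rho>0 x / c)" using c by (intro continuous_intros c0) auto
    show "0 \<le> \<rho>0 x / c" for x using c nn by (simp add: \<rho>0_def)
    show "R x = 0" if "x \<le> -2" for x using l[OF that] by (simp add: R_def)
    show "R x = 1" if "2 \<le> x" for x using r[OF that] c by (simp add: R_def c_def)
    fix a a' e :: real
    \<comment> \<open>Both translates carry the same G with separate coefficients; the chain rule
      only rescales these coefficients and replaces G by its derivative.\<close>
    define \<F> where "\<F> = {\<lambda>t. \<alpha> * G ((t - a) / e) + \<beta> * G ((t - a') / e) | \<alpha> \<beta> G. G \<in> \<G>}"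
    show "smooth (\<lambda>t. R ((t - a) / e) - R ((t - a') / e))"
    proof (rule smooth_coinduct[where \<F>=\<F>])
      show "(\<lambda>t. R ((t - a) / e) - R ((t - a') / e)) \<in> \<F>"
        unfolding \<F>_def by (intro CollectI exI[of _ 1] exI[of _ "-1"] exI[of _ R]) (auto simp: \<G>_def)
      have key: "\<exists>f'\<in>\<F>. \<forall>x. (f has_real_derivative f' x) (at x)" if "f \<in> \<F>" for f
      proof -
        obtain \<alpha> \<beta> H where f: "f = (\<lambda>t. \<alpha> * H ((t - a) / e) + \<beta> * H ((t - a') / e))" "H \<in> \<G>"
          using \<open>f \<in> \<F>\<close> by (auto simp: \<F>_def)
        obtain H' where H': "H' \<in> \<G>" "\<And>x. (H has_real_derivative H' x) (at x)" using G[OF f(2)] by blast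
        have "((\<lambda>t. H ((t - v) / e)) has_real_derivative H' ((x - v) / e) * (1 / e)) (at x)" for v x
          by (rule DERIV_chain2[OF H'(2)]) (auto intro!: derivative_eq_intros simp: divide_inverse)
        then have D: "\<forall>x. (f has_real_derivative (\<alpha> / e) * H' ((x - a) / e) + (\<beta> / e) * H' ((x - a') / e)) (at x)"
          unfolding f(1) by (auto intro!: derivative_eq_intros simp: mult.commute)
        have "(\<lambda>x. (\<alpha> / e) * H' ((x - a) / e) + (\<beta> / e) * H' ((x - a') / e)) \<in> \<F>"
          using H'(1) unfolding \<F>_def by blast
        with D show ?thesis by (rule bexI)
      qed
      show "f differentiable (at x)" if "f \<in> \<F>" for f x
        using key[OF that] unfolding has_field_derivative_def differentiable_def by blast
      show "partial v f \<in> \<F>" if "f \<in> \<F>" "v \<in> Basis" for f and v :: real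
      proof -
        obtain f' where f': "f' \<in> \<F>" "\<And>x. (f has_real_derivative f' x) (at x)" using key[OF \<open>f \<in> \<F>\<close>] by blast
        have "v = 1" using that(2) by simp
        then have "partial v f = f'" using partial_real[OF f'(2)] by blast
        then show ?thesis using f' by simp
      qed
    qed
  qed
qed

text \<open>The test function is the difference of two smooth steps at a and b. Its derivative is a
  difference of two mollifiers, so one side averages h near a and near b, and the other side is an
  almost sharp cut-off of g. Shrinking the width gives the identity between interior times, and
  continuity of \<open>hc\<close> at 0 extends it to the initial time.\<close>

theorem weak_time_derivative_primitive:
  fixes \<phi> :: "'a::euclidean_space \<Rightarrow> real"
  assumes \<phi>: "dyadic_partition \<phi>" and w: "has_weak_time_derivative T h g"
    and hc: "continuous_on {0..<T} hc" and ae: "AE t in lebesgue_on {0<..<T}. h t = hc t"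
    and t: "0 \<le> t" "t < T"
  shows "hc t = hc 0 + (LINT s|lebesgue_on {0<..<t}. g s)"
proof -
  obtain R \<rho> where R: "\<And>x. (R has_real_derivative \<rho> x) (at x)" "continuous_on UNIV \<rho>"
    "\<And>x. 0 \<le> \<rho> x" "\<And>x. x \<le> -2 \<Longrightarrow> R x = 0" "\<And>x. 2 \<le> x \<Longrightarrow> R x = 1"
    "\<And>a b e. smooth (\<lambda>t. R ((t - a) / e) - R ((t - b) / e))"
    by (rule smooth_step_exists[OF \<phi>]) (rule that; assumption)
  have h: "integrable (lebesgue_on {0<..<T}) h" and g: "integrable (lebesgue_on {0<..<T}) g"
    and weak: "\<And>\<theta> :: real \<Rightarrow> real. smooth \<theta> \<Longrightarrow> compact (closure {t. \<theta> t \<noteq> 0}) \<Longrightarrow>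
          closure {t. \<theta> t \<noteq> 0} \<subseteq> {0<..<T} \<Longrightarrow>
        (LINT t|lebesgue_on {0<..<T}. h t * deriv \<theta> t) = - (LINT t|lebesgue_on {0<..<T}. g t * \<theta> t)"
    using w unfolding has_weak_time_derivative_def by auto
  have R01: "0 \<le> R x" "R x \<le> 1" for x
  proof -
    have mono: "R x \<le> R y" if "x \<le> y" for x y
      by (rule DERIV_nonneg_imp_nondecreasing[OF that]) (use R(1,3) in blast)
    show "0 \<le> R x" using mono[of "min x (-2)" x] R(4)[of "min x (-2)"] by simp
    show "R x \<le> 1" using mono[of x "max x 2"] R(5)[of "max x 2"] by simp
  qed
  have \<rho>0: "\<rho> x = 0" if "\<bar>x\<bar> > 2" for x
  proof -
    have "(R has_real_derivative 0) (at x)"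
    proof (cases "x > 2")
      case True
      have "((\<lambda>_. 1) has_real_derivative 0) (at x)" by simp
      then show ?thesis
        by (rule has_field_derivative_transform_within_open[of _ _ _ "{2<..}"]) (use True R(5) in auto)
    next
      case False
      have "((\<lambda>_. 0) has_real_derivative 0) (at x)" by simp
      then show ?thesis
        by (rule has_field_derivative_transform_within_open[of _ _ _ "{..<-2}"]) (use False that R(4) in auto)
    qed
    then show ?thesis using DERIV_unique[OF R(1)] by blast
  qed
  define J where "J a e = (LINT t|lebesgue_on {0<..<T}. h t * (\<rho> ((t - a) / e) / e))" for a e
  have dR: "((\<lambda>t. R ((t - a) / e)) has_real_derivative \<rho> ((x - a) / e) / e) (at x)" for a e x
  proof -
    have "((\<lambda>t. R ((t - a) / e)) has_real_derivative \<rho> ((x - a) / e) * (1 / e)) (at x)"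
      by (rule DERIV_chain2[OF R(1)]) (auto intro!: derivative_eq_intros simp: divide_inverse)
    then show ?thesis by simp
  qed
  have cr: "continuous_on S (\<lambda>t. \<rho> ((t - a) / e) / e)" if "e > 0" for S a e
    using that by (intro continuous_intros continuous_on_compose2[OF R(2)]) auto
  have ri: "integrable (lebesgue_on {0<..<T}) (\<lambda>t. \<rho> ((t - a) / e) / e)" if "e > 0" for a e
  proof -
    have "integrable (lebesgue_on {0<..<T}) (\<lambda>s. (\<rho> ((s - a) / e) / e) * 1)"
      by (rule continuous_time_integrable[OF cr[OF that]])
        (use finite_measure.integrable_const[OF finite_measure_time] in auto)
    then show ?thesis by simp
  qed
  have hri: "integrable (lebesgue_on {0<..<T}) (\<lambda>t. h t * (\<rho> ((t - a) / e) / e))" if "e > 0" for a e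
    using continuous_time_integrable[OF cr[OF that] h] by (simp add: mult.commute)
  have mass: "(LINT t|lebesgue_on {0<..<T}. \<rho> ((t - a) / e) / e) = 1" if e: "0 < e" "2 * e < a" "a + 2 * e < T" for a e
  proof -
    have "((\<lambda>t. \<rho> ((t - a) / e) / e) has_integral R ((T - a) / e) - R ((0 - a) / e)) {0..T}"
      by (rule fundamental_theorem_of_calculus)
        (use e dR in \<open>auto simp: has_real_derivative_iff_has_vector_derivative[symmetric] intro: has_field_derivative_at_within\<close>)
    moreover have "R ((T - a) / e) = 1" using e by (intro R(5)) (simp add: pos_le_divide_eq)
    moreover have "R ((0 - a) / e) = 0" using e by (intro R(4)) (simp add: field_simps)
    ultimately have H: "((\<lambda>t. \<rho> ((t - a) / e) / e) has_integral 1) {0..T}" by simp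
    show ?thesis by (simp only: time_integral_eq(1)[OF ri[OF e(1)]] integral_unique[OF H])
  qed
  have main: "hc b - hc a = (LINT s|lebesgue_on {a<..<b}. g s)" if ab: "0 < a" "a < b" "b < T" for a b
  proof -
    \<comment> \<open>A mollifier of width e reaches 2 e to either side; a third of the distance to
      the endpoints leaves room for it.\<close>
    define e0 where "e0 = min (a / 3) (min ((T - b) / 3) (1::real))"
    define e where "e n = e0 / real (Suc n)" for n
    have e0: "0 < e0" using ab by (simp add: e0_def)
    have e: "0 < e n" "e n \<le> e0" for n
      using e0 by (auto simp: e_def divide_le_eq mult_le_cancel_left1)
    have ee: "2 * e n < a" "b + 2 * e n < T" "2 * e n < b" "a + 2 * e n < T" for n
      using e[of n] ab unfolding e0_def by (auto simp: min_def split: if_splits)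
    have e_lim: "e \<longlonglongrightarrow> 0"
      unfolding e_def using tendsto_mult_right_zero[OF LIMSEQ_inverse_real_of_nat, of e0] by (simp add: divide_inverse)
    define \<theta> where "\<theta> n t = R ((t - a) / e n) - R ((t - b) / e n)" for n t
    have eqn: "J a (e n) - J b (e n) = - (LINT t|lebesgue_on {0<..<T}. g t * \<theta> n t)" for n
    proof -
      have sub: "{t. \<theta> n t \<noteq> 0} \<subseteq> {a - 2 * e n..b + 2 * e n}"
      proof (rule subsetI, rule ccontr)
        fix t assume t: "t \<in> {t. \<theta> n t \<noteq> 0}" "t \<notin> {a - 2 * e n..b + 2 * e n}"
        then consider "t < a - 2 * e n" | "t > b + 2 * e n" by force
        then have "\<theta> n t = 0"
        proof cases
          case 1
          then have "(t - a) / e n \<le> -2" "(t - b) / e n \<le> -2" using e[of n] ab by (auto simp: pos_divide_le_eq)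
          then show ?thesis by (simp add: \<theta>_def R(4))
        next
          case 2
          then have "(t - a) / e n \<ge> 2" "(t - b) / e n \<ge> 2" using e[of n] ab by (auto simp: pos_le_divide_eq)
          then show ?thesis by (simp add: \<theta>_def R(5))
        qed
        then show False using t by simp
      qed
      then have cl: "closure {t. \<theta> n t \<noteq> 0} \<subseteq> {a - 2 * e n..b + 2 * e n}"
        by (intro closure_minimal) auto
      have "deriv (\<theta> n) t = \<rho> ((t - a) / e n) / e n - \<rho> ((t - b) / e n) / e n" for t
        unfolding \<theta>_def by (intro DERIV_imp_deriv DERIV_diff dR)
      moreover have "(LINT t|lebesgue_on {0<..<T}. h t * deriv (\<theta> n) t) = - (LINT t|lebesgue_on {0<..<T}. g t * \<theta> n t)"
      proof (rule weak)
        show "smooth (\<theta> n)" unfolding \<theta>_def by (rule R(6))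
        show "closure {t. \<theta> n t \<noteq> 0} \<subseteq> {0<..<T}" using cl ee[of n] by (auto dest!: subsetD[OF cl])
        show "compact (closure {t. \<theta> n t \<noteq> 0})"
          using cl compact_eq_bounded_closed bounded_subset[OF bounded_closed_interval] by blast
      qed
      ultimately show ?thesis
        unfolding J_def using hri[OF e(1)] by (simp add: right_diff_distrib)
    qed
    have Jlim: "(\<lambda>n. J v (e n)) \<longlonglongrightarrow> hc v" if v: "0 < v" "v < T" "\<And>n. 2 * e n < v" "\<And>n. v + 2 * e n < T" for v
    proof (rule LIMSEQ_I)
      fix \<eta> :: real assume "0 < \<eta>"
      have "isCont hc v"
        using hc v continuous_on_interior[of "{0..<T}" hc v] by simp
      then obtain d where d: "d > 0" "\<And>x. dist x v < d \<Longrightarrow> dist (hc x) (hc v) < \<eta> / 2"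
        unfolding continuous_at_eps_delta using \<open>0 < \<eta>\<close> by (metis half_gt_zero)
      obtain n0 where n0: "\<And>n. n \<ge> n0 \<Longrightarrow> 3 * e n < d"
      proof -
        have "(\<lambda>n. 3 * e n) \<longlonglongrightarrow> 0" using tendsto_mult_right_zero[OF e_lim] .
        from order_tendstoD(2)[OF this d(1)] show thesis using that unfolding eventually_sequentially by blast
      qed
      show "\<exists>no. \<forall>n\<ge>no. norm (J v (e n) - hc v) < \<eta>"
      proof (intro exI allI impI)
        fix n assume n: "n \<ge> n0"
        let ?r = "\<lambda>t. \<rho> ((t - v) / e n) / e n"
        have r1: "integrable (lebesgue_on {0<..<T}) ?r" by (rule ri[OF e(1)])
        have r2: "integrable (lebesgue_on {0<..<T}) (\<lambda>t. h t * ?r t)" by (rule hri[OF e(1)])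
        have r3: "integrable (lebesgue_on {0<..<T}) (\<lambda>t. hc v * ?r t)" by (rule integrable_mult_right[OF r1])
        have r4: "integrable (lebesgue_on {0<..<T}) (\<lambda>t. \<eta> / 2 * ?r t)" by (rule integrable_mult_right[OF r1])
        have "J v (e n) - hc v = (LINT t|lebesgue_on {0<..<T}. h t * ?r t) - (LINT t|lebesgue_on {0<..<T}. hc v * ?r t)"
          using mass[OF e(1)[of n] v(3,4)] by (simp add: J_def)
        then have eq: "J v (e n) - hc v = (LINT t|lebesgue_on {0<..<T}. h t * ?r t - hc v * ?r t)"
          by (simp only: Bochner_Integration.integral_diff[OF r2 r3])
        have "norm (J v (e n) - hc v) \<le> (LINT t|lebesgue_on {0<..<T}. norm (h t * ?r t - hc v * ?r t))"
          unfolding eq by (rule integral_norm_bound)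
        also have "\<dots> \<le> (LINT t|lebesgue_on {0<..<T}. \<eta> / 2 * ?r t)"
        proof (rule integral_mono_AE)
          show "integrable (lebesgue_on {0<..<T}) (\<lambda>t. norm (h t * ?r t - hc v * ?r t))"
            by (rule integrable_norm[OF Bochner_Integration.integrable_diff[OF r2 r3]])
          show "integrable (lebesgue_on {0<..<T}) (\<lambda>t. \<eta> / 2 * ?r t)"
            by (rule r4)
          show "AE t in lebesgue_on {0<..<T}. norm (h t * ?r t - hc v * ?r t) \<le> \<eta> / 2 * ?r t"
            using ae
          proof eventually_elim
            case (elim t)
            show ?case
            proof (cases "\<bar>(t - v) / e n\<bar> > 2")
              case True
              then show ?thesis using \<rho>0 by simp
            next
              case False
              then have "\<bar>t - v\<bar> \<le> 2 * e n" using e(1)[of n] by (simp add: abs_divide pos_divide_le_eq not_less)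
              then have "dist t v < d" using n0[OF n] e(1)[of n] by (simp add: dist_real_def)
              then have "\<bar>hc t - hc v\<bar> \<le> \<eta> / 2" using d(2)[of t] by (simp add: dist_real_def)
              moreover have "0 \<le> ?r t" using R(3) e(1)[of n] by (simp add: less_imp_le)
              ultimately have "\<bar>hc t - hc v\<bar> * ?r t \<le> \<eta> / 2 * ?r t" by (intro mult_right_mono)
              moreover have "norm (h t * ?r t - hc v * ?r t) = \<bar>hc t - hc v\<bar> * \<bar>?r t\<bar>"
                unfolding elim left_diff_distrib[symmetric] real_norm_def abs_mult ..
              ultimately show ?thesis using \<open>0 \<le> ?r t\<close> by (simp only: abs_of_nonneg)
            qed
          qed
        qed
        also have "\<dots> = \<eta> / 2" using mass[OF e(1)[of n] v(3,4)] by simp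
        finally show "norm (J v (e n) - hc v) < \<eta>" using \<open>0 < \<eta>\<close> by simp
      qed
    qed
    have R_meas: "continuous_on S (\<lambda>t. R ((t - v) / e n))" for S v n
      using dR by (intro continuous_at_imp_continuous_on ballI) (metis DERIV_isCont)
    have \<theta>_meas: "\<theta> n \<in> borel_measurable (lebesgue_on {0<..<T})" for n
      unfolding \<theta>_def by (intro continuous_imp_measurable_on_sets_lebesgue continuous_intros R_meas) auto
    have "(\<lambda>n. LINT t|lebesgue_on {0<..<T}. g t * \<theta> n t) \<longlonglongrightarrow> (LINT t|lebesgue_on {0<..<T}. g t * indicator {a<..<b} t)"
    proof (rule integral_dominated_convergence[where w="\<lambda>t. \<bar>g t\<bar>"])
      have "indicator {a<..<b} \<in> borel_measurable (lebesgue_on {0<..<T})"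
        by (rule measurable_restrict_space1, rule borel_measurable_indicator) auto
      then show "(\<lambda>t. g t * indicator {a<..<b} t) \<in> borel_measurable (lebesgue_on {0<..<T})"
        using g by (intro borel_measurable_times) auto
      show "(\<lambda>t. g t * \<theta> n t) \<in> borel_measurable (lebesgue_on {0<..<T})" for n
        using g \<theta>_meas by auto
      show "integrable (lebesgue_on {0<..<T}) (\<lambda>t. \<bar>g t\<bar>)" using g by simp
      show "AE t in lebesgue_on {0<..<T}. norm (g t * \<theta> n t) \<le> \<bar>g t\<bar>" for n
      proof (rule AE_I2)
        fix t
        have "\<bar>\<theta> n t\<bar> \<le> 1" unfolding \<theta>_def using R01[of "(t - a) / e n"] R01[of "(t - b) / e n"] by linarith
        then show "norm (g t * \<theta> n t) \<le> \<bar>g t\<bar>" by (simp add: abs_mult mult_left_le)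
      qed
      have "AE t in lborel. t \<noteq> a \<and> t \<noteq> b"
        using AE_lborel_singleton[of a] AE_lborel_singleton[of b] by eventually_elim auto
      then have "AE t in lebesgue. t \<noteq> a \<and> t \<noteq> b" by (simp only: AE_completion_iff)
      then have "AE t in lebesgue_on {0<..<T}. t \<noteq> a \<and> t \<noteq> b"
        unfolding time_AE_iff by eventually_elim auto
      then show "AE t in lebesgue_on {0<..<T}. (\<lambda>n. g t * \<theta> n t) \<longlonglongrightarrow> g t * indicator {a<..<b} t"
      proof eventually_elim
        case (elim t)
        have ev: "eventually (\<lambda>n. R ((t - v) / e n) = (if v < t then 1 else 0)) sequentially" if "t \<noteq> v" for v
        proof -
          have "\<bar>t - v\<bar> / 2 > 0" using that by simp
          from order_tendstoD(2)[OF e_lim this]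
          show ?thesis
          proof eventually_elim
            case (elim n)
            show ?case
            proof (cases "v < t")
              case True
              then have "2 \<le> (t - v) / e n" using elim e(1)[of n] by (simp add: pos_le_divide_eq)
              then show ?thesis using True R(5) by simp
            next
              case False
              then have "(t - v) / e n \<le> -2" using elim that e(1)[of n] by (simp add: pos_divide_le_eq)
              then show ?thesis using False R(4) by simp
            qed
          qed
        qed
        have "eventually (\<lambda>n. \<theta> n t = indicator {a<..<b} t) sequentially"
          using ev[OF conjunct1[OF elim]] ev[OF conjunct2[OF elim]]
        proof eventually_elim
          case (elim n)
          then show ?case using \<open>t \<noteq> a \<and> t \<noteq> b\<close> ab by (auto simp: \<theta>_def indicator_def)
        qed
        then have "(\<lambda>n. \<theta> n t) \<longlonglongrightarrow> indicator {a<..<b} t" by (rule tendsto_eventually)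
        then show ?case by (intro tendsto_intros)
      qed
    qed
    moreover have "(LINT t|lebesgue_on {0<..<T}. g t * indicator {a<..<b} t) = (LINT s|lebesgue_on {a<..<b}. g s)"
    proof -
      have "indicator {0<..<T} x *\<^sub>R (g x * indicator {a<..<b} x) = indicator {a<..<b} x *\<^sub>R g x" for x
        using ab by (auto simp: indicator_def)
      moreover have "(LINT t|lebesgue_on {0<..<T}. g t * indicator {a<..<b} t) =
          (LINT x|lebesgue. indicator {0<..<T} x *\<^sub>R (g x * indicator {a<..<b} x))"
        by (rule integral_restrict_space) auto
      moreover have "(LINT s|lebesgue_on {a<..<b}. g s) = (LINT x|lebesgue. indicator {a<..<b} x *\<^sub>R g x)"
        by (rule integral_restrict_space) auto
      ultimately show ?thesis by (simp only:)
    qed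
    ultimately have "(\<lambda>n. - (LINT t|lebesgue_on {0<..<T}. g t * \<theta> n t)) \<longlonglongrightarrow> - (LINT s|lebesgue_on {a<..<b}. g s)"
      by (simp add: tendsto_minus)
    moreover have "(\<lambda>n. J a (e n) - J b (e n)) \<longlonglongrightarrow> hc a - hc b"
      using ab ee by (intro tendsto_diff Jlim) auto
    ultimately have "hc a - hc b = - (LINT s|lebesgue_on {a<..<b}. g s)"
      unfolding eqn using LIMSEQ_unique by blast
    then show ?thesis by simp
  qed
  show ?thesis
  proof (cases "t = 0")
    case False
    then have t0: "0 < t" using t by simp
    \<comment> \<open>The denominator starts at 2, so that \<open>a n < t\<close> already holds for
      n = 0.\<close>
    define a where "a n = t / real (Suc (Suc n))" for n
    have a: "0 < a n" "a n < t" for n using t0 by (auto simp: a_def divide_less_eq mult_less_cancel_left1)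
    have gt: "integrable (lebesgue_on {0<..<t}) g" using time_integrable_sub[OF g] t by simp
    have a0: "a \<longlonglongrightarrow> 0"
      unfolding a_def using LIMSEQ_Suc[OF tendsto_mult_right_zero[OF LIMSEQ_inverse_real_of_nat, of t]] by (simp add: divide_inverse)
    have mem: "eventually (\<lambda>n. a n \<in> {0..<T}) sequentially" using a t by (intro always_eventually) (auto intro: less_imp_le less_trans)
    have 1: "(\<lambda>n. hc (a n)) \<longlonglongrightarrow> hc 0"
      by (rule continuous_on_tendsto_compose[OF hc a0 _ mem]) (use t in auto)
    have mem': "eventually (\<lambda>n. a n \<in> {0..t}) sequentially" using a by (intro always_eventually) (auto intro: less_imp_le)
    have "(\<lambda>n. LINT s|lebesgue_on {0<..<a n}. g s) \<longlonglongrightarrow> (LINT s|lebesgue_on {0<..<0}. g s)"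
      by (rule continuous_on_tendsto_compose[OF time_integral_continuous[OF gt] a0 _ mem']) (use t in auto)
    then have "(\<lambda>n. hc (a n) + ((LINT s|lebesgue_on {0<..<t}. g s) - (LINT s|lebesgue_on {0<..<a n}. g s))) \<longlonglongrightarrow> hc 0 + ((LINT s|lebesgue_on {0<..<t}. g s) - 0)"
      by (intro tendsto_intros 1) simp
    moreover have "hc (a n) + ((LINT s|lebesgue_on {0<..<t}. g s) - (LINT s|lebesgue_on {0<..<a n}. g s)) = hc t" for n
      using main[OF a t(2), of n] time_integral_split[OF gt, of "a n"] a[of n] by simp
    ultimately show ?thesis by (simp add: LIMSEQ_const_iff)
  qed simp
qed

text \<open>Times increasing to T; starting the denominator at 2 keeps the first one
  positive.\<close>

definition stp :: "real \<Rightarrow> nat \<Rightarrow> real" where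
  "stp T n = T - T / real (Suc (Suc n))"

lemma stp_bounds: "0 < T \<Longrightarrow> 0 < stp T n" "0 < T \<Longrightarrow> stp T n < T"
  by (auto simp: stp_def divide_less_eq mult_less_cancel_left1)

lemma stp_exceeds:
  assumes "0 < T" "t < T"
  shows "\<exists>n. t < stp T n"
proof -
  have "(\<lambda>n. T * inverse (real (Suc n))) \<longlonglongrightarrow> T * 0"
    by (intro tendsto_mult tendsto_const LIMSEQ_inverse_real_of_nat)
  then have "stp T \<longlonglongrightarrow> T - 0"
    unfolding stp_def divide_inverse
    by (intro tendsto_diff tendsto_const LIMSEQ_Suc[of "\<lambda>n. T * inverse (real (Suc n))"]) simp
  then have "eventually (\<lambda>n. t < stp T n) sequentially"
    using assms by (intro order_tendstoD(1)) auto
  then show ?thesis by (auto simp: eventually_sequentially)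
qed

text \<open>The bound is assumed for almost every t only, but each \<open>stp T n\<close> is
  followed by a time below T at which it holds; monotone convergence does the rest.\<close>

lemma nn_integral_time_exhaust:
  fixes f :: "real \<Rightarrow> ennreal"
  assumes T: "0 < T" and f: "f \<in> borel_measurable (lebesgue_on {0<..<T})"
    and b: "AE t in lebesgue_on {0<..<T}. (\<integral>\<^sup>+s. f s \<partial>lebesgue_on {0<..<t}) \<le> M"
  shows "(\<integral>\<^sup>+s. f s \<partial>lebesgue_on {0<..<T}) \<le> M"
proof -
  define \<tau> where "\<tau> = stp T"
  have \<tau>: "0 < \<tau> n" "\<tau> n < T" for n
    using stp_bounds[OF T] by (auto simp: \<tau>_def)
  have restr: "(\<integral>\<^sup>+s. f s \<partial>lebesgue_on {0<..<u}) = (\<integral>\<^sup>+s. f s * indicator {0<..<u} s \<partial>lebesgue)" for u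
    by (subst nn_integral_restrict_space) auto
  have le: "(\<integral>\<^sup>+s. f s * indicator {0<..<\<tau> n} s \<partial>lebesgue) \<le> M" for n
  proof -
    \<comment> \<open>Otherwise the nonempty interval between \<open>\<tau> n\<close> and T would be
      a null set.\<close>
    have "\<exists>t. \<tau> n < t \<and> t < T \<and> (\<integral>\<^sup>+s. f s \<partial>lebesgue_on {0<..<t}) \<le> M"
    proof (rule ccontr)
      assume no: "\<nexists>t. \<tau> n < t \<and> t < T \<and> (\<integral>\<^sup>+s. f s \<partial>lebesgue_on {0<..<t}) \<le> M"
      have "AE t in lebesgue. \<not> (\<tau> n < t \<and> t < T)"
        using b unfolding time_AE_iff
      proof eventually_elim
        case (elim t)
        then show ?case using no \<tau>(1)[of n] less_trans by blast
      qed
      then have "AE t in lborel. t \<notin> {\<tau> n<..<T}" by (simp only: AE_completion_iff) auto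
      then have "{\<tau> n<..<T} \<in> null_sets lborel" by (subst AE_iff_null_sets) auto
      then show False using \<tau>(2)[of n] by (simp add: null_sets_def)
    qed
    then obtain t where t: "\<tau> n < t" "(\<integral>\<^sup>+s. f s \<partial>lebesgue_on {0<..<t}) \<le> M" by blast
    have "(\<integral>\<^sup>+s. f s * indicator {0<..<\<tau> n} s \<partial>lebesgue) \<le> (\<integral>\<^sup>+s. f s * indicator {0<..<t} s \<partial>lebesgue)"
      using t(1) by (intro nn_integral_mono mult_left_mono) (auto simp: indicator_def)
    then show ?thesis using t(2) unfolding restr by simp
  qed
  have fT: "(\<lambda>s. f s * indicator {0<..<T} s) \<in> borel_measurable lebesgue"
    using f by (subst (asm) borel_measurable_restrict_space_iff_ennreal) auto
  have "(\<integral>\<^sup>+s. f s * indicator {0<..<T} s \<partial>lebesgue) = (SUP n. (\<integral>\<^sup>+s. f s * indicator {0<..<\<tau> n} s \<partial>lebesgue))"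
  proof -
    have "(\<integral>\<^sup>+s. f s * indicator {0<..<T} s \<partial>lebesgue) = (\<integral>\<^sup>+s. (SUP n. f s * indicator {0<..<\<tau> n} s) \<partial>lebesgue)"
    proof (intro nn_integral_cong)
      fix s
      show "f s * indicator {0<..<T} s = (SUP n. f s * indicator {0<..<\<tau> n} s)"
      proof (rule antisym)
        show "f s * indicator {0<..<T} s \<le> (SUP n. f s * indicator {0<..<\<tau> n} s)"
        proof (cases "s \<in> {0<..<T}")
          case True
          then obtain n where "s < \<tau> n" using stp_exceeds[OF T] by (auto simp: \<tau>_def)
          then show ?thesis using True by (intro SUP_upper2[of n]) auto
        qed simp
        show "(SUP n. f s * indicator {0<..<\<tau> n} s) \<le> f s * indicator {0<..<T} s"
          using \<tau>(2) by (intro SUP_least mult_left_mono) (auto simp: indicator_def intro: less_trans)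
      qed
    qed
    also have "\<dots> = (SUP n. (\<integral>\<^sup>+s. f s * indicator {0<..<\<tau> n} s \<partial>lebesgue))"
    proof (rule nn_integral_monotone_convergence_SUP)
      show "incseq (\<lambda>n s. f s * indicator {0<..<\<tau> n} s)"
      proof (intro incseq_SucI le_funI mult_left_mono)
        fix n s
        have "\<tau> n \<le> \<tau> (Suc n)" unfolding \<tau>_def stp_def using T by (intro diff_left_mono divide_left_mono) auto
        then show "(indicator {0<..<\<tau> n} s :: ennreal) \<le> indicator {0<..<\<tau> (Suc n)} s" by (auto simp: indicator_def)
      qed simp
      fix n
      have "(\<lambda>s. (f s * indicator {0<..<T} s) * indicator {0<..<\<tau> n} s) \<in> borel_measurable lebesgue"
        by (intro borel_measurable_times_ennreal fT borel_measurable_indicator) auto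
      moreover have "(f s * indicator {0<..<T} s) * indicator {0<..<\<tau> n} s = f s * indicator {0<..<\<tau> n} s" for s
        using \<tau>(2)[of n] by (auto simp: indicator_def)
      ultimately show "(\<lambda>s. f s * indicator {0<..<\<tau> n} s) \<in> borel_measurable lebesgue" by simp
    qed
    finally show ?thesis .
  qed
  also have "\<dots> \<le> M" by (intro SUP_least le)
  finally show ?thesis unfolding restr .
qed

lemma AE_exhaust:
  fixes T :: real
  assumes T: "0 < T" and "\<And>T'. 0 < T' \<Longrightarrow> T' < T \<Longrightarrow> AE t in lebesgue_on {0<..<T'}. P t"
  shows "AE t in lebesgue_on {0<..<T}. P t"
proof -
  have "AE t in lebesgue. \<forall>n. 0 < t \<and> t < stp T n \<longrightarrow> P t"
    using assms(2)[OF stp_bounds[OF T]] unfolding time_AE_iff AE_all_countable by blast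
  then show ?thesis
    unfolding time_AE_iff by eventually_elim (use stp_exceeds[OF T] in blast)
qed

subsection \<open>Energy estimates mode by mode\<close>

text \<open>The mode \<open>k\<close> has squared frequency \<open>r k\<close>, energy \<open>p k\<close>, squared nonlinearity \<open>\<nu> k\<close>, and
  \<open>q k\<close> is its pairing with the nonlinearity; \<open>G\<close> stands for the Besov norm of \<open>u\<^sub>1\<close>.\<close>
locale energy_system =
  fixes T lam C0 C1 :: real and r p0 :: "nat \<Rightarrow> real" and p q \<nu> :: "nat \<Rightarrow> real \<Rightarrow> real" and G :: "real \<Rightarrow> ennreal"
  assumes T: "0 < T" and C0: "0 \<le> C0" and C1: "0 < C1"
    and r: "\<And>k. 0 \<le> r k" and p0: "\<And>k. 0 \<le> p0 k" "summable (\<lambda>k. (1 + r k)\<^sup>2 * p0 k)"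
    and meas [measurable]: "\<And>k. p k \<in> borel_measurable (lebesgue_on {0<..<T})"
      "\<And>k. q k \<in> borel_measurable (lebesgue_on {0<..<T})" "\<And>k. \<nu> k \<in> borel_measurable (lebesgue_on {0<..<T})"
    and pos: "\<And>k t. 0 \<le> p k t" "\<And>k t. 0 \<le> \<nu> k t"
    and H4: "AE t in lebesgue_on {0<..<T}. summable (\<lambda>k. (1 + r k) ^ 4 * p k t)"
    and nu: "AE t in lebesgue_on {0<..<T}. summable (\<lambda>k. \<nu> k t) \<and> (\<Sum>k. \<nu> k t) \<le> C0 * (\<Sum>k. (1 + r k)\<^sup>2 * p k t)\<^sup>2"
    and q: "AE t in lebesgue_on {0<..<T}. \<forall>k. (q k t)\<^sup>2 \<le> p k t * \<nu> k t"
    and qsum: "AE t in lebesgue_on {0<..<T}. G t < \<infinity> \<and>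
      \<bar>\<Sum>k. q k t\<bar> \<le> (\<Sum>k. r k * p k t) / 2 + C1 * (enn2real (G t))\<^sup>2 * (\<Sum>k. p k t)"
    and G: "(\<integral>\<^sup>+t. (G t)\<^sup>2 \<partial>lebesgue_on {0<..<T}) < \<infinity>"
    and evol: "\<And>k. AE t in lebesgue_on {0<..<T}. p k t = p0 k - 2 * (LINT s|lebesgue_on {0<..<t}. q k s + ((r k)\<^sup>2 - lam * r k) * p k s)"
    and loc: "\<And>T'. 0 < T' \<Longrightarrow> T' < T \<Longrightarrow> \<exists>M. AE t in lebesgue_on {0<..<T'}. (\<Sum>k. (1 + r k)\<^sup>2 * p k t) \<le> M"
begin

section \<open>Sums over all modes at a single time\<close>

definition "E t = (\<Sum>k. p k t)"
definition "D t = (\<Sum>k. r k * p k t)"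
definition "Z t = (\<Sum>k. (r k)\<^sup>2 * p k t)"
definition "S t = (\<Sum>k. (1 + r k)\<^sup>2 * p k t)"
definition "B t = (\<Sum>k. q k t)"
text \<open>Where \<open>E t = 0\<close> the quotient is 0. \<open>\<kappa>\<close> replaces \<open>G\<^sup>2\<close>, which need not be measurable.\<close>
definition "\<kappa> t = max 0 ((\<bar>B t\<bar> - D t / 2) / E t)"

lemma meas_sums [measurable]:
  "E \<in> borel_measurable (lebesgue_on {0<..<T})" "D \<in> borel_measurable (lebesgue_on {0<..<T})"
  "Z \<in> borel_measurable (lebesgue_on {0<..<T})" "S \<in> borel_measurable (lebesgue_on {0<..<T})"
  "B \<in> borel_measurable (lebesgue_on {0<..<T})" "\<kappa> \<in> borel_measurable (lebesgue_on {0<..<T})"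
  unfolding E_def D_def Z_def S_def B_def \<kappa>_def by measurable

text \<open>Collects the facts valid at almost every time, so that later proofs discharge a single
  \<open>AE\<close> and then argue pointwise.\<close>

definition good :: "real \<Rightarrow> bool" where
  "good t \<longleftrightarrow> summable (\<lambda>k. (1 + r k) ^ 4 * p k t) \<and>
     summable (\<lambda>k. \<nu> k t) \<and> (\<Sum>k. \<nu> k t) \<le> C0 * (S t)\<^sup>2 \<and> (\<forall>k. (q k t)\<^sup>2 \<le> p k t * \<nu> k t) \<and>
     G t < \<infinity> \<and> \<bar>B t\<bar> \<le> D t / 2 + C1 * (enn2real (G t))\<^sup>2 * E t"

lemma AE_good: "AE t in lebesgue_on {0<..<T}. good t"
  using H4 nu q qsum unfolding good_def S_def B_def D_def E_def by eventually_elim auto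

lemma good_summable:
  assumes "good t" "\<And>k. \<bar>w k\<bar> \<le> C * (1 + r k) ^ 4"
  shows "summable (\<lambda>k. w k * p k t)"
proof (rule summable_comparison_test')
  show "summable (\<lambda>k. C * ((1 + r k) ^ 4 * p k t))" using assms(1) by (intro summable_mult) (auto simp: good_def)
  fix k
  show "norm (w k * p k t) \<le> C * ((1 + r k) ^ 4 * p k t)"
    using mult_right_mono[OF assms(2)[of k] pos(1)[of k t]] pos(1)[of k t] by (simp add: abs_mult mult.assoc)
qed

lemma good_sums:
  assumes "good t"
  shows "summable (\<lambda>k. p k t)" "summable (\<lambda>k. r k * p k t)" "summable (\<lambda>k. (r k)\<^sup>2 * p k t)" "summable (\<lambda>k. (1 + r k)\<^sup>2 * p k t)"
proof -
  have r1: "1 \<le> 1 + r k" for k using r by simp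
  have "1 \<le> (1 + r k) ^ 4" "r k \<le> (1 + r k) ^ 4" "(r k)\<^sup>2 \<le> (1 + r k) ^ 4" "(1 + r k)\<^sup>2 \<le> (1 + r k) ^ 4" for k
  proof -
    show 1: "1 \<le> (1 + r k) ^ 4" by (rule one_le_power[OF r1])
    show 2: "(1 + r k)\<^sup>2 \<le> (1 + r k) ^ 4" by (rule power_increasing[OF _ r1]) simp
    have "r k \<le> (1 + r k)\<^sup>2" "(r k)\<^sup>2 \<le> (1 + r k)\<^sup>2" using r[of k] by (auto simp: power2_eq_square algebra_simps)
    with 2 show "r k \<le> (1 + r k) ^ 4" "(r k)\<^sup>2 \<le> (1 + r k) ^ 4" by auto
  qed
  then show "summable (\<lambda>k. p k t)" "summable (\<lambda>k. r k * p k t)" "summable (\<lambda>k. (r k)\<^sup>2 * p k t)" "summable (\<lambda>k. (1 + r k)\<^sup>2 * p k t)"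
    using good_summable[OF assms, of "\<lambda>_. 1" 1] good_summable[OF assms, of r 1]
      good_summable[OF assms, of "\<lambda>k. (r k)\<^sup>2" 1] good_summable[OF assms, of "\<lambda>k. (1 + r k)\<^sup>2" 1] r by auto
qed

lemma good_nonneg:
  assumes "good t"
  shows "0 \<le> E t" "0 \<le> D t" "0 \<le> Z t" "0 \<le> S t" "E t \<le> S t" "Z t \<le> S t" "D t \<le> S t" "S t \<le> 2 * (E t + Z t)"
proof -
  note s = good_sums[OF assms]
  show "0 \<le> E t" "0 \<le> D t" "0 \<le> Z t" "0 \<le> S t"
    unfolding E_def D_def Z_def S_def using s r pos by (auto intro!: suminf_nonneg)
  show "E t \<le> S t" "Z t \<le> S t" "D t \<le> S t"
    unfolding E_def D_def Z_def S_def
  proof (safe intro!: suminf_le s)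
    fix k
    have "1 \<le> (1 + r k)\<^sup>2" "(r k)\<^sup>2 \<le> (1 + r k)\<^sup>2" "r k \<le> (1 + r k)\<^sup>2"
      using r[of k] by (auto simp: power2_eq_square algebra_simps)
    then show "p k t \<le> (1 + r k)\<^sup>2 * p k t" "(r k)\<^sup>2 * p k t \<le> (1 + r k)\<^sup>2 * p k t" "r k * p k t \<le> (1 + r k)\<^sup>2 * p k t"
      using mult_right_mono[OF _ pos(1)[of k t]] by force+
  qed
  have "S t \<le> (\<Sum>k. 2 * (p k t + (r k)\<^sup>2 * p k t))"
    unfolding S_def
  proof (intro suminf_le s summable_mult summable_add)
    fix k
    have "(1 + r k)\<^sup>2 \<le> 2 * (1 + (r k)\<^sup>2)" using sum_squares_bound[of 1 "r k"] by (simp add: power2_sum)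
    then show "(1 + r k)\<^sup>2 * p k t \<le> 2 * (p k t + (r k)\<^sup>2 * p k t)"
      using mult_right_mono[OF _ pos(1)[of k t]] by (fastforce simp: algebra_simps)
  qed
  also have "\<dots> = 2 * (\<Sum>k. p k t + (r k)\<^sup>2 * p k t)"
    by (rule suminf_mult[OF summable_add[OF s(1) s(3)]])
  also have "(\<Sum>k. p k t + (r k)\<^sup>2 * p k t) = E t + Z t"
    unfolding E_def Z_def by (rule suminf_add[OF s(1) s(3), symmetric])
  finally show "S t \<le> 2 * (E t + Z t)" .
qed

text \<open>The arithmetic-geometric mean applied to
  \<open>(q k t)\<^sup>2 \<le> p k t * \<nu> k t\<close>. In the second estimate the two factors are
  \<open>(1 + r k) ^ 4 * p k t / 2\<close> and \<open>2 * \<nu> k t\<close>, chosen so that twice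
  the weighted pairing uses up only half of the dissipation in the H^2 balance.\<close>

lemma good_q:
  assumes "good t"
  shows "\<bar>q k t\<bar> \<le> (p k t + \<nu> k t) / 2" "(1 + r k)\<^sup>2 * \<bar>q k t\<bar> \<le> (1 + r k) ^ 4 * p k t / 4 + \<nu> k t"
proof -
  have qk: "(q k t)\<^sup>2 \<le> p k t * \<nu> k t" using assms by (simp add: good_def)
  have am: "x * y \<le> ((x + y) / 2)\<^sup>2" for x y :: real
    using zero_le_power2[of "x - y"] by (simp add: power2_eq_square algebra_simps)
  show "\<bar>q k t\<bar> \<le> (p k t + \<nu> k t) / 2"
    using order_trans[OF qk am] pos[of k t] abs_le_square_iff[of "q k t" "(p k t + \<nu> k t) / 2"] by simp
  have "((1 + r k)\<^sup>2 * \<bar>q k t\<bar>)\<^sup>2 = (1 + r k) ^ 4 * (q k t)\<^sup>2"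
    by (simp add: power_mult_distrib flip: power_mult)
  also have "\<dots> \<le> (1 + r k) ^ 4 * (p k t * \<nu> k t)" using qk by (intro mult_left_mono) auto
  also have "\<dots> = ((1 + r k) ^ 4 * p k t / 2) * (2 * \<nu> k t)" by simp
  also have "\<dots> \<le> (((1 + r k) ^ 4 * p k t / 2 + 2 * \<nu> k t) / 2)\<^sup>2" by (rule am)
  also have "((1 + r k) ^ 4 * p k t / 2 + 2 * \<nu> k t) / 2 = (1 + r k) ^ 4 * p k t / 4 + \<nu> k t" by (simp add: field_simps)
  finally show "(1 + r k)\<^sup>2 * \<bar>q k t\<bar> \<le> (1 + r k) ^ 4 * p k t / 4 + \<nu> k t"
    by (rule power2_le_imp_le) (use pos[of _ t] r in auto)
qed

text \<open>\<open>\<kappa>\<close> is the least nonnegative factor for which the bound on B holds,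
  hence it lies below every other such factor, in particular
  \<open>C1 * (enn2real (G t))\<^sup>2\<close>. Where E vanishes, the bound holds with factor
  0.\<close>

lemma good_kappa:
  assumes "good t"
  shows "\<bar>B t\<bar> \<le> D t / 2 + \<kappa> t * E t" "\<kappa> t \<le> C1 * (enn2real (G t))\<^sup>2" "0 \<le> \<kappa> t"
proof -
  note nn = good_nonneg[OF assms]
  have b: "\<bar>B t\<bar> \<le> D t / 2 + C1 * (enn2real (G t))\<^sup>2 * E t" using assms by (simp add: good_def)
  show "0 \<le> \<kappa> t" by (simp add: \<kappa>_def)
  have g: "0 \<le> C1 * (enn2real (G t))\<^sup>2" using C1 by simp
  show "\<bar>B t\<bar> \<le> D t / 2 + \<kappa> t * E t"
  proof (cases "E t = 0")
    case False
    then have "0 < E t" using nn by simp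
    then have "\<bar>B t\<bar> - D t / 2 = (\<bar>B t\<bar> - D t / 2) / E t * E t" by simp
    also have "\<dots> \<le> \<kappa> t * E t" using \<open>0 < E t\<close> by (intro mult_right_mono) (auto simp: \<kappa>_def)
    finally show ?thesis by simp
  qed (use b in simp)
  show "\<kappa> t \<le> C1 * (enn2real (G t))\<^sup>2"
  proof (cases "E t = 0")
    case False
    then have "0 < E t" using nn by simp
    then have "(\<bar>B t\<bar> - D t / 2) / E t \<le> C1 * (enn2real (G t))\<^sup>2" using b by (simp add: pos_divide_le_eq)
    then show ?thesis using g by (simp add: \<kappa>_def)
  qed (use g in \<open>simp add: \<kappa>_def\<close>)
qed

text \<open>The nonnegative integral is monotone even if the larger function is not measurable, so
  finiteness for the square of G carries over to \<open>\<kappa>\<close>.\<close>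

lemma kappa_integrable: "integrable (lebesgue_on {0<..<T}) \<kappa>"
proof -
  have "integrable (lebesgue_on {0<..<T}) (\<lambda>t. \<kappa> t / C1)"
  proof (rule integrableI_bounded)
    have "(\<integral>\<^sup>+t. ennreal (norm (\<kappa> t / C1)) \<partial>lebesgue_on {0<..<T}) \<le> (\<integral>\<^sup>+t. (G t)\<^sup>2 \<partial>lebesgue_on {0<..<T})"
    proof (rule nn_integral_mono_AE)
      show "AE t in lebesgue_on {0<..<T}. ennreal (norm (\<kappa> t / C1)) \<le> (G t)\<^sup>2"
        using AE_good
      proof eventually_elim
        case (elim t)
        have "norm (\<kappa> t / C1) \<le> (enn2real (G t))\<^sup>2"
          using good_kappa[OF elim] C1 by (simp add: pos_divide_le_eq mult.commute)
        then have "ennreal (norm (\<kappa> t / C1)) \<le> ennreal ((enn2real (G t))\<^sup>2)" by (rule ennreal_leI)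
        also have "\<dots> = (G t)\<^sup>2"
          using elim by (simp add: good_def flip: ennreal_power)
        finally show ?case .
      qed
    qed
    then show "(\<integral>\<^sup>+t. ennreal (norm (\<kappa> t / C1)) \<partial>lebesgue_on {0<..<T}) < \<infinity>" using G by (rule le_less_trans)
  qed measurable
  then have "integrable (lebesgue_on {0<..<T}) (\<lambda>t. C1 * (\<kappa> t / C1))" by (rule integrable_mult_right)
  then show ?thesis using C1 by simp
qed

section \<open>First energy estimate: L^2 in space\<close>

lemma time_integrable_bounded:
  fixes f :: "real \<Rightarrow> real"
  assumes "f \<in> borel_measurable (lebesgue_on {0<..<T})" "t \<le> T" "AE s in lebesgue_on {0<..<t}. \<bar>f s\<bar> \<le> C"
  shows "integrable (lebesgue_on {0<..<t}) f"
proof (rule finite_measure.integrable_const_bound[OF finite_measure_time])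
  show "f \<in> borel_measurable (lebesgue_on {0<..<t})" using assms by (auto intro: time_measurable_sub)
  show "AE s in lebesgue_on {0<..<t}. norm (f s) \<le> C" using assms by simp
qed

text \<open>The bound depends on t and is purely qualitative: it makes integrals finite and
  dominates sums. For t \<le> 0 the interval is empty.\<close>

lemma S_loc:
  assumes "t < T"
  obtains M where "0 \<le> M" "AE s in lebesgue_on {0<..<t}. good s \<and> S s \<le> M"
proof (cases "0 < t")
  case True
  obtain M where "AE s in lebesgue_on {0<..<t}. S s \<le> M" using loc[OF True assms] unfolding S_def by blast
  moreover have "AE s in lebesgue_on {0<..<t}. good s" using time_AE_sub[OF AE_good, of 0 t] assms by simp
  ultimately have "AE s in lebesgue_on {0<..<t}. good s \<and> S s \<le> max 0 M" by eventually_elim auto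
  then show ?thesis using that[of "max 0 M"] by simp
next
  case False
  then have "AE s in lebesgue_on {0<..<t}. good s \<and> S s \<le> 0" by (intro AE_I2) auto
  then show ?thesis using that[of 0] by simp
qed

text \<open>The symbol of Delta^2 + lam Delta.\<close>

abbreviation "\<mu> k \<equiv> (r k)\<^sup>2 - lam * r k"

lemma mu_bound: "\<bar>\<mu> k\<bar> \<le> (1 + \<bar>lam\<bar>) * (1 + r k)\<^sup>2"
proof -
  have rr: "(r k)\<^sup>2 \<le> (1 + r k)\<^sup>2" "r k \<le> (1 + r k)\<^sup>2" using r[of k] by (auto simp: power2_eq_square algebra_simps)
  have "\<bar>\<mu> k\<bar> \<le> (r k)\<^sup>2 + \<bar>lam\<bar> * r k" using r[of k] abs_triangle_ineq4[of "(r k)\<^sup>2" "lam * r k"] by (simp add: abs_mult)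
  also have "\<dots> \<le> (1 + r k)\<^sup>2 + \<bar>lam\<bar> * (1 + r k)\<^sup>2" using rr by (intro add_mono mult_left_mono) auto
  finally show ?thesis by (simp add: algebra_simps)
qed

definition "evolves t \<longleftrightarrow> (\<forall>k. p k t = p0 k - 2 * (LINT s|lebesgue_on {0<..<t}. q k s + \<mu> k * p k s))"

lemma AE_evolves: "AE t in lebesgue_on {0<..<T}. evolves t"
  unfolding evolves_def AE_all_countable using evol by blast

text \<open>The bound is independent of n and serves as the dominating constant when the mode
  identities are summed.\<close>

lemma good_partial_bound:
  assumes "good s" "S s \<le> M" "0 \<le> M"
  shows "(\<Sum>k<n. \<bar>q k s + \<mu> k * p k s\<bar>) \<le> M + C0 * M\<^sup>2 + (1 + \<bar>lam\<bar>) * M"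
proof -
  note s = good_sums[OF assms(1)]
  have nu: "summable (\<lambda>k. \<nu> k s)" "(\<Sum>k. \<nu> k s) \<le> C0 * (S s)\<^sup>2" using assms(1) by (auto simp: good_def)
  have "(\<Sum>k<n. \<bar>q k s + \<mu> k * p k s\<bar>) \<le> (\<Sum>k<n. p k s + \<nu> k s + (1 + \<bar>lam\<bar>) * ((1 + r k)\<^sup>2 * p k s))"
  proof (rule sum_mono)
    fix k
    have "\<bar>\<mu> k * p k s\<bar> \<le> (1 + \<bar>lam\<bar>) * (1 + r k)\<^sup>2 * p k s"
      using mult_right_mono[OF mu_bound[of k] pos(1)[of k s]] pos(1)[of k s] by (simp add: abs_mult)
    moreover have "\<bar>a + b\<bar> \<le> x + y + z" if "\<bar>a\<bar> \<le> (x + y) / 2" "\<bar>b\<bar> \<le> z" "0 \<le> x" "0 \<le> y" for a b x y z :: real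
      using that abs_triangle_ineq[of a b] by argo
    ultimately show "\<bar>q k s + \<mu> k * p k s\<bar> \<le> p k s + \<nu> k s + (1 + \<bar>lam\<bar>) * ((1 + r k)\<^sup>2 * p k s)"
      using good_q(1)[OF assms(1), of k] pos[of _ s] by (simp only: mult.assoc)
  qed
  also have "\<dots> = (\<Sum>k<n. p k s) + (\<Sum>k<n. \<nu> k s) + (1 + \<bar>lam\<bar>) * (\<Sum>k<n. (1 + r k)\<^sup>2 * p k s)"
    by (simp add: sum.distrib sum_distrib_left)
  also have "\<dots> \<le> E s + C0 * (S s)\<^sup>2 + (1 + \<bar>lam\<bar>) * S s"
    unfolding E_def S_def using nu s pos unfolding S_def
    by (intro add_mono mult_left_mono order_trans[OF sum_le_suminf nu(2)[unfolded S_def]] sum_le_suminf) auto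
  also have "\<dots> \<le> M + C0 * M\<^sup>2 + (1 + \<bar>lam\<bar>) * M"
    using assms good_nonneg[OF assms(1)] C0 by (intro add_mono mult_left_mono power_mono) auto
  finally show ?thesis .
qed

lemma mode_integrable:
  assumes "t < T"
  shows "integrable (lebesgue_on {0<..<t}) (\<lambda>s. q k s + \<mu> k * p k s)"
proof -
  obtain M where M: "0 \<le> M" "AE s in lebesgue_on {0<..<t}. good s \<and> S s \<le> M" by (rule S_loc[OF assms])
  show ?thesis
  proof (rule time_integrable_bounded)
    show "AE s in lebesgue_on {0<..<t}. \<bar>q k s + \<mu> k * p k s\<bar> \<le> M + C0 * M\<^sup>2 + (1 + \<bar>lam\<bar>) * M"
      using M(2)
    proof eventually_elim
      case (elim s)
      have "\<bar>q k s + \<mu> k * p k s\<bar> \<le> (\<Sum>k<Suc k. \<bar>q k s + \<mu> k * p k s\<bar>)"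
        by (rule member_le_sum[of k "{..<Suc k}" "\<lambda>k. \<bar>q k s + \<mu> k * p k s\<bar>"]) auto
      then show ?case using good_partial_bound[of s M "Suc k"] elim M(1) by linarith
    qed
    show "(\<lambda>s. q k s + \<mu> k * p k s) \<in> borel_measurable (lebesgue_on {0<..<T})" by measurable
  qed (use assms in auto)
qed

text \<open>The identities of the modes are summed over k < n first; dominated convergence then
  exchanges the limit with the time integral.\<close>

lemma energy_identity:
  assumes t: "t < T" "evolves t" "good t"
  shows "E t = (\<Sum>k. p0 k) - 2 * (LINT s|lebesgue_on {0<..<t}. B s + (Z s - lam * D s))"
proof -
  obtain M where M: "0 \<le> M" "AE s in lebesgue_on {0<..<t}. good s \<and> S s \<le> M" by (rule S_loc[OF t(1)])
  have m1: "(\<lambda>s. B s + (Z s - lam * D s)) \<in> borel_measurable (lebesgue_on {0<..<T})" by measurable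
  have m2: "(\<lambda>s. \<Sum>k<n. q k s + \<mu> k * p k s) \<in> borel_measurable (lebesgue_on {0<..<T})" for n by measurable
  have "(\<lambda>n. LINT s|lebesgue_on {0<..<t}. (\<Sum>k<n. q k s + \<mu> k * p k s)) \<longlonglongrightarrow> (LINT s|lebesgue_on {0<..<t}. B s + (Z s - lam * D s))"
  proof (rule integral_dominated_convergence[where w="\<lambda>_. M + C0 * M\<^sup>2 + (1 + \<bar>lam\<bar>) * M"])
    show "(\<lambda>s. B s + (Z s - lam * D s)) \<in> borel_measurable (lebesgue_on {0<..<t})"
      using t(1) by (intro time_measurable_sub[OF m1]) auto
    show "(\<lambda>s. \<Sum>k<n. q k s + \<mu> k * p k s) \<in> borel_measurable (lebesgue_on {0<..<t})" for n
      using t(1) by (intro time_measurable_sub[OF m2]) auto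
    show "integrable (lebesgue_on {0<..<t}) (\<lambda>_. M + C0 * M\<^sup>2 + (1 + \<bar>lam\<bar>) * M)"
      by (rule finite_measure.integrable_const[OF finite_measure_time])
    show "AE s in lebesgue_on {0<..<t}. (\<lambda>n. \<Sum>k<n. q k s + \<mu> k * p k s) \<longlonglongrightarrow> B s + (Z s - lam * D s)"
      using M(2)
    proof eventually_elim
      case (elim s)
      then have g: "good s" by simp
      note sm = good_sums[OF g]
      have "summable (\<lambda>k. q k s)"
      proof (rule summable_comparison_test')
        show "summable (\<lambda>k. (p k s + \<nu> k s) / 2)" using sm(1) g by (intro summable_divide summable_add) (auto simp: good_def)
        show "norm (q k s) \<le> (p k s + \<nu> k s) / 2" for k using good_q(1)[OF g] by simp
      qed
      then have "(\<lambda>k. q k s + ((r k)\<^sup>2 * p k s - lam * (r k * p k s))) sums (B s + (Z s - lam * D s))"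
        unfolding B_def Z_def D_def by (intro sums_add sums_diff sums_mult summable_sums sm)
      then show ?case by (simp add: sums_def left_diff_distrib mult.assoc)
    qed
    show "AE s in lebesgue_on {0<..<t}. norm (\<Sum>k<n. q k s + \<mu> k * p k s) \<le> M + C0 * M\<^sup>2 + (1 + \<bar>lam\<bar>) * M" for n
      using M(2)
    proof eventually_elim
      case (elim s)
      then show ?case using good_partial_bound[of s M n] M(1) by (intro order_trans[OF norm_sum]) auto
    qed
  qed
  moreover have "(LINT s|lebesgue_on {0<..<t}. (\<Sum>k<n. q k s + \<mu> k * p k s)) = (\<Sum>k<n. LINT s|lebesgue_on {0<..<t}. q k s + \<mu> k * p k s)" for n
    by (rule Bochner_Integration.integral_sum) (rule mode_integrable[OF t(1)])
  ultimately have "(\<lambda>n. (\<Sum>k<n. p0 k) - 2 * (\<Sum>k<n. LINT s|lebesgue_on {0<..<t}. q k s + \<mu> k * p k s))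
      \<longlonglongrightarrow> (\<Sum>k. p0 k) - 2 * (LINT s|lebesgue_on {0<..<t}. B s + (Z s - lam * D s))"
  proof (intro tendsto_diff tendsto_mult tendsto_const, goal_cases)
    case 1
    have "summable p0"
    proof (rule summable_comparison_test'[OF p0(2)])
      fix k
      have "1 \<le> (1 + r k)\<^sup>2" using r[of k] by (intro one_le_power) simp
      then show "norm (p0 k) \<le> (1 + r k)\<^sup>2 * p0 k" using mult_right_mono[of 1 "(1 + r k)\<^sup>2" "p0 k"] p0(1)[of k] by simp
    qed
    then show ?case by (rule summable_LIMSEQ)
  qed simp
  moreover have "(\<Sum>k<n. p0 k) - 2 * (\<Sum>k<n. LINT s|lebesgue_on {0<..<t}. q k s + \<mu> k * p k s) = (\<Sum>k<n. p k t)" for n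
  proof -
    have "p k t = p0 k - 2 * (LINT s|lebesgue_on {0<..<t}. q k s + \<mu> k * p k s)" for k
      using t(2) unfolding evolves_def by blast
    then show ?thesis by (simp add: sum_subtractf sum_distrib_left)
  qed
  ultimately have "(\<lambda>n. \<Sum>k<n. p k t) \<longlonglongrightarrow> (\<Sum>k. p0 k) - 2 * (LINT s|lebesgue_on {0<..<t}. B s + (Z s - lam * D s))"
    by simp
  moreover have "(\<lambda>n. \<Sum>k<n. p k t) \<longlonglongrightarrow> E t"
    unfolding E_def using good_sums(1)[OF t(3)] by (rule summable_LIMSEQ)
  ultimately show ?thesis using LIMSEQ_unique by blast
qed

text \<open>Origin of the constant: twice the bound on B costs D + 2 \<open>\<kappa>\<close> E, the
  destabilising linear term costs 2 lam D, and (2 lam + 1) r \<le> r^2 + (2 lam + 1)^2 / 4 trades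
  all of D for one copy of Z, which is half of the available dissipation 2 Z.\<close>

definition "K t = (2 * lam + 1)\<^sup>2 / 4 + 2 * \<kappa> t"

lemma K_integrable: "integrable (lebesgue_on {0<..<T}) K"
  unfolding K_def by (intro Bochner_Integration.integrable_add integrable_mult_right kappa_integrable
      finite_measure.integrable_const[OF finite_measure_time])

lemma K_nonneg: "0 \<le> K t"
  by (simp add: K_def \<kappa>_def)

lemma bounded_mult_integrable:
  fixes f g :: "real \<Rightarrow> real"
  assumes f: "integrable (lebesgue_on {0<..<t}) f" and g: "g \<in> borel_measurable (lebesgue_on {0<..<T})" "t \<le> T"
    "AE s in lebesgue_on {0<..<t}. \<bar>g s\<bar> \<le> C"
  shows "integrable (lebesgue_on {0<..<t}) (\<lambda>s. f s * g s)"
proof (rule Bochner_Integration.integrable_bound)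
  show "integrable (lebesgue_on {0<..<t}) (\<lambda>s. C * f s)" using f by simp
  show "(\<lambda>s. f s * g s) \<in> borel_measurable (lebesgue_on {0<..<t})"
    using f time_measurable_sub[OF g(1), of 0 t] g(2) by auto
  show "AE s in lebesgue_on {0<..<t}. norm (f s * g s) \<le> norm (C * f s)"
    using g(3)
  proof eventually_elim
    case (elim s)
    have "\<bar>f s\<bar> * \<bar>g s\<bar> \<le> \<bar>f s\<bar> * \<bar>C\<bar>" using elim by (intro mult_left_mono) auto
    then show ?case by (simp add: abs_mult mult.commute)
  qed
qed

lemma KE_integrable:
  assumes "t < T"
  shows "integrable (lebesgue_on {0<..<t}) (\<lambda>s. K s * E s)"
proof -
  obtain M where M: "0 \<le> M" "AE s in lebesgue_on {0<..<t}. good s \<and> S s \<le> M" by (rule S_loc[OF assms])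
  show ?thesis
  proof (rule bounded_mult_integrable)
    show "integrable (lebesgue_on {0<..<t}) K" using time_integrable_sub[OF K_integrable, of 0 t] assms by simp
    show "AE s in lebesgue_on {0<..<t}. \<bar>E s\<bar> \<le> M"
      using M(2) by eventually_elim (use good_nonneg in fastforce)
    show "E \<in> borel_measurable (lebesgue_on {0<..<T})" by measurable
  qed (use assms in auto)
qed

lemma energy_inequality:
  assumes t: "t < T" "evolves t" "good t"
  shows "E t + (LINT s|lebesgue_on {0<..<t}. Z s) \<le> (\<Sum>k. p0 k) + (LINT s|lebesgue_on {0<..<t}. K s * E s)"
    "integrable (lebesgue_on {0<..<t}) Z"
proof -
  obtain M where M: "0 \<le> M" "AE s in lebesgue_on {0<..<t}. good s \<and> S s \<le> M" by (rule S_loc[OF t(1)])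
  have AEb: "AE s in lebesgue_on {0<..<t}. \<bar>Z s\<bar> \<le> M" "AE s in lebesgue_on {0<..<t}. \<bar>D s\<bar> \<le> M" "AE s in lebesgue_on {0<..<t}. \<bar>E s\<bar> \<le> M"
    using M(2) by (eventually_elim, use good_nonneg in fastforce)+
  have I: "integrable (lebesgue_on {0<..<t}) Z" "integrable (lebesgue_on {0<..<t}) D"
    using t(1) AEb by (auto intro!: time_integrable_bounded)
  show "integrable (lebesgue_on {0<..<t}) Z" by (rule I)
  have KE: "integrable (lebesgue_on {0<..<t}) (\<lambda>s. K s * E s)" by (rule KE_integrable[OF t(1)])
  have kE: "integrable (lebesgue_on {0<..<t}) (\<lambda>s. \<kappa> s * E s)"
    using t(1) AEb time_integrable_sub[OF kappa_integrable, of 0 t] by (intro bounded_mult_integrable) auto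
  have pw: "- 2 * (B s + (Z s - lam * D s)) \<le> K s * E s - Z s" if g: "good s" for s
  proof -
    have "(2 * lam + 1) * D s \<le> Z s + (2 * lam + 1)\<^sup>2 / 4 * E s"
    proof -
      note sm = good_sums[OF g]
      have "(\<Sum>k. (2 * lam + 1) * (r k * p k s)) \<le> (\<Sum>k. (r k)\<^sup>2 * p k s + (2 * lam + 1)\<^sup>2 / 4 * p k s)"
      proof (intro suminf_le summable_add summable_mult sm)
        fix k
        have "(2 * lam + 1) * r k \<le> (r k)\<^sup>2 + (2 * lam + 1)\<^sup>2 / 4"
          using zero_le_power2[of "r k - (2 * lam + 1) / 2"] by (simp add: power2_eq_square algebra_simps)
        from mult_right_mono[OF this pos(1)[of k s]]
        show "(2 * lam + 1) * (r k * p k s) \<le> (r k)\<^sup>2 * p k s + (2 * lam + 1)\<^sup>2 / 4 * p k s" by (simp add: algebra_simps)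
      qed
      then show ?thesis
        unfolding D_def Z_def E_def using sm
        by (simp only: suminf_mult suminf_add[symmetric] summable_mult)
    qed
    moreover have "- 2 * B s \<le> D s + 2 * (\<kappa> s * E s)" using good_kappa(1)[OF g] by linarith
    ultimately show ?thesis unfolding K_def by (simp add: algebra_simps)
  qed
  have "E t - (\<Sum>k. p0 k) = (LINT s|lebesgue_on {0<..<t}. - 2 * (B s + (Z s - lam * D s)))"
    unfolding energy_identity[OF t] integral_mult_right_zero by simp
  also have "\<dots> \<le> (LINT s|lebesgue_on {0<..<t}. K s * E s - Z s)"
  proof (rule integral_mono_AE)
    show "integrable (lebesgue_on {0<..<t}) (\<lambda>s. K s * E s - Z s)" using KE I by simp
    show "AE s in lebesgue_on {0<..<t}. - 2 * (B s + (Z s - lam * D s)) \<le> K s * E s - Z s"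
      using M(2) by eventually_elim (use pw in blast)
    have Bi: "integrable (lebesgue_on {0<..<t}) B"
    proof (rule Bochner_Integration.integrable_bound)
      show "integrable (lebesgue_on {0<..<t}) (\<lambda>s. D s / 2 + \<kappa> s * E s)" using I kE by simp
      show "B \<in> borel_measurable (lebesgue_on {0<..<t})" using t(1) by (intro time_measurable_sub[OF meas_sums(5)]) auto
      show "AE s in lebesgue_on {0<..<t}. norm (B s) \<le> norm (D s / 2 + \<kappa> s * E s)"
        using M(2) by eventually_elim (use good_kappa(1) in fastforce)
    qed
    show "integrable (lebesgue_on {0<..<t}) (\<lambda>s. - 2 * (B s + (Z s - lam * D s)))"
      using Bi I by simp
  qed
  also have "\<dots> = (LINT s|lebesgue_on {0<..<t}. K s * E s) - (LINT s|lebesgue_on {0<..<t}. Z s)"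
    using KE I by simp
  finally show "E t + (LINT s|lebesgue_on {0<..<t}. Z s) \<le> (\<Sum>k. p0 k) + (LINT s|lebesgue_on {0<..<t}. K s * E s)" by simp
qed

lemma nn_le_of_integral_le:
  fixes f :: "real \<Rightarrow> real"
  assumes "integrable (lebesgue_on {0<..<t}) f" "AE s in lebesgue_on {0<..<t}. 0 \<le> f s" "(LINT s|lebesgue_on {0<..<t}. f s) \<le> M"
  shows "(\<integral>\<^sup>+s. ennreal (f s) \<partial>lebesgue_on {0<..<t}) \<le> ennreal M"
  using assms by (subst nn_integral_eq_integral) (auto intro: ennreal_leI)

lemma K_E_le:
  fixes K f :: "real \<Rightarrow> real"
  assumes K: "integrable (lebesgue_on {0<..<T}) K" "AE s in lebesgue_on {0<..<T}. 0 \<le> K s"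
    and f: "AE s in lebesgue_on {0<..<T}. f s \<le> M" "0 \<le> M" and t: "0 < t" "t < T"
    and Kf: "integrable (lebesgue_on {0<..<t}) (\<lambda>s. K s * f s)"
  shows "(LINT s|lebesgue_on {0<..<t}. K s * f s) \<le> M * (LINT s|lebesgue_on {0<..<T}. K s)"
proof -
  have Kt: "integrable (lebesgue_on {0<..<t}) K" using time_integrable_sub[OF K(1)] t by simp
  have "(LINT s|lebesgue_on {0<..<t}. K s * f s) \<le> (LINT s|lebesgue_on {0<..<t}. M * K s)"
  proof (rule integral_mono_AE[OF Kf])
    show "integrable (lebesgue_on {0<..<t}) (\<lambda>s. M * K s)" using Kt by simp
    show "AE s in lebesgue_on {0<..<t}. K s * f s \<le> M * K s"
      using time_AE_sub[OF K(2), of 0 t] time_AE_sub[OF f(1), of 0 t] t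
      by (auto elim!: eventually_elim2 simp: mult.commute[of M] mult_left_mono)
  qed
  also have "\<dots> = M * (LINT s|lebesgue_on {0<..<t}. K s)" by simp
  also have "\<dots> \<le> M * (LINT s|lebesgue_on {0<..<T}. K s)"
  proof (rule mult_left_mono[OF _ f(2)])
    have "(LINT s|lebesgue_on {0<..<T}. K s) = (LINT s|lebesgue_on {0<..<t}. K s) + (LINT s|lebesgue_on {t<..<T}. K s)"
      using t by (intro time_integral_split K) auto
    moreover have "0 \<le> (LINT s|lebesgue_on {t<..<T}. K s)"
      using time_AE_sub[OF K(2), of t T] t by (intro integral_nonneg_AE) auto
    ultimately show "(LINT s|lebesgue_on {0<..<t}. K s) \<le> (LINT s|lebesgue_on {0<..<T}. K s)" by simp
  qed
  finally show ?thesis .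
qed

lemma AE_time: "AE t in lebesgue_on {0<..<T}. 0 < t \<and> t < T"
  by (rule AE_I2) auto

text \<open>Gronwall bounds E first; inserting this bound into the energy inequality once more
  bounds the integral of Z.\<close>

lemma L2_bounds:
  obtains M0 M1 where "0 \<le> M0" "AE t in lebesgue_on {0<..<T}. E t \<le> M0"
    "(\<integral>\<^sup>+s. ennreal (Z s) \<partial>lebesgue_on {0<..<T}) \<le> ennreal M1"
proof -
  let ?E0 = "\<Sum>k. p0 k" and ?k = "LINT s|lebesgue_on {0<..<T}. K s"
  have good_E: "AE s in lebesgue_on {0<..<T}. 0 \<le> E s" "AE s in lebesgue_on {0<..<T}. 0 \<le> Z s"
    using AE_good by (eventually_elim, simp add: good_nonneg)+
  have E0: "0 \<le> ?E0"
  proof -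
    have "summable p0"
    proof (rule summable_comparison_test'[OF p0(2)])
      fix k
      have "1 \<le> (1 + r k)\<^sup>2" using r[of k] by (intro one_le_power) simp
      then show "norm (p0 k) \<le> (1 + r k)\<^sup>2 * p0 k" using mult_right_mono[of 1 "(1 + r k)\<^sup>2" "p0 k"] p0(1)[of k] by simp
    qed
    then show ?thesis using p0(1) by (rule suminf_nonneg)
  qed
  define M0 where "M0 = ?E0 * exp (2 * ?k)"
  have M0: "0 \<le> M0" using E0 by (simp add: M0_def)
  have bE: "AE t in lebesgue_on {0<..<T}. E t \<le> M0"
    unfolding M0_def
  proof (rule gronwall_integral[OF K_integrable _ good_E(1) KE_integrable E0])
    show "AE s in lebesgue_on {0<..<T}. 0 \<le> K s" using K_nonneg by auto
    show "AE t in lebesgue_on {0<..<T}. E t \<le> ?E0 + (LINT s|lebesgue_on {0<..<t}. K s * E s)"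
      using AE_good AE_evolves AE_time
    proof eventually_elim
      case (elim t)
      have "0 \<le> (LINT s|lebesgue_on {0<..<t}. Z s)"
        using time_AE_sub[OF good_E(2), of 0 t] elim by (intro integral_nonneg_AE) auto
      then show ?case using energy_inequality(1)[of t] elim by linarith
    qed
  qed auto
  have "(\<integral>\<^sup>+s. ennreal (Z s) \<partial>lebesgue_on {0<..<T}) \<le> ennreal (?E0 + M0 * ?k)"
  proof (rule nn_integral_time_exhaust[OF T])
    show "(\<lambda>s. ennreal (Z s)) \<in> borel_measurable (lebesgue_on {0<..<T})" by measurable
    show "AE t in lebesgue_on {0<..<T}. (\<integral>\<^sup>+ s. ennreal (Z s) \<partial>lebesgue_on {0<..<t}) \<le> ennreal (?E0 + M0 * ?k)"
      using AE_good AE_evolves AE_time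
    proof eventually_elim
      case (elim t)
      have t: "t < T" "0 < t" using elim by auto
      have "(LINT s|lebesgue_on {0<..<t}. K s * E s) \<le> M0 * ?k"
        using K_nonneg t by (intro K_E_le[OF K_integrable _ bE M0 _ _ KE_integrable]) auto
      then have "(LINT s|lebesgue_on {0<..<t}. Z s) \<le> ?E0 + M0 * ?k"
        using energy_inequality(1)[of t] elim good_nonneg(1)[of t] by auto
      then show ?case
        using time_AE_sub[OF good_E(2), of 0 t] t energy_inequality(2)[of t] elim
        by (intro nn_le_of_integral_le) auto
    qed
  qed
  then show ?thesis using that M0 bE by blast
qed

text \<open>S \<le> 2 (E + Z), and both summands are controlled by the first estimate. The second
  estimate needs this because S itself appears there as a coefficient.\<close>

lemma S_integrable: "integrable (lebesgue_on {0<..<T}) S"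
proof -
  obtain M0 M1 where M: "0 \<le> M0" "AE t in lebesgue_on {0<..<T}. E t \<le> M0"
    "(\<integral>\<^sup>+s. ennreal (Z s) \<partial>lebesgue_on {0<..<T}) \<le> ennreal M1" by (rule L2_bounds)
  have Zi: "integrable (lebesgue_on {0<..<T}) Z"
  proof (rule integrableI_bounded)
    have "(\<integral>\<^sup>+s. ennreal (norm (Z s)) \<partial>lebesgue_on {0<..<T}) = (\<integral>\<^sup>+s. ennreal (Z s) \<partial>lebesgue_on {0<..<T})"
      using AE_good by (intro nn_integral_cong_AE) (auto elim!: eventually_mono simp: good_nonneg)
    also have "\<dots> < \<infinity>" using M(3) by (simp add: le_less_trans)
    finally show "(\<integral>\<^sup>+s. ennreal (norm (Z s)) \<partial>lebesgue_on {0<..<T}) < \<infinity>" .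
  qed measurable
  show ?thesis
  proof (rule Bochner_Integration.integrable_bound)
    show "integrable (lebesgue_on {0<..<T}) (\<lambda>s. 2 * (M0 + Z s))"
      by (intro integrable_mult_right Bochner_Integration.integrable_add Zi finite_measure.integrable_const[OF finite_measure_time])
    show "AE s in lebesgue_on {0<..<T}. norm (S s) \<le> norm (2 * (M0 + Z s))"
      using AE_good M(2)
    proof eventually_elim
      case (elim s)
      then show ?case using good_nonneg[of s] M(1) by simp
    qed
  qed measurable
qed

section \<open>Second energy estimate: H^2 in space\<close>

text \<open>The nonlinearity contributes \<open>2 * C0 * (S t)\<^sup>2\<close>, quadratic in S;
  reading one factor S as an integrable coefficient makes the inequality linear. The constant
  summand comes from \<open>mode_dissipation\<close>.\<close>

definition "K2 t = (2 + \<bar>lam\<bar>)\<^sup>2 + 2 * C0 * S t"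

lemma K2_integrable: "integrable (lebesgue_on {0<..<T}) K2"
  unfolding K2_def by (intro Bochner_Integration.integrable_add integrable_mult_right S_integrable
      finite_measure.integrable_const[OF finite_measure_time])

lemma K2_nonneg: "good t \<Longrightarrow> 0 \<le> K2 t"
  using good_nonneg(4)[of t] C0 by (auto simp: K2_def intro!: add_nonneg_nonneg mult_nonneg_nonneg)

lemma K2S_integrable:
  assumes "t < T"
  shows "integrable (lebesgue_on {0<..<t}) (\<lambda>s. K2 s * S s)"
proof -
  obtain M where M: "0 \<le> M" "AE s in lebesgue_on {0<..<t}. good s \<and> S s \<le> M" by (rule S_loc[OF assms])
  show ?thesis
  proof (rule bounded_mult_integrable)
    show "integrable (lebesgue_on {0<..<t}) K2" using time_integrable_sub[OF K2_integrable, of 0 t] assms by simp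
    show "AE s in lebesgue_on {0<..<t}. \<bar>S s\<bar> \<le> M"
      using M(2) by eventually_elim (use good_nonneg in fastforce)
    show "S \<in> borel_measurable (lebesgue_on {0<..<T})" by measurable
  qed (use assms in auto)
qed

text \<open>Truncated sums: integrability in time of the full fourth-order sum is part of what is to
  be proved, so the limit in n is taken only at the end.\<close>

definition "Qn n t = (\<Sum>k<n. (1 + r k) ^ 4 * p k t)"
definition "Sn n t = (\<Sum>k<n. (1 + r k)\<^sup>2 * p k t)"

lemma Qn_meas [measurable]: "Qn n \<in> borel_measurable (lebesgue_on {0<..<T})"
  unfolding Qn_def by measurable

lemma Qn_nonneg: "0 \<le> Qn n t"
  unfolding Qn_def using r pos by (intro sum_nonneg mult_nonneg_nonneg) auto

text \<open>With a = 1 + r and L = 2 + |lam|, and lam replaced by |lam|, the claim reduces to (a -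
  L)^2 + 2 + 2 |lam| \<ge> 0 after dividing by the weight a^2.\<close>

lemma mode_dissipation: "- 2 * (1 + r k)\<^sup>2 * \<mu> k \<le> (2 + \<bar>lam\<bar>)\<^sup>2 * (1 + r k)\<^sup>2 - (1 + r k) ^ 4"
proof -
  define a where "a = 1 + r k"
  have ra: "r k = a - 1" "1 \<le> a" using r[of k] by (auto simp: a_def)
  have "lam * r k \<le> \<bar>lam\<bar> * r k" using r[of k] by (intro mult_right_mono) auto
  moreover have "a\<^sup>2 - (2 + \<bar>lam\<bar>)\<^sup>2 \<le> 2 * ((r k)\<^sup>2 - \<bar>lam\<bar> * r k)"
  proof -
    have "0 \<le> (a - (2 + \<bar>lam\<bar>))\<^sup>2 + 2 + 2 * \<bar>lam\<bar>" by (intro add_nonneg_nonneg) auto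
    then show ?thesis unfolding ra by (simp add: power2_eq_square algebra_simps)
  qed
  ultimately have "a\<^sup>2 - (2 + \<bar>lam\<bar>)\<^sup>2 \<le> 2 * \<mu> k" by simp
  then have "(1 + r k)\<^sup>2 * (a\<^sup>2 - (2 + \<bar>lam\<bar>)\<^sup>2) \<le> (1 + r k)\<^sup>2 * (2 * \<mu> k)" by (intro mult_left_mono) auto
  moreover have "(1 + r k) ^ 4 = (1 + r k)\<^sup>2 * a\<^sup>2" unfolding a_def by (simp flip: power_add)
  ultimately show ?thesis by (simp add: algebra_simps)
qed

text \<open>Half of the fourth-order term absorbs the nonlinear pairing by \<open>good_q\<close>;
  the other half stays on the left. The right-hand side contains the full sum S, so it does not
  depend on n.\<close>

lemma Sn_inequality:
  assumes t: "t < T" "evolves t" "good t"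
  shows "Sn n t + (LINT s|lebesgue_on {0<..<t}. Qn n s) / 2 \<le> (\<Sum>k. (1 + r k)\<^sup>2 * p0 k) + (LINT s|lebesgue_on {0<..<t}. K2 s * S s)"
    "integrable (lebesgue_on {0<..<t}) (Qn n)"
proof -
  obtain M where M: "0 \<le> M" "AE s in lebesgue_on {0<..<t}. good s \<and> S s \<le> M" by (rule S_loc[OF t(1)])
  have mi: "integrable (lebesgue_on {0<..<t}) (\<lambda>s. (1 + r k)\<^sup>2 * (q k s + \<mu> k * p k s))" for k
    by (intro integrable_mult_right mode_integrable t)
  have pi: "integrable (lebesgue_on {0<..<t}) (\<lambda>s. (1 + r k) ^ 4 * p k s)" for k
  proof (rule integrable_mult_right, rule time_integrable_bounded)
    show "p k \<in> borel_measurable (lebesgue_on {0<..<T})" by measurable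
    show "AE s in lebesgue_on {0<..<t}. \<bar>p k s\<bar> \<le> M"
      using M(2)
    proof eventually_elim
      case (elim s)
      have "p k s \<le> E s" unfolding E_def using sum_le_suminf[OF good_sums(1)[of s], of "{k}"] elim pos by simp
      then show ?case using elim good_nonneg(5)[of s] pos(1)[of k s] by linarith
    qed
  qed (use t in auto)
  show Qi: "integrable (lebesgue_on {0<..<t}) (Qn n)"
    unfolding Qn_def by (intro Bochner_Integration.integrable_sum pi)
  have "Sn n t = (\<Sum>k<n. (1 + r k)\<^sup>2 * p0 k) - 2 * (\<Sum>k<n. LINT s|lebesgue_on {0<..<t}. (1 + r k)\<^sup>2 * (q k s + \<mu> k * p k s))"
  proof -
    have pk: "p k t = p0 k - 2 * (LINT s|lebesgue_on {0<..<t}. q k s + \<mu> k * p k s)" for k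
      using t(2) unfolding evolves_def by blast
    have "(1 + r k)\<^sup>2 * p k t = (1 + r k)\<^sup>2 * p0 k - 2 * (LINT s|lebesgue_on {0<..<t}. (1 + r k)\<^sup>2 * (q k s + \<mu> k * p k s))" for k
      unfolding pk[of k] integral_mult_right_zero by (simp only: right_diff_distrib mult.left_commute)
    then show ?thesis unfolding Sn_def by (simp only: sum_subtractf sum_distrib_left)
  qed
  also have "(\<Sum>k<n. LINT s|lebesgue_on {0<..<t}. (1 + r k)\<^sup>2 * (q k s + \<mu> k * p k s)) = (LINT s|lebesgue_on {0<..<t}. (\<Sum>k<n. (1 + r k)\<^sup>2 * (q k s + \<mu> k * p k s)))"
    by (rule Bochner_Integration.integral_sum[symmetric]) (rule mi)
  finally have eq: "Sn n t = (\<Sum>k<n. (1 + r k)\<^sup>2 * p0 k) + (LINT s|lebesgue_on {0<..<t}. - 2 * (\<Sum>k<n. (1 + r k)\<^sup>2 * (q k s + \<mu> k * p k s)))"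
    unfolding integral_mult_right_zero by simp
  have pw: "- 2 * (\<Sum>k<n. (1 + r k)\<^sup>2 * (q k s + \<mu> k * p k s)) \<le> K2 s * S s - Qn n s / 2" if g: "good s" for s
  proof -
    have "- 2 * (\<Sum>k<n. (1 + r k)\<^sup>2 * (q k s + \<mu> k * p k s)) = (\<Sum>k<n. - 2 * ((1 + r k)\<^sup>2 * (q k s + \<mu> k * p k s)))"
      by (simp only: sum_distrib_left)
    also have "\<dots> \<le> (\<Sum>k<n. (2 + \<bar>lam\<bar>)\<^sup>2 * ((1 + r k)\<^sup>2 * p k s) + 2 * \<nu> k s - (1 + r k) ^ 4 * p k s / 2)"
    proof (rule sum_mono)
      fix k
      have 1: "- 2 * (1 + r k)\<^sup>2 * \<mu> k * p k s \<le> ((2 + \<bar>lam\<bar>)\<^sup>2 * (1 + r k)\<^sup>2 - (1 + r k) ^ 4) * p k s"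
        by (rule mult_right_mono[OF mode_dissipation pos(1)])
      have "(1 + r k)\<^sup>2 * (- q k s) \<le> (1 + r k)\<^sup>2 * \<bar>q k s\<bar>" by (intro mult_left_mono) auto
      then have 2: "- 2 * ((1 + r k)\<^sup>2 * q k s) \<le> (1 + r k) ^ 4 * p k s / 2 + 2 * \<nu> k s"
        using good_q(2)[OF g, of k] by simp
      show "- 2 * ((1 + r k)\<^sup>2 * (q k s + \<mu> k * p k s)) \<le> (2 + \<bar>lam\<bar>)\<^sup>2 * ((1 + r k)\<^sup>2 * p k s) + 2 * \<nu> k s - (1 + r k) ^ 4 * p k s / 2"
      proof -
        have e1: "- 2 * ((1 + r k)\<^sup>2 * (q k s + \<mu> k * p k s)) = - 2 * ((1 + r k)\<^sup>2 * q k s) + - 2 * (1 + r k)\<^sup>2 * \<mu> k * p k s"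
          by (simp only: distrib_left mult.assoc)
        have e2: "((2 + \<bar>lam\<bar>)\<^sup>2 * (1 + r k)\<^sup>2 - (1 + r k) ^ 4) * p k s = (2 + \<bar>lam\<bar>)\<^sup>2 * ((1 + r k)\<^sup>2 * p k s) - (1 + r k) ^ 4 * p k s"
          by (simp only: left_diff_distrib mult.assoc)
        have "x + y \<le> c + 2 * v - d / 2" if "x \<le> d / 2 + 2 * v" "y \<le> c - d" for x y c d v :: real
          using that by linarith
        from this[OF 2 1[unfolded e2]] show ?thesis unfolding e1 .
      qed
    qed
    also have "\<dots> = (2 + \<bar>lam\<bar>)\<^sup>2 * Sn n s + 2 * (\<Sum>k<n. \<nu> k s) - Qn n s / 2"
      unfolding Sn_def Qn_def by (simp add: sum.distrib sum_subtractf sum_distrib_left sum_divide_distrib)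
    also have "\<dots> \<le> (2 + \<bar>lam\<bar>)\<^sup>2 * S s + 2 * (C0 * (S s)\<^sup>2) - Qn n s / 2"
    proof -
      have "Sn n s \<le> S s" unfolding Sn_def S_def using good_sums(4)[OF g] pos by (intro sum_le_suminf) auto
      moreover have "(\<Sum>k<n. \<nu> k s) \<le> (\<Sum>k. \<nu> k s)" using g pos by (intro sum_le_suminf) (auto simp: good_def)
      moreover have "(\<Sum>k. \<nu> k s) \<le> C0 * (S s)\<^sup>2" using g by (simp add: good_def)
      ultimately show ?thesis by (intro diff_right_mono add_mono mult_left_mono) auto
    qed
    also have "\<dots> = K2 s * S s - Qn n s / 2" by (simp add: K2_def power2_eq_square algebra_simps)
    finally show ?thesis .
  qed
  have "Sn n t \<le> (\<Sum>k<n. (1 + r k)\<^sup>2 * p0 k) + (LINT s|lebesgue_on {0<..<t}. K2 s * S s - Qn n s / 2)"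
    unfolding eq
  proof (intro add_left_mono integral_mono_AE)
    show "integrable (lebesgue_on {0<..<t}) (\<lambda>s. - 2 * (\<Sum>k<n. (1 + r k)\<^sup>2 * (q k s + \<mu> k * p k s)))"
      by (intro integrable_mult_right Bochner_Integration.integrable_sum mi)
    show "integrable (lebesgue_on {0<..<t}) (\<lambda>s. K2 s * S s - Qn n s / 2)"
      using K2S_integrable[OF t(1)] Qi by auto
    show "AE s in lebesgue_on {0<..<t}. - 2 * (\<Sum>k<n. (1 + r k)\<^sup>2 * (q k s + \<mu> k * p k s)) \<le> K2 s * S s - Qn n s / 2"
      using M(2) by eventually_elim (use pw in blast)
  qed
  moreover have "(LINT s|lebesgue_on {0<..<t}. K2 s * S s - Qn n s / 2) = (LINT s|lebesgue_on {0<..<t}. K2 s * S s) - (LINT s|lebesgue_on {0<..<t}. Qn n s) / 2"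
    using K2S_integrable[OF t(1)] Qi by simp
  moreover have "(\<Sum>k<n. (1 + r k)\<^sup>2 * p0 k) \<le> (\<Sum>k. (1 + r k)\<^sup>2 * p0 k)"
    using p0 by (intro sum_le_suminf) auto
  ultimately show "Sn n t + (LINT s|lebesgue_on {0<..<t}. Qn n s) / 2 \<le> (\<Sum>k. (1 + r k)\<^sup>2 * p0 k) + (LINT s|lebesgue_on {0<..<t}. K2 s * S s)"
    by linarith
qed

text \<open>The truncated inequalities share one right-hand side, so the limit in n yields an
  inequality for S, to which Gronwall applies. With S bounded, the same inequalities bound the
  integrals of \<open>Qn n\<close> uniformly, and sum and integral are exchanged at the end.\<close>

theorem a_priori_bounds:
  obtains M where "AE t in lebesgue_on {0<..<T}. (\<Sum>k. (1 + r k)\<^sup>2 * p k t) \<le> M"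
    and "(\<integral>\<^sup>+t. (\<Sum>k. ennreal ((1 + r k) ^ 4 * p k t)) \<partial>lebesgue_on {0<..<T}) < \<infinity>"
proof -
  let ?S0 = "\<Sum>k. (1 + r k)\<^sup>2 * p0 k" and ?k = "LINT s|lebesgue_on {0<..<T}. K2 s"
  have S0: "0 \<le> ?S0" using p0 by (intro suminf_nonneg) auto
  have gS: "AE s in lebesgue_on {0<..<T}. 0 \<le> S s" "AE s in lebesgue_on {0<..<T}. 0 \<le> K2 s"
    using AE_good by (eventually_elim, simp add: good_nonneg K2_nonneg)+
  define M where "M = ?S0 * exp (2 * ?k)"
  have M: "0 \<le> M" using S0 by (simp add: M_def)
  have bS: "AE t in lebesgue_on {0<..<T}. S t \<le> M"
    unfolding M_def
  proof (rule gronwall_integral[OF K2_integrable gS(2,1) K2S_integrable S0])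
    show "AE t in lebesgue_on {0<..<T}. S t \<le> ?S0 + (LINT s|lebesgue_on {0<..<t}. K2 s * S s)"
      using AE_good AE_evolves AE_time
    proof eventually_elim
      case (elim t)
      have "Sn n t \<le> ?S0 + (LINT s|lebesgue_on {0<..<t}. K2 s * S s)" for n
      proof -
        have "0 \<le> (LINT s|lebesgue_on {0<..<t}. Qn n s)" using Qn_nonneg by simp
        then show ?thesis using Sn_inequality(1)[of t n] elim by linarith
      qed
      then show ?case
        unfolding S_def Sn_def using good_sums(4) elim by (intro suminf_le_const) auto
    qed
  qed auto
  have bQ: "(\<integral>\<^sup>+s. ennreal (Qn n s) \<partial>lebesgue_on {0<..<T}) \<le> ennreal (2 * (?S0 + M * ?k))" for n
  proof (rule nn_integral_time_exhaust[OF T])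
    show "(\<lambda>s. ennreal (Qn n s)) \<in> borel_measurable (lebesgue_on {0<..<T})" by measurable
    show "AE t in lebesgue_on {0<..<T}. (\<integral>\<^sup>+ s. ennreal (Qn n s) \<partial>lebesgue_on {0<..<t}) \<le> ennreal (2 * (?S0 + M * ?k))"
      using AE_good AE_evolves AE_time
    proof eventually_elim
      case (elim t)
      have t: "t < T" "0 < t" using elim by auto
      have "(LINT s|lebesgue_on {0<..<t}. K2 s * S s) \<le> M * ?k"
        by (rule K_E_le[OF K2_integrable gS(2) bS M t(2,1) K2S_integrable[OF t(1)]])
      moreover have "0 \<le> Sn n t" unfolding Sn_def using pos by (intro sum_nonneg) auto
      ultimately have "(LINT s|lebesgue_on {0<..<t}. Qn n s) \<le> 2 * (?S0 + M * ?k)"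
        using Sn_inequality(1)[of t n] elim by auto
      then show ?case
        using Qn_nonneg Sn_inequality(2)[of t n] elim by (intro nn_le_of_integral_le) auto
    qed
  qed
  have "(\<integral>\<^sup>+t. (\<Sum>k. ennreal ((1 + r k) ^ 4 * p k t)) \<partial>lebesgue_on {0<..<T}) = (\<Sum>k. \<integral>\<^sup>+t. ennreal ((1 + r k) ^ 4 * p k t) \<partial>lebesgue_on {0<..<T})"
    by (rule nn_integral_suminf) measurable
  also have "\<dots> = (SUP n. \<Sum>k<n. \<integral>\<^sup>+t. ennreal ((1 + r k) ^ 4 * p k t) \<partial>lebesgue_on {0<..<T})"
    by (rule suminf_eq_SUP)
  also have "\<dots> \<le> ennreal (2 * (?S0 + M * ?k))"
  proof (rule SUP_least)
    fix n
    have "(\<Sum>k<n. \<integral>\<^sup>+t. ennreal ((1 + r k) ^ 4 * p k t) \<partial>lebesgue_on {0<..<T}) = (\<integral>\<^sup>+t. (\<Sum>k<n. ennreal ((1 + r k) ^ 4 * p k t)) \<partial>lebesgue_on {0<..<T})"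
      by (rule nn_integral_sum[symmetric]) measurable
    also have "\<dots> = (\<integral>\<^sup>+s. ennreal (Qn n s) \<partial>lebesgue_on {0<..<T})"
      unfolding Qn_def using r pos by (intro nn_integral_cong sum_ennreal) (auto intro!: mult_nonneg_nonneg)
    finally show "(\<Sum>k<n. \<integral>\<^sup>+t. ennreal ((1 + r k) ^ 4 * p k t) \<partial>lebesgue_on {0<..<T}) \<le> ennreal (2 * (?S0 + M * ?k))"
      using bQ by simp
  qed
  also have "\<dots> < \<infinity>" by simp
  finally show ?thesis using that bS unfolding S_def by blast
qed

end

subsection \<open>Weak derivatives and Fourier coefficients\<close>

lemma partial_eqI:
  assumes "(f has_derivative f') (at x)"
  shows "partial b f x = f' b"
  unfolding partial_def by (simp add: frechet_derivative_at[OF assms, symmetric])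

lemma has_derivative_mode: "(mode k has_derivative (\<lambda>h. \<i> * of_real (freq k \<bullet> h) * mode k x)) (at x)"
proof -
  have m: "mode k = (\<lambda>x. exp (\<i> * of_real (freq k \<bullet> x)))"
    by (simp add: fun_eq_iff mode_def cis_conv_exp)
  have "((\<lambda>x. \<i> * of_real (freq k \<bullet> x)) has_derivative (\<lambda>h. \<i> * complex_of_real (freq k \<bullet> h))) (at x)"
    by (auto intro!: derivative_eq_intros)
  moreover have "(exp has_derivative (*) (exp z)) (at z)" for z :: complex
    using DERIV_exp[of z] unfolding has_field_derivative_def .
  ultimately have "((\<lambda>x. exp (\<i> * of_real (freq k \<bullet> x))) has_derivative (\<lambda>h. exp (\<i> * of_real (freq k \<bullet> x)) * (\<i> * complex_of_real (freq k \<bullet> h)))) (at x)"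
    by (rule has_derivative_compose)
  then show ?thesis unfolding m by (simp add: mult_ac)
qed

lemma torus_smoothD:
  assumes "\<psi> \<in> torus_smooth"
  shows "smooth \<psi>" "periodic \<psi>"
  using assms by (auto simp: torus_smooth_def)

lemma periodic_partial:
  assumes "periodic f" "\<And>x. f differentiable (at x)"
  shows "periodic (partial b f)"
  unfolding periodic_def
proof (intro allI ballI)
  fix x v :: 'a assume v: "v \<in> Basis"
  let ?w = "(2 * pi) *\<^sub>R v"
  have "(f has_derivative frechet_derivative f (at (x + ?w))) (at (x + ?w))"
    using assms(2) frechet_derivative_works by blast
  moreover have "((\<lambda>y. y + ?w) has_derivative (\<lambda>h. h)) (at x)"
    by (auto intro!: derivative_eq_intros)
  ultimately have "((\<lambda>y. f (y + ?w)) has_derivative frechet_derivative f (at (x + ?w))) (at x)"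
    using has_derivative_compose[of "\<lambda>y. y + ?w" "\<lambda>h. h" x UNIV f] by auto
  moreover have "(\<lambda>y. f (y + ?w)) = f" using assms(1) v by (auto simp: periodic_def)
  ultimately show "partial b f (x + ?w) = partial b f x"
    using partial_eqI[of f _ x b] by (simp add: partial_def)
qed

lemma torus_smooth_partial:
  assumes "\<psi> \<in> torus_smooth" "b \<in> Basis"
  shows "partial b \<psi> \<in> torus_smooth"
  using smooth_partial[OF torus_smoothD(1)[OF assms(1)] assms(2)]
    periodic_partial[OF torus_smoothD(2)[OF assms(1)] smooth_differentiable[OF torus_smoothD(1)[OF assms(1)]]]
  by (auto simp: torus_smooth_def)

lemma torus_smooth_continuous: "\<psi> \<in> torus_smooth \<Longrightarrow> continuous_on S \<psi>"
  by (intro smooth_continuous torus_smoothD)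

text \<open>The derivative of the product of test function and mode has mean zero, and
  differentiating the mode produces its multiplier.\<close>

lemma integral_partial_mode:
  fixes \<psi> :: "real^2 \<Rightarrow> real"
  assumes \<psi>: "\<psi> \<in> torus_smooth" and b: "b \<in> Basis"
  shows "(LINT x|torus. mode k x * of_real (partial b \<psi> x)) = - (\<i> * of_real (freq k \<bullet> b)) * (LINT x|torus. mode k x * of_real (\<psi> x))"
proof -
  define F where "F x = of_real (\<psi> x) * mode k x" for x
  have d: "\<psi> differentiable (at x)" for x using torus_smoothD(1)[OF \<psi>] by (rule smooth_differentiable)
  have c: "continuous_on UNIV \<psi>" "continuous_on UNIV (partial b \<psi>)"
    using torus_smooth_continuous \<psi> torus_smooth_partial[OF \<psi> b] by auto
  have D: "(F has_derivative (\<lambda>h. of_real (\<psi> x) * (\<i> * of_real (freq k \<bullet> h) * mode k x) + of_real (frechet_derivative \<psi> (at x) h) * mode k x)) (at x)" for x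
  proof -
    have "(\<psi> has_derivative frechet_derivative \<psi> (at x)) (at x)" using d frechet_derivative_works by blast
    then have "((\<lambda>x. complex_of_real (\<psi> x)) has_derivative (\<lambda>h. of_real (frechet_derivative \<psi> (at x) h))) (at x)"
      by (rule has_derivative_of_real)
    from has_derivative_mult[OF this has_derivative_mode] show ?thesis unfolding F_def .
  qed
  have pF: "partial b F = (\<lambda>x. of_real (\<psi> x) * (\<i> * of_real (freq k \<bullet> b) * mode k x) + of_real (partial b \<psi> x) * mode k x)"
    using partial_eqI[OF D] by (auto simp: partial_def[of b \<psi>])
  have "(LINT x|torus. partial b F x) = 0"
  proof (rule torus_integral_partial[OF _ b])
    show "periodic F"
      using torus_smoothD(2)[OF \<psi>] periodic_cis[OF freq_in, of k] by (simp add: periodic_def F_def mode_def)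
    show "F differentiable (at x)" for x using D differentiable_def by blast
    show "continuous_on UNIV (partial b F)" unfolding pF by (intro continuous_intros c)
  qed
  moreover have "(LINT x|torus. partial b F x) = (LINT x|torus. of_real (\<psi> x) * (\<i> * of_real (freq k \<bullet> b) * mode k x)) + (LINT x|torus. of_real (partial b \<psi> x) * mode k x)"
    unfolding pF by (intro Bochner_Integration.integral_add torus_integrable_continuous continuous_intros c)
  moreover have "(LINT x|torus. of_real (\<psi> x) * (\<i> * of_real (freq k \<bullet> b) * mode k x)) = (\<i> * of_real (freq k \<bullet> b)) * (LINT x|torus. mode k x * of_real (\<psi> x))"
  proof -
    have "(\<lambda>x. of_real (\<psi> x) * (\<i> * of_real (freq k \<bullet> b) * mode k x)) = (\<lambda>x. (\<i> * of_real (freq k \<bullet> b)) * (mode k x * of_real (\<psi> x)))"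
      by (simp add: fun_eq_iff mult_ac)
    then show ?thesis by (simp only: integral_mult_right_zero)
  qed
  ultimately show ?thesis by (simp add: mult.commute add_eq_0_iff)
qed

text \<open>The weak formulation admits real fields only, so each complex mode is tested through its
  cosine and its sine.\<close>

definition Cmode :: "nat \<Rightarrow> real^2 \<Rightarrow> real" where "Cmode k x = cos (freq k \<bullet> x)"
definition Smode :: "nat \<Rightarrow> real^2 \<Rightarrow> real" where "Smode k x = sin (freq k \<bullet> x)"

lemma has_derivative_CSmode:
  "((\<lambda>x. Cmode k x *\<^sub>R v) has_derivative (\<lambda>h. (- (freq k \<bullet> h) * Smode k x) *\<^sub>R v)) (at x)"
  "((\<lambda>x. Smode k x *\<^sub>R v) has_derivative (\<lambda>h. ((freq k \<bullet> h) * Cmode k x) *\<^sub>R v)) (at x)"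
  unfolding Cmode_def Smode_def by (auto intro!: derivative_eq_intros)

lemma partial_CSmode:
  "partial b (\<lambda>x. Cmode k x *\<^sub>R v) = (\<lambda>x. (- (freq k \<bullet> b)) *\<^sub>R (Smode k x *\<^sub>R v))"
  "partial b (\<lambda>x. Smode k x *\<^sub>R v) = (\<lambda>x. (freq k \<bullet> b) *\<^sub>R (Cmode k x *\<^sub>R v))"
  using partial_eqI[OF has_derivative_CSmode(1)[of k v]] partial_eqI[OF has_derivative_CSmode(2)[of k v]] by auto

lemma CSmode_smooth:
  "(\<lambda>x. Cmode k x *\<^sub>R v) \<in> torus_smooth" "(\<lambda>x. Smode k x *\<^sub>R v) \<in> torus_smooth"
proof -
  define \<F> where "\<F> = {\<lambda>x. (\<alpha> * Cmode k x + \<beta> * Smode k x) *\<^sub>R v | \<alpha> \<beta>. True}"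
  have D: "((\<lambda>x. (\<alpha> * Cmode k x + \<beta> * Smode k x) *\<^sub>R v) has_derivative (\<lambda>h. ((\<beta> * (freq k \<bullet> h)) * Cmode k x + (- \<alpha> * (freq k \<bullet> h)) * Smode k x) *\<^sub>R v)) (at x)" for \<alpha> \<beta> x
    unfolding Cmode_def Smode_def by (auto intro!: derivative_eq_intros simp: algebra_simps)
  have *: "smooth f" if "f \<in> \<F>" for f
  proof (rule smooth_coinduct[OF that])
    show "g differentiable (at x)" if "g \<in> \<F>" for g x
      using that D unfolding \<F>_def differentiable_def by blast
    show "partial b g \<in> \<F>" if "g \<in> \<F>" for g b
    proof -
      obtain \<alpha> \<beta> where g: "g = (\<lambda>x. (\<alpha> * Cmode k x + \<beta> * Smode k x) *\<^sub>R v)"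
        using \<open>g \<in> \<F>\<close> unfolding \<F>_def by blast
      have "partial b g = (\<lambda>x. ((\<beta> * (freq k \<bullet> b)) * Cmode k x + (- \<alpha> * (freq k \<bullet> b)) * Smode k x) *\<^sub>R v)"
        unfolding g using partial_eqI[OF D] by blast
      then show ?thesis unfolding \<F>_def by blast
    qed
  qed
  have "(\<lambda>x. (1 * Cmode k x + 0 * Smode k x) *\<^sub>R v) \<in> \<F>" "(\<lambda>x. (0 * Cmode k x + 1 * Smode k x) *\<^sub>R v) \<in> \<F>"
    unfolding \<F>_def by blast+
  then have "smooth (\<lambda>x. Cmode k x *\<^sub>R v)" "smooth (\<lambda>x. Smode k x *\<^sub>R v)" using * by force+
  moreover have "periodic (\<lambda>x. Cmode k x *\<^sub>R v)" "periodic (\<lambda>x. Smode k x *\<^sub>R v)"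
    using periodic_cis[OF freq_in, of k] unfolding periodic_def Cmode_def Smode_def
    by (simp_all add: complex_eq_iff)
  ultimately show "(\<lambda>x. Cmode k x *\<^sub>R v) \<in> torus_smooth" "(\<lambda>x. Smode k x *\<^sub>R v) \<in> torus_smooth"
    by (auto simp: torus_smooth_def)
qed

lemma CSmode_smooth_real: "Cmode k \<in> torus_smooth" "Smode k \<in> torus_smooth"
  using CSmode_smooth[of k "1::real"] by auto

lemma partial_CSmode_real:
  "partial b (Cmode k) x = - (freq k \<bullet> b) * Smode k x" "partial b (Smode k) x = (freq k \<bullet> b) * Cmode k x"
  using partial_CSmode[of b k "1::real"] by (simp_all add: fun_eq_iff)

definition cf :: "(real^2 \<Rightarrow> real^2) \<Rightarrow> real^2 \<Rightarrow> nat \<Rightarrow> complex" where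
  "cf f b = fc (\<lambda>x. of_real (f x \<bullet> b))"

lemma integrable_CSmode:
  assumes "integrable torus (g :: real^2 \<Rightarrow> real)" "continuous_on UNIV h"
  shows "integrable torus (\<lambda>x. h x * g x)" "integrable torus (\<lambda>x. g x * h x)"
proof -
  have "compact (h ` cbox 0 ((2 * pi) *\<^sub>R One))"
    by (intro compact_continuous_image continuous_on_subset[OF assms(2)]) auto
  then obtain B where B: "\<And>x. x \<in> cbox 0 ((2 * pi) *\<^sub>R One) \<Longrightarrow> norm (h x) \<le> B"
    by (meson bounded_iff compact_imp_bounded image_eqI)
  show 1: "integrable torus (\<lambda>x. g x * h x)"
    by (rule torus_integrable_mult_bounded[of _ _ B])
      (use B assms in \<open>auto simp: space_torus intro!: AE_I2 torus_measurable_continuous\<close>)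
  then show "integrable torus (\<lambda>x. h x * g x)" by (simp add: mult.commute)
qed

lemma continuous_CSmode: "continuous_on S (Cmode k)" "continuous_on S (Smode k)"
  unfolding Cmode_def Smode_def by (intro continuous_intros)+

lemma fc_real:
  fixes g :: "real^2 \<Rightarrow> real"
  assumes g: "integrable torus g"
  shows "fc (\<lambda>x. of_real (g x)) k = Complex ((LINT x|torus. Cmode k x * g x) / (4 * pi\<^sup>2)) (- (LINT x|torus. Smode k x * g x) / (4 * pi\<^sup>2))"
proof -
  have "complex_of_real (g x) * cis (- (freq k \<bullet> x)) = of_real (Cmode k x * g x) - \<i> * of_real (Smode k x * g x)" for x
    by (simp add: complex_eq_iff Cmode_def Smode_def)
  then have "(LINT x|torus. complex_of_real (g x) * cis (- (freq k \<bullet> x))) =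
     (LINT x|torus. of_real (Cmode k x * g x) - \<i> * of_real (Smode k x * g x))" by simp
  also have "\<dots> = (LINT x|torus. of_real (Cmode k x * g x)) - (LINT x|torus. \<i> * of_real (Smode k x * g x))"
    by (intro Bochner_Integration.integral_diff integrable_mult_right integrable_of_real integrable_CSmode g continuous_CSmode)
  also have "\<dots> = of_real (LINT x|torus. Cmode k x * g x) - \<i> * of_real (LINT x|torus. Smode k x * g x)"
    by (simp only: integral_mult_right_zero integral_complex_of_real)
  finally have e: "(LINT x|torus. complex_of_real (g x) * cis (- (freq k \<bullet> x))) =
    of_real (LINT x|torus. Cmode k x * g x) - \<i> * of_real (LINT x|torus. Smode k x * g x)" .
  have "z / (4 * of_real pi ^ 2) = z / of_real (4 * pi\<^sup>2)" for z by simp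
  then show ?thesis unfolding fc_def e
    by (simp only: complex_eq_iff Re_divide_of_real Im_divide_of_real) simp
qed

lemma L2_inner_CSmode:
  assumes f: "integrable torus f" and b: "b \<in> Basis"
  shows "L2_inner f (\<lambda>x. Cmode k x *\<^sub>R b) = 4 * pi\<^sup>2 * Re (cf f b k)"
    "L2_inner f (\<lambda>x. Smode k x *\<^sub>R b) = - (4 * pi\<^sup>2 * Im (cf f b k))"
proof -
  have "integrable torus (\<lambda>x. f x \<bullet> b)" using f by auto
  from fc_real[OF this] show "L2_inner f (\<lambda>x. Cmode k x *\<^sub>R b) = 4 * pi\<^sup>2 * Re (cf f b k)"
    "L2_inner f (\<lambda>x. Smode k x *\<^sub>R b) = - (4 * pi\<^sup>2 * Im (cf f b k))"
    unfolding cf_def L2_inner_def by simp_all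
qed

lemma has_weak_partial_integrable: "has_weak_partial b f g \<Longrightarrow> integrable torus g"
  by (simp add: has_weak_partial_def)

lemma has_weak_partial_inner:
  fixes f g :: "real^2 \<Rightarrow> real^2"
  assumes f: "integrable torus f" and w: "has_weak_partial b f g" and \<psi>: "\<psi> \<in> torus_smooth" and b: "b \<in> Basis"
  shows "(LINT x|torus. partial b \<psi> x * (f x \<bullet> v)) = - (LINT x|torus. \<psi> x * (g x \<bullet> v))"
proof -
  have g: "integrable torus g" using w by (rule has_weak_partial_integrable)
  have int: "integrable torus (\<lambda>x. h x *\<^sub>R F x)" if "continuous_on UNIV h" "integrable torus F" for h and F :: "real^2 \<Rightarrow> real^2"
  proof (rule Bochner_Integration.integrable_bound)
    have F: "integrable torus (\<lambda>x. norm (F x))" using that(2) by simp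
    show "integrable torus (\<lambda>x. h x * norm (F x))" by (rule integrable_CSmode(1)[OF F that(1)])
    show "(\<lambda>x. h x *\<^sub>R F x) \<in> borel_measurable torus"
      using that torus_measurable_continuous[of h] by (intro borel_measurable_scaleR) auto
  qed auto
  have i1: "integrable torus (\<lambda>x. partial b \<psi> x *\<^sub>R f x)"
    by (intro int f torus_smooth_continuous torus_smooth_partial \<psi> b)
  have i2: "integrable torus (\<lambda>x. \<psi> x *\<^sub>R g x)"
    by (intro int g torus_smooth_continuous \<psi>)
  have "(LINT x|torus. partial b \<psi> x *\<^sub>R f x) \<bullet> v = (- (LINT x|torus. \<psi> x *\<^sub>R g x)) \<bullet> v"
    using w \<psi> by (simp add: has_weak_partial_def)
  then show ?thesis
    using integral_inner_left[OF i1, of v] integral_inner_left[OF i2, of v]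
    by (simp only: inner_minus_left inner_scaleR_left)
qed

text \<open>Testing with the cosine and sine of each frequency determines the coefficients of every
  weak derivative, whichever one the choice operator returns.\<close>

lemma weak_partial_coeff:
  fixes f g :: "real^2 \<Rightarrow> real^2"
  assumes f: "integrable torus f" and w: "has_weak_partial b f g" and b: "b \<in> Basis"
  shows "cf g v k = dcoef b (cf f v) k"
proof -
  have g: "integrable torus g" using w by (rule has_weak_partial_integrable)
  have "(LINT x|torus. - (freq k \<bullet> b) * (Smode k x * (f x \<bullet> v))) = - (LINT x|torus. Cmode k x * (g x \<bullet> v))"
    using has_weak_partial_inner[OF f w CSmode_smooth_real(1)[of k] b, of v] by (simp only: partial_CSmode_real mult.assoc)
  then have 1: "(LINT x|torus. Cmode k x * (g x \<bullet> v)) = (freq k \<bullet> b) * (LINT x|torus. Smode k x * (f x \<bullet> v))"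
    by (simp add: integral_mult_right_zero)
  have "(LINT x|torus. (freq k \<bullet> b) * (Cmode k x * (f x \<bullet> v))) = - (LINT x|torus. Smode k x * (g x \<bullet> v))"
    using has_weak_partial_inner[OF f w CSmode_smooth_real(2)[of k] b, of v] by (simp only: partial_CSmode_real mult.assoc)
  then have 2: "(LINT x|torus. Smode k x * (g x \<bullet> v)) = - (freq k \<bullet> b) * (LINT x|torus. Cmode k x * (f x \<bullet> v))"
    by (simp add: integral_mult_right_zero)
  have "integrable torus (\<lambda>x. f x \<bullet> v)" "integrable torus (\<lambda>x. g x \<bullet> v)" using f g by auto
  from fc_real[OF this(1), of k] fc_real[OF this(2), of k] show ?thesis
    unfolding cf_def dcoef_def 1 2 by (simp add: complex_eq_iff)
qed

lemma AE_cf_fser: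
  assumes "integrable torus f" "summable (\<lambda>k. cmod (cf f v k))"
  shows "AE x in torus. complex_of_real (f x \<bullet> v) = fser (cf f v) x"
  unfolding cf_def
  by (rule AE_eq_fser) (use assms in \<open>auto simp: cf_def intro!: integrable_of_real\<close>)

text \<open>Without a witness the choice in \<open>weak_partial\<close> would carry no information.
  The witness is the termwise differentiated series; expanding f in modes reduces the defining
  identity to \<open>integral_partial_mode\<close>.\<close>

lemma has_weak_partial_exists:
  fixes f :: "real^2 \<Rightarrow> real^2"
  assumes f: "integrable torus f" and b: "b \<in> Basis"
    and s: "\<And>v. v \<in> Basis \<Longrightarrow> summable (\<lambda>k. cmod (cf f v k))" "\<And>v. v \<in> Basis \<Longrightarrow> summable (\<lambda>k. cmod (dcoef b (cf f v) k))"
  shows "has_weak_partial b f (\<lambda>x. \<Sum>v\<in>Basis. Re (fser (dcoef b (cf f v)) x) *\<^sub>R v)"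
proof -
  define g where "g x = (\<Sum>v\<in>Basis. Re (fser (dcoef b (cf f v)) x) *\<^sub>R v)" for x
  have gc: "continuous_on UNIV g"
    unfolding g_def by (intro continuous_intros continuous_on_fser s)
  have gp: "periodic g"
    using periodic_fser[OF s(2)] unfolding periodic_def g_def by (auto intro!: sum.cong)
  have gv: "g x \<bullet> v = Re (fser (dcoef b (cf f v)) x)" if "v \<in> Basis" for x v
    using that unfolding g_def by (simp add: inner_sum_left inner_Basis if_distrib sum.delta cong: if_cong)
  have "(LINT x|torus. partial b \<psi> x *\<^sub>R f x) = - (LINT x|torus. \<psi> x *\<^sub>R g x)" if \<psi>: "\<psi> \<in> torus_smooth" for \<psi> :: "real^2 \<Rightarrow> real"
  proof (rule euclidean_eqI)
    fix v :: "real^2" assume v: "v \<in> Basis"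
    have c: "continuous_on UNIV \<psi>" "continuous_on UNIV (partial b \<psi>)"
      using torus_smooth_continuous \<psi> torus_smooth_partial[OF \<psi> b] by auto
    have i1: "integrable torus (\<lambda>x. partial b \<psi> x *\<^sub>R f x)"
    proof (rule Bochner_Integration.integrable_bound)
      have F: "integrable torus (\<lambda>x. norm (f x))" using f by simp
      show "integrable torus (\<lambda>x. partial b \<psi> x * norm (f x))" by (rule integrable_CSmode(1)[OF F c(2)])
      show "(\<lambda>x. partial b \<psi> x *\<^sub>R f x) \<in> borel_measurable torus"
        using f torus_measurable_continuous[OF c(2)] by (intro borel_measurable_scaleR) auto
    qed auto
    have i2: "integrable torus (\<lambda>x. \<psi> x *\<^sub>R g x)"
      by (intro torus_integrable_continuous continuous_intros c gc)
    have I: "integrable torus (\<lambda>x. complex_of_real (h x))" if "continuous_on UNIV h" for h :: "real^2 \<Rightarrow> real"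
      by (intro torus_integrable_continuous continuous_intros that)
    have m: "integrable torus (\<lambda>x. fser a x * of_real (h x))" if "summable (\<lambda>k. cmod (a k))" "continuous_on UNIV h" for a and h :: "real^2 \<Rightarrow> real"
      by (intro torus_integrable_continuous continuous_intros continuous_on_fser that)
    have "(\<lambda>k. cf f v k * (LINT x|torus. mode k x * of_real (partial b \<psi> x))) sums (LINT x|torus. fser (cf f v) x * of_real (partial b \<psi> x))"
      by (rule fser_integral_sums[OF s(1)[OF v] I[OF c(2)]])
    moreover have "cf f v k * (LINT x|torus. mode k x * of_real (partial b \<psi> x)) = - (dcoef b (cf f v) k * (LINT x|torus. mode k x * of_real (\<psi> x)))" for k
      unfolding integral_partial_mode[OF \<psi> b] dcoef_def by (simp add: mult_ac)
    ultimately have "(\<lambda>k. - (dcoef b (cf f v) k * (LINT x|torus. mode k x * of_real (\<psi> x)))) sums (LINT x|torus. fser (cf f v) x * of_real (partial b \<psi> x))"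
      by simp
    moreover have "(\<lambda>k. - (dcoef b (cf f v) k * (LINT x|torus. mode k x * of_real (\<psi> x)))) sums - (LINT x|torus. fser (dcoef b (cf f v)) x * of_real (\<psi> x))"
      by (rule sums_minus[OF fser_integral_sums[OF s(2)[OF v] I[OF c(1)]]])
    ultimately have eq: "(LINT x|torus. fser (cf f v) x * of_real (partial b \<psi> x)) = - (LINT x|torus. fser (dcoef b (cf f v)) x * of_real (\<psi> x))"
      by (rule sums_unique2)
    have "(LINT x|torus. partial b \<psi> x *\<^sub>R f x) \<bullet> v = (LINT x|torus. partial b \<psi> x * (f x \<bullet> v))"
      using integral_inner_left[OF i1, of v] by (simp only: inner_scaleR_left)
    also have "\<dots> = (LINT x|torus. Re (fser (cf f v) x * of_real (partial b \<psi> x)))"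
    proof (rule integral_cong_AE)
      show "(\<lambda>x. partial b \<psi> x * (f x \<bullet> v)) \<in> borel_measurable torus"
        using torus_measurable_continuous[OF c(2)] f by auto
      show "(\<lambda>x. Re (fser (cf f v) x * of_real (partial b \<psi> x))) \<in> borel_measurable torus"
        by (intro torus_measurable_continuous continuous_intros continuous_on_fser s v c)
      show "AE x in torus. partial b \<psi> x * (f x \<bullet> v) = Re (fser (cf f v) x * of_real (partial b \<psi> x))"
        using AE_cf_fser[OF f s(1)[OF v]]
      proof eventually_elim
        case (elim x)
        show ?case unfolding elim[symmetric] by simp
      qed
    qed
    also have "\<dots> = Re (LINT x|torus. fser (cf f v) x * of_real (partial b \<psi> x))"
      by (rule integral_Re[OF m[OF s(1)[OF v] c(2)]])
    also have "\<dots> = - Re (LINT x|torus. fser (dcoef b (cf f v)) x * of_real (\<psi> x))"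
      unfolding eq by simp
    also have "Re (LINT x|torus. fser (dcoef b (cf f v)) x * of_real (\<psi> x)) = (LINT x|torus. Re (fser (dcoef b (cf f v)) x * of_real (\<psi> x)))"
      by (rule integral_Re[OF m[OF s(2)[OF v] c(1)], symmetric])
    also have "\<dots> = (LINT x|torus. \<psi> x * (g x \<bullet> v))"
      using gv[OF v] by (simp add: mult.commute)
    also have "\<dots> = (LINT x|torus. \<psi> x *\<^sub>R g x) \<bullet> v"
      using integral_inner_left[OF i2, of v] by (simp only: inner_scaleR_left)
    finally show "(LINT x|torus. partial b \<psi> x *\<^sub>R f x) \<bullet> v = (- (LINT x|torus. \<psi> x *\<^sub>R g x)) \<bullet> v"
      by (simp add: inner_minus_left)
  qed
  then show ?thesis
    unfolding has_weak_partial_def g_def[symmetric]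
    using gp torus_integrable_continuous[OF gc] by blast
qed

lemma weak_partial:
  fixes f :: "real^2 \<Rightarrow> real^2"
  assumes f: "integrable torus f" and b: "b \<in> Basis"
    and s: "\<And>v. v \<in> Basis \<Longrightarrow> summable (\<lambda>k. cmod (cf f v k))" "\<And>v. v \<in> Basis \<Longrightarrow> summable (\<lambda>k. cmod (dcoef b (cf f v) k))"
  shows "integrable torus (weak_partial b f)" "cf (weak_partial b f) v k = dcoef b (cf f v) k"
proof -
  have w: "has_weak_partial b f (weak_partial b f)"
    unfolding weak_partial_def by (rule someI[where P="has_weak_partial b f"]) (rule has_weak_partial_exists[OF f b s])
  show "integrable torus (weak_partial b f)" by (rule has_weak_partial_integrable[OF w])
  show "cf (weak_partial b f) v k = dcoef b (cf f v) k" by (rule weak_partial_coeff[OF f w b])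
qed

text \<open>The regularity of the solution at almost every time. The field and its chosen weak
  derivatives agree almost everywhere with explicit series, so later estimates can work with
  coefficients.\<close>

locale smooth_field =
  fixes f :: "real^2 \<Rightarrow> real^2"
  assumes f: "integrable torus f" and nice_cf: "\<And>v. v \<in> Basis \<Longrightarrow> nice (cf f v)"
begin

lemmas cf_summable = nice_summable[OF nice_cf] nice_dcoef[OF nice_cf] nice_dcoef2[OF nice_cf]

lemma f_fser: "v \<in> Basis \<Longrightarrow> AE x in torus. complex_of_real (f x \<bullet> v) = fser (cf f v) x"
  by (intro AE_cf_fser f cf_summable)

lemma weak1:
  assumes b: "b \<in> Basis"
  shows "integrable torus (weak_partial b f)" "cf (weak_partial b f) v k = dcoef b (cf f v) k"
  using weak_partial[OF f b cf_summable(1) cf_summable(2)] b by auto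

lemma weak1_fser:
  assumes b: "b \<in> Basis" and v: "v \<in> Basis"
  shows "AE x in torus. complex_of_real (weak_partial b f x \<bullet> v) = fser (dcoef b (cf f v)) x"
proof -
  have "cf (weak_partial b f) v = dcoef b (cf f v)" using weak1(2)[OF b] by blast
  then show ?thesis using AE_cf_fser[OF weak1(1)[OF b], of v] cf_summable(2)[OF v b] by simp
qed

lemma weak2:
  assumes b: "b \<in> Basis"
  shows "integrable torus (weak_partial b (weak_partial b f))" "cf (weak_partial b (weak_partial b f)) v k = dcoef b (dcoef b (cf f v)) k"
proof -
  have e: "cf (weak_partial b f) v = dcoef b (cf f v)" for v using weak1(2)[OF b] by blast
  have w: "integrable torus (weak_partial b (weak_partial b f))" "cf (weak_partial b (weak_partial b f)) v k = dcoef b (cf (weak_partial b f) v) k"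
    using weak_partial(1)[OF weak1(1)[OF b] b] weak_partial(2)[OF weak1(1)[OF b] b, of v k] cf_summable(2,3) b
    unfolding e by auto
  show "integrable torus (weak_partial b (weak_partial b f))" by (rule w)
  show "cf (weak_partial b (weak_partial b f)) v k = dcoef b (dcoef b (cf f v)) k" using w(2) unfolding e .
qed

lemma cf_add: "integrable torus g \<Longrightarrow> integrable torus h \<Longrightarrow> cf (\<lambda>x. g x + h x) v k = cf g v k + cf h v k"
proof -
  assume g: "integrable torus g" and h: "integrable torus h"
  have gi: "integrable torus (\<lambda>x. complex_of_real (g x \<bullet> v))" "integrable torus (\<lambda>x. complex_of_real (h x \<bullet> v))"
    using g h by (auto intro!: integrable_of_real)
  show ?thesis
    unfolding cf_def fc_def using fc_integrable[OF gi(1), of k] fc_integrable[OF gi(2), of k]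
    by (simp add: inner_add_left distrib_right add_divide_distrib)
qed

lemma weak_laplacian:
  shows "integrable torus (weak_laplacian f)" "cf (weak_laplacian f) v k = - (fsq k * cf f v k)"
proof -
  have w: "weak_laplacian f = (\<lambda>x. weak_partial e1 (weak_partial e1 f) x + weak_partial e2 (weak_partial e2 f) x)"
    by (auto simp: weak_laplacian_def sum_Basis_real2)
  have B: "e1 \<in> Basis" "e2 \<in> Basis" by (auto simp: Basis_real2)
  show "integrable torus (weak_laplacian f)" unfolding w using weak2(1) B by auto
  have "cf (weak_laplacian f) v k = dcoef e1 (dcoef e1 (cf f v)) k + dcoef e2 (dcoef e2 (cf f v)) k"
    unfolding w by (simp only: cf_add weak2 B)
  also have "\<dots> = - (fsq k * cf f v k)"
    unfolding fsq_inner dcoef_def by (simp add: power2_eq_square algebra_simps)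
  finally show "cf (weak_laplacian f) v k = - (fsq k * cf f v k)" .
qed

lemma nice_field_cf: "nice_field (cf f)"
proof
  fix b :: "real^2" assume b: "b \<in> Basis"
  show "nice (cf f b)" by (rule nice_cf[OF b])
  show "AE x in torus. cnj (fser (cf f b) x) = fser (cf f b) x"
    using f_fser[OF b]
  proof eventually_elim
    case (elim x)
    show ?case unfolding elim[symmetric] by simp
  qed
qed

sublocale nf: nice_field "cf f" by (rule nice_field_cf)

text \<open>Replaces products with weak derivatives by the continuous function N, from which
  integrability, coefficients and bounds of the convection term follow.\<close>

lemma convection_N:
  assumes v: "v \<in> Basis"
  shows "AE x in torus. complex_of_real (convection f f x \<bullet> v) = nf.N v x"
proof -
  have B: "e1 \<in> Basis" "e2 \<in> Basis" by (auto simp: Basis_real2)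
  show ?thesis
    using f_fser[OF B(1)] f_fser[OF B(2)] weak1_fser[OF B(1) v] weak1_fser[OF B(2) v]
  proof eventually_elim
    case (elim x)
    show ?case
      unfolding convection_def nf.N_def sum_Basis_real2 inner_add_left inner_scaleR_left of_real_add of_real_mult elim ..
  qed
qed

lemma convection_integrable: "integrable torus (convection f f)"
proof -
  have B: "e1 \<in> Basis" "e2 \<in> Basis" by (auto simp: Basis_real2)
  have [measurable]: "f \<in> borel_measurable torus" "weak_partial e1 f \<in> borel_measurable torus" "weak_partial e2 f \<in> borel_measurable torus"
    using f weak1(1) B by auto
  have m: "convection f f \<in> borel_measurable torus"
    unfolding convection_def sum_Basis_real2 by measurable
  have "integrable torus (\<lambda>x. convection f f x \<bullet> v)" if v: "v \<in> Basis" for v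
  proof -
    have "integrable torus (\<lambda>x. complex_of_real (convection f f x \<bullet> v))"
    proof (rule iffD2[OF integrable_cong_AE])
      show "(\<lambda>x. complex_of_real (convection f f x \<bullet> v)) \<in> borel_measurable torus" using m by measurable
      show "nf.N v \<in> borel_measurable torus" by (rule torus_measurable_continuous[OF nf.N_cont[OF v]])
      show "integrable torus (nf.N v)" by (rule torus_integrable_continuous[OF nf.N_cont[OF v]])
      show "AE x in torus. complex_of_real (convection f f x \<bullet> v) = nf.N v x" by (rule convection_N[OF v])
    qed
    then show ?thesis by (simp add: complex_of_real_integrable_eq)
  qed
  then have "integrable torus (\<lambda>x. \<Sum>v\<in>Basis. (convection f f x \<bullet> v) *\<^sub>R v)"
    by (intro Bochner_Integration.integrable_sum integrable_scaleR_left)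
  then show ?thesis by (simp add: euclidean_representation)
qed

lemma cf_convection:
  assumes v: "v \<in> Basis"
  shows "cf (convection f f) v k = nf.nh v k"
proof -
  have "(LINT x|torus. complex_of_real (convection f f x \<bullet> v) * cis (- (freq k \<bullet> x))) = (LINT x|torus. nf.N v x * cis (- (freq k \<bullet> x)))"
  proof (rule integral_cong_AE)
    show "(\<lambda>x. complex_of_real (convection f f x \<bullet> v) * cis (- (freq k \<bullet> x))) \<in> borel_measurable torus"
      by (rule borel_measurable_times[OF _ torus_measurable_continuous])
        (use convection_integrable in \<open>auto intro!: continuous_intros\<close>)
    show "(\<lambda>x. nf.N v x * cis (- (freq k \<bullet> x))) \<in> borel_measurable torus"
      by (intro torus_measurable_continuous continuous_intros nf.N_cont v)
    show "AE x in torus. complex_of_real (convection f f x \<bullet> v) * cis (- (freq k \<bullet> x)) = nf.N v x * cis (- (freq k \<bullet> x))"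
      using convection_N[OF v] by eventually_elim simp
  qed
  then show ?thesis by (simp add: cf_def nf.nh_def fc_def)
qed

end

subsection \<open>Sobolev norms\<close>

lemma epowr_ennreal: "0 \<le> x \<Longrightarrow> epowr (ennreal x) r = ennreal (x powr r)"
  by (simp add: epowr_def)

lemma epowr_less_top [simp]: "epowr x r < \<infinity> \<longleftrightarrow> x < \<infinity>" "epowr x r < top \<longleftrightarrow> x < top"
  by (auto simp: epowr_def less_top)

lemma epowr_2: "epowr x 2 = x\<^sup>2"
proof (cases x)
  case (real r)
  then show ?thesis by (simp add: epowr_ennreal ennreal_power)
next
  case top
  then show ?thesis by (simp add: epowr_def power2_eq_square ennreal_top_mult)
qed

lemma epowr_half_2: "(epowr x (1 / 2))\<^sup>2 = x"
proof (cases x)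
  case (real r)
  then show ?thesis by (simp add: epowr_ennreal ennreal_power powr_half_sqrt)
next
  case top
  then show ?thesis by (simp add: epowr_def power2_eq_square ennreal_top_mult)
qed

lemma Lp_norm_2: "Lp_norm 2 M f = epowr (\<integral>\<^sup>+x. (f x)\<^sup>2 \<partial>M) (1 / 2)"
  by (simp add: Lp_norm_def epowr_2)

definition pw :: "(real^2 \<Rightarrow> real^2) \<Rightarrow> nat \<Rightarrow> real" where
  "pw f k = (\<Sum>b\<in>Basis. (cmod (cf f b k))\<^sup>2)"

lemma pw_nonneg [simp]: "0 \<le> pw f k"
  by (simp add: pw_def sum_nonneg)

lemma nn_integral_lattice_Basis:
  fixes h :: "(real^2) \<times> (real^2) \<Rightarrow> ennreal"
  shows "(\<integral>\<^sup>+z. h z \<partial>count_space (int_lattice \<times> Basis)) = (\<Sum>k. \<Sum>b\<in>Basis. h (freq k, b))"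
proof -
  have "(\<integral>\<^sup>+z. h z \<partial>count_space (int_lattice \<times> Basis)) = (\<integral>\<^sup>+z. h z * indicator (int_lattice \<times> Basis) z \<partial>count_space UNIV)"
    by (subst nn_integral_count_space_indicator) auto
  also have "\<dots> = (\<integral>\<^sup>+m. \<integral>\<^sup>+b. h (m, b) * indicator (int_lattice \<times> Basis) (m, b) \<partial>count_space UNIV \<partial>count_space UNIV)"
    by (rule nn_integral_fst_count_space[symmetric])
  also have "\<dots> = (\<integral>\<^sup>+m. (\<integral>\<^sup>+b. h (m, b) * indicator Basis b \<partial>count_space UNIV) * indicator int_lattice m \<partial>count_space UNIV)"
    by (intro nn_integral_cong) (auto simp: indicator_def)
  also have "\<dots> = (\<integral>\<^sup>+m. (\<integral>\<^sup>+b. h (m, b) * indicator Basis b \<partial>count_space UNIV) \<partial>count_space int_lattice)"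
    by (subst (2) nn_integral_count_space_indicator) (auto simp: countable_int_lattice)
  also have "\<dots> = (\<integral>\<^sup>+m. (\<Sum>b\<in>Basis. h (m, b)) \<partial>count_space int_lattice)"
  proof (rule nn_integral_cong)
    fix m
    have "(\<integral>\<^sup>+b. h (m, b) * indicator Basis b \<partial>count_space UNIV) = (\<integral>\<^sup>+b. h (m, b) \<partial>count_space Basis)"
      by (subst (2) nn_integral_count_space_indicator) auto
    then show "(\<integral>\<^sup>+b. h (m, b) * indicator Basis b \<partial>count_space UNIV) = (\<Sum>b\<in>Basis. h (m, b))"
      by (simp add: nn_integral_count_space_finite)
  qed
  also have "\<dots> = (\<integral>\<^sup>+k. (\<Sum>b\<in>Basis. h (freq k, b)) \<partial>count_space UNIV)"
    by (rule nn_integral_bij_count_space[OF bij_freq, symmetric])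
  also have "\<dots> = (\<Sum>k. \<Sum>b\<in>Basis. h (freq k, b))"
    by (rule nn_integral_count_space_nat)
  finally show ?thesis .
qed

lemma sobolev_norm_eq:
  "sobolev_norm (real n) f = epowr (\<Sum>k. ennreal ((1 + fsq k) ^ n * pw f k)) (1 / 2)"
proof -
  have "(\<Sum>b\<in>Basis. (ennreal ((1 + (norm (freq k))\<^sup>2) powr (real n / 2) * cmod (fourier_coeff (\<lambda>x. f x \<bullet> b) (freq k))))\<^sup>2)
     = ennreal ((1 + fsq k) ^ n * pw f k)" for k
  proof -
    have "0 < 1 + fsq k" using fsq_nonneg[of k] by linarith
    then have "((1 + fsq k) powr (real n / 2))\<^sup>2 = (1 + fsq k) ^ n"
      by (simp add: powr_powr powr_realpow flip: powr_numeral)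
    then have "(ennreal ((1 + (norm (freq k))\<^sup>2) powr (real n / 2) * cmod (fourier_coeff (\<lambda>x. f x \<bullet> b) (freq k))))\<^sup>2
        = ennreal ((1 + fsq k) ^ n * (cmod (cf f b k))\<^sup>2)" for b
      by (simp add: ennreal_power power_mult_distrib fourier_coeff_fc cf_def flip: fsq_def)
    then show ?thesis
      by (simp add: sum_ennreal pw_def sum_distrib_left)
  qed
  then show ?thesis
    unfolding sobolev_norm_def Lp_norm_2 nn_integral_lattice_Basis by simp
qed

lemma suminf_ennreal_less_top:
  fixes f :: "nat \<Rightarrow> real"
  assumes "\<And>k. 0 \<le> f k"
  shows "(\<Sum>k. ennreal (f k)) < \<infinity> \<longleftrightarrow> summable f"
proof
  assume "(\<Sum>k. ennreal (f k)) < \<infinity>"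
  then have "(\<Sum>k. ennreal (f k)) \<noteq> top" by (metis infinity_ennreal_def less_irrefl)
  then show "summable f" by (rule summable_suminf_not_top[OF assms])
next
  assume "summable f"
  then have "(\<Sum>k. ennreal (f k)) = ennreal (suminf f)" by (rule suminf_ennreal2[OF assms])
  then show "(\<Sum>k. ennreal (f k)) < \<infinity>" by simp
qed

lemma sobolev_norm_finite:
  "sobolev_norm (real n) f < \<infinity> \<longleftrightarrow> summable (\<lambda>k. (1 + fsq k) ^ n * pw f k)"
proof -
  have "0 \<le> (1 + fsq k) ^ n * pw f k" for k by (simp add: add_nonneg_nonneg)
  then show ?thesis unfolding sobolev_norm_eq epowr_less_top by (rule suminf_ennreal_less_top)
qed

text \<open>The last bound is Cauchy-Schwarz against the constant 1; the torus has area 4 pi^2, with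
  root 2 pi. It lets convergence in L^2 pass to pairings with bounded functions.\<close>

lemma L2_torus_integrable:
  fixes f :: "real^2 \<Rightarrow> real^2"
  assumes "f \<in> L2_torus"
  shows "integrable torus f" "integrable torus (\<lambda>x. (norm (f x))\<^sup>2)" "(LINT x|torus. norm (f x)) \<le> 2 * pi * enn2real (L2_norm f)"
proof -
  have m[measurable]: "f \<in> borel_measurable torus" and fin: "L2_norm f < \<infinity>"
    using assms by (auto simp: L2_torus_def)
  have X: "(\<integral>\<^sup>+x. (ennreal (norm (f x)))\<^sup>2 \<partial>torus) < \<infinity>"
    using fin unfolding L2_norm_def Lp_norm_2 by simp
  then have X': "(\<integral>\<^sup>+x. ennreal ((norm (f x))\<^sup>2) \<partial>torus) < \<infinity>" by (simp add: ennreal_power)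
  show sq: "integrable torus (\<lambda>x. (norm (f x))\<^sup>2)"
    by (rule integrableI_bounded) (use X' in auto)
  have "integrable torus (\<lambda>x. norm (f x))"
    by (rule torus.square_integrable_imp_integrable) (use sq in auto)
  then show "integrable torus f" by (simp add: integrable_norm_iff)
  have "(\<integral>\<^sup>+x. ennreal (norm (f x)) * 1 \<partial>torus)\<^sup>2 \<le> (\<integral>\<^sup>+x. (ennreal (norm (f x)))\<^sup>2 \<partial>torus) * (\<integral>\<^sup>+x. 1\<^sup>2 \<partial>(torus :: (real^2) measure))"
    by (rule Cauchy_Schwarz_nn_integral) auto
  moreover have "(\<integral>\<^sup>+x. 1\<^sup>2 \<partial>(torus :: (real^2) measure)) = ennreal (4 * pi\<^sup>2)"
    using measure_space_torus[where 'a="real^2"] torus.emeasure_eq_measure[where A="space (torus :: (real^2) measure)"]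
    by (simp add: power_mult_distrib)
  moreover have "(\<integral>\<^sup>+x. (ennreal (norm (f x)))\<^sup>2 \<partial>torus) = (L2_norm f)\<^sup>2"
    unfolding L2_norm_def Lp_norm_2 epowr_half_2 ..
  ultimately have "(\<integral>\<^sup>+x. ennreal (norm (f x)) \<partial>torus)\<^sup>2 \<le> (L2_norm f)\<^sup>2 * ennreal (4 * pi\<^sup>2)" by simp
  moreover have "(\<integral>\<^sup>+x. ennreal (norm (f x)) \<partial>torus) = ennreal (LINT x|torus. norm (f x))"
    using \<open>integrable torus (\<lambda>x. norm (f x))\<close> by (intro nn_integral_eq_integral) auto
  moreover have "(L2_norm f)\<^sup>2 * ennreal (4 * pi\<^sup>2) = ennreal ((2 * pi * enn2real (L2_norm f))\<^sup>2)"
  proof -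
    have "L2_norm f = ennreal (enn2real (L2_norm f))" using fin by simp
    then have "(L2_norm f)\<^sup>2 * ennreal (4 * pi\<^sup>2) = (ennreal (enn2real (L2_norm f)))\<^sup>2 * ennreal (4 * pi\<^sup>2)" by simp
    then show ?thesis by (simp add: ennreal_power power_mult_distrib mult.commute flip: ennreal_mult)
  qed
  ultimately have "(LINT x|torus. norm (f x))\<^sup>2 \<le> (2 * pi * enn2real (L2_norm f))\<^sup>2"
    by (simp add: ennreal_power)
  then show "(LINT x|torus. norm (f x)) \<le> 2 * pi * enn2real (L2_norm f)"
    by (rule power2_le_imp_le) simp
qed

lemma sobolev4_smooth_field:
  fixes f :: "real^2 \<Rightarrow> real^2"
  assumes "f \<in> sobolev 4"
  shows "smooth_field f" "summable (\<lambda>k. (1 + fsq k) ^ 4 * pw f k)"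
proof -
  have f: "f \<in> L2_torus" "sobolev_norm (real 4) f < \<infinity>" using assms by (auto simp: sobolev_def)
  show s: "summable (\<lambda>k. (1 + fsq k) ^ 4 * pw f k)" using f(2) unfolding sobolev_norm_finite .
  show "smooth_field f"
  proof
    show "integrable torus f" by (rule L2_torus_integrable[OF f(1)])
    fix v :: "real^2" assume v: "v \<in> Basis"
    show "nice (cf f v)"
    proof (rule nice_of_weighted, rule summable_comparison_test'[OF s])
      fix k
      have "(cmod (cf f v k))\<^sup>2 \<le> pw f k" unfolding pw_def using v by (intro member_le_sum) auto
      then show "norm ((1 + fsq k) ^ 4 * (cmod (cf f v k))\<^sup>2) \<le> (1 + fsq k) ^ 4 * pw f k"
        by (simp add: mult_left_mono)
    qed
  qed
qed

subsection \<open>The Besov norm controls the oscillation\<close>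

text \<open>The weights \<open>1 / (1 + fsq k)\<^sup>2\<close> tend to 0, but stay away from 0 where
  \<open>fsq k \<le> R\<close>.\<close>

lemma fsq_finite: "finite {k. fsq k \<le> R}"
proof -
  have "(\<lambda>k. 1 / (1 + fsq k)\<^sup>2) \<longlonglongrightarrow> 0" by (rule summable_LIMSEQ_zero[OF summable_weight])
  moreover have "0 < 1 / (1 + \<bar>R\<bar>)\<^sup>2" by (intro divide_pos_pos zero_less_power) auto
  ultimately have "eventually (\<lambda>k. 1 / (1 + fsq k)\<^sup>2 < 1 / (1 + \<bar>R\<bar>)\<^sup>2) sequentially" by (rule order_tendstoD)
  then obtain K where K: "\<And>k. k \<ge> K \<Longrightarrow> 1 / (1 + fsq k)\<^sup>2 < 1 / (1 + \<bar>R\<bar>)\<^sup>2" by (auto simp: eventually_sequentially)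
  have "{k. fsq k \<le> R} \<subseteq> {..<K}"
  proof (rule subsetI, rule ccontr)
    fix k assume k: "k \<in> {k. fsq k \<le> R}" "k \<notin> {..<K}"
    have "(1 + fsq k)\<^sup>2 \<le> (1 + \<bar>R\<bar>)\<^sup>2" using k by (intro power_mono) auto
    moreover have "0 < (1 + fsq k)\<^sup>2" using fsq_nonneg[of k] by (intro zero_less_power) linarith
    ultimately have "1 / (1 + \<bar>R\<bar>)\<^sup>2 \<le> 1 / (1 + fsq k)\<^sup>2" by (intro divide_left_mono) (auto intro!: mult_pos_pos)
    then show False using K[of k] k by auto
  qed
  then show ?thesis by (rule finite_subset) simp
qed

locale littlewood_paley =
  fixes \<phi> :: "real^2 \<Rightarrow> real"
  assumes \<phi>: "dyadic_partition \<phi>"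
begin

text \<open>The Fourier multiplier of the j-th dyadic block.\<close>

definition ph :: "int \<Rightarrow> nat \<Rightarrow> real" where "ph j k = \<phi> ((2 powi (- j)) *\<^sub>R freq k)"

lemma ph01: "0 \<le> ph j k" "ph j k \<le> 1"
  using \<phi> by (auto simp: dyadic_partition_def ph_def)

lemma phi_support: "\<phi> \<xi> \<noteq> 0 \<Longrightarrow> 1 / 2 < norm \<xi> \<and> norm \<xi> < 2"
  using \<phi> closure_subset[of "{\<xi>. \<phi> \<xi> \<noteq> 0}"] unfolding dyadic_partition_def by blast

lemma ph_support: "ph j k \<noteq> 0 \<Longrightarrow> norm (freq k) < 2 * 2 powi j" "ph j k \<noteq> 0 \<Longrightarrow> 2 powi j < 2 * norm (freq k)"
proof -
  assume "ph j k \<noteq> 0"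
  then have "1 / 2 < norm ((2 powi (- j)) *\<^sub>R freq k)" "norm ((2 powi (- j)) *\<^sub>R freq k) < 2"
    using phi_support[of "(2 powi (- j)) *\<^sub>R freq k"] by (auto simp: ph_def)
  moreover have "norm ((2 powi (- j)) *\<^sub>R freq k) = norm (freq k) / 2 powi j"
    by (simp add: power_int_minus divide_inverse)
  moreover have "0 < (2::real) powi j" by simp
  ultimately have d: "1 / 2 < norm (freq k) / 2 powi j" "norm (freq k) / 2 powi j < 2" and P: "0 < (2::real) powi j"
    by (simp_all only:)
  from d show "norm (freq k) < 2 * 2 powi j" "2 powi j < 2 * norm (freq k)"
    unfolding pos_divide_less_eq[OF P] pos_less_divide_eq[OF P] by linarith+
qed

lemma freq_norm_ge_1: "freq k \<noteq> 0 \<Longrightarrow> 1 \<le> norm (freq k)"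
proof -
  assume "freq k \<noteq> 0"
  then obtain b where b: "b \<in> Basis" "freq k \<bullet> b \<noteq> 0" using euclidean_all_zero_iff by blast
  then have "freq k \<bullet> b \<in> \<int>" using freq_in[of k] by (auto simp: int_lattice_def)
  then have "1 \<le> \<bar>freq k \<bullet> b\<bar>" using b(2) by (auto elim!: Ints_cases)
  then show ?thesis using Basis_le_norm[OF b(1), of "freq k"] by linarith
qed

lemma ph_finite: "finite {k. ph j k \<noteq> 0}"
proof (rule finite_subset)
  show "{k. ph j k \<noteq> 0} \<subseteq> {k. fsq k \<le> (2 * 2 powi j)\<^sup>2}"
  proof (rule subsetI)
    fix k assume "k \<in> {k. ph j k \<noteq> 0}"
    then have "norm (freq k) \<le> 2 * 2 powi j" using ph_support(1)[of j k] by simp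
    then have "fsq k \<le> (2 * 2 powi j)\<^sup>2" unfolding fsq_def by (rule power_mono) simp
    then show "k \<in> {k. fsq k \<le> (2 * 2 powi j)\<^sup>2}" by simp
  qed
qed (rule fsq_finite)

lemma ph_zero: "freq k = 0 \<Longrightarrow> ph j k = 0"
proof (rule ccontr)
  assume "freq k = 0" "ph j k \<noteq> 0"
  then have "(2::real) powi j < 0" using ph_support(2)[of j k] by simp
  moreover have "0 < (2::real) powi j" by simp
  ultimately show False by linarith
qed

text \<open>For j = -1 the support condition reads |m| < 1, so its strictness is what excludes the
  frequencies of norm 1.\<close>

lemma ph_neg: "j < 0 \<Longrightarrow> ph j k = 0"
proof (rule ccontr)
  assume j: "j < 0" and p: "ph j k \<noteq> 0"
  then have "1 \<le> norm (freq k)" using freq_norm_ge_1 ph_zero by blast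
  moreover have "norm (freq k) < 2 * 2 powi j" by (rule ph_support(1)[OF p])
  moreover have "(2::real) powi j \<le> 2 powi (-1)" using j by (intro power_int_increasing) auto
  ultimately show False by (simp add: power_int_minus)
qed

lemma ph_sums: "freq k \<noteq> 0 \<Longrightarrow> (\<lambda>j. ph (int j) k) sums 1"
proof -
  assume "freq k \<noteq> 0"
  then have "((\<lambda>j. ph j k) has_sum 1) UNIV" using \<phi> unfolding dyadic_partition_def ph_def by blast
  then have "((\<lambda>j. ph j k) has_sum 1) (range int)"
  proof (subst has_sum_cong_neutral[where T=UNIV and g="\<lambda>j. ph j k"])
    fix x :: int assume "x \<in> UNIV - range int"
    then have "x < 0" by (metis DiffD2 nat_0_le not_le rangeI)
    then show "ph x k = 0" by (rule ph_neg)
  qed auto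
  then have "((\<lambda>j. ph (int j) k) has_sum 1) UNIV"
    by (subst (asm) has_sum_reindex) (auto simp: o_def)
  then show ?thesis by (rule has_sum_imp_sums)
qed

lemma dyadic_kernel_sum: "dyadic_kernel \<phi> j x = (\<Sum>k | ph j k \<noteq> 0. of_real (ph j k) * mode k x)"
proof -
  have "dyadic_kernel \<phi> j x = (\<Sum>\<^sub>\<infinity>k. of_real (ph j k) * mode k x)"
    unfolding dyadic_kernel_def ph_def mode_def by (rule infsum_reindex_bij_betw[OF bij_freq, symmetric])
  also have "\<dots> = (\<Sum>\<^sub>\<infinity>k\<in>{k. ph j k \<noteq> 0}. of_real (ph j k) * mode k x)"
    by (rule infsum_cong_neutral) auto
  finally show ?thesis using ph_finite by simp
qed

text \<open>The kernel is an unnormalised sum of modes while \<open>fc\<close> divides by the area;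
  hence the factor 4 pi^2.\<close>

lemma dyadic_block_sum:
  fixes f :: "real^2 \<Rightarrow> real"
  assumes f: "integrable torus f"
  shows "dyadic_block \<phi> j (distribution_of f) x = 4 * pi\<^sup>2 * (\<Sum>k | ph j k \<noteq> 0. of_real (ph j k) * fc (\<lambda>x. of_real (f x)) k * mode k x)"
proof -
  have fi: "integrable torus (\<lambda>y. complex_of_real (f y) * cis (- (freq k \<bullet> y)))" for k
    by (intro fc_integrable integrable_of_real f)
  have "dyadic_block \<phi> j (distribution_of f) x = (LINT y|torus. (\<Sum>k | ph j k \<noteq> 0. of_real (ph j k) * mode k x * (complex_of_real (f y) * cis (- (freq k \<bullet> y)))))"
    unfolding dyadic_block_def distribution_of_def dyadic_kernel_sum
  proof (intro Bochner_Integration.integral_cong refl)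
    fix y
    have md: "mode k (x - y) = mode k x * cis (- (freq k \<bullet> y))" for k
      by (simp add: mode_def inner_diff_right cis_mult)
    show "complex_of_real (f y) * (\<Sum>k | ph j k \<noteq> 0. of_real (ph j k) * mode k (x - y)) =
      (\<Sum>k | ph j k \<noteq> 0. of_real (ph j k) * mode k x * (complex_of_real (f y) * cis (- (freq k \<bullet> y))))"
      unfolding md sum_distrib_left by (intro sum.cong refl) (simp only: mult_ac)
  qed
  also have "\<dots> = (\<Sum>k | ph j k \<noteq> 0. of_real (ph j k) * mode k x * (LINT y|torus. complex_of_real (f y) * cis (- (freq k \<bullet> y))))"
    by (subst Bochner_Integration.integral_sum) (simp_all add: fi)
  also have "\<dots> = 4 * pi\<^sup>2 * (\<Sum>k | ph j k \<noteq> 0. of_real (ph j k) * fc (\<lambda>x. of_real (f x)) k * mode k x)"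
    unfolding sum_distrib_left by (intro sum.cong refl) (simp add: fc_def)
  finally show ?thesis .
qed

text \<open>The first J blocks multiply coefficient k by a number in [0,1] that tends to 1, except
  at frequency zero, where every block vanishes. Tannery's theorem with the summable moduli as
  majorant gives the limit, which therefore lacks the mean.\<close>

lemma block_partial_limit:
  fixes f :: "real^2 \<Rightarrow> real"
  assumes f: "integrable torus f" and s: "summable (\<lambda>k. cmod (fc (\<lambda>x. of_real (f x)) k))"
    and k0: "freq k0 = 0"
  shows "(\<lambda>J. \<Sum>j<J. dyadic_block \<phi> (int j) (distribution_of f) x) \<longlonglongrightarrow> 4 * pi\<^sup>2 * fser ((fc (\<lambda>x. of_real (f x)))(k0 := 0)) x"
proof -
  define c where "c = fc (\<lambda>x. complex_of_real (f x))"
  define \<sigma> where "\<sigma> J k = (\<Sum>j<J. ph (int j) k)" for J k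
  have \<sigma>: "\<bar>\<sigma> J k\<bar> \<le> 1" "(\<lambda>J. \<sigma> J k) \<longlonglongrightarrow> (if k = k0 then 0 else 1)" for J k
  proof -
    have "\<bar>\<sigma> J k\<bar> \<le> 1 \<and> (\<lambda>J. \<sigma> J k) \<longlonglongrightarrow> (if k = k0 then 0 else 1)"
    proof (cases "k = k0")
      case True
      then show ?thesis using ph_zero k0 by (simp add: \<sigma>_def)
    next
      case False
      then have "freq k \<noteq> 0" using k0 freq_inj by metis
      then have ps: "(\<lambda>j. ph (int j) k) sums 1" by (rule ph_sums)
      then have "\<sigma> J k \<le> 1" unfolding \<sigma>_def using sum_le_suminf[OF sums_summable[OF ps], of "{..<J}"] sums_unique[OF ps] ph01 by simp
      moreover have "0 \<le> \<sigma> J k" unfolding \<sigma>_def using ph01 by (intro sum_nonneg) auto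
      ultimately show ?thesis using ps False by (simp add: sums_def \<sigma>_def)
    qed
    then show "\<bar>\<sigma> J k\<bar> \<le> 1" "(\<lambda>J. \<sigma> J k) \<longlonglongrightarrow> (if k = k0 then 0 else 1)" by auto
  qed
  have blk: "(\<lambda>k. of_real (ph j k) * c k * mode k x) sums (\<Sum>k | ph j k \<noteq> 0. of_real (ph j k) * c k * mode k x)" for j
    by (rule sums_finite[OF ph_finite]) auto
  have part: "(\<Sum>j<J. \<Sum>k | ph (int j) k \<noteq> 0. of_real (ph (int j) k) * c k * mode k x) = (\<Sum>k. of_real (\<sigma> J k) * c k * mode k x)" for J
  proof -
    have "(\<lambda>k. \<Sum>j<J. of_real (ph (int j) k) * c k * mode k x) sums (\<Sum>j<J. \<Sum>k | ph (int j) k \<noteq> 0. of_real (ph (int j) k) * c k * mode k x)"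
      by (rule sums_sum) (rule blk)
    then show ?thesis by (simp add: sums_iff \<sigma>_def sum_distrib_right)
  qed
  have "(\<lambda>J. \<Sum>k. of_real (\<sigma> J k) * c k * mode k x) \<longlonglongrightarrow> (\<Sum>k. of_real (if k = k0 then 0 else 1) * c k * mode k x)"
  proof (rule conjunct2[OF conjunct2[OF tannerys_theorem[where M="\<lambda>k. cmod (c k)"]]])
    show "((\<lambda>J. of_real (\<sigma> J k) * c k * mode k x) \<longlongrightarrow> of_real (if k = k0 then 0 else 1) * c k * mode k x) sequentially" for k
      by (intro tendsto_mult tendsto_const tendsto_of_real \<sigma>)
    show "eventually (\<lambda>(k, J). norm (of_real (\<sigma> J k) * c k * mode k x) \<le> cmod (c k)) (at_top \<times>\<^sub>F sequentially)"
    proof (intro always_eventually allI, clarify)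
      fix k J
      have "\<bar>\<sigma> J k\<bar> * cmod (c k) \<le> 1 * cmod (c k)" using \<sigma>(1) by (intro mult_right_mono) auto
      then show "norm (of_real (\<sigma> J k) * c k * mode k x) \<le> cmod (c k)" by (simp add: norm_mult)
    qed
  qed (use s in \<open>auto simp: c_def\<close>)
  moreover have "(\<Sum>k. of_real (if k = k0 then 0 else 1) * c k * mode k x) = fser (c(k0 := 0)) x"
    unfolding fser_def by (intro suminf_cong) auto
  ultimately have "(\<lambda>J. 4 * pi\<^sup>2 * (\<Sum>j<J. \<Sum>k | ph (int j) k \<noteq> 0. of_real (ph (int j) k) * c k * mode k x)) \<longlonglongrightarrow> 4 * pi\<^sup>2 * fser (c(k0 := 0)) x"
    unfolding part by (intro tendsto_mult tendsto_const) simp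
  then show ?thesis
    unfolding dyadic_block_sum[OF f] c_def[symmetric] sum_distrib_left by simp
qed

text \<open>The sum of the geometric series with ratio 2^(-1/2), divided by the factor 4 pi^2 of
  \<open>dyadic_block_sum\<close>.\<close>

definition Cb :: real where "Cb = 1 / ((1 - 2 powr (- 1 / 2)) * (4 * pi\<^sup>2))"

lemma half_powr: "0 < (2::real) powr (- 1 / 2)" "(2::real) powr (- 1 / 2) < 1"
  by (auto simp: powr_less_one)

lemma Cb_pos: "0 < Cb"
  unfolding Cb_def using half_powr by (intro divide_pos_pos mult_pos_pos) auto

lemma besov_oscillation:
  fixes f :: "real^2 \<Rightarrow> real"
  assumes f: "integrable torus f" and s: "summable (\<lambda>k. cmod (fc (\<lambda>x. of_real (f x)) k))"
    and k0: "freq k0 = 0"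
    and B: "besov_norm \<phi> (1 / 2) \<infinity> \<infinity> (distribution_of f) < \<infinity>"
  shows "AE x in torus. cmod (fser ((fc (\<lambda>x. of_real (f x)))(k0 := 0)) x) \<le> Cb * enn2real (besov_norm \<phi> (1 / 2) \<infinity> \<infinity> (distribution_of f))"
proof -
  define N where "N = besov_norm \<phi> (1 / 2) \<infinity> \<infinity> (distribution_of f)"
  define q where "q = (2::real) powr (- 1 / 2)"
  let ?b = "\<lambda>j x. dyadic_block \<phi> (int j) (distribution_of f) x"
  have q: "0 < q" "q < 1" using half_powr by (auto simp: q_def)
  have "AE x in torus. cmod (?b j x) \<le> q ^ j * enn2real N" for j
  proof -
    let ?g = "\<lambda>j::int. ennreal (2 powr (1 / 2 * of_int j)) * esssup torus (\<lambda>x. ennreal (cmod (dyadic_block \<phi> j (distribution_of f) x)))"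
    \<comment> \<open>For the counting measure only the empty set is null, so the essential supremum
      bounds every block.\<close>
    have "AE i in count_space UNIV. ?g i \<le> N"
      unfolding N_def besov_norm_def Lp_norm_def by (simp only: simp_thms if_True) (rule esssup_AE)
    then have "\<forall>i\<in>UNIV. ?g i \<le> N" by (simp only: AE_count_space)
    then have "?g (int j) \<le> N" by blast
    moreover have "AE x in torus. ennreal (cmod (?b j x)) \<le> esssup torus (\<lambda>x. ennreal (cmod (?b j x)))"
      by (rule esssup_AE)
    ultimately have "AE x in torus. ennreal (2 powr (1 / 2 * of_int (int j))) * ennreal (cmod (?b j x)) \<le> N"
      by (auto elim!: eventually_mono intro: order_trans[OF mult_left_mono])
    then show ?thesis
    proof eventually_elim
      case (elim x)
      have "ennreal (2 powr (real j / 2) * cmod (?b j x)) \<le> ennreal (enn2real N)"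
        using elim B by (simp add: ennreal_mult N_def)
      then have "2 powr (real j / 2) * cmod (?b j x) \<le> enn2real N" by (simp add: ennreal_le_iff)
      moreover have "q ^ j * (2 powr (real j / 2)) = 1"
        unfolding q_def by (simp add: powr_power flip: powr_add)
      ultimately show ?case
        using mult_left_mono[of "2 powr (real j / 2) * cmod (?b j x)" "enn2real N" "q ^ j"] q by (simp add: mult.assoc[symmetric])
    qed
  qed
  then have "AE x in torus. \<forall>j. cmod (?b j x) \<le> q ^ j * enn2real N" by (subst AE_all_countable) blast
  then show ?thesis
    unfolding N_def[symmetric]
  proof eventually_elim
    case (elim x)
    have "cmod (\<Sum>j<J. ?b j x) \<le> enn2real N / (1 - q)" for J
    proof -
      have "cmod (\<Sum>j<J. ?b j x) \<le> (\<Sum>j<J. q ^ j * enn2real N)"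
        using elim by (intro order_trans[OF norm_sum] sum_mono) auto
      also have "\<dots> = (\<Sum>j<J. q ^ j) * enn2real N" by (simp add: sum_distrib_right)
      also have "\<dots> \<le> (1 / (1 - q)) * enn2real N"
        using q sum_le_suminf[of "\<lambda>j. q ^ j" "{..<J}"] suminf_geometric[of q]
        by (intro mult_right_mono) (auto simp: summable_geometric)
      finally show ?thesis by simp
    qed
    then have "cmod (4 * pi\<^sup>2 * fser ((fc (\<lambda>x. of_real (f x)))(k0 := 0)) x) \<le> enn2real N / (1 - q)"
      by (intro LIMSEQ_le_const2[OF tendsto_norm[OF block_partial_limit[OF f s k0]]]) auto
    then have "4 * pi\<^sup>2 * cmod (fser ((fc (\<lambda>x. of_real (f x)))(k0 := 0)) x) \<le> enn2real N / (1 - q)"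
      by (simp add: norm_mult norm_power)
    moreover have "x \<le> 1 / ((1 - q) * V) * n" if "V * x \<le> n / (1 - q)" "0 < V" for x n V :: real
      using that q by (simp add: field_simps)
    ultimately show ?case unfolding Cb_def q_def[symmetric] by simp
  qed
qed

end

subsection \<open>Measurability and exhaustion in time\<close>

text \<open>Relies on the completeness of Lebesgue measure. Several quantities in time are
  accessible only through a measurable function that agrees with them almost everywhere.\<close>

lemma lebesgue_on_measurable_cong_AE:
  fixes f g :: "'a::euclidean_space \<Rightarrow> 'b::euclidean_space"
  assumes f: "f \<in> borel_measurable (lebesgue_on S)" and S: "S \<in> sets lebesgue" and ae: "AE x in lebesgue_on S. f x = g x"
  shows "g \<in> borel_measurable (lebesgue_on S)"
proof -
  have "(\<lambda>x. indicator S x *\<^sub>R f x) \<in> borel_measurable lebesgue"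
    using f S by (subst (asm) borel_measurable_restrict_space_iff) auto
  moreover have "AE x in lebesgue. indicator S x *\<^sub>R f x = indicator S x *\<^sub>R g x"
    using ae S by (subst (asm) AE_restrict_space_iff) (auto elim!: eventually_mono simp: indicator_def)
  ultimately have "(\<lambda>x. indicator S x *\<^sub>R g x) \<in> borel_measurable lebesgue"
    by (rule borel_measurable_AE)
  then show ?thesis using S by (subst borel_measurable_restrict_space_iff) auto
qed

lemma measurable_exhaust:
  fixes T :: real
  assumes T: "0 < T" and f: "\<And>T'. 0 < T' \<Longrightarrow> T' < T \<Longrightarrow> f \<in> borel_measurable (lebesgue_on {0<..<T'})"
  shows "f \<in> borel_measurable (lebesgue_on {0<..<T})"
proof (rule measurable_piecewise_restrict)
  show "countable (range (\<lambda>n. {0<..<stp T n}))" by simp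
  show "space (lebesgue_on {0<..<T}) \<subseteq> \<Union> (range (\<lambda>n. {0<..<stp T n}))"
    using stp_exceeds[OF T] by auto
  fix X assume "X \<in> range (\<lambda>n. {0<..<stp T n})"
  then obtain n where X: "X = {0<..<stp T n}" by auto
  have sub: "X \<inter> {0<..<T} = {0<..<stp T n}" using X stp_bounds[OF T, of n] by auto
  then show "X \<inter> space (lebesgue_on {0<..<T}) \<in> sets (lebesgue_on {0<..<T})"
    by (auto simp: sets_restrict_space image_iff intro!: bexI[of _ "{0<..<stp T n}"])
  have "restrict_space (lebesgue_on {0<..<T}) X = lebesgue_on {0<..<stp T n}"
    using sub by (subst restrict_restrict_space) (auto simp: X Int_commute)
  then show "f \<in> borel_measurable (restrict_space (lebesgue_on {0<..<T}) X)"
    using f stp_bounds[OF T] by simp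
qed

text \<open>The time intervals in use differ only in their endpoints, a null set; the arguments are
  carried out on the open interval.\<close>

lemma AE_at_endpoints:
  assumes "{0<..<T} \<subseteq> I" "I \<subseteq> {0..T}" "I \<in> sets lebesgue"
  shows "(AE t in lebesgue_on I. P t) \<longleftrightarrow> (AE t in lebesgue_on {0<..<T::real}. P t)"
proof -
  have "AE t in lborel. t \<noteq> 0 \<and> t \<noteq> T"
    using AE_lborel_singleton[of 0] AE_lborel_singleton[of T] by eventually_elim auto
  then have ne: "AE t in lebesgue. t \<noteq> 0 \<and> t \<noteq> T" by (simp only: AE_completion_iff)
  have "(AE t in lebesgue_on I. P t) \<longleftrightarrow> (AE t in lebesgue. t \<in> I \<longrightarrow> P t)"
    using assms by (subst AE_restrict_space_iff) auto
  also have "\<dots> \<longleftrightarrow> (AE t in lebesgue. 0 < t \<and> t < T \<longrightarrow> P t)"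
  proof
    assume "AE t in lebesgue. t \<in> I \<longrightarrow> P t"
    then show "AE t in lebesgue. 0 < t \<and> t < T \<longrightarrow> P t" by eventually_elim (use assms in auto)
  next
    assume "AE t in lebesgue. 0 < t \<and> t < T \<longrightarrow> P t"
    with ne show "AE t in lebesgue. t \<in> I \<longrightarrow> P t" by eventually_elim (use assms in force)
  qed
  finally show ?thesis unfolding time_AE_iff .
qed

lemma measurable_at_endpoints:
  fixes f :: "real \<Rightarrow> ennreal"
  assumes I: "{0<..<T} \<subseteq> I" "I \<subseteq> {0..T}" "I \<in> sets lebesgue"
    and f: "f \<in> borel_measurable (lebesgue_on {0<..<T})"
  shows "f \<in> borel_measurable (lebesgue_on I)"
proof (rule measurable_piecewise_restrict)
  show "countable {{0<..<T}, {0}, {T}}" by simp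
  show "space (lebesgue_on I) \<subseteq> \<Union> {{0<..<T}, {0}, {T}}" using I by force
  fix X assume X: "X \<in> {{0<..<T}, {0}, {T}}"
  then have XL: "X \<in> sets lebesgue" by auto
  then show "X \<inter> space (lebesgue_on I) \<in> sets (lebesgue_on I)"
    by (auto simp: sets_restrict_space)
  have r: "restrict_space (lebesgue_on I) X = lebesgue_on (I \<inter> X)"
    using I XL by (subst restrict_restrict_space) auto
  show "f \<in> borel_measurable (restrict_space (lebesgue_on I) X)"
  proof (cases "X = {0<..<T}")
    case True
    then have "I \<inter> X = {0<..<T}" using I by auto
    then show ?thesis unfolding r using f by simp
  next
    case False
    then obtain a where a: "X = {a}" using X by auto
    then have "f \<in> borel_measurable (lebesgue_on (I \<inter> X)) \<longleftrightarrow> (\<lambda>_. f a) \<in> borel_measurable (lebesgue_on (I \<inter> X))"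
      by (intro measurable_cong) auto
    then show ?thesis unfolding r by simp
  qed
qed

lemma nn_integral_at_endpoints:
  fixes f :: "real \<Rightarrow> ennreal"
  assumes I: "{0<..<T} \<subseteq> I" "I \<subseteq> {0..T}" "I \<in> sets lebesgue"
  shows "(\<integral>\<^sup>+t. f t \<partial>lebesgue_on I) = (\<integral>\<^sup>+t. f t \<partial>lebesgue_on {0<..<T})"
proof -
  have "AE t in lborel. t \<noteq> 0 \<and> t \<noteq> T"
    using AE_lborel_singleton[of 0] AE_lborel_singleton[of T] by eventually_elim auto
  then have ne: "AE t in lebesgue. t \<noteq> 0 \<and> t \<noteq> T" by (simp only: AE_completion_iff)
  have "(\<integral>\<^sup>+t. f t \<partial>lebesgue_on I) = (\<integral>\<^sup>+t. f t * indicator I t \<partial>lebesgue)"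
    using I by (subst nn_integral_restrict_space) auto
  also have "\<dots> = (\<integral>\<^sup>+t. f t * indicator {0<..<T} t \<partial>lebesgue)"
  proof (rule nn_integral_cong_AE)
    show "AE t in lebesgue. f t * indicator I t = f t * indicator {0<..<T} t"
      using ne
    proof eventually_elim
      case (elim t)
      have "t \<in> I \<longleftrightarrow> t \<in> {0<..<T}"
      proof
        assume "t \<in> I"
        then have "t \<in> {0..T}" using I(2) by blast
        then show "t \<in> {0<..<T}" using elim by auto
      next
        assume "t \<in> {0<..<T}" then show "t \<in> I" using I(1) by blast
      qed
      then show ?case by (simp add: indicator_def)
    qed
  qed
  also have "\<dots> = (\<integral>\<^sup>+t. f t \<partial>lebesgue_on {0<..<T})"
    by (subst nn_integral_restrict_space) auto
  finally show ?thesis .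
qed

text \<open>Local approximants are glued along the disjoint differences of the intervals
  \<open>{0..<stp T j}\<close>. The n-th approximant uses the first n + 1 pieces and the filler z
  elsewhere, so it has finitely many values; at a fixed time it eventually follows the approximants
  of one piece.\<close>

lemma strongly_measurable_exhaust:
  fixes u :: "real \<Rightarrow> 'f::minus"
  assumes T: "0 < T" and z: "z \<in> X"
    and I: "{0..<T} \<subseteq> I" "I \<subseteq> {0..T}" "I \<in> sets lebesgue"
    and sm: "\<And>T'. 0 < T' \<Longrightarrow> T' < T \<Longrightarrow> strongly_measurable {0..<T'} X N u"
  shows "strongly_measurable I X N u"
proof -
  have "\<forall>j. \<exists>s. (\<forall>n::nat. simple_function (lebesgue_on {0..<stp T j}) (s n) \<and> s n ` {0..<stp T j} \<subseteq> X) \<and>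
          (AE t in lebesgue_on {0..<stp T j}. (\<lambda>n. N (s n t - u t)) \<longlonglongrightarrow> 0)"
    using sm[OF stp_bounds[OF T]] unfolding strongly_measurable_def by blast
  from choice[OF this] obtain s where s0: "\<forall>j. (\<forall>n::nat. simple_function (lebesgue_on {0..<stp T j}) (s j n) \<and> s j n ` {0..<stp T j} \<subseteq> X) \<and>
          (AE t in lebesgue_on {0..<stp T j}. (\<lambda>n. N (s j n t - u t)) \<longlonglongrightarrow> 0)"
    by (elim exE)
  have s: "simple_function (lebesgue_on {0..<stp T j}) (s j n)" "s j n ` {0..<stp T j} \<subseteq> X"
    "AE t in lebesgue_on {0..<stp T j}. (\<lambda>n. N (s j n t - u t)) \<longlonglongrightarrow> 0" for j n
    using s0 by simp_all
  define A where "A j = {0..<stp T j}" for j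
  define piece where "piece j = A j - (\<Union>i<j. A i)" for j
  define F where "F n = rec_nat (\<lambda>t. z) (\<lambda>j g t. if t \<in> piece j then s j n t else g t)" for n :: nat
  have F0: "F n 0 = (\<lambda>t. z)" and FS: "F n (Suc j) = (\<lambda>t. if t \<in> piece j then s j n t else F n j t)" for n j
    by (auto simp: F_def)
  have AI: "A j \<subseteq> I" "A j \<in> sets lebesgue" for j using I stp_bounds[OF T, of j] by (auto simp: A_def)
  have A_sets: "B \<inter> space (lebesgue_on I) \<in> sets (lebesgue_on I)" if "B \<in> sets lebesgue" for B
    using that by (auto simp: sets_restrict_space)
  \<comment> \<open>\<open>s j n\<close> is known to be simple on \<open>A j\<close> only, so it is
    extended by z before it is used on I.\<close>
  have ext: "simple_function (lebesgue_on I) (\<lambda>t. if t \<in> A j then s j n t else z)" for j n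
    unfolding simple_function_def
  proof (intro conjI ballI)
    have sf: "simple_function (lebesgue_on (A j)) (s j n)" using s(1) by (simp add: A_def)
    have "(\<lambda>t. if t \<in> A j then s j n t else z) ` space (lebesgue_on I) \<subseteq> insert z (s j n ` space (lebesgue_on (A j)))"
      by auto
    then show "finite ((\<lambda>t. if t \<in> A j then s j n t else z) ` space (lebesgue_on I))"
      using simple_functionD(1)[OF sf] finite_subset by blast
    fix y
    have 1: "s j n -` {y} \<inter> A j \<in> sets lebesgue"
      using simple_functionD(2)[OF sf, of "{y}"] AI(2)[of j] by (auto simp: sets_restrict_space)
    have "(\<lambda>t. if t \<in> A j then s j n t else z) -` {y} \<inter> I = (s j n -` {y} \<inter> A j) \<union> (if z = y then I - A j else {})"
      using AI(1)[of j] by (auto split: if_splits)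
    moreover have "\<dots> \<in> sets lebesgue" using 1 AI(2)[of j] I(3) by auto
    ultimately have "(\<lambda>t. if t \<in> A j then s j n t else z) -` {y} \<inter> I \<in> sets lebesgue" by simp
    then show "(\<lambda>t. if t \<in> A j then s j n t else z) -` {y} \<inter> space (lebesgue_on I) \<in> sets (lebesgue_on I)"
      by (auto simp: sets_restrict_space image_iff intro!: bexI[of _ "(\<lambda>t. if t \<in> A j then s j n t else z) -` {y} \<inter> I"])
  qed
  have simple: "simple_function (lebesgue_on I) (F n j)" for n j
  proof (induction j)
    case (Suc j)
    have "simple_function (lebesgue_on I) (\<lambda>t. if t \<in> piece j then (if t \<in> A j then s j n t else z) else F n j t)"
      by (rule simple_function_If_set[OF ext Suc A_sets]) (use AI(2) in \<open>auto simp: piece_def\<close>)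
    moreover have "(\<lambda>t. if t \<in> piece j then (if t \<in> A j then s j n t else z) else F n j t) = F n (Suc j)"
      by (auto simp: FS piece_def fun_eq_iff)
    ultimately show ?case by simp
  qed (simp add: F0)
  have FX: "F n j t \<in> X" for n j t
  proof (induction j)
    case (Suc j)
    show ?case
    proof (cases "t \<in> piece j")
      case True
      then have "t \<in> A j" by (simp add: piece_def)
      then show ?thesis using True s(2)[of j n] by (auto simp: FS A_def)
    qed (simp add: FS Suc)
  qed (simp add: F0 z)
  have disj: "t \<in> piece i \<Longrightarrow> t \<in> piece j \<Longrightarrow> i = j" for t i j
    unfolding piece_def by (metis DiffD1 DiffD2 UN_I lessThan_iff linorder_neqE_nat)
  have Fval: "F n m t = s j n t" if "t \<in> piece j" "j < m" for n m t j
    using that(2)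
  proof (induction m)
    case (Suc m)
    show ?case
    proof (cases "j = m")
      case False
      then have "t \<notin> piece m" using disj that(1) by blast
      then show ?thesis using Suc False by (simp add: FS)
    qed (use that in \<open>simp add: FS\<close>)
  qed simp
  have conv: "AE t in lebesgue_on I. (\<lambda>n. N (F n (Suc n) t - u t)) \<longlonglongrightarrow> 0"
  proof -
    have "AE t in lebesgue. \<forall>j. t \<in> A j \<longrightarrow> (\<lambda>n. N (s j n t - u t)) \<longlonglongrightarrow> 0"
      unfolding AE_all_countable
    proof
      fix j show "AE t in lebesgue. t \<in> A j \<longrightarrow> (\<lambda>n. N (s j n t - u t)) \<longlonglongrightarrow> 0"
        using s(3)[of j] unfolding A_def by (subst (asm) AE_restrict_space_iff) auto
    qed
    then have "AE t in lebesgue. 0 < t \<and> t < T \<longrightarrow> (\<lambda>n. N (F n (Suc n) t - u t)) \<longlonglongrightarrow> 0"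
    proof eventually_elim
      case (elim t)
      show ?case
      proof
        assume t: "0 < t \<and> t < T"
        \<comment> \<open>The least index puts t into the piece not covered by earlier
          intervals.\<close>
        define j where "j = (LEAST j. t < stp T j)"
        have "t < stp T j" unfolding j_def using stp_exceeds[OF T, of t] t by (auto intro: LeastI_ex)
        moreover have "\<not> t < stp T i" if "i < j" for i using that not_less_Least unfolding j_def by blast
        ultimately have p: "t \<in> piece j" using t by (auto simp: piece_def A_def)
        then have "(\<lambda>n. N (s j n t - u t)) \<longlonglongrightarrow> 0" using elim by (auto simp: piece_def)
        then show "(\<lambda>n. N (F n (Suc n) t - u t)) \<longlonglongrightarrow> 0"
          by (rule Lim_transform_eventually) (use Fval[OF p] in \<open>auto simp: eventually_sequentially intro!: exI[of _ j]\<close>)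
      qed
    qed
    then have "AE t in lebesgue_on {0<..<T}. (\<lambda>n. N (F n (Suc n) t - u t)) \<longlonglongrightarrow> 0" unfolding time_AE_iff .
    moreover have "{0<..<T} \<subseteq> I" using I(1) by auto
    ultimately show ?thesis using AE_at_endpoints[OF _ I(2,3)] by blast
  qed
  show ?thesis
    unfolding strongly_measurable_def
    by (rule exI[of _ "\<lambda>n. F n (Suc n)"]) (use simple FX conv in auto)
qed

subsection \<open>Estimates at a fixed time\<close>

lemma torus_smooth_bounded:
  fixes \<psi> :: "real^2 \<Rightarrow> 'b::euclidean_space"
  assumes "continuous_on UNIV \<psi>"
  obtains B where "0 \<le> B" "AE x in torus. norm (\<psi> x) \<le> B"
proof -
  have "compact (\<psi> ` cbox 0 ((2 * pi) *\<^sub>R One))"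
    by (intro compact_continuous_image continuous_on_subset[OF assms]) auto
  then obtain B where B: "\<And>x. x \<in> cbox 0 ((2 * pi) *\<^sub>R One) \<Longrightarrow> norm (\<psi> x) \<le> B"
    by (meson bounded_iff compact_imp_bounded image_eqI)
  then have "AE x in torus. norm (\<psi> x) \<le> \<bar>B\<bar>"
    by (intro AE_I2) (force simp: space_torus)
  then show ?thesis using that[of "\<bar>B\<bar>"] by simp
qed

lemma L2_inner_bound:
  fixes g \<psi> :: "real^2 \<Rightarrow> real^2"
  assumes g: "integrable torus g" and \<psi>: "continuous_on UNIV \<psi>" "AE x in torus. norm (\<psi> x) \<le> B" "0 \<le> B"
  shows "\<bar>L2_inner g \<psi>\<bar> \<le> B * ((LINT x|torus. \<bar>g x \<bullet> e1\<bar>) + (LINT x|torus. \<bar>g x \<bullet> e2\<bar>))"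
proof -
  have i: "integrable torus (\<lambda>x. \<bar>g x \<bullet> v\<bar>)" for v using g by auto
  have [measurable]: "g \<in> borel_measurable torus" "\<psi> \<in> borel_measurable torus"
    using g torus_measurable_continuous[OF \<psi>(1)] by auto
  have "\<bar>L2_inner g \<psi>\<bar> \<le> (LINT x|torus. \<bar>g x \<bullet> \<psi> x\<bar>)"
    unfolding L2_inner_def by (rule integral_abs_bound)
  also have "\<dots> \<le> (LINT x|torus. B * (\<bar>g x \<bullet> e1\<bar> + \<bar>g x \<bullet> e2\<bar>))"
  proof (rule integral_mono_AE)
    show "integrable torus (\<lambda>x. B * (\<bar>g x \<bullet> e1\<bar> + \<bar>g x \<bullet> e2\<bar>))" using i by auto
    have pw: "AE x in torus. \<bar>g x \<bullet> \<psi> x\<bar> \<le> B * (\<bar>g x \<bullet> e1\<bar> + \<bar>g x \<bullet> e2\<bar>)"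
      using \<psi>(2)
    proof eventually_elim
      case (elim x)
      have "\<bar>g x \<bullet> \<psi> x\<bar> \<le> norm (g x) * norm (\<psi> x)" by (rule Cauchy_Schwarz_ineq2)
      also have "\<dots> \<le> (\<bar>g x \<bullet> e1\<bar> + \<bar>g x \<bullet> e2\<bar>) * B"
        using elim norm_le_l1[of "g x"] by (intro mult_mono) (auto simp: sum_Basis_real2)
      finally show ?case by (simp add: mult.commute)
    qed
    then show "AE x in torus. \<bar>g x \<bullet> \<psi> x\<bar> \<le> B * (\<bar>g x \<bullet> e1\<bar> + \<bar>g x \<bullet> e2\<bar>)" .
    show "integrable torus (\<lambda>x. \<bar>g x \<bullet> \<psi> x\<bar>)"
    proof (rule Bochner_Integration.integrable_bound)
      show "integrable torus (\<lambda>x. B * (\<bar>g x \<bullet> e1\<bar> + \<bar>g x \<bullet> e2\<bar>))" using i by auto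
      show "AE x in torus. norm \<bar>g x \<bullet> \<psi> x\<bar> \<le> norm (B * (\<bar>g x \<bullet> e1\<bar> + \<bar>g x \<bullet> e2\<bar>))"
        using pw by eventually_elim (use \<psi>(3) in auto)
    qed measurable
  qed
  also have "\<dots> = B * ((LINT x|torus. \<bar>g x \<bullet> e1\<bar>) + (LINT x|torus. \<bar>g x \<bullet> e2\<bar>))" using i by simp
  finally show ?thesis .
qed

text \<open>From |g| \<le> (1 + g^2) / 2 and Parseval. The bound is affine in S instead of involving
  a root, and the factor is half of the area 4 pi^2.\<close>

lemma abs_integral_fser:
  fixes g :: "real^2 \<Rightarrow> real"
  assumes a: "summable (\<lambda>k. cmod (a k))" and g: "integrable torus g" "AE x in torus. complex_of_real (g x) = fser a x"
    and S: "summable (\<lambda>k. (cmod (a k))\<^sup>2)" "(\<Sum>k. (cmod (a k))\<^sup>2) \<le> S"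
  shows "(LINT x|torus. \<bar>g x\<bar>) \<le> 2 * pi\<^sup>2 * (1 + S)"
proof -
  have F: "integrable torus (\<lambda>x. (cmod (fser a x))\<^sup>2)"
    by (intro torus_integrable_continuous continuous_intros continuous_on_fser a)
  have "(LINT x|torus. \<bar>g x\<bar>) \<le> (LINT x|torus. (1 + (cmod (fser a x))\<^sup>2) / 2)"
  proof (rule integral_mono_AE)
    show "integrable torus (\<lambda>x. (1 + (cmod (fser a x))\<^sup>2) / 2)" using F by auto
    show "AE x in torus. \<bar>g x\<bar> \<le> (1 + (cmod (fser a x))\<^sup>2) / 2"
      using g(2)
    proof eventually_elim
      case (elim x)
      have "cmod (fser a x) = \<bar>g x\<bar>" unfolding elim[symmetric] by simp
      then show ?case using sum_squares_bound[of 1 "\<bar>g x\<bar>"] by simp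
    qed
  qed (use g in auto)
  also have "\<dots> = (4 * pi\<^sup>2 + (LINT x|torus. (cmod (fser a x))\<^sup>2)) / 2"
    using F by (simp add: measure_space_torus power_mult_distrib)
  also have "(LINT x|torus. (cmod (fser a x))\<^sup>2) = 4 * pi\<^sup>2 * (\<Sum>k. (cmod (a k))\<^sup>2)"
    using sums_unique[OF fser_parseval[OF a]] by (simp add: field_simps)
  also have "(4 * pi\<^sup>2 + 4 * pi\<^sup>2 * (\<Sum>k. (cmod (a k))\<^sup>2)) / 2 \<le> 2 * pi\<^sup>2 * (1 + S)"
    using S(2) by (simp add: algebra_simps)
  finally show ?thesis .
qed

definition nlc :: "(real^2 \<Rightarrow> real^2) \<Rightarrow> real^2 \<Rightarrow> nat \<Rightarrow> complex" where
  "nlc f b k = cf (convection f f) b k"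

definition qf :: "(real^2 \<Rightarrow> real^2) \<Rightarrow> nat \<Rightarrow> real" where
  "qf f k = (\<Sum>b\<in>Basis. Re (cnj (cf f b k) * nlc f b k))"

definition nlsq :: "(real^2 \<Rightarrow> real^2) \<Rightarrow> nat \<Rightarrow> real" where
  "nlsq f k = (\<Sum>b\<in>Basis. (cmod (nlc f b k))\<^sup>2)"

lemma qf_square: "(qf f k)\<^sup>2 \<le> pw f k * nlsq f k"
proof -
  have cs: "(x1 * y1 + x2 * y2)\<^sup>2 \<le> (x1\<^sup>2 + x2\<^sup>2) * (y1\<^sup>2 + y2\<^sup>2)" for x1 x2 y1 y2 :: real
    using zero_le_power2[of "x1 * y2 - x2 * y1"] by (simp add: power2_eq_square algebra_simps)
  have re: "\<bar>Re (cnj x * y)\<bar> \<le> cmod x * cmod y" for x y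
    using abs_Re_le_cmod[of "cnj x * y"] by (simp add: norm_mult)
  have "\<bar>qf f k\<bar> \<le> cmod (cf f e1 k) * cmod (nlc f e1 k) + cmod (cf f e2 k) * cmod (nlc f e2 k)"
    unfolding qf_def sum_Basis_real2
    by (intro order_trans[OF abs_triangle_ineq] add_mono re)
  then have "(qf f k)\<^sup>2 \<le> (cmod (cf f e1 k) * cmod (nlc f e1 k) + cmod (cf f e2 k) * cmod (nlc f e2 k))\<^sup>2"
    by (intro abs_le_square_iff[THEN iffD1]) simp
  also have "\<dots> \<le> pw f k * nlsq f k" unfolding pw_def nlsq_def sum_Basis_real2 by (rule cs)
  finally show ?thesis .
qed

definition Ssum :: "(real^2 \<Rightarrow> real^2) \<Rightarrow> real" where
  "Ssum f = (\<Sum>k. (1 + fsq k)\<^sup>2 * pw f k)"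

context smooth_field
begin

lemma B12: "e1 \<in> Basis" "e2 \<in> Basis" by (auto simp: Basis_real2)

lemma nlc_nh: "b \<in> Basis \<Longrightarrow> nlc f b k = nf.nh b k"
  unfolding nlc_def by (rule cf_convection)

lemma weighted_pw:
  assumes "summable (\<lambda>k. w k * pw f k)" "\<And>k. 0 \<le> w k"
  shows "b \<in> Basis \<Longrightarrow> summable (\<lambda>k. w k * (cmod (cf f b k))\<^sup>2)"
    "(\<Sum>k. w k * pw f k) = (\<Sum>b\<in>Basis. \<Sum>k. w k * (cmod (cf f b k))\<^sup>2)"
proof -
  show s: "summable (\<lambda>k. w k * (cmod (cf f b k))\<^sup>2)" if b: "b \<in> Basis" for b
  proof (rule summable_comparison_test'[OF assms(1)])
    fix k
    have "(cmod (cf f b k))\<^sup>2 \<le> pw f k" unfolding pw_def using b by (intro member_le_sum) auto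
    then show "norm (w k * (cmod (cf f b k))\<^sup>2) \<le> w k * pw f k" using assms(2)[of k] by (simp add: mult_left_mono)
  qed
  show "(\<Sum>k. w k * pw f k) = (\<Sum>b\<in>Basis. \<Sum>k. w k * (cmod (cf f b k))\<^sup>2)"
    unfolding pw_def sum_distrib_left by (rule suminf_sum) (rule s)
qed

text \<open>The factor 8 collects the 4 of \<open>convection_bound\<close> for each of the two
  components.\<close>

lemma convection_square_sum:
  assumes S: "summable (\<lambda>k. (1 + fsq k)\<^sup>2 * pw f k)"
  shows "summable (nlsq f)" "(\<Sum>k. nlsq f k) \<le> 8 * Cw * (Ssum f)\<^sup>2"
proof -
  note w = weighted_pw[OF S]
  have Ss: "Ssum f = (\<Sum>b\<in>Basis. \<Sum>k. (1 + fsq k)\<^sup>2 * (cmod (cf f b k))\<^sup>2)"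
    unfolding Ssum_def by (rule w(2)) simp
  have cb: "summable (\<lambda>k. (cmod (nf.nh b k))\<^sup>2)" "(\<Sum>k. (cmod (nf.nh b k))\<^sup>2) \<le> 4 * Cw * (Ssum f)\<^sup>2" if "b \<in> Basis" for b
    using nf.convection_bound[OF w(1) Ss that] by auto
  have nfe: "nlsq f k = (cmod (nf.nh e1 k))\<^sup>2 + (cmod (nf.nh e2 k))\<^sup>2" for k
    by (simp add: nlsq_def sum_Basis_real2 nlc_nh B12)
  show "summable (nlsq f)" unfolding nfe[abs_def] by (intro summable_add cb B12)
  have "(\<Sum>k. nlsq f k) = (\<Sum>k. (cmod (nf.nh e1 k))\<^sup>2) + (\<Sum>k. (cmod (nf.nh e2 k))\<^sup>2)"
    unfolding nfe by (rule suminf_add[symmetric]) (intro cb B12)+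
  then show "(\<Sum>k. nlsq f k) \<le> 8 * Cw * (Ssum f)\<^sup>2" using cb(2)[OF B12(1)] cb(2)[OF B12(2)] by simp
qed

lemma qf_sum_bound:
  assumes S: "summable (\<lambda>k. (1 + fsq k)\<^sup>2 * pw f k)"
    and W: "AE x in torus. cmod (fser ((cf f e1)(nf.k0 := 0)) x) \<le> W"
  shows "\<bar>\<Sum>k. qf f k\<bar> \<le> (\<Sum>k. fsq k * pw f k) / 2 + W\<^sup>2 * (\<Sum>k. pw f k)"
proof -
  have "(\<lambda>k. \<Sum>b\<in>Basis. cnj (cf f b k) * nf.nh b k) sums (\<Sum>b\<in>Basis. (LINT x|torus. nf.N b x * fser (cf f b) x) / (4 * pi\<^sup>2))"
    by (intro sums_sum nf.energy_pairing)
  then have "(\<lambda>k. Re (\<Sum>b\<in>Basis. cnj (cf f b k) * nf.nh b k)) sums Re (\<Sum>b\<in>Basis. (LINT x|torus. nf.N b x * fser (cf f b) x) / (4 * pi\<^sup>2))"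
    by (rule sums_Re)
  moreover have "Re (\<Sum>b\<in>Basis. cnj (cf f b k) * nf.nh b k) = qf f k" for k
    unfolding qf_def Re_sum by (intro sum.cong refl) (simp add: nlc_nh)
  ultimately have "(\<Sum>k. qf f k) = Re (\<Sum>b\<in>Basis. (LINT x|torus. nf.N b x * fser (cf f b) x) / (4 * pi\<^sup>2))"
    by (simp only: sums_iff)
  then have "\<bar>\<Sum>k. qf f k\<bar> \<le> cmod (\<Sum>b\<in>Basis. (LINT x|torus. nf.N b x * fser (cf f b) x) / (4 * pi\<^sup>2))"
    by (simp only: abs_Re_le_cmod)
  also have "\<dots> \<le> (\<Sum>b\<in>Basis. \<Sum>k. fsq k * (cmod (cf f b k))\<^sup>2) / 2 + W\<^sup>2 * (\<Sum>b\<in>Basis. \<Sum>k. (cmod (cf f b k))\<^sup>2)"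
    by (rule nf.convection_cancel) (use W in \<open>simp add: nf.w0_def\<close>)
  also have "(\<Sum>b\<in>Basis. \<Sum>k. fsq k * (cmod (cf f b k))\<^sup>2) = (\<Sum>k. fsq k * pw f k)"
  proof (rule weighted_pw(2)[symmetric])
    show "summable (\<lambda>k. fsq k * pw f k)"
    proof (rule summable_comparison_test'[OF S])
      fix k
      have "fsq k \<le> (1 + fsq k)\<^sup>2" using fsq_nonneg[of k] by (simp add: power2_eq_square algebra_simps)
      then show "norm (fsq k * pw f k) \<le> (1 + fsq k)\<^sup>2 * pw f k" by (simp add: mult_right_mono)
    qed
  qed simp
  also have "(\<Sum>b\<in>Basis. \<Sum>k. (cmod (cf f b k))\<^sup>2) = (\<Sum>k. pw f k)"
  proof -
    have "summable (\<lambda>k. 1 * pw f k)"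
    proof (rule summable_comparison_test'[OF S])
      fix k
      have "1 \<le> (1 + fsq k)\<^sup>2" by (rule one_le_power) simp
      then show "norm (1 * pw f k) \<le> (1 + fsq k)\<^sup>2 * pw f k" using mult_right_mono[of 1 "(1 + fsq k)\<^sup>2" "pw f k"] by simp
    qed
    from weighted_pw(2)[OF this] show ?thesis by simp
  qed
  finally show ?thesis .
qed

text \<open>One criterion covers u, its first derivatives and its Laplacian, whose coefficients are
  all at most \<open>1 + fsq k\<close> times those of u in modulus.\<close>

lemma coefficient_sums:
  assumes S: "summable (\<lambda>k. (1 + fsq k)\<^sup>2 * pw f k)" and b: "b \<in> Basis" and a: "\<And>k. cmod (a k) \<le> (1 + fsq k) * cmod (cf f b k)"
  shows "summable (\<lambda>k. cmod (a k))" "summable (\<lambda>k. (cmod (a k))\<^sup>2)" "(\<Sum>k. (cmod (a k))\<^sup>2) \<le> Ssum f"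
proof -
  have w: "summable (\<lambda>k. (1 + fsq k)\<^sup>2 * (cmod (cf f b k))\<^sup>2)"
    by (rule weighted_pw(1)[OF S _ b]) simp
  show "summable (\<lambda>k. cmod (a k))"
    using nice_cf[OF b] unfolding nice_def by (rule summable_comparison_test') (use a in simp)
  have le: "(cmod (a k))\<^sup>2 \<le> (1 + fsq k)\<^sup>2 * (cmod (cf f b k))\<^sup>2" for k
    using power_mono[OF a[of k], of 2] by (simp add: power_mult_distrib)
  show s: "summable (\<lambda>k. (cmod (a k))\<^sup>2)"
    by (rule summable_comparison_test'[OF w]) (use le in simp)
  show "(\<Sum>k. (cmod (a k))\<^sup>2) \<le> Ssum f"
    unfolding Ssum_def
  proof (rule suminf_le[OF _ s S])
    fix k
    have "(cmod (cf f b k))\<^sup>2 \<le> pw f k" unfolding pw_def using b by (intro member_le_sum) auto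
    then show "(cmod (a k))\<^sup>2 \<le> (1 + fsq k)\<^sup>2 * pw f k"
      using le[of k] mult_left_mono[of "(cmod (cf f b k))\<^sup>2" "pw f k" "(1 + fsq k)\<^sup>2"] by simp
  qed
qed

lemma weight_ge: "cmod z \<le> (1 + fsq k) * cmod z" "fsq k * cmod z \<le> (1 + fsq k) * cmod z"
  "j \<in> Basis \<Longrightarrow> \<bar>freq k \<bullet> j\<bar> * cmod z \<le> (1 + fsq k) * cmod z"
  using mult_right_mono[of 1 "1 + fsq k" "cmod z"] abs_freq_inner(1)[of j k] by (auto intro!: mult_right_mono)

text \<open>With a bounded H^2 norm these estimates make every term of the weak equation bounded in
  time. For the convection term, Young's inequality leaves half of four square integrals, each at
  most \<open>4 * pi\<^sup>2 * Ssum f\<close>.\<close>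

lemma integral_abs_bounds:
  assumes S: "summable (\<lambda>k. (1 + fsq k)\<^sup>2 * pw f k)" and b: "b \<in> Basis"
  shows "(LINT x|torus. \<bar>f x \<bullet> b\<bar>) \<le> 2 * pi\<^sup>2 * (1 + Ssum f)"
    "j \<in> Basis \<Longrightarrow> (LINT x|torus. \<bar>weak_partial j f x \<bullet> b\<bar>) \<le> 2 * pi\<^sup>2 * (1 + Ssum f)"
    "(LINT x|torus. \<bar>weak_laplacian f x \<bullet> b\<bar>) \<le> 2 * pi\<^sup>2 * (1 + Ssum f)"
    "(LINT x|torus. \<bar>convection f f x \<bullet> b\<bar>) \<le> 8 * pi\<^sup>2 * Ssum f"
proof -
  have c0: "cmod (cf f b k) \<le> (1 + fsq k) * cmod (cf f b k)" if "b \<in> Basis" for b k by (rule weight_ge)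
  have c1: "cmod (dcoef j (cf f b) k) \<le> (1 + fsq k) * cmod (cf f b k)" if "j \<in> Basis" for j b k
    unfolding cmod_dcoef by (rule weight_ge(3)[OF that])
  have c2: "cmod (cf (weak_laplacian f) b k) \<le> (1 + fsq k) * cmod (cf f b k)" for k
    unfolding weak_laplacian(2) by (simp add: norm_mult weight_ge)
  note C0 = coefficient_sums[OF S _ c0] and C1 = coefficient_sums[OF S _ c1] and C2 = coefficient_sums[OF S b c2]
  show "(LINT x|torus. \<bar>f x \<bullet> b\<bar>) \<le> 2 * pi\<^sup>2 * (1 + Ssum f)"
    by (rule abs_integral_fser[OF C0(1)[OF b b] _ f_fser[OF b] C0(2,3)[OF b b]]) (use f in auto)
  show "(LINT x|torus. \<bar>weak_partial j f x \<bullet> b\<bar>) \<le> 2 * pi\<^sup>2 * (1 + Ssum f)" if j: "j \<in> Basis"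
    by (rule abs_integral_fser[OF C1(1)[OF b j] _ weak1_fser[OF j b] C1(2,3)[OF b j]]) (use weak1(1)[OF j] in auto)
  show "(LINT x|torus. \<bar>weak_laplacian f x \<bullet> b\<bar>) \<le> 2 * pi\<^sup>2 * (1 + Ssum f)"
    by (rule abs_integral_fser[OF C2(1) _ AE_cf_fser[OF weak_laplacian(1) C2(1)] C2(2,3)]) (use weak_laplacian(1) in auto)
  have sq: "(LINT x|torus. (cmod (fser (cf f j) x))\<^sup>2) \<le> 4 * pi\<^sup>2 * Ssum f" "(LINT x|torus. (cmod (fser (dcoef j (cf f b)) x))\<^sup>2) \<le> 4 * pi\<^sup>2 * Ssum f"
    if j: "j \<in> Basis" for j
  proof -
    show "(LINT x|torus. (cmod (fser (cf f j) x))\<^sup>2) \<le> 4 * pi\<^sup>2 * Ssum f"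
      using sums_unique[OF fser_parseval[OF C0(1)[OF j j]]] C0(3)[OF j j] by (simp add: field_simps)
    show "(LINT x|torus. (cmod (fser (dcoef j (cf f b)) x))\<^sup>2) \<le> 4 * pi\<^sup>2 * Ssum f"
      using sums_unique[OF fser_parseval[OF C1(1)[OF b j]]] C1(3)[OF b j] by (simp add: field_simps)
  qed
  have I: "integrable torus (\<lambda>x. (cmod (fser (cf f j) x))\<^sup>2)" "integrable torus (\<lambda>x. (cmod (fser (dcoef j (cf f b)) x))\<^sup>2)" if j: "j \<in> Basis" for j
    by (intro torus_integrable_continuous continuous_intros continuous_on_fser C0(1)[OF j j] C1(1)[OF b j])+
  have "(LINT x|torus. \<bar>convection f f x \<bullet> b\<bar>) \<le> (LINT x|torus. ((cmod (fser (cf f e1) x))\<^sup>2 + (cmod (fser (dcoef e1 (cf f b)) x))\<^sup>2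
      + (cmod (fser (cf f e2) x))\<^sup>2 + (cmod (fser (dcoef e2 (cf f b)) x))\<^sup>2) / 2)"
  proof (rule integral_mono_AE)
    show "integrable torus (\<lambda>x. \<bar>convection f f x \<bullet> b\<bar>)" using convection_integrable by auto
    show "integrable torus (\<lambda>x. ((cmod (fser (cf f e1) x))\<^sup>2 + (cmod (fser (dcoef e1 (cf f b)) x))\<^sup>2
      + (cmod (fser (cf f e2) x))\<^sup>2 + (cmod (fser (dcoef e2 (cf f b)) x))\<^sup>2) / 2)"
      using I B12 by auto
    show "AE x in torus. \<bar>convection f f x \<bullet> b\<bar> \<le> ((cmod (fser (cf f e1) x))\<^sup>2 + (cmod (fser (dcoef e1 (cf f b)) x))\<^sup>2
      + (cmod (fser (cf f e2) x))\<^sup>2 + (cmod (fser (dcoef e2 (cf f b)) x))\<^sup>2) / 2"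
      using convection_N[OF b]
    proof eventually_elim
      case (elim x)
      have "\<bar>convection f f x \<bullet> b\<bar> = cmod (nf.N b x)" unfolding elim[symmetric] by simp
      also have "\<dots> \<le> cmod (fser (cf f e1) x) * cmod (fser (dcoef e1 (cf f b)) x) + cmod (fser (cf f e2) x) * cmod (fser (dcoef e2 (cf f b)) x)"
        unfolding nf.N_def sum_Basis_real2 norm_mult[symmetric] by (rule norm_triangle_ineq)
      finally show ?case
        using sum_squares_bound[of "cmod (fser (cf f e1) x)" "cmod (fser (dcoef e1 (cf f b)) x)"]
          sum_squares_bound[of "cmod (fser (cf f e2) x)" "cmod (fser (dcoef e2 (cf f b)) x)"] by simp
    qed
  qed
  also have "\<dots> = ((LINT x|torus. (cmod (fser (cf f e1) x))\<^sup>2) + (LINT x|torus. (cmod (fser (dcoef e1 (cf f b)) x))\<^sup>2)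
      + (LINT x|torus. (cmod (fser (cf f e2) x))\<^sup>2) + (LINT x|torus. (cmod (fser (dcoef e2 (cf f b)) x))\<^sup>2)) / 2"
    using I[OF B12(1)] I[OF B12(2)] by simp
  also have "\<dots> \<le> 8 * pi\<^sup>2 * Ssum f" using sq[OF B12(1)] sq[OF B12(2)] by simp
  finally show "(LINT x|torus. \<bar>convection f f x \<bullet> b\<bar>) \<le> 8 * pi\<^sup>2 * Ssum f" .
qed

text \<open>The cosine yields the real part and the sine minus the imaginary part of the equation
  for one coefficient, because coefficients are taken against the conjugate mode.\<close>

lemma mode_equation:
  assumes b: "b \<in> Basis"
  shows "L2_inner (convection f f) (\<lambda>x. Cmode k x *\<^sub>R b) + L2_inner (weak_laplacian f) (laplacian (\<lambda>x. Cmode k x *\<^sub>R b))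
      - lam * (\<Sum>j\<in>Basis. L2_inner (weak_partial j f) (partial j (\<lambda>x. Cmode k x *\<^sub>R b)))
      = 4 * pi\<^sup>2 * (Re (nlc f b k) + ((fsq k)\<^sup>2 - lam * fsq k) * Re (cf f b k))"
    "L2_inner (convection f f) (\<lambda>x. Smode k x *\<^sub>R b) + L2_inner (weak_laplacian f) (laplacian (\<lambda>x. Smode k x *\<^sub>R b))
      - lam * (\<Sum>j\<in>Basis. L2_inner (weak_partial j f) (partial j (\<lambda>x. Smode k x *\<^sub>R b)))
      = - (4 * pi\<^sup>2 * (Im (nlc f b k) + ((fsq k)\<^sup>2 - lam * fsq k) * Im (cf f b k)))"
proof -
  let ?C = "\<lambda>x. Cmode k x *\<^sub>R b" and ?S = "\<lambda>x. Smode k x *\<^sub>R b"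
  have pc: "partial j (\<lambda>x. c *\<^sub>R ?S x) = (\<lambda>x. (c * (freq k \<bullet> j)) *\<^sub>R ?C x)" "partial j (\<lambda>x. c *\<^sub>R ?C x) = (\<lambda>x. (- c * (freq k \<bullet> j)) *\<^sub>R ?S x)" for c j
  proof -
    show "partial j (\<lambda>x. c *\<^sub>R ?S x) = (\<lambda>x. (c * (freq k \<bullet> j)) *\<^sub>R ?C x)"
      using partial_CSmode(2)[of j k "c *\<^sub>R b"] by (simp add: fun_eq_iff mult_ac)
    show "partial j (\<lambda>x. c *\<^sub>R ?C x) = (\<lambda>x. (- c * (freq k \<bullet> j)) *\<^sub>R ?S x)"
      using partial_CSmode(1)[of j k "c *\<^sub>R b"] by (simp add: fun_eq_iff mult_ac)
  qed
  have lap: "laplacian ?C = (\<lambda>x. (- fsq k) *\<^sub>R ?C x)" "laplacian ?S = (\<lambda>x. (- fsq k) *\<^sub>R ?S x)"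
    unfolding laplacian_def partial_CSmode pc sum_Basis_real2 fsq_inner
    by (simp_all add: fun_eq_iff power2_eq_square scaleR_left_distrib[symmetric] algebra_simps)
  have sc: "L2_inner g (\<lambda>x. c *\<^sub>R h x) = c * L2_inner g h" for g h :: "real^2 \<Rightarrow> real^2" and c
    unfolding L2_inner_def by simp
  note LC = L2_inner_CSmode[OF convection_integrable b, of k, folded nlc_def] L2_inner_CSmode[OF weak_laplacian(1) b, of k]
    L2_inner_CSmode[OF weak1(1)[OF B12(1)] b, of k] L2_inner_CSmode[OF weak1(1)[OF B12(2)] b, of k]
  show "L2_inner (convection f f) ?C + L2_inner (weak_laplacian f) (laplacian ?C)
      - lam * (\<Sum>j\<in>Basis. L2_inner (weak_partial j f) (partial j ?C))
      = 4 * pi\<^sup>2 * (Re (nlc f b k) + ((fsq k)\<^sup>2 - lam * fsq k) * Re (cf f b k))"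
    unfolding lap partial_CSmode sc sum_Basis_real2 LC weak_laplacian(2) weak1(2)[OF B12(1)] weak1(2)[OF B12(2)] dcoef_def
    by (simp add: fsq_inner[of k] power2_eq_square algebra_simps)
  show "L2_inner (convection f f) ?S + L2_inner (weak_laplacian f) (laplacian ?S)
      - lam * (\<Sum>j\<in>Basis. L2_inner (weak_partial j f) (partial j ?S))
      = - (4 * pi\<^sup>2 * (Im (nlc f b k) + ((fsq k)\<^sup>2 - lam * fsq k) * Im (cf f b k)))"
    unfolding lap partial_CSmode sc sum_Basis_real2 LC weak_laplacian(2) weak1(2)[OF B12(1)] weak1(2)[OF B12(2)] dcoef_def
    by (simp add: fsq_inner[of k] power2_eq_square algebra_simps)
qed

end

subsection \<open>The equation for the Fourier coefficients\<close>

lemma sobolev_2: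
  assumes "f \<in> sobolev 2"
  shows "f \<in> L2_torus" "summable (\<lambda>k. (1 + fsq k)\<^sup>2 * pw f k)" "(sobolev_norm 2 f)\<^sup>2 = ennreal (Ssum f)" "0 \<le> Ssum f"
proof -
  have f: "f \<in> L2_torus" "sobolev_norm (real 2) f < \<infinity>" using assms by (auto simp: sobolev_def)
  show "f \<in> L2_torus" by (rule f)
  show s: "summable (\<lambda>k. (1 + fsq k)\<^sup>2 * pw f k)" using f(2) unfolding sobolev_norm_finite .
  have nn: "0 \<le> (1 + fsq k)\<^sup>2 * pw f k" for k by simp
  show "(sobolev_norm 2 f)\<^sup>2 = ennreal (Ssum f)"
    using sobolev_norm_eq[of 2 f] suminf_ennreal2[OF nn s] unfolding Ssum_def by (simp add: epowr_half_2)
  show "0 \<le> Ssum f" unfolding Ssum_def by (rule suminf_nonneg[OF s nn])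
qed

lemma L2_inner_cong_AE:
  assumes "f \<in> borel_measurable torus" "g \<in> borel_measurable torus" "AE x in torus. f x = g x"
    and "\<psi> \<in> borel_measurable torus"
  shows "L2_inner f \<psi> = L2_inner g \<psi>"
  unfolding L2_inner_def
  by (rule integral_cong_AE) (use assms in \<open>auto elim!: eventually_mono intro!: borel_measurable_inner\<close>)

locale kuramoto = littlewood_paley \<phi> for \<phi> :: "real^2 \<Rightarrow> real" +
  fixes T lam :: real and u0 :: "real^2 \<Rightarrow> real^2" and u :: "real \<Rightarrow> real^2 \<Rightarrow> real^2"
  assumes T: "0 < T" and u0: "u0 \<in> sobolev 2" and sol: "solution_on lam u0 T u"
    and bes: "(\<lambda>t. distribution_of (\<lambda>x. u t x $ 1)) \<in> bochner_besov \<phi> 2 {0<..<T} (1 / 2) \<infinity> \<infinity>"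
begin

lemma strong: "0 < T' \<Longrightarrow> T' < T \<Longrightarrow> strong_solution lam u0 T' u"
  using sol unfolding solution_on_def by blast

lemma interval_endpoints: "{0<..<T'} \<subseteq> {0..<T'}" "{0..<T'} \<subseteq> {0..T'}" "{0..<T'} \<in> sets lebesgue" for T' :: real
  by auto

lemma AE_sobolev:
  "AE t in lebesgue_on {0<..<T}. u t \<in> sobolev 2" "AE t in lebesgue_on {0<..<T}. u t \<in> sobolev 4"
proof -
  have "(AE t in lebesgue_on {0<..<T'}. u t \<in> sobolev 2) \<and> (AE t in lebesgue_on {0<..<T'}. u t \<in> sobolev 4)" if "0 < T'" "T' < T" for T'
    using strong[OF that] AE_at_endpoints[OF interval_endpoints] unfolding strong_solution_def bochner_def by blast
  then show "AE t in lebesgue_on {0<..<T}. u t \<in> sobolev 2" "AE t in lebesgue_on {0<..<T}. u t \<in> sobolev 4"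
    using AE_exhaust[OF T] by blast+
qed

lemma S_local:
  assumes "0 < T'" "T' < T"
  shows "\<exists>M. AE t in lebesgue_on {0<..<T'}. Ssum (u t) \<le> M"
proof -
  define K where "K = esssup (lebesgue_on {0..<T'}) (\<lambda>t. sobolev_norm 2 (u t))"
  have K: "K < \<infinity>"
    using strong[OF assms] unfolding strong_solution_def bochner_def Lp_norm_def K_def by simp
  have "AE t in lebesgue_on {0..<T'}. sobolev_norm 2 (u t) \<le> K"
    unfolding K_def by (rule esssup_AE)
  then have "AE t in lebesgue_on {0<..<T'}. sobolev_norm 2 (u t) \<le> K"
    using AE_at_endpoints[OF interval_endpoints] by blast
  moreover have "AE t in lebesgue_on {0<..<T'}. u t \<in> sobolev 2"
    using time_AE_sub[OF AE_sobolev(1), of 0 T'] assms by simp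
  ultimately have "AE t in lebesgue_on {0<..<T'}. Ssum (u t) \<le> enn2real (K\<^sup>2)"
  proof eventually_elim
    case (elim t)
    have "ennreal (Ssum (u t)) \<le> K\<^sup>2"
      using sobolev_2(3)[OF elim(2)] power_mono[OF elim(1), of 2] by simp
    moreover have "K\<^sup>2 < top" using K by (simp add: power_less_top_ennreal)
    ultimately show ?case
      using enn2real_mono[of "ennreal (Ssum (u t))" "K\<^sup>2"] sobolev_2(4)[OF elim(2)] by simp
  qed
  then show ?thesis by blast
qed

text \<open>The derivative of the pairing, solved for from the equation. The weak formulation
  provides a derivative separately for each T'; this formula is common to all of them.\<close>

definition rhs :: "(real^2 \<Rightarrow> real^2) \<Rightarrow> real \<Rightarrow> real" where
  "rhs \<psi> t = lam * (\<Sum>b\<in>Basis. L2_inner (weak_partial b (u t)) (partial b \<psi>))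
     - L2_inner (convection (u t) (u t)) \<psi> - L2_inner (weak_laplacian (u t)) (laplacian \<psi>)"

text \<open>The derivative that the weak formulation provides equals \<open>rhs \<psi>\<close>
  almost everywhere, and \<open>rhs \<psi>\<close> inherits measurability and integrability from
  it.\<close>

lemma weak_eq:
  assumes \<psi>: "\<psi> \<in> torus_smooth" and T': "0 < T'" "T' < T"
  shows "has_weak_time_derivative T' (\<lambda>t. L2_inner (u t) \<psi>) (rhs \<psi>)"
proof -
  obtain dt where dt: "has_weak_time_derivative T' (\<lambda>t. L2_inner (u t) \<psi>) dt"
    and ae: "AE t in lebesgue_on {0<..<T'}.
              dt t + L2_inner (convection (u t) (u t)) \<psi>
                + L2_inner (weak_laplacian (u t)) (laplacian \<psi>)
              = lam * (\<Sum>b\<in>Basis. L2_inner (weak_partial b (u t)) (partial b \<psi>))"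
    using strong[OF T'] \<psi> unfolding strong_solution_def by blast
  have eq: "AE t in lebesgue_on {0<..<T'}. dt t = rhs \<psi> t"
    using ae unfolding rhs_def by eventually_elim linarith
  have di: "integrable (lebesgue_on {0<..<T'}) dt" using dt by (simp add: has_weak_time_derivative_def)
  have rm: "rhs \<psi> \<in> borel_measurable (lebesgue_on {0<..<T'})"
    by (rule lebesgue_on_measurable_cong_AE[OF _ _ eq]) (use di in auto)
  have ri: "integrable (lebesgue_on {0<..<T'}) (rhs \<psi>)"
    using integrable_cong_AE[OF borel_measurable_integrable[OF di] rm eq] di by blast
  show ?thesis
    unfolding has_weak_time_derivative_def
  proof (intro conjI allI impI ri)
    show "integrable (lebesgue_on {0<..<T'}) (\<lambda>t. L2_inner (u t) \<psi>)"
      using dt by (simp add: has_weak_time_derivative_def)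
    fix \<theta> :: "real \<Rightarrow> real"
    assume \<theta>: "smooth \<theta> \<and> compact (closure {t. \<theta> t \<noteq> 0}) \<and> closure {t. \<theta> t \<noteq> 0} \<subseteq> {0<..<T'}"
    have \<theta>m: "\<theta> \<in> borel_measurable (lebesgue_on {0<..<T'})"
      using \<theta> by (intro continuous_imp_measurable_on_sets_lebesgue smooth_continuous) auto
    have "(LINT t|lebesgue_on {0<..<T'}. L2_inner (u t) \<psi> * deriv \<theta> t) = - (LINT t|lebesgue_on {0<..<T'}. dt t * \<theta> t)"
      using dt \<theta> unfolding has_weak_time_derivative_def by blast
    also have "(LINT t|lebesgue_on {0<..<T'}. dt t * \<theta> t) = (LINT t|lebesgue_on {0<..<T'}. rhs \<psi> t * \<theta> t)"
    proof (rule integral_cong_AE)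
      show "AE t in lebesgue_on {0<..<T'}. dt t * \<theta> t = rhs \<psi> t * \<theta> t" using eq by eventually_elim simp
    qed (use di rm \<theta>m in auto)
    finally show "(LINT t|lebesgue_on {0<..<T'}. L2_inner (u t) \<psi> * deriv \<theta> t) = - (LINT t|lebesgue_on {0<..<T'}. rhs \<psi> t * \<theta> t)" .
  qed
qed

lemma weak_integrable:
  assumes "\<psi> \<in> torus_smooth" "0 < T'" "T' < T"
  shows "integrable (lebesgue_on {0<..<T'}) (\<lambda>t. L2_inner (u t) \<psi>)" "integrable (lebesgue_on {0<..<T'}) (rhs \<psi>)"
  using weak_eq[OF assms] by (auto simp: has_weak_time_derivative_def)

section \<open>The continuous representative and the integrated equation\<close>

definition represents :: "real \<Rightarrow> (real \<Rightarrow> real^2 \<Rightarrow> real^2) \<Rightarrow> bool" where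
  "represents T' v \<longleftrightarrow> (\<forall>t\<in>{0..<T'}. v t \<in> L2_torus) \<and>
          (AE t in lebesgue_on {0..<T'}. AE x in torus. v t x = u t x) \<and>
          (\<forall>t\<in>{0..<T'}. ((\<lambda>r. L2_norm (v r - v t)) \<longlongrightarrow> 0) (at t within {0..<T'})) \<and>
          (AE x in torus. v 0 x = u0 x)"

lemma represents_exists: "0 < T' \<Longrightarrow> T' < T \<Longrightarrow> \<exists>v. represents T' v"
  using strong unfolding strong_solution_def has_initial_value_def represents_def by blast

text \<open>Pairing with a bounded function is Lipschitz for the L^2 distance, since the torus has
  finite area.\<close>

lemma L2_inner_continuous:
  assumes v: "represents T' v" and \<psi>: "continuous_on UNIV \<psi>"
  shows "continuous_on {0..<T'} (\<lambda>t. L2_inner (v t) \<psi>)"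
  unfolding continuous_on_def
proof
  fix t assume t: "t \<in> {0..<T'}"
  obtain B where B: "0 \<le> B" "AE x in torus. norm (\<psi> x) \<le> B" by (rule torus_smooth_bounded[OF \<psi>])
  have vL: "v r \<in> L2_torus" if "r \<in> {0..<T'}" for r using v that by (auto simp: represents_def)
  have lim: "((\<lambda>r. L2_norm (v r - v t)) \<longlongrightarrow> 0) (at t within {0..<T'})" using v t by (auto simp: represents_def)
  \<comment> \<open>A distance below 1 guarantees that the difference has finite norm; at infinity
    \<open>enn2real\<close> would return 0 and the estimate would be lost.\<close>
  have est: "norm (L2_inner (v r) \<psi> - L2_inner (v t) \<psi>) \<le> B * (4 * pi) * enn2real (L2_norm (v r - v t))"
    if r: "r \<in> {0..<T'}" and fin: "L2_norm (v r - v t) < 1" for r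
  proof -
    have vi: "integrable torus (v r)" "integrable torus (v t)" using L2_torus_integrable(1) vL r t by auto
    have gL: "v r - v t \<in> L2_torus"
      using vL[OF r] vL[OF t] fin less_trans[OF fin, of \<infinity>] unfolding L2_torus_def periodic_def
      by (auto simp: fun_diff_def)
    have gi: "integrable torus (v r - v t)" by (rule L2_torus_integrable[OF gL])
    have \<psi>i: "integrable torus (\<lambda>x. g x \<bullet> \<psi> x)" if g: "integrable torus g" for g
    proof (rule Bochner_Integration.integrable_bound)
      show "integrable torus (\<lambda>x. B * norm (g x))" using g by simp
      show "(\<lambda>x. g x \<bullet> \<psi> x) \<in> borel_measurable torus"
        using g torus_measurable_continuous[OF \<psi>] by (intro borel_measurable_inner) auto
      show "AE x in torus. norm (g x \<bullet> \<psi> x) \<le> norm (B * norm (g x))"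
        using B(2)
      proof eventually_elim
        case (elim x)
        have "\<bar>g x \<bullet> \<psi> x\<bar> \<le> norm (g x) * norm (\<psi> x)" by (rule Cauchy_Schwarz_ineq2)
        also have "\<dots> \<le> norm (g x) * B" using elim by (intro mult_left_mono) auto
        finally show ?case using B(1) by (simp add: mult.commute)
      qed
    qed
    have d: "L2_inner (v r) \<psi> - L2_inner (v t) \<psi> = L2_inner (v r - v t) \<psi>"
      unfolding L2_inner_def using \<psi>i[OF vi(1)] \<psi>i[OF vi(2)] by (simp add: inner_diff_left)
    have A: "\<bar>L2_inner (v r - v t) \<psi>\<bar> \<le> B * ((LINT x|torus. \<bar>(v r - v t) x \<bullet> e1\<bar>) + (LINT x|torus. \<bar>(v r - v t) x \<bullet> e2\<bar>))"
      by (rule L2_inner_bound[OF gi \<psi> B(2,1)])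
    have I: "(LINT x|torus. \<bar>(v r - v t) x \<bullet> b\<bar>) \<le> 2 * pi * enn2real (L2_norm (v r - v t))" if "b \<in> Basis" for b
    proof -
      have "(LINT x|torus. \<bar>(v r - v t) x \<bullet> b\<bar>) \<le> (LINT x|torus. norm ((v r - v t) x))"
      proof (rule integral_mono)
        have gi': "integrable torus (\<lambda>x. v r x - v t x)" using gi by (simp add: fun_diff_def)
        show "integrable torus (\<lambda>x. \<bar>(v r - v t) x \<bullet> b\<bar>)" "integrable torus (\<lambda>x. norm ((v r - v t) x))"
          using gi' by auto
        show "\<bar>(v r - v t) x \<bullet> b\<bar> \<le> norm ((v r - v t) x)" for x by (rule Basis_le_norm[OF that])
      qed
      also have "\<dots> \<le> 2 * pi * enn2real (L2_norm (v r - v t))" by (rule L2_torus_integrable(3)[OF gL])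
      finally show ?thesis .
    qed
    have Be: "e1 \<in> Basis" "e2 \<in> Basis" by (auto simp: Basis_real2)
    have "norm (L2_inner (v r) \<psi> - L2_inner (v t) \<psi>) \<le> B * (2 * pi * enn2real (L2_norm (v r - v t)) + 2 * pi * enn2real (L2_norm (v r - v t)))"
      unfolding d real_norm_def using A mult_left_mono[OF add_mono[OF I[OF Be(1)] I[OF Be(2)]] B(1)] by (rule order_trans)
    then show ?thesis by (simp add: algebra_simps)
  qed
  have "((\<lambda>r. L2_norm (v r - v t)) \<longlongrightarrow> ennreal 0) (at t within {0..<T'})" using lim by simp
  then have "((\<lambda>r. enn2real (L2_norm (v r - v t))) \<longlongrightarrow> 0) (at t within {0..<T'})"
    by (rule tendsto_enn2real) simp
  then have z: "((\<lambda>r. B * (4 * pi) * enn2real (L2_norm (v r - v t))) \<longlongrightarrow> 0) (at t within {0..<T'})"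
    by (intro tendsto_mult_right_zero) simp
  have "eventually (\<lambda>r. norm (L2_inner (v r) \<psi> - L2_inner (v t) \<psi>) \<le> B * (4 * pi) * enn2real (L2_norm (v r - v t))) (at t within {0..<T'})"
  proof -
    have "eventually (\<lambda>r. L2_norm (v r - v t) < 1) (at t within {0..<T'})"
      by (rule order_tendstoD(2)[OF lim]) simp
    moreover have "eventually (\<lambda>r. r \<in> {0..<T'}) (at t within {0..<T'})"
      by (simp add: eventually_at_filter)
    ultimately show ?thesis by eventually_elim (rule est)
  qed
  from Lim_null_comparison[OF this z]
  show "((\<lambda>t. L2_inner (v t) \<psi>) \<longlongrightarrow> L2_inner (v t) \<psi>) (at t within {0..<T'})"
    by (rule LIM_zero_cancel)
qed

lemma represents_AE:
  assumes v: "represents T' v" and T': "0 < T'" "T' < T" and \<psi>: "continuous_on UNIV \<psi>"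
  shows "AE t in lebesgue_on {0<..<T'}. L2_inner (u t) \<psi> = L2_inner (v t) \<psi>"
proof -
  have "AE t in lebesgue_on {0<..<T'}. AE x in torus. v t x = u t x"
    using v AE_at_endpoints[OF interval_endpoints] unfolding represents_def by blast
  moreover have "AE t in lebesgue_on {0<..<T'}. u t \<in> sobolev 2"
    using time_AE_sub[OF AE_sobolev(1), of 0 T'] T' by simp
  moreover have "AE t in lebesgue_on {0<..<T'}. 0 < t \<and> t < T'" by (rule AE_I2) auto
  ultimately show ?thesis
  proof eventually_elim
    case (elim t)
    have m: "u t \<in> borel_measurable torus" "v t \<in> borel_measurable torus"
      using sobolev_2(1)[OF elim(2)] v elim(3) by (auto simp: L2_torus_def represents_def)
    show ?case
      by (rule L2_inner_cong_AE[OF m(2,1) elim(1) torus_measurable_continuous[OF \<psi>], symmetric])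
  qed
qed

lemma laplacian_bound_continuous:
  assumes "\<psi> \<in> torus_smooth"
  shows "continuous_on UNIV (laplacian \<psi>)"
  unfolding laplacian_def[abs_def]
  by (intro continuous_intros torus_smooth_continuous torus_smooth_partial assms)

text \<open>Valid at every time and not only almost every one: the representative is continuous, so
  the weak derivative can be integrated from 0. The right-hand side contains only u and the initial
  value, which later allows representatives to be glued.\<close>

lemma value_formula:
  assumes v: "represents T' v" and T': "0 < T'" "T' < T" and \<psi>: "\<psi> \<in> torus_smooth" and t: "0 \<le> t" "t < T'"
  shows "L2_inner (v t) \<psi> = L2_inner u0 \<psi> + (LINT s|lebesgue_on {0<..<t}. rhs \<psi> s)"
proof -
  have c: "continuous_on UNIV \<psi>" by (rule torus_smooth_continuous[OF \<psi>])
  have "L2_inner (v t) \<psi> = L2_inner (v 0) \<psi> + (LINT s|lebesgue_on {0<..<t}. rhs \<psi> s)"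
    by (rule weak_time_derivative_primitive[OF \<phi> weak_eq[OF \<psi> T'] L2_inner_continuous[OF v c] represents_AE[OF v T' c] t])
  also have "L2_inner (v 0) \<psi> = L2_inner u0 \<psi>"
  proof (rule L2_inner_cong_AE)
    show "v 0 \<in> borel_measurable torus" using v T' by (auto simp: represents_def L2_torus_def)
    show "u0 \<in> borel_measurable torus" using sobolev_2(1)[OF u0] by (auto simp: L2_torus_def)
    show "AE x in torus. v 0 x = u0 x" using v by (simp add: represents_def)
  qed (rule torus_measurable_continuous[OF c])
  finally show ?thesis .
qed

text \<open>\<open>primitive_square\<close> applies to the continuous representative; the result
  passes to u because the pairings agree at almost every time.\<close>

lemma square_formula:
  assumes T': "0 < T'" "T' < T" and \<psi>: "\<psi> \<in> torus_smooth"
  shows "AE t in lebesgue_on {0<..<T'}. (L2_inner (u t) \<psi>)\<^sup>2 = (L2_inner u0 \<psi>)\<^sup>2 + 2 * (LINT s|lebesgue_on {0<..<t}. L2_inner (u s) \<psi> * rhs \<psi> s)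
      \<and> integrable (lebesgue_on {0<..<t}) (\<lambda>s. L2_inner (u s) \<psi> * rhs \<psi> s)"
proof -
  obtain v where v: "represents T' v" using represents_exists[OF T'] by blast
  have c: "continuous_on UNIV \<psi>" by (rule torus_smooth_continuous[OF \<psi>])
  note ae = represents_AE[OF v T' c]
  have "AE t in lebesgue_on {0<..<T'}. 0 < t \<and> t < T'" by (rule AE_I2) auto
  then show ?thesis using ae
  proof eventually_elim
    case (elim t)
    have ri: "integrable (lebesgue_on {0<..<t}) (rhs \<psi>)"
      using time_integrable_sub[OF weak_integrable(2)[OF \<psi> T'], of 0 t] elim by simp
    have hi: "integrable (lebesgue_on {0<..<t}) (\<lambda>t. L2_inner (u t) \<psi>)"
      using time_integrable_sub[OF weak_integrable(1)[OF \<psi> T'], of 0 t] elim by simp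
    have v0: "L2_inner (v 0) \<psi> = L2_inner u0 \<psi>" using value_formula[OF v T' \<psi>, of 0] T' by simp
    have sq: "(L2_inner (v t) \<psi>)\<^sup>2 = (L2_inner (v 0) \<psi>)\<^sup>2 + 2 * (LINT s|lebesgue_on {0<..<t}. L2_inner (v s) \<psi> * rhs \<psi> s)"
    proof (rule primitive_square[OF ri])
      show "0 \<le> t" using elim by simp
      show "L2_inner (v s) \<psi> = L2_inner (v 0) \<psi> + (LINT r|lebesgue_on {0<..<s}. rhs \<psi> r)" if "0 \<le> s" "s \<le> t" for s
        unfolding v0 using value_formula[OF v T' \<psi>, of s] that elim by simp
    qed
    have vi: "integrable (lebesgue_on {0<..<t}) (\<lambda>s. L2_inner (v s) \<psi> * rhs \<psi> s)"
      by (rule continuous_time_integrable[OF continuous_on_subset[OF L2_inner_continuous[OF v c]] ri]) (use elim in auto)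
    have ae': "AE s in lebesgue_on {0<..<t}. L2_inner (v s) \<psi> * rhs \<psi> s = L2_inner (u s) \<psi> * rhs \<psi> s"
      using time_AE_sub[OF ae, of 0 t] elim by (auto elim!: eventually_mono)
    have um: "(\<lambda>s. L2_inner (u s) \<psi> * rhs \<psi> s) \<in> borel_measurable (lebesgue_on {0<..<t})" using hi ri by auto
    show ?case
      using sq elim(2) v0 integral_cong_AE[OF borel_measurable_integrable[OF vi] um ae']
        integrable_cong_AE[OF borel_measurable_integrable[OF vi] um ae'] vi by simp
  qed
qed

section \<open>Evolution of the energy of a single mode\<close>

lemma AE_smooth_field: "AE t in lebesgue_on {0<..<T}. smooth_field (u t) \<and> u t \<in> sobolev 2 \<and> u t \<in> sobolev 4"
  using AE_sobolev by eventually_elim (use sobolev4_smooth_field(1) in blast)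

abbreviation \<mu>k :: "nat \<Rightarrow> real" where "\<mu>k k \<equiv> (fsq k)\<^sup>2 - lam * fsq k"
abbreviation Cm :: "nat \<Rightarrow> real^2 \<Rightarrow> real^2 \<Rightarrow> real^2" where "Cm k b \<equiv> (\<lambda>x. Cmode k x *\<^sub>R b)"
abbreviation Sm :: "nat \<Rightarrow> real^2 \<Rightarrow> real^2 \<Rightarrow> real^2" where "Sm k b \<equiv> (\<lambda>x. Smode k x *\<^sub>R b)"

lemma mode_values:
  assumes f: "smooth_field (u t)" and b: "b \<in> Basis"
  shows "L2_inner (u t) (Cm k b) = 4 * pi\<^sup>2 * Re (cf (u t) b k)" "L2_inner (u t) (Sm k b) = - (4 * pi\<^sup>2 * Im (cf (u t) b k))"
    "rhs (Cm k b) t = - (4 * pi\<^sup>2 * (Re (nlc (u t) b k) + \<mu>k k * Re (cf (u t) b k)))"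
    "rhs (Sm k b) t = 4 * pi\<^sup>2 * (Im (nlc (u t) b k) + \<mu>k k * Im (cf (u t) b k))"
proof -
  have i: "integrable torus (u t)" using f by (simp add: smooth_field_def)
  show "L2_inner (u t) (Cm k b) = 4 * pi\<^sup>2 * Re (cf (u t) b k)" "L2_inner (u t) (Sm k b) = - (4 * pi\<^sup>2 * Im (cf (u t) b k))"
    by (rule L2_inner_CSmode[OF i b])+
  show "rhs (Cm k b) t = - (4 * pi\<^sup>2 * (Re (nlc (u t) b k) + \<mu>k k * Re (cf (u t) b k)))"
    "rhs (Sm k b) t = 4 * pi\<^sup>2 * (Im (nlc (u t) b k) + \<mu>k k * Im (cf (u t) b k))"
    using smooth_field.mode_equation[OF f b, of k lam] unfolding rhs_def by linarith+
qed

text \<open>Pairings and \<open>rhs\<close> are measurable because the weak formulation makes them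
  integrable. The coefficients of u follow directly; those of the convection term are what remains
  of \<open>rhs\<close> after the linear part is subtracted.\<close>

lemma measurable_coefficients:
  assumes b: "b \<in> Basis"
  shows "(\<lambda>t. Re (cf (u t) b k)) \<in> borel_measurable (lebesgue_on {0<..<T})" "(\<lambda>t. Im (cf (u t) b k)) \<in> borel_measurable (lebesgue_on {0<..<T})"
    "(\<lambda>t. Re (nlc (u t) b k)) \<in> borel_measurable (lebesgue_on {0<..<T})" "(\<lambda>t. Im (nlc (u t) b k)) \<in> borel_measurable (lebesgue_on {0<..<T})"
proof -
  have m: "(\<lambda>t. L2_inner (u t) \<psi>) \<in> borel_measurable (lebesgue_on {0<..<T})" "rhs \<psi> \<in> borel_measurable (lebesgue_on {0<..<T})"
    if "\<psi> \<in> torus_smooth" for \<psi>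
    using weak_integrable[OF that] by (auto intro!: measurable_exhaust[OF T])
  note mC = m[OF CSmode_smooth(1)[of k b]] and mS = m[OF CSmode_smooth(2)[of k b]]
  have pi: "4 * pi\<^sup>2 \<noteq> (0::real)" by simp
  have L: "{0<..<T} \<in> sets lebesgue" by simp
  show c1: "(\<lambda>t. Re (cf (u t) b k)) \<in> borel_measurable (lebesgue_on {0<..<T})"
  proof (rule lebesgue_on_measurable_cong_AE[OF _ L])
    show "(\<lambda>t. L2_inner (u t) (Cm k b) / (4 * pi\<^sup>2)) \<in> borel_measurable (lebesgue_on {0<..<T})" using mC by simp
    show "AE t in lebesgue_on {0<..<T}. L2_inner (u t) (Cm k b) / (4 * pi\<^sup>2) = Re (cf (u t) b k)"
      using AE_smooth_field by eventually_elim (simp add: mode_values b)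
  qed
  show c2: "(\<lambda>t. Im (cf (u t) b k)) \<in> borel_measurable (lebesgue_on {0<..<T})"
  proof (rule lebesgue_on_measurable_cong_AE[OF _ L])
    show "(\<lambda>t. - L2_inner (u t) (Sm k b) / (4 * pi\<^sup>2)) \<in> borel_measurable (lebesgue_on {0<..<T})" using mS by simp
    show "AE t in lebesgue_on {0<..<T}. - L2_inner (u t) (Sm k b) / (4 * pi\<^sup>2) = Im (cf (u t) b k)"
      using AE_smooth_field by eventually_elim (simp add: mode_values b)
  qed
  show "(\<lambda>t. Re (nlc (u t) b k)) \<in> borel_measurable (lebesgue_on {0<..<T})"
  proof (rule lebesgue_on_measurable_cong_AE[OF _ L])
    show "(\<lambda>t. - rhs (Cm k b) t / (4 * pi\<^sup>2) - \<mu>k k * Re (cf (u t) b k)) \<in> borel_measurable (lebesgue_on {0<..<T})" using mC c1 by simp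
    show "AE t in lebesgue_on {0<..<T}. - rhs (Cm k b) t / (4 * pi\<^sup>2) - \<mu>k k * Re (cf (u t) b k) = Re (nlc (u t) b k)"
      using AE_smooth_field by eventually_elim (simp add: mode_values b)
  qed
  show "(\<lambda>t. Im (nlc (u t) b k)) \<in> borel_measurable (lebesgue_on {0<..<T})"
  proof (rule lebesgue_on_measurable_cong_AE[OF _ L])
    show "(\<lambda>t. rhs (Sm k b) t / (4 * pi\<^sup>2) - \<mu>k k * Im (cf (u t) b k)) \<in> borel_measurable (lebesgue_on {0<..<T})" using mS c2 by simp
    show "AE t in lebesgue_on {0<..<T}. rhs (Sm k b) t / (4 * pi\<^sup>2) - \<mu>k k * Im (cf (u t) b k) = Im (nlc (u t) b k)"
      using AE_smooth_field by eventually_elim (simp add: mode_values b)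
  qed
qed

lemma measurable_energies:
  "(\<lambda>t. pw (u t) k) \<in> borel_measurable (lebesgue_on {0<..<T})"
  "(\<lambda>t. qf (u t) k) \<in> borel_measurable (lebesgue_on {0<..<T})"
  "(\<lambda>t. nlsq (u t) k) \<in> borel_measurable (lebesgue_on {0<..<T})"
proof -
  note [measurable] = measurable_coefficients
  show "(\<lambda>t. pw (u t) k) \<in> borel_measurable (lebesgue_on {0<..<T})"
    unfolding pw_def cmod_power2 by measurable
  show "(\<lambda>t. qf (u t) k) \<in> borel_measurable (lebesgue_on {0<..<T})"
    unfolding qf_def times_complex.sel cnj.sel by measurable
  show "(\<lambda>t. nlsq (u t) k) \<in> borel_measurable (lebesgue_on {0<..<T})"
    unfolding nlsq_def cmod_power2 by measurable
qed

text \<open>The squares of the cosine and sine pairings add up to (4 pi^2)^2 times the squared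
  modulus of the coefficient, and their two right-hand sides recombine to the real part of one
  complex product.\<close>

lemma mode_square_evolution:
  assumes T': "0 < T'" "T' < T" and b: "b \<in> Basis"
  shows "AE t in lebesgue_on {0<..<T'}. (cmod (cf (u t) b k))\<^sup>2 = (cmod (cf u0 b k))\<^sup>2
      - 2 * (LINT s|lebesgue_on {0<..<t}. Re (cnj (cf (u s) b k) * nlc (u s) b k) + \<mu>k k * (cmod (cf (u s) b k))\<^sup>2)
      \<and> integrable (lebesgue_on {0<..<t}) (\<lambda>s. Re (cnj (cf (u s) b k) * nlc (u s) b k) + \<mu>k k * (cmod (cf (u s) b k))\<^sup>2)"
proof -
  let ?V = "4 * pi\<^sup>2"
  let ?X = "\<lambda>s. Re (cnj (cf (u s) b k) * nlc (u s) b k) + \<mu>k k * (cmod (cf (u s) b k))\<^sup>2"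
  have i0: "integrable torus u0" by (rule L2_torus_integrable[OF sobolev_2(1)[OF u0]])
  note sf = time_AE_sub[OF AE_smooth_field, of 0 T']
  have "AE t in lebesgue_on {0<..<T'}. smooth_field (u t)"
    using sf T' by (auto elim!: eventually_mono)
  moreover note square_formula[OF T' CSmode_smooth(1)[of k b]] square_formula[OF T' CSmode_smooth(2)[of k b]]
  moreover have "AE t in lebesgue_on {0<..<T'}. 0 < t \<and> t < T'" by (rule AE_I2) auto
  ultimately show ?thesis
  proof eventually_elim
    case (elim t)
    let ?G = "\<lambda>s. L2_inner (u s) (Cm k b) * rhs (Cm k b) s + L2_inner (u s) (Sm k b) * rhs (Sm k b) s"
    have Gi: "integrable (lebesgue_on {0<..<t}) ?G" using elim by auto
    have sft: "AE s in lebesgue_on {0<..<t}. smooth_field (u s)"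
      using time_AE_sub[OF AE_smooth_field, of 0 t] elim T' by (auto elim!: eventually_mono)
    have ae: "AE s in lebesgue_on {0<..<t}. ?G s = - ?V\<^sup>2 * ?X s"
      using sft
    proof eventually_elim
      case (elim s)
      show ?case
        unfolding mode_values[OF elim b] cmod_power2 by (simp add: power2_eq_square algebra_simps)
    qed
    have Xm: "?X \<in> borel_measurable (lebesgue_on {0<..<t})"
    proof (rule time_measurable_sub[of _ 0 T])
      note [measurable] = measurable_coefficients[OF b]
      show "?X \<in> borel_measurable (lebesgue_on {0<..<T})"
        unfolding cmod_power2 times_complex.sel cnj.sel by measurable
    qed (use elim T' in auto)
    have VXm: "(\<lambda>s. - ?V\<^sup>2 * ?X s) \<in> borel_measurable (lebesgue_on {0<..<t})" by (intro borel_measurable_times Xm) simp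
    have V: "?V \<noteq> 0" by simp
    have VXi: "integrable (lebesgue_on {0<..<t}) (\<lambda>s. - ?V\<^sup>2 * ?X s)"
      using integrable_cong_AE[OF borel_measurable_integrable[OF Gi] VXm ae] Gi by blast
    then have "integrable (lebesgue_on {0<..<t}) (\<lambda>s. (- 1 / ?V\<^sup>2) * (- ?V\<^sup>2 * ?X s))" by (rule integrable_mult_right)
    moreover have "(- 1 / ?V\<^sup>2) * (- ?V\<^sup>2 * y) = y" for y :: real using V by (simp add: field_simps)
    ultimately have Xi: "integrable (lebesgue_on {0<..<t}) ?X" by (simp only:)
    have "(LINT s|lebesgue_on {0<..<t}. ?G s) = (LINT s|lebesgue_on {0<..<t}. - ?V\<^sup>2 * ?X s)"
      by (rule integral_cong_AE[OF borel_measurable_integrable[OF Gi] VXm ae])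
    then have GX: "(LINT s|lebesgue_on {0<..<t}. ?G s) = - ?V\<^sup>2 * (LINT s|lebesgue_on {0<..<t}. ?X s)"
      by (simp only: integral_mult_right_zero)
    have Gsplit: "(LINT s|lebesgue_on {0<..<t}. ?G s) = (LINT s|lebesgue_on {0<..<t}. L2_inner (u s) (Cm k b) * rhs (Cm k b) s) + (LINT s|lebesgue_on {0<..<t}. L2_inner (u s) (Sm k b) * rhs (Sm k b) s)"
      using elim by (intro Bochner_Integration.integral_add) auto
    have "(L2_inner (u t) (Cm k b))\<^sup>2 + (L2_inner (u t) (Sm k b))\<^sup>2 = (L2_inner u0 (Cm k b))\<^sup>2 + (L2_inner u0 (Sm k b))\<^sup>2 + 2 * (- ?V\<^sup>2 * (LINT s|lebesgue_on {0<..<t}. ?X s))"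
      using elim(2,3) GX Gsplit by linarith
    then have "?V\<^sup>2 * (cmod (cf (u t) b k))\<^sup>2 = ?V\<^sup>2 * ((cmod (cf u0 b k))\<^sup>2 - 2 * (LINT s|lebesgue_on {0<..<t}. ?X s))"
      unfolding mode_values(1,2)[OF elim(1) b] L2_inner_CSmode[OF i0 b] cmod_power2[of "cf (u t) b k"] cmod_power2[of "cf u0 b k"]
      by (simp add: power_mult_distrib algebra_simps)
    then have "(cmod (cf (u t) b k))\<^sup>2 = (cmod (cf u0 b k))\<^sup>2 - 2 * (LINT s|lebesgue_on {0<..<t}. ?X s)"
      using V by simp
    then show ?case using Xi by blast
  qed
qed

lemma pw_evolution:
  "AE t in lebesgue_on {0<..<T}. pw (u t) k = pw u0 k - 2 * (LINT s|lebesgue_on {0<..<t}. qf (u s) k + \<mu>k k * pw (u s) k)"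
proof (rule AE_exhaust[OF T])
  fix T' assume T': "0 < T'" "T' < T"
  let ?X = "\<lambda>b s. Re (cnj (cf (u s) b k) * nlc (u s) b k) + \<mu>k k * (cmod (cf (u s) b k))\<^sup>2"
  have B: "e1 \<in> Basis" "e2 \<in> Basis" by (auto simp: Basis_real2)
  show "AE t in lebesgue_on {0<..<T'}. pw (u t) k = pw u0 k - 2 * (LINT s|lebesgue_on {0<..<t}. qf (u s) k + \<mu>k k * pw (u s) k)"
    using mode_square_evolution[OF T' B(1), of k] mode_square_evolution[OF T' B(2), of k]
  proof eventually_elim
    case (elim t)
    have "qf (u s) k + \<mu>k k * pw (u s) k = ?X e1 s + ?X e2 s" for s
      unfolding qf_def pw_def sum_Basis_real2 by (simp only: distrib_left add_ac)
    then have "(LINT s|lebesgue_on {0<..<t}. qf (u s) k + \<mu>k k * pw (u s) k) = (LINT s|lebesgue_on {0<..<t}. ?X e1 s + ?X e2 s)"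
      by (simp only:)
    also have "\<dots> = (LINT s|lebesgue_on {0<..<t}. ?X e1 s) + (LINT s|lebesgue_on {0<..<t}. ?X e2 s)"
      by (rule Bochner_Integration.integral_add) (use elim in blast)+
    finally show ?case using elim unfolding pw_def sum_Basis_real2 by linarith
  qed
qed

definition G :: "real \<Rightarrow> ennreal" where
  "G t = besov_norm \<phi> (1 / 2) \<infinity> \<infinity> (distribution_of (\<lambda>x. u t x $ 1))"

text \<open>The bound \<open>Cb * enn2real (G t)\<close> on the oscillation enters squared, hence
  \<open>Cb\<^sup>2\<close>; \<open>8 * Cw\<close> is the constant of
  \<open>convection_square_sum\<close>.\<close>

sublocale energy_system T lam "8 * Cw" "Cb\<^sup>2" fsq "pw u0" "\<lambda>k t. pw (u t) k" "\<lambda>k t. qf (u t) k" "\<lambda>k t. nlsq (u t) k" G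
proof
  show "0 < T" by (rule T)
  show "0 \<le> 8 * Cw" using Cw_nonneg by simp
  show "0 < Cb\<^sup>2" using Cb_pos by simp
  show "0 \<le> fsq k" for k by simp
  show "0 \<le> pw u0 k" for k by simp
  show "summable (\<lambda>k. (1 + fsq k)\<^sup>2 * pw u0 k)" by (rule sobolev_2(2)[OF u0])
  show "(\<lambda>t. pw (u t) k) \<in> borel_measurable (lebesgue_on {0<..<T})" "(\<lambda>t. qf (u t) k) \<in> borel_measurable (lebesgue_on {0<..<T})"
    "(\<lambda>t. nlsq (u t) k) \<in> borel_measurable (lebesgue_on {0<..<T})" for k
    by (rule measurable_energies)+
  show "0 \<le> pw (u t) k" "0 \<le> nlsq (u t) k" for t k by (auto simp: nlsq_def sum_nonneg)
  show "AE t in lebesgue_on {0<..<T}. summable (\<lambda>k. (1 + fsq k) ^ 4 * pw (u t) k)"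
    using AE_smooth_field by eventually_elim (use sobolev4_smooth_field(2) in blast)
  show "AE t in lebesgue_on {0<..<T}. summable (\<lambda>k. nlsq (u t) k) \<and> (\<Sum>k. nlsq (u t) k) \<le> 8 * Cw * (\<Sum>k. (1 + fsq k)\<^sup>2 * pw (u t) k)\<^sup>2"
    using AE_smooth_field
    by eventually_elim (use smooth_field.convection_square_sum sobolev_2(2) in \<open>simp add: Ssum_def\<close>)
  show "AE t in lebesgue_on {0<..<T}. \<forall>k. (qf (u t) k)\<^sup>2 \<le> pw (u t) k * nlsq (u t) k"
    using qf_square by simp
  have "AE t in lebesgue_on {0<..<T}. distribution_of (\<lambda>x. u t x $ 1) \<in> besov \<phi> (1 / 2) \<infinity> \<infinity>"
    using bes by (simp add: bochner_def)
  then show "AE t in lebesgue_on {0<..<T}. G t < \<infinity> \<and> \<bar>\<Sum>k. qf (u t) k\<bar> \<le> (\<Sum>k. fsq k * pw (u t) k) / 2 + Cb\<^sup>2 * (enn2real (G t))\<^sup>2 * (\<Sum>k. pw (u t) k)"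
    using AE_smooth_field
  proof eventually_elim
    case (elim t)
    interpret f: smooth_field "u t" using elim by simp
    have Gt: "G t < \<infinity>" using elim(1) by (simp add: besov_def G_def)
    have c: "fc (\<lambda>x. complex_of_real (u t x $ 1)) = cf (u t) e1"
      by (simp add: cf_def cart_eq_inner_axis)
    have "integrable torus (\<lambda>x. u t x \<bullet> e1)" using f.f by auto
    then have i: "integrable torus (\<lambda>x. u t x $ 1)" by (simp add: cart_eq_inner_axis)
    have s: "summable (\<lambda>k. cmod (fc (\<lambda>x. complex_of_real (u t x $ 1)) k))"
      unfolding c by (rule f.cf_summable(1)[OF f.B12(1)])
    have "AE x in torus. cmod (fser ((cf (u t) e1)(f.nf.k0 := 0)) x) \<le> Cb * enn2real (G t)"
      using besov_oscillation[OF i s f.nf.freq_k0] Gt unfolding c G_def by simp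
    from f.qf_sum_bound[OF _ this] show ?case
      using Gt sobolev_2(2)[of "u t"] elim by (simp add: power_mult_distrib)
  qed
  have "Lp_norm 2 (lebesgue_on {0<..<T}) G < \<infinity>" using bes by (simp add: bochner_def G_def[abs_def])
  then show "(\<integral>\<^sup>+ t. (G t)\<^sup>2 \<partial>lebesgue_on {0<..<T}) < \<infinity>" by (simp add: Lp_norm_2)
  show "AE t in lebesgue_on {0<..<T}. pw (u t) k = pw u0 k - 2 * (LINT s|lebesgue_on {0<..<t}. qf (u s) k + ((fsq k)\<^sup>2 - lam * fsq k) * pw (u s) k)" for k
    by (rule pw_evolution)
  show "\<exists>M. AE t in lebesgue_on {0<..<T'}. (\<Sum>k. (1 + fsq k)\<^sup>2 * pw (u t) k) \<le> M" if "0 < T'" "T' < T" for T'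
    using S_local[OF that] by (simp add: Ssum_def)
qed

end

subsection \<open>Extension up to the final time\<close>

lemma AE_eq_of_cf_eq:
  assumes f: "integrable torus f" and g: "integrable torus g" and eq: "\<And>b k. b \<in> Basis \<Longrightarrow> cf f b k = cf g b k"
  shows "AE x in torus. f x = g x"
proof -
  have "AE x in torus. complex_of_real (f x \<bullet> b) - of_real (g x \<bullet> b) = 0" if b: "b \<in> Basis" for b
  proof (rule torus_fourier_unique)
    have F: "integrable torus (\<lambda>x. complex_of_real (f x \<bullet> b))" "integrable torus (\<lambda>x. complex_of_real (g x \<bullet> b))"
      using f g by (auto intro!: integrable_of_real)
    then show "integrable torus (\<lambda>x. complex_of_real (f x \<bullet> b) - of_real (g x \<bullet> b))" by simp
    fix m :: "real^2" assume "m \<in> int_lattice"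
    then obtain k where k: "freq k = - m" using freq_surj int_lattice_uminus by blast
    show "(LINT x|torus. (complex_of_real (f x \<bullet> b) - of_real (g x \<bullet> b)) * cis (m \<bullet> x)) = 0"
      using fc_integrable[OF F(1), of k] fc_integrable[OF F(2), of k] eq[OF b, of k]
      by (simp add: cf_def fc_def k left_diff_distrib)
  qed
  then have "AE x in torus. \<forall>b\<in>Basis. complex_of_real (f x \<bullet> b) - of_real (g x \<bullet> b) = 0"
    by (intro AE_finite_allI) auto
  then show ?thesis
    by eventually_elim (auto intro: euclidean_eqI)
qed

lemma L2_norm_cong_AE:
  assumes "AE x in torus. f x = g x"
  shows "L2_norm f = L2_norm g"
  unfolding L2_norm_def Lp_norm_2
  by (rule arg_cong[where f="\<lambda>z. epowr z (1 / 2)"], rule nn_integral_cong_AE) (use assms in \<open>auto elim!: eventually_mono\<close>)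

lemma epowr_measurable [measurable]:
  assumes [measurable]: "f \<in> borel_measurable M"
  shows "(\<lambda>x. epowr (f x) r) \<in> borel_measurable M"
  unfolding epowr_def by measurable

lemma sobolev_norm_measurable:
  assumes [measurable]: "\<And>k. (\<lambda>t. pw (u t) k) \<in> borel_measurable M"
  shows "(\<lambda>t. sobolev_norm (real n) (u t)) \<in> borel_measurable M"
  unfolding sobolev_norm_eq by measurable

context kuramoto
begin

lemma H2_bound: obtains M where "0 \<le> M" "AE t in lebesgue_on {0<..<T}. Ssum (u t) \<le> M"
proof -
  obtain M where M: "AE t in lebesgue_on {0<..<T}. (\<Sum>k. (1 + fsq k)\<^sup>2 * pw (u t) k) \<le> M"
    by (rule a_priori_bounds)
  then have "AE t in lebesgue_on {0<..<T}. Ssum (u t) \<le> max 0 M"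
    unfolding Ssum_def by eventually_elim simp
  then show ?thesis using that[of "max 0 M"] by simp
qed

lemma H4_integral: "(\<integral>\<^sup>+t. (\<Sum>k. ennreal ((1 + fsq k) ^ 4 * pw (u t) k)) \<partial>lebesgue_on {0<..<T}) < \<infinity>"
  by (rule a_priori_bounds)

text \<open>The interval is kept general because the conclusion concerns both [0,T) and
  [0,T].\<close>

lemma in_bochner:
  assumes I: "{0..<T} \<subseteq> I" "I \<subseteq> {0..T}" "I \<in> sets lebesgue"
  shows "u \<in> bochner_sobolev \<infinity> I 2" "u \<in> bochner_sobolev 2 I 4"
proof -
  have I0: "{0<..<T} \<subseteq> I" using I(1) by auto
  note ends = AE_at_endpoints[OF I0 I(2,3)]
  have sm: "strongly_measurable I X N u"
    if loc: "\<And>T'. 0 < T' \<Longrightarrow> T' < T \<Longrightarrow> strongly_measurable {0..<T'} X N u" for X N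
  proof -
    \<comment> \<open>The gluing needs some element of X as filler; the approximants on a shorter
      interval provide one.\<close>
    obtain s :: "nat \<Rightarrow> real \<Rightarrow> real^2 \<Rightarrow> real^2" where "\<forall>n. s n ` {0..<T / 2} \<subseteq> X"
      using loc[of "T / 2"] T unfolding strongly_measurable_def by auto
    moreover have "(0::real) \<in> {0..<T / 2}" using T by simp
    ultimately have "s 0 0 \<in> X" by blast
    then show ?thesis by (rule strongly_measurable_exhaust[OF T _ I loc])
  qed
  have sm2: "strongly_measurable I (sobolev 2) (sobolev_norm 2) u" and sm4: "strongly_measurable I (sobolev 4) (sobolev_norm 4) u"
    using strong by (auto intro!: sm simp: strong_solution_def bochner_def)
  have ae2: "AE t in lebesgue_on I. u t \<in> sobolev 2" and ae4: "AE t in lebesgue_on I. u t \<in> sobolev 4"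
    using AE_sobolev unfolding ends by auto
  obtain M where M: "0 \<le> M" "AE t in lebesgue_on {0<..<T}. Ssum (u t) \<le> M" by (rule H2_bound)
  have "esssup (lebesgue_on I) (\<lambda>t. sobolev_norm 2 (u t)) \<le> ennreal (sqrt M)"
  proof (rule esssup_I)
    have "(\<lambda>t. sobolev_norm (real 2) (u t)) \<in> borel_measurable (lebesgue_on {0<..<T})"
      by (rule sobolev_norm_measurable) (rule measurable_energies)
    then show "(\<lambda>t. sobolev_norm 2 (u t)) \<in> borel_measurable (lebesgue_on I)"
      by (intro measurable_at_endpoints[OF I0 I(2,3)]) simp
    show "AE t in lebesgue_on I. sobolev_norm 2 (u t) \<le> ennreal (sqrt M)"
      unfolding ends using M(2) AE_sobolev(1)
    proof eventually_elim
      case (elim t)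
      have nn: "0 \<le> (1 + fsq k)\<^sup>2 * pw (u t) k" for k by simp
      have "sobolev_norm 2 (u t) = epowr (ennreal (Ssum (u t))) (1 / 2)"
        using sobolev_norm_eq[of 2 "u t"] suminf_ennreal2[OF nn sobolev_2(2)[OF elim(2)]] by (simp add: Ssum_def)
      also have "\<dots> = ennreal (sqrt (Ssum (u t)))"
        using sobolev_2(4)[OF elim(2)] by (simp add: epowr_ennreal powr_half_sqrt)
      also have "\<dots> \<le> ennreal (sqrt M)" using elim(1) by (intro ennreal_leI) simp
      finally show ?case .
    qed
  qed
  then have "Lp_norm \<infinity> (lebesgue_on I) (\<lambda>t. sobolev_norm 2 (u t)) < \<infinity>"
    by (simp add: Lp_norm_def le_less_trans)
  then show "u \<in> bochner_sobolev \<infinity> I 2" using sm2 ae2 by (simp add: bochner_def)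
  have "(sobolev_norm 4 f)\<^sup>2 = (\<Sum>k. ennreal ((1 + fsq k) ^ 4 * pw f k))" for f
    using sobolev_norm_eq[of 4 f] by (simp add: epowr_half_2)
  then have "Lp_norm 2 (lebesgue_on I) (\<lambda>t. sobolev_norm 4 (u t)) < \<infinity>"
    using H4_integral by (simp add: Lp_norm_2 nn_integral_at_endpoints[OF I0 I(2,3)])
  then show "u \<in> bochner_sobolev 2 I 4" using sm4 ae4 by (simp add: bochner_def)
qed

text \<open>The uniform H^2 bound makes the pairing and its derivative bounded on all of (0,T),
  whereas the weak formulation gives integrability only on shorter intervals.\<close>

lemma weak_terms_bounded:
  assumes \<psi>: "\<psi> \<in> torus_smooth"
  shows "\<exists>C. AE t in lebesgue_on {0<..<T}. \<bar>L2_inner (u t) \<psi>\<bar> \<le> C \<and> \<bar>rhs \<psi> t\<bar> \<le> C"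
proof -
  obtain M where M: "0 \<le> M" "AE t in lebesgue_on {0<..<T}. Ssum (u t) \<le> M" by (rule H2_bound)
  have Be: "e1 \<in> Basis" "e2 \<in> Basis" by (auto simp: Basis_real2)
  have c: "continuous_on UNIV \<psi>" "continuous_on UNIV (partial e1 \<psi>)" "continuous_on UNIV (partial e2 \<psi>)" "continuous_on UNIV (laplacian \<psi>)"
    using torus_smooth_continuous[OF \<psi>] torus_smooth_continuous[OF torus_smooth_partial[OF \<psi> Be(1)]]
      torus_smooth_continuous[OF torus_smooth_partial[OF \<psi> Be(2)]] laplacian_bound_continuous[OF \<psi>] by auto
  obtain B0 where B0: "0 \<le> B0" "AE x in torus. norm (\<psi> x) \<le> B0" by (rule torus_smooth_bounded[OF c(1)])
  obtain B1 where B1: "0 \<le> B1" "AE x in torus. norm (partial e1 \<psi> x) \<le> B1" by (rule torus_smooth_bounded[OF c(2)])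
  obtain B2 where B2: "0 \<le> B2" "AE x in torus. norm (partial e2 \<psi> x) \<le> B2" by (rule torus_smooth_bounded[OF c(3)])
  obtain B3 where B3: "0 \<le> B3" "AE x in torus. norm (laplacian \<psi> x) \<le> B3" by (rule torus_smooth_bounded[OF c(4)])
  define K where "K = 8 * pi\<^sup>2 * (1 + M)"
  have K: "0 \<le> K" using M(1) by (simp add: K_def)
  have K1: "2 * pi\<^sup>2 * (1 + y) \<le> K" "8 * pi\<^sup>2 * y \<le> K" if "0 \<le> y" "y \<le> M" for y
  proof -
    have p: "0 \<le> pi\<^sup>2" by simp
    have "pi\<^sup>2 * y \<le> pi\<^sup>2 * M" using that(2) p by (rule mult_left_mono)
    moreover have "0 \<le> pi\<^sup>2 * M" using M(1) p by simp
    ultimately show "2 * pi\<^sup>2 * (1 + y) \<le> K" "8 * pi\<^sup>2 * y \<le> K"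
      unfolding K_def distrib_left mult.assoc using p by linarith+
  qed
  define C where "C = \<bar>lam\<bar> * (B1 * (K + K) + B2 * (K + K)) + B0 * (K + K) + B3 * (K + K)"
  have "AE t in lebesgue_on {0<..<T}. \<bar>L2_inner (u t) \<psi>\<bar> \<le> C \<and> \<bar>rhs \<psi> t\<bar> \<le> C"
    using M(2) AE_smooth_field
  proof eventually_elim
    case (elim t)
    interpret f: smooth_field "u t" using elim by simp
    have S: "summable (\<lambda>k. (1 + fsq k)\<^sup>2 * pw (u t) k)" "0 \<le> Ssum (u t)" using sobolev_2[of "u t"] elim by auto
    note k = K1[OF S(2) elim(1)]
    have ib: "(LINT x|torus. \<bar>u t x \<bullet> b\<bar>) \<le> K" "j \<in> Basis \<Longrightarrow> (LINT x|torus. \<bar>weak_partial j (u t) x \<bullet> b\<bar>) \<le> K"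
      "(LINT x|torus. \<bar>weak_laplacian (u t) x \<bullet> b\<bar>) \<le> K" "(LINT x|torus. \<bar>convection (u t) (u t) x \<bullet> b\<bar>) \<le> K"
      if b: "b \<in> Basis" for b j
      using order_trans[OF f.integral_abs_bounds(1)[OF S(1) b] k(1)] order_trans[OF f.integral_abs_bounds(2)[OF S(1) b] k(1)]
        order_trans[OF f.integral_abs_bounds(3)[OF S(1) b] k(1)] order_trans[OF f.integral_abs_bounds(4)[OF S(1) b] k(2)] by auto
    have est: "\<bar>L2_inner g h\<bar> \<le> B * (K + K)"
      if "integrable torus g" "continuous_on UNIV h" "AE x in torus. norm (h x) \<le> B" "0 \<le> B"
        "\<And>b. b \<in> Basis \<Longrightarrow> (LINT x|torus. \<bar>g x \<bullet> b\<bar>) \<le> K" for g h :: "real^2 \<Rightarrow> real^2" and B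
      using L2_inner_bound[OF that(1-4)] mult_left_mono[OF add_mono[OF that(5)[OF Be(1)] that(5)[OF Be(2)]] that(4)]
      by (rule order_trans)
    have a1: "\<bar>L2_inner (u t) \<psi>\<bar> \<le> B0 * (K + K)" by (rule est[OF f.f c(1) B0(2,1) ib(1)])
    have a2: "\<bar>L2_inner (weak_partial e1 (u t)) (partial e1 \<psi>)\<bar> \<le> B1 * (K + K)"
      by (rule est[OF f.weak1(1)[OF Be(1)] c(2) B1(2,1) ib(2)[OF _ Be(1)]])
    have a3: "\<bar>L2_inner (weak_partial e2 (u t)) (partial e2 \<psi>)\<bar> \<le> B2 * (K + K)"
      by (rule est[OF f.weak1(1)[OF Be(2)] c(3) B2(2,1) ib(2)[OF _ Be(2)]])
    have a4: "\<bar>L2_inner (weak_laplacian (u t)) (laplacian \<psi>)\<bar> \<le> B3 * (K + K)"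
      by (rule est[OF f.weak_laplacian(1) c(4) B3(2,1) ib(3)])
    have a5: "\<bar>L2_inner (convection (u t) (u t)) \<psi>\<bar> \<le> B0 * (K + K)"
      by (rule est[OF f.convection_integrable c(1) B0(2,1) ib(4)])
    have pos: "0 \<le> B1 * (K + K)" "0 \<le> B2 * (K + K)" "0 \<le> B0 * (K + K)" "0 \<le> B3 * (K + K)"
      using K B0(1) B1(1) B2(1) B3(1) by auto
    have l: "\<bar>lam * (\<Sum>b\<in>Basis. L2_inner (weak_partial b (u t)) (partial b \<psi>))\<bar> \<le> \<bar>lam\<bar> * (B1 * (K + K) + B2 * (K + K))"
      unfolding abs_mult sum_Basis_real2
      by (intro mult_left_mono order_trans[OF abs_triangle_ineq] add_mono a2 a3) auto
    have l0: "0 \<le> \<bar>lam\<bar> * (B1 * (K + K) + B2 * (K + K))" using pos by (intro mult_nonneg_nonneg[OF abs_ge_zero] add_nonneg_nonneg)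
    have "\<bar>x - y - z\<bar> \<le> a + b + d" if "\<bar>x\<bar> \<le> a" "\<bar>y\<bar> \<le> b" "\<bar>z\<bar> \<le> d" for x y z a b d :: real
      using that by linarith
    from this[OF l a5 a4] have "\<bar>rhs \<psi> t\<bar> \<le> C" unfolding rhs_def C_def .
    moreover have "\<bar>L2_inner (u t) \<psi>\<bar> \<le> C" unfolding C_def using a1 l0 pos(4) by linarith
    ultimately show ?case by blast
  qed
  then show ?thesis by blast
qed

text \<open>A test function with compact support in (0,T) vanishes beyond some T' < T, so the
  equation on (0,T') suffices; integrability up to T comes from boundedness.\<close>

lemma weak_eq_T:
  assumes \<psi>: "\<psi> \<in> torus_smooth"
  shows "has_weak_time_derivative T (\<lambda>t. L2_inner (u t) \<psi>) (rhs \<psi>)"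
proof -
  obtain C where C: "AE t in lebesgue_on {0<..<T}. \<bar>L2_inner (u t) \<psi>\<bar> \<le> C \<and> \<bar>rhs \<psi> t\<bar> \<le> C"
    using weak_terms_bounded[OF \<psi>] by blast
  have m: "(\<lambda>t. L2_inner (u t) \<psi>) \<in> borel_measurable (lebesgue_on {0<..<T})" "rhs \<psi> \<in> borel_measurable (lebesgue_on {0<..<T})"
    using weak_integrable[OF \<psi>] by (auto intro!: measurable_exhaust[OF T])
  have I: "integrable (lebesgue_on {0<..<T}) (\<lambda>t. L2_inner (u t) \<psi>)" "integrable (lebesgue_on {0<..<T}) (rhs \<psi>)"
    by (rule finite_measure.integrable_const_bound[OF finite_measure_time, of _ C], use C in \<open>auto elim!: eventually_mono\<close>, rule m)+
  show ?thesis
    unfolding has_weak_time_derivative_def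
  proof (intro conjI allI impI I)
    fix \<theta> :: "real \<Rightarrow> real"
    assume \<theta>: "smooth \<theta> \<and> compact (closure {t. \<theta> t \<noteq> 0}) \<and> closure {t. \<theta> t \<noteq> 0} \<subseteq> {0<..<T}"
    define Q where "Q = closure {t. \<theta> t \<noteq> 0}"
    have Q: "compact Q" "Q \<subseteq> {0<..<T}" "\<And>t. t \<notin> Q \<Longrightarrow> \<theta> t = 0"
      using \<theta> closure_subset[of "{t. \<theta> t \<noteq> 0}"] by (auto simp: Q_def)
    obtain s where s: "0 < s" "s < T" "\<And>t. t \<in> Q \<Longrightarrow> t \<le> s"
    proof (cases "Q = {}")
      case True
      then show ?thesis using that[of "T / 2"] T by auto
    next
      case False
      then obtain s where "s \<in> Q" "\<forall>t\<in>Q. t \<le> s" using compact_attains_sup[OF Q(1)] by blast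
      then show ?thesis using that[of s] Q(2) by auto
    qed
    \<comment> \<open>Strictly beyond the support, so that the test function vanishes on a
      neighbourhood of every t \<ge> T' and its derivative is zero there as well.\<close>
    define T' where "T' = (s + T) / 2"
    have T': "0 < T'" "T' < T" "s < T'" using s by (auto simp: T'_def)
    have \<theta>0: "\<theta> t = 0" "deriv \<theta> t = 0" if "T' \<le> t" for t
    proof -
      show "\<theta> t = 0" using Q(3)[of t] s(3)[of t] that T'(3) by force
      have "((\<lambda>_. 0) has_real_derivative 0) (at t)" by simp
      then have "(\<theta> has_real_derivative 0) (at t)"
        by (rule has_field_derivative_transform_within_open[of _ _ _ "{s<..}"])
          (use that T'(3) Q(3) s(3) in \<open>auto simp: not_le[symmetric]\<close>)
      then show "deriv \<theta> t = 0" by (rule DERIV_imp_deriv)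
    qed
    have restr: "(LINT t|lebesgue_on {0<..<T}. F t) = (LINT t|lebesgue_on {0<..<T'}. F t)"
      if "\<And>t. T' \<le> t \<Longrightarrow> F t = 0" for F :: "real \<Rightarrow> real"
    proof -
      have "(LINT t|lebesgue_on {0<..<T}. F t) = (LINT t|lebesgue. indicator {0<..<T} t *\<^sub>R F t)"
        by (rule integral_restrict_space) auto
      moreover have "(LINT t|lebesgue_on {0<..<T'}. F t) = (LINT t|lebesgue. indicator {0<..<T'} t *\<^sub>R F t)"
        by (rule integral_restrict_space) auto
      moreover have "indicator {0<..<T} t *\<^sub>R F t = indicator {0<..<T'} t *\<^sub>R F t" for t
        using that[of t] T'(2) by (cases "T' \<le> t") (auto simp: indicator_def)
      ultimately show ?thesis by (simp only:)
    qed
    have "closure {t. \<theta> t \<noteq> 0} \<subseteq> {0<..<T'}"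
      using Q(2) s(3) T'(3) unfolding Q_def[symmetric] by force
    then have "(LINT t|lebesgue_on {0<..<T'}. L2_inner (u t) \<psi> * deriv \<theta> t) = - (LINT t|lebesgue_on {0<..<T'}. rhs \<psi> t * \<theta> t)"
      using weak_eq[OF \<psi> T'(1,2)] \<theta> unfolding has_weak_time_derivative_def by blast
    then show "(LINT t|lebesgue_on {0<..<T}. L2_inner (u t) \<psi> * deriv \<theta> t) = - (LINT t|lebesgue_on {0<..<T}. rhs \<psi> t * \<theta> t)"
      by (subst (1 2) restr) (simp_all add: \<theta>0)
  qed
qed

text \<open>The representatives on [0, stp T n) agree almost everywhere in space at each common
  time, because \<open>value_formula\<close> fixes all their trigonometric pairings. The glued
  function uses, at time t, the representative with the least index whose interval contains
  t.\<close>

lemma initial_value_T: "has_initial_value T u u0"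
proof -
  have "\<forall>n. \<exists>v. represents (stp T n) v" using represents_exists[OF stp_bounds[OF T]] by blast
  from choice[OF this] obtain w where w: "\<And>n. represents (stp T n) (w n)" by blast
  define j where "j t = (LEAST j. t < stp T j)" for t
  define v where "v t = w (j t) t" for t
  have j: "t < stp T (j t)" if "t < T" for t
    unfolding j_def using stp_exceeds[OF T that] by (rule LeastI_ex)
  have wL: "w n t \<in> L2_torus" if "0 \<le> t" "t < stp T n" for n t
    using w[of n] that by (auto simp: represents_def)
  have same: "AE x in torus. w m t x = w n t x" if t: "0 \<le> t" "t < stp T m" "t < stp T n" for m n t
  proof (rule AE_eq_of_cf_eq)
    have i: "integrable torus (w m t)" "integrable torus (w n t)" using L2_torus_integrable(1) wL t by auto
    then show "integrable torus (w m t)" "integrable torus (w n t)" by auto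
    fix b :: "real^2" and k assume b: "b \<in> Basis"
    have "L2_inner (w m t) \<psi> = L2_inner (w n t) \<psi>" if \<psi>: "\<psi> \<in> torus_smooth" for \<psi>
      using value_formula[OF w stp_bounds[OF T] \<psi> t(1,2)] value_formula[OF w stp_bounds[OF T] \<psi> t(1,3)] by simp
    from this[OF CSmode_smooth(1)[of k b]] this[OF CSmode_smooth(2)[of k b]]
    show "cf (w m t) b k = cf (w n t) b k"
      unfolding L2_inner_CSmode[OF i(1) b] L2_inner_CSmode[OF i(2) b] by (simp add: complex_eq_iff)
  qed
  have vw: "AE x in torus. v t x = w n t x" if "0 \<le> t" "t < stp T n" for n t
    unfolding v_def using that stp_bounds(2)[OF T, of n] by (intro same j) auto
  show ?thesis
    unfolding has_initial_value_def
  proof (intro exI[of _ v] conjI ballI)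
    show "v t \<in> L2_torus" if "t \<in> {0..<T}" for t
      unfolding v_def using that j by (intro wL) auto
    have "AE t in lebesgue_on {0<..<T}. AE x in torus. v t x = u t x"
    proof (rule AE_exhaust[OF T])
      fix T' assume T': "0 < T'" "T' < T"
      obtain n where n: "T' < stp T n" using stp_exceeds[OF T T'(2)] by blast
      have "AE t in lebesgue_on {0<..<stp T n}. AE x in torus. w n t x = u t x"
        using w[of n] AE_at_endpoints[OF interval_endpoints] unfolding represents_def by blast
      then have "AE t in lebesgue_on {0<..<T'}. AE x in torus. w n t x = u t x"
        by (rule time_AE_sub) (use n in auto)
      moreover have "AE t in lebesgue_on {0<..<T'}. 0 < t \<and> t < T'" by (rule AE_I2) auto
      ultimately show "AE t in lebesgue_on {0<..<T'}. AE x in torus. v t x = u t x"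
      proof eventually_elim
        case (elim t)
        have "AE x in torus. v t x = w n t x" using elim n by (intro vw) auto
        then show ?case using elim(1) by eventually_elim simp
      qed
    qed
    then show "AE t in lebesgue_on {0..<T}. AE x in torus. v t x = u t x"
      using AE_at_endpoints[OF interval_endpoints] by blast
    show "AE x in torus. v 0 x = u0 x"
    proof -
      have "AE x in torus. w 0 0 x = u0 x" using w[of 0] by (simp add: represents_def)
      moreover have "AE x in torus. v 0 x = w 0 0 x" using stp_bounds[OF T] by (intro vw) auto
      ultimately show ?thesis by eventually_elim simp
    qed
    fix t assume t: "t \<in> {0..<T}"
    obtain n where n: "t < stp T n" using stp_exceeds[OF T, of t] t by auto
    have "((\<lambda>r. L2_norm (w n r - w n t)) \<longlongrightarrow> 0) (at t within {0..<stp T n})"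
      using w[of n] t n by (auto simp: represents_def)
    then have "((\<lambda>r. L2_norm (v r - v t)) \<longlongrightarrow> 0) (at t within {0..<stp T n})"
    proof (rule Lim_transform_eventually)
      have "eventually (\<lambda>r. r \<in> {0..<stp T n}) (at t within {0..<stp T n})" by (simp add: eventually_at_filter)
      then show "eventually (\<lambda>r. L2_norm (w n r - w n t) = L2_norm (v r - v t)) (at t within {0..<stp T n})"
      proof eventually_elim
        case (elim r)
        have "AE x in torus. v r x = w n r x" "AE x in torus. v t x = w n t x" using elim t n by (auto intro!: vw)
        then have "AE x in torus. (w n r - w n t) x = (v r - v t) x" by eventually_elim simp
        then show ?case by (rule L2_norm_cong_AE)
      qed
    qed
    \<comment> \<open>The limit at t concerns only times close to t, so the shorter interval may be
      replaced by the full one.\<close>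
    moreover have "at t within {0..<stp T n} = at t within {0..<T}"
      by (rule at_within_nhd[of _ "{..<stp T n}"]) (use n stp_bounds(2)[OF T, of n] in auto)
    ultimately show "((\<lambda>r. L2_norm (v r - v t)) \<longlongrightarrow> 0) (at t within {0..<T})" by simp
  qed
qed

lemma strong_solution_T: "strong_solution lam u0 T u"
  unfolding strong_solution_def
proof (intro conjI allI impI)
  show "u \<in> bochner_sobolev \<infinity> {0..<T} 2" "u \<in> bochner_sobolev 2 {0..<T} 4" by (rule in_bochner; auto)+
  show "has_initial_value T u u0" by (rule initial_value_T)
  fix \<psi> :: "real^2 \<Rightarrow> real^2" assume \<psi>: "\<psi> \<in> torus_smooth"
  have "rhs \<psi> t + L2_inner (convection (u t) (u t)) \<psi> + L2_inner (weak_laplacian (u t)) (laplacian \<psi>)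
     = lam * (\<Sum>b\<in>Basis. L2_inner (weak_partial b (u t)) (partial b \<psi>))" for t
    unfolding rhs_def by simp
  then show "\<exists>dt. has_weak_time_derivative T (\<lambda>t. L2_inner (u t) \<psi>) dt \<and>
           (AE t in lebesgue_on {0<..<T}.
              dt t + L2_inner (convection (u t) (u t)) \<psi>
                + L2_inner (weak_laplacian (u t)) (laplacian \<psi>)
              = lam * (\<Sum>b\<in>Basis. L2_inner (weak_partial b (u t)) (partial b \<psi>)))"
    using weak_eq_T[OF \<psi>] by blast
qed

end

theorem theorem3p4:
  fixes T lam :: real
    and u0 :: "real^2 \<Rightarrow> real^2"
    and u :: "real \<Rightarrow> real^2 \<Rightarrow> real^2"
    and \<phi> :: "real^2 \<Rightarrow> real"
  assumes "dyadic_partition \<phi>"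
    and "T > 0" and "lam > 0"
    and "u0 \<in> sobolev 2"
    and "solution_on lam u0 T u"
    and "(\<lambda>t. distribution_of (\<lambda>x. u t x $ 1)) \<in> bochner_besov \<phi> 2 {0<..<T} (- 1 / 2) \<infinity> \<infinity>"
    and "(\<lambda>t. distribution_of (\<lambda>x. u t x $ 1)) \<in> bochner_besov \<phi> 2 {0<..<T} (1 / 2) \<infinity> \<infinity>"
  shows "strong_solution lam u0 T u \<and>
    u \<in> bochner_sobolev \<infinity> {0..T} 2 \<and> u \<in> bochner_sobolev 2 {0..T} 4"
proof -
  interpret kuramoto \<phi> T lam u0 u
    by unfold_locales (use assms in auto)
  have "{0..<T} \<subseteq> {0..T}" "{0..T} \<in> sets lebesgue" by auto
  then show ?thesis
    using strong_solution_T in_bochner[of "{0..T}"] by simp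
qed

end
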